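(* Let $\nu>0$, let $u$ be a boundary datum, $u_h\in Y_h^\partial$ an approximation, $(y,p)$ the weak solution with viscosity $\nu$, $(\bar y,\bar p)$ the weak solution with viscosity $1$, and $(y_h,p_h)$ the discrete solution. Let (A1), (A2) and (A3) be satisfied, with $k\in\mathbb N$ from (A2). Assume that $\bar y\in H^{t+\frac12}(\Omega)^d$, $\bar p\in H^{t-\frac12}(\Omega)$ and $u\in\tilde H^t(\Gamma)^d$ with some $t\ge\frac12$, and that the approximate boundary datum satisfies $$\|u-u_h\|_{H^{\frac12}(\Gamma)^d}\le c\,h^{\min(t-\frac12,k)}\|u\|_{\tilde H^t(\Gamma)^d}$$ with a constant independent of $h$. Then $$\nu\|\nabla(y-y_h)\|_{L^2(\Omega)^{d\times d}}+\|p-p_h\|_{L^2(\Omega)}\le c\,\nu\,h^{\min(t-\frac12,k)}\left(\|\bar y\|_{H^{t+\frac12}(\Omega)^d}+\|\bar p\|_{H^{t-\frac12}(\Omega)}+\|u\|_{\tilde H^t(\Gamma)^d}\right)$$ with a constant $c$ independent of $h$ and $\nu$. If $u-u_h\equiv0$, the estimate holds without the term $\|u\|_{\tilde H^t(\Gamma)^d}$ on the right-hand side.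
   Context: $\Omega\subset\mathbb{R}^d$, $d\in\{2,3\}$, is a bounded polygonal or polyhedral domain with Lipschitz boundary $\Gamma=\bigcup_{j=1}^N\bar\Gamma_j$, $\Gamma_j$ the plane facets (convexity is not assumed). $\tilde H^t(\Gamma)=H^t(\Gamma)$ for $t\in[0,1]$ and $\tilde H^t(\Gamma)=\{v\in C(\Gamma):v|_{\Gamma_j}\in H^t(\Gamma_j),\ j=1,\dots,N\}$ for $t>1$, with norm $\|v\|_{\tilde H^t(\Gamma)}=\sum_{j=1}^N\|v\|_{H^t(\Gamma_j)}$. $(\cdot,\cdot)$ is the $L^2(\Omega)$ scalar product (also for vector/matrix fields), $Q=L^2_0(\Omega)=\{q\in L^2(\Omega):(q,1)=0\}$, $Y_0=H^1_0(\Omega)^d$ with norm $\|\nabla v\|_{L^2(\Omega)^{d\times d}}$, $Y_*=\{v\in H^1(\Omega)^d:v=u\text{ a.e. on }\Gamma\}$. Weak solution with viscosity $\nu>0$: the unique $(y,p)\in Y_*\times Q$ with $\nu(\nabla y,\nabla v)-(\nabla\cdot v,p)=0$ for all $v\in Y_0$ and $(\nabla\cdot y,q)=0$ for all $q\in Q$. No compatibility condition on $u$ or $u_h$ is required. One has $(y,p)=(\bar y,\nu\bar p)$. Discretization: for each $h>0$, $Y_h\subset H^1(\Omega)^d$ and $Q_h\subset L^2_0(\Omega)$ are finite-dimensional; $Y_{0h}=\{v_h\in Y_h:v_h|_\Gamma=0\}$, $Y_h^\partial=\{v_h|_\Gamma:v_h\in Y_h\}$, $\tilde Q_h=Q_h\oplus\mathcal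 P_0(\Omega)$ ($\mathcal P_0(\Omega)$ the constants), $Y_{*h}=\{v_h\in Y_h:v_h|_\Gamma=u_h\}$. The discrete solution is $(y_h,p_h)\in Y_{*h}\times Q_h$ with $\nu(\nabla y_h,\nabla v_h)-(\nabla\cdot v_h,p_h)=0$ for all $v_h\in Y_{0h}$ and $(\nabla\cdot y_h,q_h)=0$ for all $q_h\in Q_h$. Assumptions (constants independent of $h$): (A1) There is $\alpha>0$ with $\sup_{v_h\in Y_{0h}\setminus\{0\}}\frac{(\nabla\cdot v_h,q_h)}{\|v_h\|_{H^1_0(\Omega)^d}}\ge\alpha\|q_h\|_{L^2(\Omega)}$ for all $q_h\in Q_h$. (A2) There is $k\in\mathbb N$ such that for all real $r\ge0$: $\inf_{v_h\in Y_h}\|v-v_h\|_{H^1(\Omega)^d}\le ch^{\min(k,r)}\|v\|_{H^{r+1}(\Omega)^d}$ for all $v\in H^{r+1}(\Omega)^d$, and $\inf_{\tilde q_h\in\tilde Q_h}\|q-\tilde q_h\|_{L^2(\Omega)}\le ch^{\min(k,r)}\|q\|_{H^r(\Omega)}$ for all $q\in H^r(\Omega)$. (A3) There is $c_1>0$ with $\inf_{\varphi_h\in Y_h,\ \varphi_h|_\Gamma=w_h}\|\nabla\varphi_h\|_{L^2(\Omega)^{d\times d}}\le c_1\|w_h\|_{H^{\frac12}(\Gamma)^d}$ for all $w_h\in Y_h^\partial$. *)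

theory Defs
  imports "HOL-Analysis.Analysis"
begin

section \<open>Lebesgue spaces\<close>

text \<open>
  Functions are representatives of almost-everywhere classes; only their values on the
  space of the measure matter.
\<close>

definition L2 :: "'a measure \<Rightarrow> ('a \<Rightarrow> real) set" where
  "L2 M = {f \<in> borel_measurable M. integrable M (\<lambda>x. (f x)\<^sup>2)}"

definition l2_inner :: "'a measure \<Rightarrow> ('a \<Rightarrow> real) \<Rightarrow> ('a \<Rightarrow> real) \<Rightarrow> real" where
  "l2_inner M f g = (\<integral>x. f x * g x \<partial>M)"

definition l2_norm :: "'a measure \<Rightarrow> ('a \<Rightarrow> real) \<Rightarrow> real" where
  "l2_norm M f = sqrt (l2_inner M f f)"

definition L2_0 :: "'a measure \<Rightarrow> ('a \<Rightarrow> real) set" where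
  "L2_0 M = {q \<in> L2 M. l2_inner M q (\<lambda>_. 1) = 0}"


section \<open>Weak derivatives and Sobolev spaces of real order\<close>

definition dir_deriv :: "'a::euclidean_space \<Rightarrow> ('a \<Rightarrow> real) \<Rightarrow> 'a \<Rightarrow> real" where
  "dir_deriv b f x = frechet_derivative f (at x) b"

text \<open>Iterated derivatives are indexed by words (lists) of directions.\<close>

fun word_deriv :: "'a::euclidean_space list \<Rightarrow> ('a \<Rightarrow> real) \<Rightarrow> 'a \<Rightarrow> real" where
  "word_deriv [] f = f"
| "word_deriv (b # w) f = dir_deriv b (word_deriv w f)"

definition words :: "'a set \<Rightarrow> nat \<Rightarrow> 'a list set" where
  "words B m = {w. set w \<subseteq> B \<and> length w = m}"

definition smooth :: "('a::euclidean_space \<Rightarrow> real) \<Rightarrow> bool" where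
  "smooth f \<longleftrightarrow> (\<forall>w \<in> lists Basis. \<forall>x. word_deriv w f differentiable (at x))"

text \<open>
  The Sobolev spaces below are used both on an open set \<open>\<Omega>\<close> (with
  \<open>M = lebesgue_on \<Omega>\<close>, \<open>B = Basis\<close>) and on a relatively open subset \<open>F\<close> of a hyperplane
  (with \<open>M\<close> the surface measure on \<open>F\<close> and \<open>B\<close> an orthonormal basis of the tangent space).
  A test function on \<open>space M\<close> is the restriction of a smooth function on the ambient space;
  its derivatives along tangential directions depend on the restriction only.
\<close>

definition test_function :: "'a::euclidean_space set \<Rightarrow> ('a \<Rightarrow> real) \<Rightarrow> bool" where
  "test_function F \<phi> \<longleftrightarrow>
     smooth \<phi> \<and> (\<exists>K. compact K \<and> K \<subseteq> F \<and> (\<forall>x \<in> F - K. \<phi> x = 0))"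

definition has_weak_deriv ::
  "'a::euclidean_space measure \<Rightarrow> 'a list \<Rightarrow> ('a \<Rightarrow> real) \<Rightarrow> ('a \<Rightarrow> real) \<Rightarrow> bool" where
  "has_weak_deriv M w f g \<longleftrightarrow>
     g \<in> L2 M \<and>
     (\<forall>\<phi>. test_function (space M) \<phi> \<longrightarrow>
        l2_inner M f (word_deriv w \<phi>) = (-1) ^ length w * l2_inner M g \<phi>)"

definition weak_deriv ::
  "'a::euclidean_space measure \<Rightarrow> 'a list \<Rightarrow> ('a \<Rightarrow> real) \<Rightarrow> 'a \<Rightarrow> real" where
  "weak_deriv M w f = (SOME g. has_weak_deriv M w f g)"

text \<open>
  Squared Sobolev--Slobodeckij seminorm of order \<open>\<theta> \<in> (0,1)\<close> over an \<open>n\<close>-dimensional set.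
  The integrand vanishes on the diagonal by the convention \<open>0 / 0 = 0\<close>.
\<close>

definition slobodeckij ::
  "'a::euclidean_space measure \<Rightarrow> nat \<Rightarrow> real \<Rightarrow> ('a \<Rightarrow> real) \<Rightarrow> ennreal" where
  "slobodeckij M n \<theta> g =
     (\<integral>\<^sup>+x. \<integral>\<^sup>+y. ennreal ((g x - g y)\<^sup>2 / norm (x - y) powr (real n + 2 * \<theta>)) \<partial>M \<partial>M)"

text \<open>
  The space $H^s$ for real \<open>s \<ge> 0\<close>. Summing over words of length \<open>l\<close> gives the Frobenius norm
  of the \<open>l\<close>-th derivative, so the norm does not depend on the choice of the orthonormal
  basis \<open>B\<close>.
\<close>

definition sobolev ::
  "'a::euclidean_space measure \<Rightarrow> 'a set \<Rightarrow> real \<Rightarrow> ('a \<Rightarrow> real) set" where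
  "sobolev M B s =
     (let m = nat \<lfloor>s\<rfloor>; \<theta> = s - real m in
      {f \<in> L2 M.
         (\<forall>l \<le> m. \<forall>w \<in> words B l. \<exists>g. has_weak_deriv M w f g) \<and>
         (\<theta> > 0 \<longrightarrow> (\<forall>w \<in> words B m. slobodeckij M (card B) \<theta> (weak_deriv M w f) < \<infinity>))})"

definition sobolev_norm ::
  "'a::euclidean_space measure \<Rightarrow> 'a set \<Rightarrow> real \<Rightarrow> ('a \<Rightarrow> real) \<Rightarrow> real" where
  "sobolev_norm M B s f =
     (let m = nat \<lfloor>s\<rfloor>; \<theta> = s - real m in
      sqrt ((\<Sum>l\<le>m. \<Sum>w\<in>words B l. (l2_norm M (weak_deriv M w f))\<^sup>2) +
            (if \<theta> > 0
             then \<Sum>w\<in>words B m. enn2real (slobodeckij M (card B) \<theta> (weak_deriv M w f))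
             else 0)))"

definition H :: "real \<Rightarrow> 'a::euclidean_space set \<Rightarrow> ('a \<Rightarrow> real) set" where
  "H s \<Omega> = sobolev (lebesgue_on \<Omega>) Basis s"

definition H_norm :: "real \<Rightarrow> 'a::euclidean_space set \<Rightarrow> ('a \<Rightarrow> real) \<Rightarrow> real" where
  "H_norm s \<Omega> = sobolev_norm (lebesgue_on \<Omega>) Basis s"


section \<open>Vector fields\<close>

definition component :: "('a \<Rightarrow> 'a::euclidean_space) \<Rightarrow> 'a \<Rightarrow> 'a \<Rightarrow> real" where
  "component v b = (\<lambda>x. v x \<bullet> b)"

definition vec_space :: "('a \<Rightarrow> real) set \<Rightarrow> ('a \<Rightarrow> 'a::euclidean_space) set" where
  "vec_space X = {v. \<forall>b\<in>Basis. component v b \<in> X}"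

definition vec_norm :: "(('a \<Rightarrow> real) \<Rightarrow> real) \<Rightarrow> ('a \<Rightarrow> 'a::euclidean_space) \<Rightarrow> real" where
  "vec_norm N v = sqrt (\<Sum>b\<in>Basis. (N (component v b))\<^sup>2)"

definition grad_inner ::
  "'a set \<Rightarrow> ('a \<Rightarrow> 'a::euclidean_space) \<Rightarrow> ('a \<Rightarrow> 'a) \<Rightarrow> real" where
  "grad_inner \<Omega> v w =
     (\<Sum>b\<in>Basis. \<Sum>c\<in>Basis.
        l2_inner (lebesgue_on \<Omega>)
          (weak_deriv (lebesgue_on \<Omega>) [c] (component v b))
          (weak_deriv (lebesgue_on \<Omega>) [c] (component w b)))"

definition grad_norm :: "'a set \<Rightarrow> ('a \<Rightarrow> 'a::euclidean_space) \<Rightarrow> real" where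
  "grad_norm \<Omega> v = sqrt (grad_inner \<Omega> v v)"

definition divergence :: "'a set \<Rightarrow> ('a \<Rightarrow> 'a::euclidean_space) \<Rightarrow> 'a \<Rightarrow> real" where
  "divergence \<Omega> v = (\<lambda>x. \<Sum>b\<in>Basis. weak_deriv (lebesgue_on \<Omega>) [b] (component v b) x)"


section \<open>Polyhedral Lipschitz domains and their boundary\<close>

text \<open>
  Near every boundary point, \<open>\<Omega>\<close> is the strict epigraph in direction \<open>e\<close> of a Lipschitz
  function of the coordinates orthogonal to \<open>e\<close>.
\<close>

definition lipschitz_boundary :: "'a::euclidean_space set \<Rightarrow> bool" where
  "lipschitz_boundary \<Omega> \<longleftrightarrow>
     (\<forall>z \<in> frontier \<Omega>. \<exists>e \<gamma> L U.
        norm e = 1 \<and> L-lipschitz_on UNIV \<gamma> \<and> (\<forall>x s. \<gamma> (x + s *\<^sub>R e) = \<gamma> x) \<and>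
        open U \<and> z \<in> U \<and> \<Omega> \<inter> U = {x \<in> U. \<gamma> x < x \<bullet> e})"

definition is_outer_normal :: "'a::euclidean_space set \<Rightarrow> 'a \<Rightarrow> 'a \<Rightarrow> bool" where
  "is_outer_normal \<Omega> x n \<longleftrightarrow>
     norm n = 1 \<and> (\<exists>r>0. \<Omega> \<inter> ball x r = {y \<in> ball x r. n \<bullet> (y - x) < 0})"

definition outer_normal :: "'a::euclidean_space set \<Rightarrow> 'a \<Rightarrow> 'a" where
  "outer_normal \<Omega> x = (THE n. is_outer_normal \<Omega> x n)"

text \<open>
  The facets are the connected components of the set of those boundary points near which
  \<open>\<Omega>\<close> coincides with a half-space. Each facet is a relatively open subset of a hyperplane.
\<close>

definition facets :: "'a::euclidean_space set \<Rightarrow> 'a set set" where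
  "facets \<Omega> = components {x. \<exists>n. is_outer_normal \<Omega> x n}"

definition polyhedral_domain :: "'a::euclidean_space set \<Rightarrow> bool" where
  "polyhedral_domain \<Omega> \<longleftrightarrow>
     open \<Omega> \<and> connected \<Omega> \<and> \<Omega> \<noteq> {} \<and> bounded \<Omega> \<and> lipschitz_boundary \<Omega> \<and>
     finite (facets \<Omega>) \<and> frontier \<Omega> = (\<Union>F\<in>facets \<Omega>. closure F)"

text \<open>
  Surface measure: the area of a subset of a facet is the volume of the right prism of
  height \<open>1\<close> over it. The edges of \<open>\<Omega>\<close> form a null set.
\<close>

definition prism :: "'a::euclidean_space set \<Rightarrow> 'a set \<Rightarrow> 'a set" where
  "prism \<Omega> A = {x + s *\<^sub>R outer_normal \<Omega> x | x s. x \<in> A \<and> 0 \<le> s \<and> s \<le> 1}"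

definition surface_measure :: "'a::euclidean_space set \<Rightarrow> 'a measure" where
  "surface_measure \<Omega> =
     measure_of (frontier \<Omega>) (sets (restrict_space borel (frontier \<Omega>)))
       (\<lambda>A. \<Sum>F\<in>facets \<Omega>. emeasure lborel (prism \<Omega> (A \<inter> F)))"

definition facet_measure :: "'a::euclidean_space set \<Rightarrow> 'a set \<Rightarrow> 'a measure" where
  "facet_measure \<Omega> F = restrict_space (surface_measure \<Omega>) F"

definition facet_basis :: "'a::euclidean_space set \<Rightarrow> 'a set" where
  "facet_basis F =
     (SOME B. pairwise orthogonal B \<and> (\<forall>b\<in>B. norm b = 1) \<and>
        span B = span {x - y | x y. x \<in> F \<and> y \<in> F})"


section \<open>Sobolev spaces on the boundary\<close>

text \<open>
  First-order weak tangential derivatives on the closed Lipschitz surface \<open>\<Gamma>\<close>: the operators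
  $n_b \partial_c - n_c \partial_b$ are tangential and satisfy
  $\int_\Gamma (n_b \partial_c - n_c \partial_b)\psi = 0$ for all smooth \<open>\<psi>\<close>. This controls the
  derivatives inside the facets and excludes jumps across edges.
\<close>

definition has_tangential_deriv ::
  "'a::euclidean_space set \<Rightarrow> 'a \<Rightarrow> 'a \<Rightarrow> ('a \<Rightarrow> real) \<Rightarrow> ('a \<Rightarrow> real) \<Rightarrow> bool" where
  "has_tangential_deriv \<Omega> b c f g \<longleftrightarrow>
     g \<in> L2 (surface_measure \<Omega>) \<and>
     (\<forall>\<phi>. smooth \<phi> \<longrightarrow>
        l2_inner (surface_measure \<Omega>) f
          (\<lambda>x. (outer_normal \<Omega> x \<bullet> b) * dir_deriv c \<phi> x - (outer_normal \<Omega> x \<bullet> c) * dir_deriv b \<phi> x)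
        = - l2_inner (surface_measure \<Omega>) g \<phi>)"

definition tangential_deriv ::
  "'a::euclidean_space set \<Rightarrow> 'a \<Rightarrow> 'a \<Rightarrow> ('a \<Rightarrow> real) \<Rightarrow> 'a \<Rightarrow> real" where
  "tangential_deriv \<Omega> b c f = (SOME g. has_tangential_deriv \<Omega> b c f g)"

text \<open>
  $H^t(\Gamma)$ for \<open>t \<in> [0,1]\<close>. The factor \<open>1/2\<close> turns the sum over all pairs of coordinate
  directions into the squared $L^2$ norm of the tangential gradient.
\<close>

definition Hbd :: "real \<Rightarrow> 'a::euclidean_space set \<Rightarrow> ('a \<Rightarrow> real) set" where
  "Hbd t \<Omega> =
     {f \<in> L2 (surface_measure \<Omega>).
        (0 < t \<and> t < 1 \<longrightarrow> slobodeckij (surface_measure \<Omega>) (DIM('a) - 1) t f < \<infinity>) \<and>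
        (t = 1 \<longrightarrow> (\<forall>b\<in>Basis. \<forall>c\<in>Basis. \<exists>g. has_tangential_deriv \<Omega> b c f g))}"

definition Hbd_norm :: "real \<Rightarrow> 'a::euclidean_space set \<Rightarrow> ('a \<Rightarrow> real) \<Rightarrow> real" where
  "Hbd_norm t \<Omega> f =
     sqrt ((l2_norm (surface_measure \<Omega>) f)\<^sup>2 +
       (if 0 < t \<and> t < 1 then enn2real (slobodeckij (surface_measure \<Omega>) (DIM('a) - 1) t f)
        else if t = 1 then
          1/2 * (\<Sum>b\<in>Basis. \<Sum>c\<in>Basis.
                   (l2_norm (surface_measure \<Omega>) (tangential_deriv \<Omega> b c f))\<^sup>2)
        else 0))"

text \<open>The space $\tilde H^t(\Gamma)$ for \<open>t \<ge> 0\<close>.\<close>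

definition Htilde :: "real \<Rightarrow> 'a::euclidean_space set \<Rightarrow> ('a \<Rightarrow> real) set" where
  "Htilde t \<Omega> =
     (if t \<le> 1 then Hbd t \<Omega>
      else {f. continuous_on (frontier \<Omega>) f \<and>
               (\<forall>F\<in>facets \<Omega>. f \<in> sobolev (facet_measure \<Omega> F) (facet_basis F) t)})"

definition Htilde_norm :: "real \<Rightarrow> 'a::euclidean_space set \<Rightarrow> ('a \<Rightarrow> real) \<Rightarrow> real" where
  "Htilde_norm t \<Omega> f =
     (if t \<le> 1 then Hbd_norm t \<Omega> f
      else \<Sum>F\<in>facets \<Omega>. sobolev_norm (facet_measure \<Omega> F) (facet_basis F) t f)"

text \<open>
  \<open>has_trace \<Omega> v g\<close> means \<open>v = g\<close> almost everywhere on \<open>\<Gamma>\<close> in the sense of traces: the trace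
  operator is the continuous extension to $H^1(\Omega)$, with values in $L^2(\Gamma)$, of the
  restriction of smooth functions to \<open>\<Gamma>\<close>.
\<close>

definition has_trace ::
  "'a::euclidean_space set \<Rightarrow> ('a \<Rightarrow> real) \<Rightarrow> ('a \<Rightarrow> real) \<Rightarrow> bool" where
  "has_trace \<Omega> v g \<longleftrightarrow>
     v \<in> H 1 \<Omega> \<and> g \<in> L2 (surface_measure \<Omega>) \<and>
     (\<exists>\<phi> :: nat \<Rightarrow> 'a \<Rightarrow> real. (\<forall>n. smooth (\<phi> n)) \<and>
        (\<lambda>n. H_norm 1 \<Omega> (\<lambda>x. \<phi> n x - v x)) \<longlonglongrightarrow> 0 \<and>
        (\<lambda>n. l2_norm (surface_measure \<Omega>) (\<lambda>x. \<phi> n x - g x)) \<longlonglongrightarrow> 0)"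

definition has_trace_vec ::
  "'a::euclidean_space set \<Rightarrow> ('a \<Rightarrow> 'a) \<Rightarrow> ('a \<Rightarrow> 'a) \<Rightarrow> bool" where
  "has_trace_vec \<Omega> v g \<longleftrightarrow> (\<forall>b\<in>Basis. has_trace \<Omega> (component v b) (component g b))"


section \<open>The Stokes problem and its discretization\<close>

definition Y_star :: "'a::euclidean_space set \<Rightarrow> ('a \<Rightarrow> 'a) \<Rightarrow> ('a \<Rightarrow> 'a) set" where
  "Y_star \<Omega> u = {v \<in> vec_space (H 1 \<Omega>). has_trace_vec \<Omega> v u}"

definition Y_zero :: "'a::euclidean_space set \<Rightarrow> ('a \<Rightarrow> 'a) set" where
  "Y_zero \<Omega> = {v \<in> vec_space (H 1 \<Omega>). has_trace_vec \<Omega> v (\<lambda>_. 0)}"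

definition weak_solution ::
  "'a::euclidean_space set \<Rightarrow> real \<Rightarrow> ('a \<Rightarrow> 'a) \<Rightarrow> ('a \<Rightarrow> 'a) \<Rightarrow> ('a \<Rightarrow> real) \<Rightarrow> bool" where
  "weak_solution \<Omega> \<nu> u y p \<longleftrightarrow>
     y \<in> Y_star \<Omega> u \<and> p \<in> L2_0 (lebesgue_on \<Omega>) \<and>
     (\<forall>v \<in> Y_zero \<Omega>.
        \<nu> * grad_inner \<Omega> y v - l2_inner (lebesgue_on \<Omega>) (divergence \<Omega> v) p = 0) \<and>
     (\<forall>q \<in> L2_0 (lebesgue_on \<Omega>). l2_inner (lebesgue_on \<Omega>) (divergence \<Omega> y) q = 0)"

text \<open>
  Linear combinations are taken pointwise: a finite-dimensional space of classes is
  represented by the span of one representative per basis element.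
\<close>

definition finite_dimensional :: "('a \<Rightarrow> 'b::real_vector) set \<Rightarrow> bool" where
  "finite_dimensional V \<longleftrightarrow>
     (\<exists>(n::nat) e. V = {v. \<exists>c :: nat \<Rightarrow> real. v = (\<lambda>x. \<Sum>i<n. c i *\<^sub>R e i x)})"

text \<open>In the following, \<open>Yh\<close> and \<open>Qh\<close> are the discrete spaces for one value of \<open>h\<close>.\<close>

definition Y_zero_h :: "'a::euclidean_space set \<Rightarrow> ('a \<Rightarrow> 'a) set \<Rightarrow> ('a \<Rightarrow> 'a) set" where
  "Y_zero_h \<Omega> Yh = {vh \<in> Yh. has_trace_vec \<Omega> vh (\<lambda>_. 0)}"

definition Y_bd_h :: "'a::euclidean_space set \<Rightarrow> ('a \<Rightarrow> 'a) set \<Rightarrow> ('a \<Rightarrow> 'a) set" where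
  "Y_bd_h \<Omega> Yh = {wh. \<exists>vh\<in>Yh. has_trace_vec \<Omega> vh wh}"

definition Y_star_h ::
  "'a::euclidean_space set \<Rightarrow> ('a \<Rightarrow> 'a) set \<Rightarrow> ('a \<Rightarrow> 'a) \<Rightarrow> ('a \<Rightarrow> 'a) set" where
  "Y_star_h \<Omega> Yh uh = {vh \<in> Yh. has_trace_vec \<Omega> vh uh}"

definition Q_tilde_h :: "('a \<Rightarrow> real) set \<Rightarrow> ('a \<Rightarrow> real) set" where
  "Q_tilde_h Qh = {(\<lambda>x. qh x + a) | qh a. qh \<in> Qh}"

definition discrete_solution ::
  "'a::euclidean_space set \<Rightarrow> ('a \<Rightarrow> 'a) set \<Rightarrow> ('a \<Rightarrow> real) set \<Rightarrow> real \<Rightarrow> ('a \<Rightarrow> 'a)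
     \<Rightarrow> ('a \<Rightarrow> 'a) \<Rightarrow> ('a \<Rightarrow> real) \<Rightarrow> bool" where
  "discrete_solution \<Omega> Yh Qh \<nu> uh yh ph \<longleftrightarrow>
     yh \<in> Y_star_h \<Omega> Yh uh \<and> ph \<in> Qh \<and>
     (\<forall>vh \<in> Y_zero_h \<Omega> Yh.
        \<nu> * grad_inner \<Omega> yh vh - l2_inner (lebesgue_on \<Omega>) (divergence \<Omega> vh) ph = 0) \<and>
     (\<forall>qh \<in> Qh. l2_inner (lebesgue_on \<Omega>) (divergence \<Omega> yh) qh = 0)"

definition discrete_spaces ::
  "'a::euclidean_space set \<Rightarrow> (real \<Rightarrow> ('a \<Rightarrow> 'a) set) \<Rightarrow> (real \<Rightarrow> ('a \<Rightarrow> real) set) \<Rightarrow> bool" where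
  "discrete_spaces \<Omega> Y Q \<longleftrightarrow>
     (\<forall>h>0. finite_dimensional (Y h) \<and> Y h \<subseteq> vec_space (H 1 \<Omega>) \<and>
            finite_dimensional (Q h) \<and> Q h \<subseteq> L2_0 (lebesgue_on \<Omega>))"

text \<open>
  The element \<open>0\<close> need not be excluded from the supremum: by \<open>0 / 0 = 0\<close> it contributes the
  value \<open>0\<close>, which only fixes the supremum to be \<open>0\<close> when there is no other element.
\<close>

definition assumption_A1 ::
  "'a::euclidean_space set \<Rightarrow> (real \<Rightarrow> ('a \<Rightarrow> 'a) set) \<Rightarrow> (real \<Rightarrow> ('a \<Rightarrow> real) set) \<Rightarrow> bool" where
  "assumption_A1 \<Omega> Y Q \<longleftrightarrow>
     (\<exists>\<alpha>>0. \<forall>h>0. \<forall>qh \<in> Q h.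
        (SUP vh \<in> Y_zero_h \<Omega> (Y h).
           l2_inner (lebesgue_on \<Omega>) (divergence \<Omega> vh) qh / grad_norm \<Omega> vh)
        \<ge> \<alpha> * l2_norm (lebesgue_on \<Omega>) qh)"

text \<open>The constants may depend on \<open>r\<close>, but not on \<open>h\<close>.\<close>

definition assumption_A2 ::
  "'a::euclidean_space set \<Rightarrow> (real \<Rightarrow> ('a \<Rightarrow> 'a) set) \<Rightarrow> (real \<Rightarrow> ('a \<Rightarrow> real) set)
     \<Rightarrow> nat \<Rightarrow> bool" where
  "assumption_A2 \<Omega> Y Q k \<longleftrightarrow>
     (\<forall>r\<ge>0. \<exists>c. \<forall>h>0.
        (\<forall>v \<in> vec_space (H (r + 1) \<Omega>).
           (INF vh \<in> Y h. vec_norm (H_norm 1 \<Omega>) (\<lambda>x. v x - vh x))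
           \<le> c * h powr (min (real k) r) * vec_norm (H_norm (r + 1) \<Omega>) v) \<and>
        (\<forall>q \<in> H r \<Omega>.
           (INF qh \<in> Q_tilde_h (Q h). l2_norm (lebesgue_on \<Omega>) (\<lambda>x. q x - qh x))
           \<le> c * h powr (min (real k) r) * H_norm r \<Omega> q))"

definition assumption_A3 ::
  "'a::euclidean_space set \<Rightarrow> (real \<Rightarrow> ('a \<Rightarrow> 'a) set) \<Rightarrow> bool" where
  "assumption_A3 \<Omega> Y \<longleftrightarrow>
     (\<exists>c1>0. \<forall>h>0. \<forall>wh \<in> Y_bd_h \<Omega> (Y h).
        (INF \<phi>h \<in> Y_star_h \<Omega> (Y h) wh. grad_norm \<Omega> \<phi>h)
        \<le> c1 * vec_norm (Hbd_norm (1/2) \<Omega>) wh)"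

end

theory Submission
  imports Defs
begin

text \<open>
  Testing with discrete functions and using the inf-sup condition, the error is bounded by the
  distance of \<open>(ybar, pbar)\<close> to pairs whose velocity has the prescribed discrete trace \<open>uh\<close>.
  Such a velocity is \<open>zh - \<phi>h\<close>, where \<open>zh\<close> is a good approximation of \<open>ybar\<close> from (A2) and \<open>\<phi>h\<close>
  is the lifting from (A3) of the trace of \<open>zh\<close> minus \<open>uh\<close>. That boundary function splits into
  the trace of \<open>zh - ybar\<close>, controlled by the trace theorem from $H^1(\Omega)$ to
  $H^{1/2}(\Gamma)$, and \<open>u - uh\<close>. The dependence on the viscosity is a scaling: \<open>y = ybar\<close> and
  \<open>p = \<nu> pbar\<close> up to null sets.

  The trace theorem rests on the uniform interior cone at the points of the Lipschitz boundary.
  For \<open>x\<close>, \<open>y\<close> on \<open>\<Gamma>\<close> at distance \<open>r\<close>, both values are compared with the values on a ball of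
  radius \<open>r\<close> contained in both cones. Only the bound \<open>r^(n - 1)\<close> for the area of the part of
  the boundary in a ball of radius \<open>r\<close> enters, so no parametrization of the boundary is needed.
  Existence of traces uses the density of smooth functions, by mollifying into the cone.
\<close>

subsection \<open>Calculus of smooth functions\<close>

text \<open>A discrete velocity with trace \<open>uh\<close> need not be discretely divergence free.
  Testing with the velocity error therefore leaves a product of the divergence of the approximation
  error with the pressure error. The inf-sup condition bounds the pressure error by the velocity
  error, which turns this product into a quadratic inequality for the velocity error; solving it
  avoids the construction of a discretely solenoidal comparison function. The trace seminorm is
  reached through an intermediate quantity: weighted increments between a boundary point and the
  points of its cone. A Hardy-type rescaling along segments bounds them by the Dirichlet integral,
  and a triangle inequality through common interior points bounds the seminorm by them. Two features
  of the encoding shape the details. The infima in (A2) and (A3) need not be attained, so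
  approximations are taken with a slack that disappears only at the end. Weak derivatives are
  arbitrary representatives and \<open>enn2real\<close> hides infinite seminorms, so linearity holds
  almost everywhere and finiteness has to be supplied by the trace inequality.\<close>

lemma dir_deriv_eq:
  assumes "(f has_derivative f') (at x)"
  shows "dir_deriv b f x = f' b"
  using frechet_derivative_at[OF assms] by (simp add: dir_deriv_def)

text \<open>\<open>smooth\<close> asks for all iterated derivatives at once. Membership in a set of
  differentiable functions that derivatives do not leave is an invariant along every word, so no
  formula for a higher derivative is ever computed.\<close>

lemma smooth_coinduct:
  assumes "f \<in> S" and "\<And>g x. g \<in> S \<Longrightarrow> g differentiable (at x)"
    and "\<And>g b. g \<in> S \<Longrightarrow> b \<in> Basis \<Longrightarrow> dir_deriv b g \<in> S"
  shows "smooth f"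
proof -
  have "word_deriv w f \<in> S" if "w \<in> lists Basis" for w
    using that by (induction w) (auto simp: assms)
  then show ?thesis
    by (auto simp: smooth_def assms(2))
qed

lemma word_deriv_append: "word_deriv (v @ w) f = word_deriv v (word_deriv w f)"
  by (induction v) auto

lemma smooth_differentiable: "smooth f \<Longrightarrow> f differentiable (at x)"
  unfolding smooth_def by (metis lists.Nil word_deriv.simps(1))

lemma smooth_word_deriv: "smooth f \<Longrightarrow> w \<in> lists Basis \<Longrightarrow> smooth (word_deriv w f)"
  unfolding smooth_def by (simp add: word_deriv_append[symmetric])

lemma smooth_dir_deriv: "smooth f \<Longrightarrow> b \<in> Basis \<Longrightarrow> smooth (dir_deriv b f)"
  using smooth_word_deriv[of f "[b]"] by simp

lemma smooth_continuous_on: "smooth f \<Longrightarrow> continuous_on A f"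
  by (meson continuous_at_imp_continuous_on differentiable_imp_continuous_within smooth_differentiable)

lemma smooth_borel [measurable_dest]: "smooth f \<Longrightarrow> f \<in> borel_measurable borel"
  by (simp add: borel_measurable_continuous_onI smooth_continuous_on)

lemma smooth_has_derivative:
  fixes f :: "'a::euclidean_space \<Rightarrow> real"
  assumes "smooth f"
  shows "(f has_derivative (\<lambda>h. \<Sum>b\<in>Basis. (h \<bullet> b) * dir_deriv b f x)) (at x)"
proof -
  let ?D = "frechet_derivative f (at x)"
  have D: "(f has_derivative ?D) (at x)"
    using smooth_differentiable[OF assms] frechet_derivative_works by blast
  then interpret linear ?D by (rule has_derivative_linear)
  have "?D h = (\<Sum>b\<in>Basis. (h \<bullet> b) * dir_deriv b f x)" for h
  proof -
    have "?D h = ?D (\<Sum>b\<in>Basis. (h \<bullet> b) *\<^sub>R b)" by (simp add: euclidean_representation)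
    also have "\<dots> = (\<Sum>b\<in>Basis. (h \<bullet> b) * dir_deriv b f x)"
      by (simp add: sum scale dir_deriv_def)
    finally show ?thesis .
  qed
  then have "?D = (\<lambda>h. \<Sum>b\<in>Basis. (h \<bullet> b) * dir_deriv b f x)" by auto
  with D show ?thesis by simp
qed

text \<open>By the Leibniz rule the algebra generated by a set is closed under derivatives as soon
  as the derivatives of the generators lie in it. It is thus the natural invariant set for
  \<open>smooth_coinduct\<close>, for sums and products as well as for families such as
  \<open>flat_exp\<close>.\<close>

inductive_set generated_algebra :: "('a \<Rightarrow> real) set \<Rightarrow> ('a \<Rightarrow> real) set" for B where
  generated_algebra_base: "f \<in> B \<Longrightarrow> f \<in> generated_algebra B"
| generated_algebra_add: "f \<in> generated_algebra B \<Longrightarrow> g \<in> generated_algebra B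
    \<Longrightarrow> (\<lambda>x. f x + g x) \<in> generated_algebra B"
| generated_algebra_mult: "f \<in> generated_algebra B \<Longrightarrow> g \<in> generated_algebra B
    \<Longrightarrow> (\<lambda>x. f x * g x) \<in> generated_algebra B"

lemma dir_deriv_add:
  fixes f g :: "'a::euclidean_space \<Rightarrow> real"
  assumes "f differentiable (at x)" "g differentiable (at x)"
  shows "dir_deriv b (\<lambda>x. f x + g x) x = dir_deriv b f x + dir_deriv b g x"
proof -
  have "((\<lambda>x. f x + g x) has_derivative
      (\<lambda>h. frechet_derivative f (at x) h + frechet_derivative g (at x) h)) (at x)"
    using assms by (intro has_derivative_add) (auto simp: frechet_derivative_works)
  from dir_deriv_eq[OF this] show ?thesis by (simp add: dir_deriv_def)
qed

lemma dir_deriv_mult: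
  fixes f g :: "'a::euclidean_space \<Rightarrow> real"
  assumes "f differentiable (at x)" "g differentiable (at x)"
  shows "dir_deriv b (\<lambda>x. f x * g x) x = f x * dir_deriv b g x + dir_deriv b f x * g x"
proof -
  have "((\<lambda>x. f x * g x) has_derivative
      (\<lambda>h. f x * frechet_derivative g (at x) h + frechet_derivative f (at x) h * g x)) (at x)"
    using assms by (intro has_derivative_mult) (auto simp: frechet_derivative_works)
  from dir_deriv_eq[OF this] show ?thesis by (simp add: dir_deriv_def)
qed

lemma smooth_generated_algebraI:
  fixes f :: "'a::euclidean_space \<Rightarrow> real"
  assumes "f \<in> generated_algebra B" and diff: "\<And>g x. g \<in> B \<Longrightarrow> g differentiable (at x)"
    and D: "\<And>g b. g \<in> B \<Longrightarrow> b \<in> Basis \<Longrightarrow> dir_deriv b g \<in> generated_algebra B"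
  shows "smooth f"
proof (rule smooth_coinduct[OF assms(1)])
  show d: "g differentiable (at x)" if "g \<in> generated_algebra B" for g x
    using that by (induction) (auto intro: diff)
  show "dir_deriv b g \<in> generated_algebra B" if "g \<in> generated_algebra B" "b \<in> Basis" for g b
    using that
  proof (induction)
    case (generated_algebra_base f)
    then show ?case by (simp add: D)
  next
    case (generated_algebra_add f g)
    then have "dir_deriv b (\<lambda>x. f x + g x) = (\<lambda>x. dir_deriv b f x + dir_deriv b g x)"
      by (intro ext dir_deriv_add) (auto intro: d)
    then show ?case using generated_algebra_add by (auto intro: generated_algebra.intros)
  next
    case (generated_algebra_mult f g)
    then have "dir_deriv b (\<lambda>x. f x * g x) = (\<lambda>x. f x * dir_deriv b g x + dir_deriv b f x * g x)"
      by (intro ext dir_deriv_mult) (auto intro: d)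
    then show ?case using generated_algebra_mult by (auto intro: generated_algebra.intros)
  qed
qed

lemma smooth_add: "smooth f \<Longrightarrow> smooth g \<Longrightarrow> smooth (\<lambda>x. f x + g x)"
  and smooth_mult: "smooth f \<Longrightarrow> smooth g \<Longrightarrow> smooth (\<lambda>x. f x * g x)"
proof -
  have *: "f \<in> generated_algebra (Collect smooth)" if "smooth f" for f :: "'a \<Rightarrow> real"
    using that by (simp add: generated_algebra_base)
  have "smooth h" if "h \<in> generated_algebra (Collect smooth)" for h :: "'a \<Rightarrow> real"
    using that by (rule smooth_generated_algebraI) (simp_all add: smooth_differentiable smooth_dir_deriv *)
  then show "smooth f \<Longrightarrow> smooth g \<Longrightarrow> smooth (\<lambda>x. f x + g x)" "smooth f \<Longrightarrow> smooth g \<Longrightarrow> smooth (\<lambda>x. f x * g x)"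
    by (simp_all add: generated_algebra_add generated_algebra_mult *)
qed

lemma smooth_affine: "smooth (\<lambda>x. x \<bullet> v + a)"
proof (rule smooth_generated_algebraI[where B = "{\<lambda>x. x \<bullet> v + a |v a. True}"])
  fix g :: "'a \<Rightarrow> real" and b :: 'a assume "g \<in> {\<lambda>x. x \<bullet> v + a |v a. True}"
  then obtain v a where g: "g = (\<lambda>x. x \<bullet> v + a)" by auto
  have "dir_deriv b g = (\<lambda>x. b \<bullet> v)"
    unfolding g by (rule ext, rule dir_deriv_eq) (auto intro!: derivative_eq_intros)
  also have "\<dots> = (\<lambda>x. x \<bullet> 0 + b \<bullet> v)" by simp
  finally show "dir_deriv b g \<in> generated_algebra {\<lambda>x. x \<bullet> v + a |v a. True}"
    by (intro generated_algebra_base) blast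
  show "g differentiable (at x)" for x unfolding g by simp
qed (intro generated_algebra_base, blast)

lemma smooth_const: "smooth (\<lambda>x. c)"
  using smooth_affine[of 0 c] by simp

lemma smooth_cmult: "smooth f \<Longrightarrow> smooth (\<lambda>x. c * f x)"
  by (rule smooth_mult[OF smooth_const])

lemma smooth_diff: "smooth f \<Longrightarrow> smooth g \<Longrightarrow> smooth (\<lambda>x. f x - g x)"
  using smooth_add[of f "\<lambda>x. -1 * g x"] smooth_cmult[of g "-1"] by simp

lemma smooth_prod: "(\<And>i. i \<in> I \<Longrightarrow> smooth (f i)) \<Longrightarrow> smooth (\<lambda>x. \<Prod>i\<in>I. f i x)"
  by (induction I rule: infinite_finite_induct) (auto intro: smooth_const smooth_mult)

text \<open>The derivative of \<open>1 / d\<close> is minus the square of \<open>1 / d\<close> times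
  that of \<open>d\<close>, a product of generators; so one extra generator closes the
  algebra.\<close>

lemma smooth_inverse:
  fixes d :: "'a::euclidean_space \<Rightarrow> real"
  assumes d: "smooth d" "\<And>x. d x \<noteq> 0"
  shows "smooth (\<lambda>x. inverse (d x))"
proof (rule smooth_generated_algebraI[where B = "insert (\<lambda>x. inverse (d x)) (Collect smooth)"])
  let ?B = "insert (\<lambda>x. inverse (d x)) (Collect smooth)"
  fix g and b :: 'a assume g: "g \<in> ?B"
  show "g differentiable (at x)" for x
    using g d(2) Deriv.differentiable_inverse[OF smooth_differentiable[OF d(1)], of x]
    by (auto intro: smooth_differentiable)
  assume b: "b \<in> Basis"
  show "dir_deriv b g \<in> generated_algebra ?B"
  proof (cases "smooth g")
    case True
    with b show ?thesis by (auto intro!: generated_algebra_base smooth_dir_deriv)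
  next
    case False
    with g have g: "g = (\<lambda>x. inverse (d x))" by auto
    have "dir_deriv b g = (\<lambda>x. inverse (d x) * (inverse (d x) * (-1 * dir_deriv b d x)))"
    proof
      fix x
      have "(d has_derivative frechet_derivative d (at x)) (at x)"
        using smooth_differentiable[OF d(1)] frechet_derivative_works by blast
      from Deriv.has_derivative_inverse[OF d(2) this]
      have "(g has_derivative (\<lambda>h. - (inverse (d x) * frechet_derivative d (at x) h * inverse (d x)))) (at x)"
        unfolding g by simp
      from dir_deriv_eq[OF this] show "dir_deriv b g x = inverse (d x) * (inverse (d x) * (-1 * dir_deriv b d x))"
        by (simp add: dir_deriv_def algebra_simps)
    qed
    also have "\<dots> \<in> generated_algebra ?B"
      by (intro generated_algebra_mult) 
        (auto intro!: generated_algebra_base smooth_dir_deriv smooth_const d b)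
    finally show ?thesis .
  qed
qed (auto intro: generated_algebra_base)

subsection \<open>Bump functions\<close>

text \<open>The powers of \<open>1 / t\<close> in front of the classical flat function
  \<open>exp (- 1 / t)\<close> close the family under derivatives: differentiation raises
  \<open>k\<close> by at most 2.\<close>

definition flat_exp :: "nat \<Rightarrow> real \<Rightarrow> real" where
  "flat_exp k t = (if t > 0 then inverse t ^ k * exp (- inverse t) else 0)"

lemma flat_exp_tendsto_0: "(flat_exp k \<longlongrightarrow> 0) (at 0)"
proof (rule filterlim_split_at)
  show "(flat_exp k \<longlongrightarrow> 0) (at_left 0)"
    by (rule tendsto_eventually) (auto simp: flat_exp_def eventually_at_filter)
  have "((\<lambda>t::real. inverse t ^ k / exp (inverse t)) \<longlongrightarrow> 0) (at_right 0)"
    by (rule filterlim_compose[OF tendsto_power_div_exp_0 filterlim_inverse_at_top_right])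
  then show "(flat_exp k \<longlongrightarrow> 0) (at_right 0)"
    by (rule Lim_transform_eventually)
      (auto simp: flat_exp_def eventually_at_filter exp_minus field_simps)
qed

lemma flat_exp_deriv:
  "(flat_exp k has_real_derivative (flat_exp (k + 2) t - real k * flat_exp (k + 1) t)) (at t)"
proof -
  consider "t < 0" | "t > 0" | "t = 0" by linarith
  then show ?thesis
  proof cases
    case 1
    have "((\<lambda>_. 0) has_real_derivative 0) (at t)" by simp
    then have "(flat_exp k has_real_derivative 0) (at t)"
      by (rule has_field_derivative_transform_within_open[of _ _ _ "{..<0}"])
        (use 1 in \<open>auto simp: flat_exp_def\<close>)
    with 1 show ?thesis by (simp add: flat_exp_def)
  next
    case 2
    have "((\<lambda>t. inverse t ^ k * exp (- inverse t)) has_real_derivative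
       (flat_exp (k + 2) t - real k * flat_exp (k + 1) t)) (at t)"
    proof -
      have "((\<lambda>t. inverse t ^ k * exp (- inverse t)) has_real_derivative
         real k * inverse t ^ (k - 1) * (- (inverse t * inverse t)) * exp (- inverse t)
         + inverse t ^ k * (exp (- inverse t) * (inverse t * inverse t))) (at t)"
        using 2 by (auto intro!: derivative_eq_intros simp: power2_eq_square)
      moreover have "real k * inverse t ^ (k - 1) * (- (inverse t * inverse t)) = - (real k * inverse t ^ (k + 1))"
        by (cases k) auto
      ultimately show ?thesis
        using 2 by (simp only: flat_exp_def if_True power_add) (simp add: algebra_simps power2_eq_square)
    qed
    then show ?thesis
      by (rule has_field_derivative_transform_within_open[of _ _ _ "{0<..}"])
        (use 2 in \<open>auto simp: flat_exp_def\<close>)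
  next
    case 3
    have "((\<lambda>h. (flat_exp k (0 + h) - flat_exp k 0) / h) \<longlongrightarrow> 0) (at 0)"
    proof -
      \<comment> \<open>Dividing by \<open>h\<close> raises the power of \<open>inverse h\<close> by
        one, so the quotient is again a member of the family, whose limit at 0 is known; for
        negative \<open>h\<close> both sides are 0.\<close>
      have "(flat_exp k (0 + h) - flat_exp k 0) / h = flat_exp (k + 1) h" for h
        by (simp add: flat_exp_def divide_inverse)
      then show ?thesis using flat_exp_tendsto_0[of "k + 1"] by presburger
    qed
    then have "(flat_exp k has_real_derivative 0) (at 0)" by (simp add: DERIV_def)
    with 3 show ?thesis by (simp add: flat_exp_def)
  qed
qed

lemma smooth_flat_exp: "smooth (\<lambda>x. flat_exp k (x \<bullet> v + a))"
proof (rule smooth_generated_algebraI)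
  let ?B = "{\<lambda>x. flat_exp k (x \<bullet> v + a) |k. True} \<union> Collect smooth"
  show "(\<lambda>x. flat_exp k (x \<bullet> v + a)) \<in> generated_algebra ?B"
    by (intro generated_algebra_base) blast
  have *: "((\<lambda>x. flat_exp k (x \<bullet> v + a)) has_derivative
     (\<lambda>h. (h \<bullet> v) * (flat_exp (k + 2) (x \<bullet> v + a) - real k * flat_exp (k + 1) (x \<bullet> v + a)))) (at x)" for k x
  proof -
    have "((\<lambda>x. x \<bullet> v + a) has_derivative (\<lambda>h. h \<bullet> v)) (at x)"
      by (auto intro!: derivative_eq_intros)
    from has_derivative_compose[OF this flat_exp_deriv[of k, unfolded has_field_derivative_def]]
    show ?thesis by (simp add: algebra_simps)
  qed
  fix g and b x :: 'a assume g: "g \<in> ?B"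
  show "g differentiable (at x)"
    using g * by (auto simp: differentiable_def intro: smooth_differentiable[unfolded differentiable_def])
  assume b: "b \<in> Basis"
  show "dir_deriv b g \<in> generated_algebra ?B"
  proof (cases "smooth g")
    case True
    with b show ?thesis by (auto intro!: generated_algebra_base smooth_dir_deriv)
  next
    case False
    with g obtain k where g: "g = (\<lambda>x. flat_exp k (x \<bullet> v + a))" by auto
    have "dir_deriv b g = (\<lambda>x. (b \<bullet> v) * (flat_exp (k + 2) (x \<bullet> v + a) + - real k * flat_exp (k + 1) (x \<bullet> v + a)))"
      unfolding g using dir_deriv_eq[OF *] by auto
    also have "\<dots> \<in> generated_algebra ?B"
      by (intro generated_algebra_mult generated_algebra_add) 
         (auto intro!: generated_algebra_base smooth_const)
    finally show ?thesis .
  qed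
qed

text \<open>The usual transition from 0 to 1 on the unit interval. One of \<open>t\<close> and
  \<open>1 - t\<close> is always positive, so the quotient has no singularity.\<close>

definition smooth_step :: "real \<Rightarrow> real" where
  "smooth_step t = flat_exp 0 t * inverse (flat_exp 0 t + flat_exp 0 (1 - t))"

lemma smooth_step_denom: "flat_exp 0 t + flat_exp 0 (1 - t) > 0"
  by (auto simp: flat_exp_def intro: add_pos_pos)

lemma smooth_smooth_step: "smooth (\<lambda>x. smooth_step (x \<bullet> v + a))"
proof -
  have "smooth (\<lambda>x. flat_exp 0 (x \<bullet> (-v) + (1 - a)))" by (rule smooth_flat_exp)
  then have "smooth (\<lambda>x. flat_exp 0 (1 - (x \<bullet> v + a)))" by (simp add: algebra_simps)
  then show ?thesis
    unfolding smooth_step_def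
    by (intro smooth_mult smooth_inverse smooth_add smooth_flat_exp)
       (assumption, rule less_imp_neq[THEN not_sym, OF smooth_step_denom])
qed

lemma smooth_step_eq_0: "t \<le> 0 \<Longrightarrow> smooth_step t = 0"
  and smooth_step_eq_1: "t \<ge> 1 \<Longrightarrow> smooth_step t = 1"
  by (simp_all add: smooth_step_def flat_exp_def)

lemma norm_le_Basis: 
  fixes x :: "'a::euclidean_space"
  assumes "\<And>b. b \<in> Basis \<Longrightarrow> \<bar>x \<bullet> b\<bar> \<le> r"
  shows "norm x \<le> real DIM('a) * r"
  using norm_le_l1[of x] sum_bounded_above[of "Basis::'a set" "\<lambda>b. \<bar>x \<bullet> b\<bar>" r] assms by auto

lemma exists_smooth_cutoff:
  fixes z :: "'a::euclidean_space"
  assumes "open U" "z \<in> U"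
  obtains b V C where "smooth b" "open V" "z \<in> V" "\<And>x. x \<in> V \<Longrightarrow> b x = (1::real)"
    "compact C" "C \<subseteq> U" "\<And>x. x \<notin> C \<Longrightarrow> b x = 0"
proof -
  obtain e where e: "e > 0" "cball z e \<subseteq> U" using assms open_contains_cball by blast
  \<comment> \<open>Per coordinate \<open>c\<close> the two factors of \<open>b\<close> below are 1
    while \<open>\<bar>(x - z) \<bullet> c\<bar> < d\<close>, and one of them is 0 beyond
    \<open>2 * d\<close>. Outside the ball of radius \<open>e\<close> some coordinate exceeds
    \<open>2 * d\<close>, because the norm is at most the sum of the absolute coordinates.\<close>
  define d where "d = e / (2 * DIM('a))"
  have d: "d > 0" using e by (simp add: d_def)
  define b where "b x = (\<Prod>c\<in>Basis. smooth_step (x \<bullet> (c /\<^sub>R d) + (2 - z \<bullet> c / d)) *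
     smooth_step (x \<bullet> (- (c /\<^sub>R d)) + (2 + z \<bullet> c / d)))" for x
  define V where "V = {x. \<forall>c\<in>Basis. \<bar>(x - z) \<bullet> c\<bar> < d}"
  show ?thesis
  proof
    show "smooth b" unfolding b_def by (intro smooth_prod smooth_mult smooth_smooth_step)
    have "V = (\<Inter>c\<in>Basis. {x. \<bar>(x - z) \<bullet> c\<bar> < d})" by (auto simp: V_def)
    also have "open \<dots>" by (intro open_INT finite_Basis ballI open_Collect_less continuous_intros)
    finally show "open V" .
    show "z \<in> V" using d by (simp add: V_def)
    show "b x = 1" if "x \<in> V" for x unfolding b_def
    proof (intro prod.neutral ballI)
      fix c :: 'a assume "c \<in> Basis"
      with that have "\<bar>(x - z) \<bullet> c\<bar> < d" by (auto simp: V_def)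
      then show "smooth_step (x \<bullet> (c /\<^sub>R d) + (2 - z \<bullet> c / d)) *
           smooth_step (x \<bullet> (- (c /\<^sub>R d)) + (2 + z \<bullet> c / d)) = 1"
        using d by (subst (1 2) smooth_step_eq_1) (simp_all add: inner_diff_left divide_simps abs_less_iff)
    qed
    show "compact (cball z e)" by simp
    show "cball z e \<subseteq> U" by fact
    show "b x = 0" if "x \<notin> cball z e" for x
    proof -
      have "\<exists>c\<in>Basis. \<bar>(x - z) \<bullet> c\<bar> > 2 * d"
      proof (rule ccontr)
        assume "\<not> ?thesis"
        then have "norm (x - z) \<le> DIM('a) * (2 * d)" using norm_le_Basis[of "x - z" "2 * d"] by (meson linorder_not_le)
        also have "\<dots> = e" by (simp add: d_def)
        finally show False using that by (simp add: dist_norm norm_minus_commute)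
      qed
      then obtain c where c: "c \<in> Basis" "\<bar>(x - z) \<bullet> c\<bar> > 2 * d" by auto
      then have "smooth_step (x \<bullet> (c /\<^sub>R d) + (2 - z \<bullet> c / d)) = 0 \<or>
           smooth_step (x \<bullet> (- (c /\<^sub>R d)) + (2 + z \<bullet> c / d)) = 0"
        using d by (cases "(x - z) \<bullet> c > 0") 
          (auto intro!: smooth_step_eq_0 simp: inner_diff_left divide_simps abs_if split: if_splits)
      with c show ?thesis unfolding b_def by (intro prod_zero) auto
    qed
  qed
qed

lemma exists_smooth_kernel:
  fixes e :: "'a::euclidean_space"
  assumes "\<kappa> > 0"
  obtains \<rho> :: "'a \<Rightarrow> real" and C where "smooth \<rho>" "compact C" "C \<subseteq> ball e \<kappa>"
    "\<And>x. x \<notin> C \<Longrightarrow> \<rho> x = 0" "\<And>x. \<rho> x \<ge> 0" "integrable lborel \<rho>" "(\<integral>x. \<rho> x \<partial>lborel) = 1"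
proof -
  obtain b V C where b: "smooth b" "open V" "e \<in> V" "\<And>x. x \<in> V \<Longrightarrow> b x = (1::real)"
    "compact C" "C \<subseteq> ball e \<kappa>" "\<And>x. x \<notin> C \<Longrightarrow> b x = 0"
    using exists_smooth_cutoff[of "ball e \<kappa>" e] assms by auto
  \<comment> \<open>Squaring makes the cutoff nonnegative without information on its sign; it still
    equals 1 near \<open>e\<close>, so its integral is positive and can be normalized.\<close>
  define g where "g x = b x * b x" for x
  have g: "smooth g" "\<And>x. g x \<ge> 0" using smooth_mult[OF b(1) b(1)] by (auto simp: g_def[abs_def])
  have ig: "integrable lborel g"
  proof -
    have "integrable lborel (\<lambda>x. indicator C x *\<^sub>R g x)"
      using b g(1) by (intro borel_integrable_compact) (auto intro: smooth_continuous_on)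
    also have "(\<lambda>x. indicator C x *\<^sub>R g x) = g"
      using b(7) by (auto simp: g_def indicator_def fun_eq_iff)
    finally show ?thesis .
  qed
  obtain r where r: "r > 0" "ball e r \<subseteq> V" using b(2,3) open_contains_ball by blast
  have "0 < measure lborel (ball e r)" using r by (simp add: content_ball_pos)
  also have "\<dots> = (\<integral>x. indicator (ball e r) x \<partial>lborel)" by simp
  also have "\<dots> \<le> (\<integral>x. g x \<partial>lborel)"
  proof (rule integral_mono)
    show "integrable lborel (indicat_real (ball e r))"
      by (intro integrable_real_indicator) (auto intro: emeasure_bounded_finite[OF bounded_ball, simplified])
    show "indicat_real (ball e r) x \<le> g x" for x
      using r b(4)[of x] g(2)[of x] by (auto simp: indicator_def g_def)
  qed (rule ig)
  finally have pos: "(\<integral>x. g x \<partial>lborel) > 0" .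
  show ?thesis
  proof
    show "smooth (\<lambda>x. inverse (\<integral>x. g x \<partial>lborel) * g x)" by (intro smooth_cmult g)
    show "compact C" "C \<subseteq> ball e \<kappa>" by fact+
    show "inverse (\<integral>x. g x \<partial>lborel) * g x = 0" if "x \<notin> C" for x
      using b(7)[OF that] by (simp add: g_def)
  qed (use g ig pos in auto)
qed

subsection \<open>Square-integrable functions\<close>

lemma L2_measurable [measurable_dest]: "f \<in> L2 M \<Longrightarrow> f \<in> borel_measurable M"
  and L2_integrable_sq: "f \<in> L2 M \<Longrightarrow> integrable M (\<lambda>x. (f x)\<^sup>2)"
  by (auto simp: L2_def)

lemma L2_integrable_mult:
  assumes "f \<in> L2 M" "g \<in> L2 M"
  shows "integrable M (\<lambda>x. f x * g x)"
proof (rule Bochner_Integration.integrable_bound)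
  show "integrable M (\<lambda>x. (f x)\<^sup>2 + (g x)\<^sup>2)"
    using assms by (intro Bochner_Integration.integrable_add L2_integrable_sq)
  have "\<bar>a * b\<bar> \<le> a\<^sup>2 + b\<^sup>2" for a b :: real
  proof -
    have "0 \<le> \<bar>a\<bar> * \<bar>b\<bar>" by simp
    with sum_squares_bound[of "\<bar>a\<bar>" "\<bar>b\<bar>"] show ?thesis
      unfolding abs_mult power2_abs by linarith
  qed
  then show "AE x in M. norm (f x * g x) \<le> norm ((f x)\<^sup>2 + (g x)\<^sup>2)" by auto
qed (use assms in \<open>auto intro!: borel_measurable_times L2_measurable\<close>)

lemma L2_add: "f \<in> L2 M \<Longrightarrow> g \<in> L2 M \<Longrightarrow> (\<lambda>x. f x + g x) \<in> L2 M"
proof -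
  assume a: "f \<in> L2 M" "g \<in> L2 M"
  then have "integrable M (\<lambda>x. (f x)\<^sup>2 + (g x)\<^sup>2 + 2 * (f x * g x))"
    by (intro Bochner_Integration.integrable_add L2_integrable_sq integrable_mult_right L2_integrable_mult)
  also have "(\<lambda>x. (f x)\<^sup>2 + (g x)\<^sup>2 + 2 * (f x * g x)) = (\<lambda>x. (f x + g x)\<^sup>2)"
    by (simp add: fun_eq_iff power2_sum)
  finally show ?thesis using a by (auto simp: L2_def)
qed

lemma L2_cmult: "f \<in> L2 M \<Longrightarrow> (\<lambda>x. c * f x) \<in> L2 M"
  by (auto simp: L2_def power_mult_distrib)

lemma L2_diff: "f \<in> L2 M \<Longrightarrow> g \<in> L2 M \<Longrightarrow> (\<lambda>x. f x - g x) \<in> L2 M"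
  using L2_add[of f M "\<lambda>x. -1 * g x"] L2_cmult[of g M "-1"] by simp

lemma L2_zero: "(\<lambda>x. 0) \<in> L2 M"
  by (simp add: L2_def)

lemma L2_sum: "(\<And>i. i \<in> I \<Longrightarrow> f i \<in> L2 M) \<Longrightarrow> (\<lambda>x. \<Sum>i\<in>I. f i x) \<in> L2 M"
  by (induction I rule: infinite_finite_induct) (auto intro: L2_add L2_zero)

lemma L2_cong_AE:
  assumes "f \<in> L2 M" "g \<in> borel_measurable M" "AE x in M. f x = g x"
  shows "g \<in> L2 M"
proof -
  have "integrable M (\<lambda>x. (g x)\<^sup>2)"
    by (rule integrable_cong_AE_imp[OF L2_integrable_sq[OF assms(1)]]) (use assms in auto)
  then show ?thesis using assms by (simp add: L2_def)
qed

lemma L2_bounded_mult: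
  assumes f: "f \<in> L2 M" and g: "g \<in> borel_measurable M" and B: "\<And>x. x \<in> space M \<Longrightarrow> \<bar>g x\<bar> \<le> B"
  shows "(\<lambda>x. g x * f x) \<in> L2 M"
proof -
  have "integrable M (\<lambda>x. (g x * f x)\<^sup>2)"
  proof (rule Bochner_Integration.integrable_bound)
    show "integrable M (\<lambda>x. B\<^sup>2 * (f x)\<^sup>2)"
      by (intro integrable_mult_right L2_integrable_sq f)
    have "(g x)\<^sup>2 \<le> B\<^sup>2" if "x \<in> space M" for x
      using power_mono[OF B[OF that], of 2] by simp
    then show "AE x in M. norm ((g x * f x)\<^sup>2) \<le> norm (B\<^sup>2 * (f x)\<^sup>2)"
      by (auto simp: power_mult_distrib intro!: mult_right_mono)
  qed (use f g in \<open>auto intro: L2_measurable\<close>)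
  moreover have "f \<in> borel_measurable M" by (rule L2_measurable[OF f])
  ultimately show ?thesis using g by (simp add: L2_def)
qed

lemma l2_inner_commute: "l2_inner M f g = l2_inner M g f"
  by (simp add: l2_inner_def mult.commute)

lemma l2_inner_add_left:
  "f \<in> L2 M \<Longrightarrow> g \<in> L2 M \<Longrightarrow> k \<in> L2 M \<Longrightarrow>
    l2_inner M (\<lambda>x. f x + g x) k = l2_inner M f k + l2_inner M g k"
  by (simp add: l2_inner_def distrib_right L2_integrable_mult)

lemma l2_inner_diff_left:
  "f \<in> L2 M \<Longrightarrow> g \<in> L2 M \<Longrightarrow> k \<in> L2 M \<Longrightarrow>
    l2_inner M (\<lambda>x. f x - g x) k = l2_inner M f k - l2_inner M g k"
  by (simp add: l2_inner_def left_diff_distrib L2_integrable_mult)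

lemma l2_inner_diff_right:
  "f \<in> L2 M \<Longrightarrow> g \<in> L2 M \<Longrightarrow> k \<in> L2 M \<Longrightarrow>
    l2_inner M k (\<lambda>x. f x - g x) = l2_inner M k f - l2_inner M k g"
  by (simp add: l2_inner_diff_left l2_inner_commute[of M k])

lemma l2_inner_cmult_left: "l2_inner M (\<lambda>x. c * f x) k = c * l2_inner M f k"
  by (simp add: l2_inner_def mult.assoc)

lemma l2_inner_cmult_right: "l2_inner M k (\<lambda>x. c * f x) = c * l2_inner M k f"
  by (simp add: l2_inner_cmult_left l2_inner_commute[of M k])

lemma l2_inner_add_right:
  "f \<in> L2 M \<Longrightarrow> g \<in> L2 M \<Longrightarrow> k \<in> L2 M \<Longrightarrow>
    l2_inner M k (\<lambda>x. f x + g x) = l2_inner M k f + l2_inner M k g"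
  by (simp add: l2_inner_add_left l2_inner_commute[of M k])

lemma l2_inner_sum_left:
  "(\<And>i. i \<in> I \<Longrightarrow> f i \<in> L2 M) \<Longrightarrow> k \<in> L2 M \<Longrightarrow>
    l2_inner M (\<lambda>x. \<Sum>i\<in>I. f i x) k = (\<Sum>i\<in>I. l2_inner M (f i) k)"
  by (simp add: l2_inner_def sum_distrib_right L2_integrable_mult)

lemma l2_inner_cong_AE:
  assumes "AE x in M. f x = f' x" "AE x in M. g x = g' x"
    "f \<in> borel_measurable M" "g \<in> borel_measurable M" "f' \<in> borel_measurable M" "g' \<in> borel_measurable M"
  shows "l2_inner M f g = l2_inner M f' g'"
  unfolding l2_inner_def by (rule integral_cong_AE) (use assms in auto)

lemma l2_inner_self_nonneg: "l2_inner M f f \<ge> 0"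
  by (simp add: l2_inner_def)

lemma l2_norm_nonneg: "l2_norm M f \<ge> 0"
  by (simp add: l2_norm_def l2_inner_self_nonneg)

lemma l2_norm_sq: "(l2_norm M f)\<^sup>2 = (\<integral>x. (f x)\<^sup>2 \<partial>M)"
  using l2_inner_self_nonneg[of M f] by (simp add: l2_norm_def l2_inner_def power2_eq_square)

lemma l2_norm_sq_inner: "(l2_norm M f)\<^sup>2 = l2_inner M f f"
  using l2_inner_self_nonneg[of M f] by (simp add: l2_norm_def)

lemma l2_norm_cmult: "l2_norm M (\<lambda>x. c * f x) = \<bar>c\<bar> * l2_norm M f"
  by (simp add: l2_norm_def l2_inner_cmult_left l2_inner_cmult_right real_sqrt_mult)

lemma l2_norm_minus_commute: "l2_norm M (\<lambda>x. f x - g x) = l2_norm M (\<lambda>x. g x - f x)"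
  using l2_norm_cmult[of M "-1" "\<lambda>x. f x - g x"] by simp

lemma l2_norm_zero: "l2_norm M (\<lambda>x. 0) = 0"
  by (simp add: l2_norm_def l2_inner_def)

lemma l2_norm_cong_AE:
  assumes "AE x in M. f x = g x" "f \<in> borel_measurable M" "g \<in> borel_measurable M"
  shows "l2_norm M f = l2_norm M g"
  unfolding l2_norm_def using l2_inner_cong_AE[OF assms(1,1)] assms by simp

lemma nn_integral_sq:
  "f \<in> L2 M \<Longrightarrow> (\<integral>\<^sup>+x. ennreal ((f x)\<^sup>2) \<partial>M) = ennreal ((l2_norm M f)\<^sup>2)"
  by (simp add: nn_integral_eq_integral L2_integrable_sq l2_norm_sq)

lemma L2_I_nn_integral:
  assumes "f \<in> borel_measurable M" "(\<integral>\<^sup>+x. ennreal ((f x)\<^sup>2) \<partial>M) < \<infinity>"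
  shows "f \<in> L2 M"
  using assms by (auto simp: L2_def integrable_iff_bounded)

text \<open>Covers the degenerate case of a linear function, where
  \<open>t = - (a + 1) / (2 * b)\<close> would produce the value -1. Hence it yields Cauchy-Schwarz
  for forms that are only semidefinite: the L2 product on representatives and later
  \<open>grad_inner\<close>.\<close>

lemma discriminant_le:
  fixes a b c :: real
  assumes "\<And>t. a + 2 * t * b + t\<^sup>2 * c \<ge> 0" "c \<ge> 0"
  shows "b\<^sup>2 \<le> a * c"
proof (cases "c = 0")
  case True
  have "b = 0"
  proof (rule ccontr)
    assume "b \<noteq> 0"
    then show False using assms(1)[of "- (a + 1) / (2 * b)"] True by (simp add: field_simps)
  qed
  with True show ?thesis by simp
next
  case False
  then have "c > 0" using assms by simp
  with assms(1)[of "- b / c"] show ?thesis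
    by (simp add: field_simps power2_eq_square)
qed

lemma l2_Cauchy_Schwarz:
  assumes "f \<in> L2 M" "g \<in> L2 M"
  shows "\<bar>l2_inner M f g\<bar> \<le> l2_norm M f * l2_norm M g"
proof -
  have "l2_inner M f f + 2 * t * l2_inner M f g + t\<^sup>2 * l2_inner M g g \<ge> 0" for t
  proof -
    have "0 \<le> l2_inner M (\<lambda>x. f x + t * g x) (\<lambda>x. f x + t * g x)"
      by (rule l2_inner_self_nonneg)
    also have "\<dots> = l2_inner M f f + 2 * t * l2_inner M f g + t\<^sup>2 * l2_inner M g g"
      using assms
      by (simp add: l2_inner_add_left l2_inner_add_right L2_add L2_cmult l2_inner_cmult_left
          l2_inner_cmult_right l2_inner_commute[of M g f] power2_eq_square distrib_left)
    finally show ?thesis .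
  qed
  from discriminant_le[OF this l2_inner_self_nonneg]
  have "(l2_inner M f g)\<^sup>2 \<le> (l2_norm M f * l2_norm M g)\<^sup>2"
    by (simp add: power_mult_distrib l2_norm_sq_inner)
  then show ?thesis
    using l2_norm_nonneg[of M f] l2_norm_nonneg[of M g] by (simp add: abs_le_square_iff[symmetric])
qed

lemma l2_norm_triangle:
  assumes "f \<in> L2 M" "g \<in> L2 M"
  shows "l2_norm M (\<lambda>x. f x + g x) \<le> l2_norm M f + l2_norm M g"
proof (rule power2_le_imp_le)
  have "(l2_norm M (\<lambda>x. f x + g x))\<^sup>2 = (l2_norm M f)\<^sup>2 + 2 * l2_inner M f g + (l2_norm M g)\<^sup>2"
    using assms
    by (simp add: l2_norm_sq_inner l2_inner_add_left l2_inner_add_right L2_add l2_inner_commute[of M g f])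
  also have "\<dots> \<le> (l2_norm M f + l2_norm M g)\<^sup>2"
    using l2_Cauchy_Schwarz[OF assms] by (simp add: power2_sum)
  finally show "(l2_norm M (\<lambda>x. f x + g x))\<^sup>2 \<le> (l2_norm M f + l2_norm M g)\<^sup>2" .
qed (simp add: l2_norm_nonneg)

lemma l2_norm_triangle_diff:
  assumes "f \<in> L2 M" "g \<in> L2 M"
  shows "l2_norm M (\<lambda>x. f x - g x) \<le> l2_norm M f + l2_norm M g"
  using l2_norm_triangle[OF assms(1) L2_cmult[OF assms(2), of "-1"]] l2_norm_cmult[of M "-1" g] by simp

text \<open>The squared differences tend to 0 in L1, and L1 convergence has an almost everywhere
  convergent subsequence.\<close>

lemma l2_tendsto_AE_subseq:
  assumes f: "\<And>n. f n \<in> L2 M" "g \<in> L2 M"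
    and lim: "(\<lambda>n. l2_norm M (\<lambda>x. f n x - g x)) \<longlonglongrightarrow> 0"
  obtains r :: "nat \<Rightarrow> nat" where "strict_mono r" "AE x in M. (\<lambda>n. f (r n) x) \<longlonglongrightarrow> g x"
proof -
  have "(\<lambda>n. (l2_norm M (\<lambda>x. f n x - g x))\<^sup>2) \<longlonglongrightarrow> 0"
    using tendsto_power[OF lim, of 2] by simp
  then have "(\<lambda>n. \<integral>x. norm ((f n x - g x)\<^sup>2) \<partial>M) \<longlonglongrightarrow> 0"
    by (simp add: l2_norm_sq)
  moreover have "integrable M (\<lambda>x. (f n x - g x)\<^sup>2)" for n
    by (intro L2_integrable_sq L2_diff f)
  ultimately obtain r :: "nat \<Rightarrow> nat"
    where r: "strict_mono r" "AE x in M. (\<lambda>n. (f (r n) x - g x)\<^sup>2) \<longlonglongrightarrow> 0"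
    using tendsto_L1_AE_subseq[of M "\<lambda>n x. (f n x - g x)\<^sup>2"] by auto
  have "AE x in M. (\<lambda>n. f (r n) x) \<longlonglongrightarrow> g x"
    using r(2)
  proof eventually_elim
    case (elim x)
    then have "(\<lambda>n. f (r n) x - g x) \<longlonglongrightarrow> 0"
      using tendsto_real_sqrt[OF elim] by (simp add: tendsto_rabs_zero_iff)
    then show ?case by (simp add: LIM_zero_iff)
  qed
  with r(1) show ?thesis by (rule that)
qed

lemma L2_bounded:
  assumes "f \<in> borel_measurable M" "\<And>x. x \<in> space M \<Longrightarrow> \<bar>f x\<bar> \<le> B" "finite_measure M"
  shows "f \<in> L2 M"
proof -
  interpret finite_measure M by fact
  have "(\<lambda>x. 1) \<in> L2 M" by (simp add: L2_def)
  from L2_bounded_mult[OF this assms(1,2)] show ?thesis by simp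
qed

subsection \<open>Translations and mollification\<close>

lemma nn_integral_lborel_translate:
  fixes h :: "'a::euclidean_space"
  assumes [measurable]: "f \<in> borel_measurable borel"
  shows "(\<integral>\<^sup>+x. f (x + h) \<partial>lborel) = (\<integral>\<^sup>+x. f x \<partial>lborel)"
proof -
  have "(\<integral>\<^sup>+x. f x \<partial>lborel) = (\<integral>\<^sup>+x. f x \<partial>distr lborel borel ((+) h))"
    by (simp add: lborel_distr_plus)
  also have "\<dots> = (\<integral>\<^sup>+x. f (h + x) \<partial>lborel)" by (subst nn_integral_distr) auto
  finally show ?thesis by (simp add: add.commute)
qed

lemma nn_integral_lborel_affine:
  fixes t :: "'a::euclidean_space"
  assumes [measurable]: "f \<in> borel_measurable borel" and c: "c > 0"
  shows "(\<integral>\<^sup>+x. f x \<partial>lborel) = ennreal (c ^ DIM('a)) * (\<integral>\<^sup>+x. f (t + c *\<^sub>R x) \<partial>lborel)"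
  using c by (subst lborel_affine[of c t])
     (simp_all add: nn_integral_density nn_integral_distr nn_integral_cmult)

lemma integral_lborel_affine:
  fixes t :: "'a::euclidean_space" and f :: "'a \<Rightarrow> real"
  assumes [measurable]: "f \<in> borel_measurable borel" and c: "c > 0"
  shows "(\<integral>x. f x \<partial>lborel) = c ^ DIM('a) * (\<integral>x. f (t + c *\<^sub>R x) \<partial>lborel)"
  using c by (subst lborel_affine[of c t])
     (simp_all add: integral_density integral_distr)

lemma L2_lborel_affine:
  fixes t :: "'a::euclidean_space"
  assumes f: "f \<in> L2 lborel" and c: "c > 0"
  shows "(\<lambda>x. f (t + c *\<^sub>R x)) \<in> L2 lborel"
proof (rule L2_I_nn_integral)
  have [measurable]: "f \<in> borel_measurable borel" using L2_measurable[OF f] by simp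
  show "(\<lambda>x. f (t + c *\<^sub>R x)) \<in> borel_measurable lborel" by simp
  show "(\<integral>\<^sup>+x. ennreal ((f (t + c *\<^sub>R x))\<^sup>2) \<partial>lborel) < \<infinity>"
    using nn_integral_sq[OF f] nn_integral_lborel_affine[of "\<lambda>x. ennreal ((f x)\<^sup>2)" c t] c
    by (auto simp: less_top[symmetric] ennreal_mult_eq_top_iff)
qed

lemma tendsto_0_le_ennreal:
  fixes f g :: "nat \<Rightarrow> ennreal"
  assumes "\<And>n. f n \<le> g n" "g \<longlonglongrightarrow> 0"
  shows "f \<longlonglongrightarrow> 0"
  by (rule tendsto_sandwich[OF _ _ tendsto_const assms(2)]) (simp_all add: assms(1))

text \<open>The shape of a density argument: each approximation contributes a null sequence
  \<open>G\<close> and an error \<open>e\<close> that does not depend on \<open>n\<close>.\<close>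

lemma tendsto_0_ennreal_approx:
  fixes F :: "nat \<Rightarrow> ennreal"
  assumes "\<And>e::real. e > 0 \<Longrightarrow> \<exists>G. G \<longlonglongrightarrow> 0 \<and> (\<forall>n. F n \<le> G n + ennreal e)"
  shows "F \<longlonglongrightarrow> 0"
proof (rule order_tendstoI)
  fix a :: ennreal assume "0 < a"
  then obtain b where b: "0 < b" "b < a" using dense by blast
  then obtain r where r: "b = ennreal r" "r > 0"
    by (cases b) auto
  then obtain G where G: "G \<longlonglongrightarrow> 0" "\<And>n. F n \<le> G n + ennreal (r / 2)"
    using assms[of "r / 2"] by auto
  have "eventually (\<lambda>n. G n < ennreal (r / 2)) sequentially"
    using r by (intro order_tendstoD(2)[OF G(1)]) auto
  then show "eventually (\<lambda>n. F n < a) sequentially"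
  proof eventually_elim
    case (elim n)
    have "F n \<le> G n + ennreal (r / 2)" by (rule G)
    also have "\<dots> \<le> ennreal (r / 2) + ennreal (r / 2)" using elim by (intro add_mono) auto
    also have "\<dots> = b" using r by (simp flip: ennreal_plus)
    finally show ?case using b by simp
  qed
qed simp

text \<open>Translation preserves the integral, so replacing \<open>f\<close> by \<open>g\<close>
  costs the same error once for the shifted and once for the unshifted function.\<close>

lemma L1_translation_approx:
  fixes f g :: "'a::euclidean_space \<Rightarrow> real"
  assumes [measurable]: "f \<in> borel_measurable borel" "g \<in> borel_measurable borel"
    and fg: "(\<integral>\<^sup>+x. ennreal \<bar>f x - g x\<bar> \<partial>lborel) \<le> ennreal e" "e \<ge> 0"
  shows "(\<integral>\<^sup>+x. ennreal \<bar>f (x + h) - f x\<bar> \<partial>lborel)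
    \<le> (\<integral>\<^sup>+x. ennreal \<bar>g (x + h) - g x\<bar> \<partial>lborel) + ennreal (2 * e)"
proof -
  have "(\<integral>\<^sup>+x. ennreal \<bar>f (x + h) - f x\<bar> \<partial>lborel)
    \<le> (\<integral>\<^sup>+x. ennreal \<bar>g (x + h) - g x\<bar> + (ennreal \<bar>f (x + h) - g (x + h)\<bar> + ennreal \<bar>f x - g x\<bar>) \<partial>lborel)"
    by (intro nn_integral_mono) (simp flip: ennreal_plus)
  also have "\<dots> = (\<integral>\<^sup>+x. ennreal \<bar>g (x + h) - g x\<bar> \<partial>lborel) +
     ((\<integral>\<^sup>+x. ennreal \<bar>f (x + h) - g (x + h)\<bar> \<partial>lborel) + (\<integral>\<^sup>+x. ennreal \<bar>f x - g x\<bar> \<partial>lborel))"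
    by (subst nn_integral_add; (simp add: nn_integral_add)?)
  also have "(\<integral>\<^sup>+x. ennreal \<bar>f (x + h) - g (x + h)\<bar> \<partial>lborel) = (\<integral>\<^sup>+x. ennreal \<bar>f x - g x\<bar> \<partial>lborel)"
    by (rule nn_integral_lborel_translate[of "\<lambda>x. ennreal \<bar>f x - g x\<bar>"]) simp
  also have "(\<integral>\<^sup>+x. ennreal \<bar>f x - g x\<bar> \<partial>lborel) + (\<integral>\<^sup>+x. ennreal \<bar>f x - g x\<bar> \<partial>lborel) \<le> ennreal e + ennreal e"
    by (intro add_mono fg)
  also have "ennreal e + ennreal e = ennreal (2 * e)" using fg(2) by (simp flip: ennreal_plus)
  finally show ?thesis by (auto intro: add_left_mono)
qed

text \<open>A point of an open set stays in it under small shifts, so dominated convergence handles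
  the points that leave \<open>U\<close>. The points that enter \<open>U\<close> are reduced to this
  case by translating back, that is by the sequence \<open>- h\<close>.\<close>

lemma indicator_open_translation_continuous:
  fixes U :: "'a::euclidean_space set"
  assumes U: "open U" "emeasure lborel U < \<infinity>" and h: "h \<longlonglongrightarrow> 0"
  shows "(\<lambda>n. \<integral>\<^sup>+x. ennreal \<bar>indicat_real U (x + h n) - indicat_real U x\<bar> \<partial>lborel) \<longlonglongrightarrow> 0"
proof -
  have [measurable]: "U \<in> sets borel" using U by auto
  have D: "(\<lambda>n. \<integral>\<^sup>+x. indicator U x * indicator (- U) (x + k n) \<partial>lborel) \<longlonglongrightarrow> (0::ennreal)"
    if k: "k \<longlonglongrightarrow> 0" for k
  proof -
    have "(\<lambda>n. \<integral>\<^sup>+x. indicator U x * indicator (- U) (x + k n) \<partial>lborel) \<longlonglongrightarrow> (\<integral>\<^sup>+x. (0::ennreal) \<partial>(lborel::'a measure))"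
    proof (rule nn_integral_dominated_convergence)
      show "AE x in lborel. indicator U x * indicator (- U) (x + k j) \<le> (indicator U x :: ennreal)" for j
        by (auto simp: indicator_def)
      show "integral\<^sup>N lborel (indicator U) < \<infinity>" using U by simp
      show "AE x in lborel. (\<lambda>i. indicator U x * indicator (- U) (x + k i)) \<longlonglongrightarrow> (0::ennreal)"
      proof (rule AE_I2)
        fix x :: 'a
        have "(\<lambda>i. x + k i) \<longlonglongrightarrow> x + 0" by (intro tendsto_intros k)
        then have "x \<in> U \<Longrightarrow> eventually (\<lambda>i. x + k i \<in> U) sequentially"
          using topological_tendstoD[OF _ U(1)] by simp
        then show "(\<lambda>i. indicator U x * indicator (- U) (x + k i)) \<longlonglongrightarrow> (0::ennreal)"
          by (intro tendsto_eventually) (cases "x \<in> U"; auto elim!: eventually_mono)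
      qed
    qed auto
    then show ?thesis by simp
  qed
  have eq: "(\<integral>\<^sup>+x. ennreal \<bar>indicat_real U (x + h n) - indicat_real U x\<bar> \<partial>lborel)
    = (\<integral>\<^sup>+x. indicator U x * indicator (- U) (x + h n) \<partial>lborel)
      + (\<integral>\<^sup>+x. indicator U x * indicator (- U) (x + - h n) \<partial>lborel)" for n
  proof -
    have "(\<integral>\<^sup>+x. indicator U x * indicator (- U) (x + - h n) \<partial>lborel)
       = (\<integral>\<^sup>+x. indicator U (x + h n) * indicator (- U) x \<partial>lborel)"
      using nn_integral_lborel_translate[of "\<lambda>x. indicator U x * indicator (- U) (x + - h n)" "h n"]
      by simp
    moreover have "(\<integral>\<^sup>+x. ennreal \<bar>indicat_real U (x + h n) - indicat_real U x\<bar> \<partial>lborel)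
      = (\<integral>\<^sup>+x. indicator U x * indicator (- U) (x + h n) + indicator U (x + h n) * indicator (- U) x \<partial>lborel)"
      by (intro nn_integral_cong) (auto simp: indicator_def)
    ultimately show ?thesis by (simp add: nn_integral_add)
  qed
  have "(\<lambda>n. - h n) \<longlonglongrightarrow> 0" using tendsto_minus[OF h] by simp
  from tendsto_add[OF D[OF h] D[OF this]] show ?thesis unfolding eq by simp
qed

text \<open>Outer regularity supplies an open superset with small excess measure, hence L1 close;
  the finite measure of \<open>A\<close> keeps that of \<open>U\<close> finite.\<close>

lemma indicator_translation_continuous:
  fixes A :: "'a::euclidean_space set"
  assumes A [measurable]: "A \<in> sets borel" and fin: "emeasure lborel A < \<infinity>" and h: "h \<longlonglongrightarrow> 0"
  shows "(\<lambda>n. \<integral>\<^sup>+x. ennreal \<bar>indicat_real A (x + h n) - indicat_real A x\<bar> \<partial>lborel) \<longlonglongrightarrow> 0"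
proof (rule tendsto_0_ennreal_approx)
  fix e :: real assume e: "e > 0"
  obtain U where U: "open U" "A \<subseteq> U" "emeasure lborel (U - A) < ennreal (e / 2)"
    using outer_regular_lborel[OF A, of "e / 2"] e by auto
  have [measurable]: "U \<in> sets borel" using U by auto
  have "emeasure lborel U \<le> emeasure lborel A + emeasure lborel (U - A)"
    using U(2) emeasure_subadditive[of A lborel "U - A"] by (simp add: Un_absorb1)
  also have "\<dots> < \<infinity>" using fin U(3) order.strict_trans[OF U(3), of top] by auto
  finally have fU: "emeasure lborel U < \<infinity>" .
  have "(\<integral>\<^sup>+x. ennreal \<bar>indicat_real A x - indicat_real U x\<bar> \<partial>lborel) = (\<integral>\<^sup>+x. indicator (U - A) x \<partial>lborel)"
    using U(2) by (intro nn_integral_cong) (auto simp: indicator_def)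
  also have "\<dots> \<le> ennreal (e / 2)" using U(3) by simp
  finally have "(\<integral>\<^sup>+x. ennreal \<bar>indicat_real A x - indicat_real U x\<bar> \<partial>lborel) \<le> ennreal (e / 2)" .
  from L1_translation_approx[OF _ _ this]
  have "(\<integral>\<^sup>+x. ennreal \<bar>indicat_real A (x + h n) - indicat_real A x\<bar> \<partial>lborel)
     \<le> (\<integral>\<^sup>+x. ennreal \<bar>indicat_real U (x + h n) - indicat_real U x\<bar> \<partial>lborel) + ennreal e" for n
    using e by simp
  with indicator_open_translation_continuous[OF U(1) fU h]
  show "\<exists>G. G \<longlonglongrightarrow> 0 \<and> (\<forall>n. (\<integral>\<^sup>+x. ennreal \<bar>indicat_real A (x + h n) - indicat_real A x\<bar> \<partial>lborel) \<le> G n + ennreal e)"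
    by blast
qed

lemma L1_translation_continuous:
  fixes f :: "'a::euclidean_space \<Rightarrow> real"
  assumes "integrable lborel f" "h \<longlonglongrightarrow> 0"
  shows "(\<lambda>n. \<integral>\<^sup>+x. ennreal \<bar>f (x + h n) - f x\<bar> \<partial>lborel) \<longlonglongrightarrow> 0"
  using assms(1)
proof (induction rule: integrable_induct)
  case (base A c)
  then have [measurable]: "A \<in> sets borel" by simp
  have "(\<integral>\<^sup>+x. ennreal \<bar>indicator A (x + h n) *\<^sub>R c - indicator A x *\<^sub>R c\<bar> \<partial>lborel)
    = ennreal \<bar>c\<bar> * (\<integral>\<^sup>+x. ennreal \<bar>indicat_real A (x + h n) - indicat_real A x\<bar> \<partial>lborel)" for n
    by (subst nn_integral_cmult[symmetric])
      (auto intro!: nn_integral_cong simp: mult.commute[of _ c] simp flip: ennreal_mult abs_mult right_diff_distrib)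
  moreover have "(\<lambda>n. ennreal \<bar>c\<bar> * (\<integral>\<^sup>+x. ennreal \<bar>indicat_real A (x + h n) - indicat_real A x\<bar> \<partial>lborel)) \<longlonglongrightarrow> ennreal \<bar>c\<bar> * 0"
    using base by (intro ennreal_tendsto_cmult indicator_translation_continuous assms(2)) auto
  ultimately show ?case by simp
next
  case (add f g)
  have [measurable]: "f \<in> borel_measurable borel" "g \<in> borel_measurable borel" using add by auto
  have le: "(\<integral>\<^sup>+x. ennreal \<bar>f (x + h n) + g (x + h n) - (f x + g x)\<bar> \<partial>lborel)
     \<le> (\<integral>\<^sup>+x. ennreal \<bar>f (x + h n) - f x\<bar> \<partial>lborel) + (\<integral>\<^sup>+x. ennreal \<bar>g (x + h n) - g x\<bar> \<partial>lborel)" for n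
    by (subst nn_integral_add[symmetric])
      (auto intro!: nn_integral_mono ennreal_leI simp flip: ennreal_plus)
  show ?case
    by (rule tendsto_sandwich[OF _ _ tendsto_const tendsto_add[OF add.IH, simplified]])
      (auto intro!: always_eventually le)
next
  case (lim f s)
  have [measurable]: "f \<in> borel_measurable borel" "\<And>i. s i \<in> borel_measurable borel" using lim by auto
  show ?case
  proof (rule tendsto_0_ennreal_approx)
    fix e :: real assume e: "e > 0"
    have "(\<lambda>i. \<integral>\<^sup>+x. ennreal \<bar>f x - s i x\<bar> \<partial>lborel) \<longlonglongrightarrow> (\<integral>\<^sup>+x. 0 \<partial>(lborel::'a measure))"
    proof (rule nn_integral_dominated_convergence)
      \<comment> \<open>The induction rule for integrable functions delivers
        \<open>\<bar>s j x\<bar> \<le> 2 * \<bar>f x\<bar>\<close>, which makes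
        \<open>3 * \<bar>f x\<bar>\<close> a majorant.\<close>
      show "AE x in lborel. ennreal \<bar>f x - s j x\<bar> \<le> ennreal (3 * \<bar>f x\<bar>)" for j
      proof (intro AE_I2 ennreal_leI)
        fix x :: 'a
        have "\<bar>s j x\<bar> \<le> 2 * \<bar>f x\<bar>" using lim.hyps(3)[of x j] by simp
        then show "\<bar>f x - s j x\<bar> \<le> 3 * \<bar>f x\<bar>" by linarith
      qed
      show "(\<integral>\<^sup>+x. ennreal (3 * \<bar>f x\<bar>) \<partial>lborel) < \<infinity>"
        using lim.hyps(4) by (subst nn_integral_eq_integral) auto
      show "AE x in lborel. (\<lambda>i. ennreal \<bar>f x - s i x\<bar>) \<longlonglongrightarrow> 0"
      proof (rule AE_I2)
        fix x :: 'a
        have "(\<lambda>i. \<bar>f x - s i x\<bar>) \<longlonglongrightarrow> \<bar>f x - f x\<bar>"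
          by (intro tendsto_intros lim.hyps(2)) simp
        then show "(\<lambda>i. ennreal \<bar>f x - s i x\<bar>) \<longlonglongrightarrow> 0"
          using tendsto_ennrealI by fastforce
      qed
    qed auto
    then have "eventually (\<lambda>i. (\<integral>\<^sup>+x. ennreal \<bar>f x - s i x\<bar> \<partial>lborel) < ennreal (e / 2)) sequentially"
      using e by (intro order_tendstoD(2)) auto
    then obtain i where i: "(\<integral>\<^sup>+x. ennreal \<bar>f x - s i x\<bar> \<partial>lborel) \<le> ennreal (e / 2)"
      using eventually_happens'[OF sequentially_bot] less_imp_le by blast
    from L1_translation_approx[OF _ _ i]
    have "(\<integral>\<^sup>+x. ennreal \<bar>f (x + h n) - f x\<bar> \<partial>lborel)
       \<le> (\<integral>\<^sup>+x. ennreal \<bar>s i (x + h n) - s i x\<bar> \<partial>lborel) + ennreal e" for n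
      using e by simp
    with lim.IH[of i] show "\<exists>G. G \<longlonglongrightarrow> 0 \<and> (\<forall>n. (\<integral>\<^sup>+x. ennreal \<bar>f (x + h n) - f x\<bar> \<partial>lborel) \<le> G n + ennreal e)"
      by blast
  qed
qed

text \<open>Follows from the \<open>L1\<close> case, since \<open>(a - b)^2\<close> is at most the absolute value of
  \<open>a^2 - b^2\<close> for nonnegative \<open>a\<close>, \<open>b\<close>.\<close>

lemma L2_translation_continuous:
  fixes f :: "'a::euclidean_space \<Rightarrow> real"
  assumes f: "f \<in> L2 lborel" and h: "h \<longlonglongrightarrow> 0"
  shows "(\<lambda>n. \<integral>\<^sup>+x. ennreal ((f (x + h n) - f x)\<^sup>2) \<partial>lborel) \<longlonglongrightarrow> 0"
proof -
  have [measurable]: "f \<in> borel_measurable borel" using L2_measurable[OF f] by simp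
  \<comment> \<open>The inequality between nonnegative numbers fails for opposite signs, so the
    positive and the negative part are squared separately; both squares are integrable.\<close>
  define p where "p x = (max 0 (f x))\<^sup>2" for x
  define m where "m x = (max 0 (- f x))\<^sup>2" for x
  have [measurable]: "p \<in> borel_measurable borel" "m \<in> borel_measurable borel"
    unfolding p_def[abs_def] m_def[abs_def] by auto
  have "integrable lborel p"
    by (rule Bochner_Integration.integrable_bound[OF L2_integrable_sq[OF f]])
       (auto simp: p_def max_def)
  note p = L1_translation_continuous[OF this h]
  have "integrable lborel m"
    by (rule Bochner_Integration.integrable_bound[OF L2_integrable_sq[OF f]])
       (auto simp: m_def max_def)
  note m = L1_translation_continuous[OF this h]
  have sq: "(a - b)\<^sup>2 \<le> \<bar>a\<^sup>2 - b\<^sup>2\<bar>" if "a \<ge> 0" "b \<ge> 0" for a b :: real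
  proof -
    have "(a - b)\<^sup>2 = \<bar>a - b\<bar> * \<bar>a - b\<bar>" by (simp add: power2_eq_square)
    also have "\<dots> \<le> \<bar>a - b\<bar> * (a + b)" using that by (intro mult_left_mono) auto
    also have "\<dots> = \<bar>a\<^sup>2 - b\<^sup>2\<bar>" using that
      by (simp add: power2_eq_square square_diff_square_factored abs_mult mult.commute)
    finally show ?thesis .
  qed
  have pt: "(a - b)\<^sup>2 \<le> 2 * (\<bar>(max 0 a)\<^sup>2 - (max 0 b)\<^sup>2\<bar> + \<bar>(max 0 (-a))\<^sup>2 - (max 0 (-b))\<^sup>2\<bar>)" for a b :: real
  proof -
    have "(a - b)\<^sup>2 = ((max 0 a - max 0 b) - (max 0 (-a) - max 0 (-b)))\<^sup>2"
      by (simp add: max_def)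
    also have "\<dots> \<le> 2 * ((max 0 a - max 0 b)\<^sup>2 + (max 0 (-a) - max 0 (-b))\<^sup>2)"
      using sum_squares_bound[of "max 0 a - max 0 b" "-(max 0 (-a) - max 0 (-b))"] 
      by (simp add: power2_diff power2_eq_square algebra_simps)
    also have "\<dots> \<le> 2 * (\<bar>(max 0 a)\<^sup>2 - (max 0 b)\<^sup>2\<bar> + \<bar>(max 0 (-a))\<^sup>2 - (max 0 (-b))\<^sup>2\<bar>)"
      by (intro mult_left_mono add_mono sq) auto
    finally show ?thesis .
  qed
  have le: "(\<integral>\<^sup>+x. ennreal ((f (x + h n) - f x)\<^sup>2) \<partial>lborel)
     \<le> 2 * ((\<integral>\<^sup>+x. ennreal \<bar>p (x + h n) - p x\<bar> \<partial>lborel) + (\<integral>\<^sup>+x. ennreal \<bar>m (x + h n) - m x\<bar> \<partial>lborel))" for n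
  proof -
    have "(\<integral>\<^sup>+x. ennreal ((f (x + h n) - f x)\<^sup>2) \<partial>lborel)
      \<le> (\<integral>\<^sup>+x. 2 * (ennreal \<bar>p (x + h n) - p x\<bar> + ennreal \<bar>m (x + h n) - m x\<bar>) \<partial>lborel)"
    proof (intro nn_integral_mono)
      fix x
      have "ennreal ((f (x + h n) - f x)\<^sup>2) \<le> ennreal (2 * (\<bar>p (x + h n) - p x\<bar> + \<bar>m (x + h n) - m x\<bar>))"
        unfolding p_def m_def by (intro ennreal_leI pt)
      also have "\<dots> = 2 * (ennreal \<bar>p (x + h n) - p x\<bar> + ennreal \<bar>m (x + h n) - m x\<bar>)"
        by (simp only: ennreal_mult'[of 2, OF zero_le_numeral] ennreal_numeral ennreal_plus[OF abs_ge_zero abs_ge_zero])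
      finally show "ennreal ((f (x + h n) - f x)\<^sup>2) \<le> 2 * (ennreal \<bar>p (x + h n) - p x\<bar> + ennreal \<bar>m (x + h n) - m x\<bar>)" .
    qed
    also have "\<dots> = 2 * ((\<integral>\<^sup>+x. ennreal \<bar>p (x + h n) - p x\<bar> \<partial>lborel) + (\<integral>\<^sup>+x. ennreal \<bar>m (x + h n) - m x\<bar> \<partial>lborel))"
      by (simp add: nn_integral_cmult nn_integral_add)
    finally show ?thesis .
  qed
  have "(\<lambda>n. 2 * ((\<integral>\<^sup>+x. ennreal \<bar>p (x + h n) - p x\<bar> \<partial>lborel) + (\<integral>\<^sup>+x. ennreal \<bar>m (x + h n) - m x\<bar> \<partial>lborel)))
     \<longlonglongrightarrow> 2 * (0 + 0)"
    by (rule ennreal_tendsto_cmult[OF _ tendsto_add[OF p m]]) simp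
  then have "(\<lambda>n. 2 * ((\<integral>\<^sup>+x. ennreal \<bar>p (x + h n) - p x\<bar> \<partial>lborel) + (\<integral>\<^sup>+x. ennreal \<bar>m (x + h n) - m x\<bar> \<partial>lborel))) \<longlonglongrightarrow> 0"
    by simp
  then show ?thesis by (rule tendsto_0_le_ennreal[OF le])
qed

section \<open>Bounds and Taylor expansion for smooth functions of compact support\<close>

definition supported_in :: "('a \<Rightarrow> real) \<Rightarrow> 'a set \<Rightarrow> bool" where
  "supported_in f C \<longleftrightarrow> (\<forall>x. x \<notin> C \<longrightarrow> f x = 0)"

lemma dir_deriv_zero_on_open:
  fixes k :: "'a::euclidean_space \<Rightarrow> real"
  assumes "open U" "x \<in> U" "\<And>y. y \<in> U \<Longrightarrow> k y = 0"
  shows "dir_deriv b k x = 0"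
proof -
  have "((\<lambda>x. 0 :: real) has_derivative (\<lambda>h. 0)) (at x)" by simp
  then have "(k has_derivative (\<lambda>h. 0)) (at x)"
    by (rule has_derivative_transform_within_open[OF _ assms(1,2)]) (simp add: assms(3))
  then show ?thesis by (rule dir_deriv_eq)
qed

lemma supported_in_dir_deriv:
  fixes k :: "'a::euclidean_space \<Rightarrow> real"
  assumes "supported_in k C" "compact C"
  shows "supported_in (dir_deriv b k) C"
  using assms compact_imp_closed[OF assms(2)]
  by (auto simp: supported_in_def intro!: dir_deriv_zero_on_open[of "- C"])

lemma smooth_compact_bounded:
  fixes k :: "'a::euclidean_space \<Rightarrow> real"
  assumes "smooth k" "compact C" "supported_in k C"
  obtains B where "B \<ge> 0" "\<And>x. \<bar>k x\<bar> \<le> B"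
proof -
  have "compact (k ` C)"
    using assms by (intro compact_continuous_image smooth_continuous_on)
  then obtain B where B: "\<And>x. x \<in> C \<Longrightarrow> \<bar>k x\<bar> \<le> B"
    using compact_imp_bounded bounded_iff by (metis imageI real_norm_def)
  have "\<bar>k x\<bar> \<le> max 0 B" for x
    using B[of x] assms(3) by (cases "x \<in> C") (auto simp: supported_in_def)
  then show ?thesis by (intro that[of "max 0 B"]) auto
qed

lemma abs_sum_Basis_le:
  fixes h :: "'a::euclidean_space"
  assumes "\<And>b. b \<in> Basis \<Longrightarrow> \<bar>c b\<bar> \<le> B"
  shows "\<bar>\<Sum>b\<in>Basis. (h \<bullet> b) * c b\<bar> \<le> real DIM('a) * B * norm h"
proof -
  have "\<bar>\<Sum>b\<in>Basis. (h \<bullet> b) * c b\<bar> \<le> (\<Sum>b\<in>(Basis::'a set). norm h * B)"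
    using assms
    by (intro order_trans[OF sum_abs] sum_mono) (auto simp: abs_mult Basis_le_norm intro!: mult_mono)
  then show ?thesis by (simp add: mult_ac)
qed

text \<open>The first derivatives inherit the compact support and are therefore bounded on the whole
  space; the mean value inequality does the rest.\<close>

lemma smooth_compact_lipschitz:
  fixes k :: "'a::euclidean_space \<Rightarrow> real"
  assumes k: "smooth k" "compact C" "supported_in k C"
  obtains L where "L \<ge> 0" "\<And>x y. \<bar>k x - k y\<bar> \<le> L * norm (x - y)"
proof -
  have "\<exists>B. B \<ge> 0 \<and> (\<forall>x. \<bar>dir_deriv b k x\<bar> \<le> B)" if "b \<in> Basis" for b
    using smooth_compact_bounded[OF smooth_dir_deriv[OF k(1) that] k(2) supported_in_dir_deriv[OF k(3,2)]]
    by metis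
  then obtain B where B: "\<And>b. b \<in> Basis \<Longrightarrow> B b \<ge> 0" "\<And>b x. b \<in> Basis \<Longrightarrow> \<bar>dir_deriv b k x\<bar> \<le> B b"
    by metis
  define L where "L = real DIM('a) * (\<Sum>b\<in>Basis. B b)"
  have le: "\<bar>dir_deriv b k x\<bar> \<le> (\<Sum>b\<in>Basis. B b)" if "b \<in> Basis" for b x
    using B(2)[OF that, of x] member_le_sum[of b Basis B] B(1) that by fastforce
  show ?thesis
  proof
    show "L \<ge> 0" unfolding L_def using B(1) by (simp add: sum_nonneg)
    show "\<bar>k x - k y\<bar> \<le> L * norm (x - y)" for x y
    proof -
      have "norm (k x - k y) \<le> L * norm (x - y)"
      proof (rule differentiable_bound[of UNIV])
        show "(k has_derivative (\<lambda>h. \<Sum>b\<in>Basis. (h \<bullet> b) * dir_deriv b k x)) (at x within UNIV)" for x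
          using smooth_has_derivative[OF k(1)] by simp
        show "onorm (\<lambda>h. \<Sum>b\<in>Basis. (h \<bullet> b) * dir_deriv b k x) \<le> L" for x
          unfolding L_def using abs_sum_Basis_le[OF le] by (intro onorm_le) auto
      qed auto
      then show ?thesis by simp
    qed
  qed
qed

text \<open>The first derivatives are Lipschitz, so the remainder is quadratic with one constant for
  all base points \<open>u\<close>. This uniformity permits differentiation under the integral by a
  direct estimate.\<close>

lemma smooth_compact_taylor:
  fixes k :: "'a::euclidean_space \<Rightarrow> real"
  assumes k: "smooth k" "compact C" "supported_in k C"
  obtains L where "L \<ge> 0"
    "\<And>u h. \<bar>k (u + h) - k u - (\<Sum>b\<in>Basis. (h \<bullet> b) * dir_deriv b k u)\<bar> \<le> L * (norm h)\<^sup>2"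
proof -
  have "\<exists>B. B \<ge> 0 \<and> (\<forall>x y. \<bar>dir_deriv b k x - dir_deriv b k y\<bar> \<le> B * norm (x - y))" if "b \<in> Basis" for b
    using smooth_compact_lipschitz[OF smooth_dir_deriv[OF k(1) that] k(2) supported_in_dir_deriv[OF k(3,2)]]
    by metis
  then obtain B where B: "\<And>b. b \<in> Basis \<Longrightarrow> B b \<ge> 0"
      "\<And>b x y. b \<in> Basis \<Longrightarrow> \<bar>dir_deriv b k x - dir_deriv b k y\<bar> \<le> B b * norm (x - y)"
    by metis
  define M where "M = (\<Sum>b\<in>Basis. B b)"
  have M: "M \<ge> 0" unfolding M_def using B(1) by (simp add: sum_nonneg)
  have le: "\<bar>dir_deriv b k x - dir_deriv b k y\<bar> \<le> M * norm (x - y)" if "b \<in> Basis" for b x y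
    using B(2)[OF that, of x y] mult_right_mono[OF member_le_sum[of b Basis B], of "norm (x - y)"] B(1) that
    unfolding M_def by fastforce
  show ?thesis
  proof
    show "real DIM('a) * M \<ge> 0" using M by simp
    fix u h :: 'a
    define D where "D x = (\<lambda>h. \<Sum>b\<in>Basis. (h \<bullet> b) * dir_deriv b k x)" for x
    have "norm (k (u + h) - k u - D u (u + h - u)) \<le> norm (u + h - u) * (real DIM('a) * (M * norm h))"
    proof (rule differentiable_bound_linearization)
      show "u + t *\<^sub>R (u + h - u) \<in> cball u (norm h)" if "t \<in> {0..1}" for t
      proof -
        have "t * norm h \<le> norm h" using that by (simp add: mult_left_le_one_le)
        moreover have "u - (u + t *\<^sub>R (u + h - u)) = - (t *\<^sub>R h)" by simp
        ultimately show ?thesis using that unfolding mem_cball dist_norm by simp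
      qed
      show "(k has_derivative D x) (at x within cball u (norm h))" for x
        unfolding D_def by (rule has_derivative_at_withinI[OF smooth_has_derivative[OF k(1)]])
      fix x assume x: "x \<in> cball u (norm h)"
      show "onorm (D x - D u) \<le> real DIM('a) * (M * norm h)"
      proof (rule onorm_le)
        fix v :: 'a
        have "norm ((D x - D u) v) = \<bar>\<Sum>b\<in>Basis. (v \<bullet> b) * (dir_deriv b k x - dir_deriv b k u)\<bar>"
          by (simp add: D_def sum_subtractf right_diff_distrib)
        also have "\<dots> \<le> real DIM('a) * (M * norm h) * norm v"
        proof (rule abs_sum_Basis_le)
          fix b :: 'a assume "b \<in> Basis"
          have "\<bar>dir_deriv b k x - dir_deriv b k u\<bar> \<le> M * norm (x - u)" by (rule le) fact
          also have "\<dots> \<le> M * norm h"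
            using x M by (intro mult_left_mono) (auto simp: dist_norm norm_minus_commute)
          finally show "\<bar>dir_deriv b k x - dir_deriv b k u\<bar> \<le> M * norm h" .
        qed
        finally show "norm ((D x - D u) v) \<le> real DIM('a) * (M * norm h) * norm v" .
      qed
    qed auto
    then show "\<bar>k (u + h) - k u - (\<Sum>b\<in>Basis. (h \<bullet> b) * dir_deriv b k u)\<bar> \<le> real DIM('a) * M * (norm h)\<^sup>2"
      by (simp add: D_def power2_eq_square mult_ac)
  qed
qed

section \<open>Differentiation under the integral sign\<close>

lemma integrable_bounded_mult:
  fixes f g :: "'a \<Rightarrow> real"
  assumes f: "integrable M f" and g: "g \<in> borel_measurable M" and B: "\<And>x. \<bar>g x\<bar> \<le> B"
  shows "integrable M (\<lambda>x. g x * f x)"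
proof (rule Bochner_Integration.integrable_bound)
  show "integrable M (\<lambda>x. B * f x)" using f by simp
  show "AE x in M. norm (g x * f x) \<le> norm (B * f x)"
  proof (rule AE_I2)
    fix x
    have "\<bar>g x\<bar> \<le> \<bar>B\<bar>" using B[of x] by linarith
    then show "norm (g x * f x) \<le> norm (B * f x)" by (simp add: abs_mult mult_right_mono)
  qed
qed (use f g in auto)

text \<open>Convolution with the reflected kernel. With \<open>y - x\<close> instead of
  \<open>x - y\<close> the value at \<open>x\<close> uses \<open>f\<close> on \<open>x\<close> plus
  the support of \<open>k\<close>, which suits kernels supported in a cone; the price is the minus
  sign in the derivative.\<close>

definition correlation :: "('a::euclidean_space \<Rightarrow> real) \<Rightarrow> ('a \<Rightarrow> real) \<Rightarrow> 'a \<Rightarrow> real" where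
  "correlation k f x = (\<integral>y. k (y - x) * f y \<partial>lborel)"

lemma integrable_correlation:
  fixes k :: "'a::euclidean_space \<Rightarrow> real"
  assumes k: "smooth k" "compact C" "supported_in k C" and f: "integrable lborel f"
  shows "integrable lborel (\<lambda>y. k (y - x) * f y)"
proof -
  obtain B where "\<And>x. \<bar>k x\<bar> \<le> B" using smooth_compact_bounded[OF k] by metis
  then show ?thesis
    by (intro integrable_bounded_mult[OF f, of _ B]) (use smooth_borel[OF k(1)] in auto)
qed

text \<open>The Taylor remainder of the kernel, integrated against \<open>f\<close>, is at most
  \<open>L * N\<close> times the squared increment, where \<open>N\<close> is the L1 norm of
  \<open>f\<close>.\<close>

lemma correlation_has_derivative:
  fixes k :: "'a::euclidean_space \<Rightarrow> real"
  assumes k: "smooth k" "compact C" "supported_in k C" and f: "integrable lborel f"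
  shows "(correlation k f has_derivative
    (\<lambda>h. \<Sum>b\<in>Basis. (h \<bullet> b) * correlation (\<lambda>x. - dir_deriv b k x) f x)) (at x)"
proof -
  obtain L where L: "L \<ge> 0"
    "\<And>u h. \<bar>k (u + h) - k u - (\<Sum>b\<in>Basis. (h \<bullet> b) * dir_deriv b k u)\<bar> \<le> L * (norm h)\<^sup>2"
    using smooth_compact_taylor[OF k] by metis
  define N where "N = (\<integral>y. \<bar>f y\<bar> \<partial>lborel)"
  let ?D = "\<lambda>h. \<Sum>b\<in>Basis. (h \<bullet> b) * correlation (\<lambda>x. - dir_deriv b k x) f x"
  have iD: "integrable lborel (\<lambda>y. - dir_deriv b k (y - x) * f y)" if "b \<in> Basis" for b
    using integrable_correlation[OF smooth_dir_deriv[OF k(1) that] k(2) supported_in_dir_deriv[OF k(3,2)] f]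
    by simp
  have est: "\<bar>correlation k f z - correlation k f x - ?D (z - x)\<bar> \<le> L * N * (norm (z - x))\<^sup>2" for z
  proof -
    let ?h = "z - x"
    let ?s = "\<lambda>y. \<Sum>b\<in>Basis. (?h \<bullet> b) * (- dir_deriv b k (y - x) * f y)"
    have s: "integrable lborel ?s"
      by (intro Bochner_Integration.integrable_sum integrable_mult_right iD)
    have "?D ?h = (\<Sum>b\<in>Basis. \<integral>y. (?h \<bullet> b) * (- dir_deriv b k (y - x) * f y) \<partial>lborel)"
      unfolding correlation_def by (simp only: integral_mult_right_zero)
    also have "\<dots> = (\<integral>y. ?s y \<partial>lborel)"
      by (rule Bochner_Integration.integral_sum[symmetric]) (intro integrable_mult_right iD)
    finally have "correlation k f z - correlation k f x - ?D ?h
      = (\<integral>y. k (y - z) * f y - k (y - x) * f y - ?s y \<partial>lborel)"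
      unfolding correlation_def
      using Bochner_Integration.integral_diff[OF Bochner_Integration.integrable_diff[OF
          integrable_correlation[OF k f, of z] integrable_correlation[OF k f, of x]] s]
        Bochner_Integration.integral_diff[OF integrable_correlation[OF k f, of z] integrable_correlation[OF k f, of x]]
      by simp
    also have "\<dots> = (\<integral>y. (k (y - z) - k (y - x) - (\<Sum>b\<in>Basis. (- ?h \<bullet> b) * dir_deriv b k (y - x))) * f y \<partial>lborel)"
    proof (intro Bochner_Integration.integral_cong refl)
      fix y
      have "(x - z) \<bullet> b = - (?h \<bullet> b)" for b by (simp add: inner_diff_left)
      then show "k (y - z) * f y - k (y - x) * f y - ?s y
        = (k (y - z) - k (y - x) - (\<Sum>b\<in>Basis. (- ?h \<bullet> b) * dir_deriv b k (y - x))) * f y"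
        by (simp add: algebra_simps sum_distrib_left sum_negf)
    qed
    also have "\<bar>\<dots>\<bar> \<le> (\<integral>y. L * (norm ?h)\<^sup>2 * \<bar>f y\<bar> \<partial>lborel)"
    proof (rule order_trans[OF integral_abs_bound integral_mono'])
      show "integrable lborel (\<lambda>y. L * (norm ?h)\<^sup>2 * \<bar>f y\<bar>)" using f by simp
      fix y
      have "\<bar>k (y - z) - k (y - x) - (\<Sum>b\<in>Basis. (- ?h \<bullet> b) * dir_deriv b k (y - x))\<bar> \<le> L * (norm ?h)\<^sup>2"
        using L(2)[of "y - x" "- ?h"] by (simp add: algebra_simps norm_minus_commute)
      then show "\<bar>(k (y - z) - k (y - x) - (\<Sum>b\<in>Basis. (- ?h \<bullet> b) * dir_deriv b k (y - x))) * f y\<bar> \<le> L * (norm ?h)\<^sup>2 * \<bar>f y\<bar>"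
        unfolding abs_mult by (intro mult_right_mono) auto
    qed (use L(1) in auto)
    also have "\<dots> = L * N * (norm ?h)\<^sup>2" by (simp add: N_def mult_ac)
    finally show ?thesis .
  qed
  show ?thesis
  proof (rule has_derivativeI_sandwich[where e = 1 and H = "\<lambda>z. L * N * norm (z - x)"])
    show "bounded_linear ?D"
      by (intro bounded_linear_sum bounded_linear_mult_const bounded_linear_inner_left)
    show "norm (correlation k f z - correlation k f x - ?D (z - x)) / norm (z - x) \<le> L * N * norm (z - x)"
      if "z \<noteq> x" for z
      using est[of z] that by (simp add: divide_le_eq power2_eq_square mult_ac)
    have "((\<lambda>z. L * N * norm (z - x)) \<longlongrightarrow> L * N * norm (x - x)) (at x)"
      by (intro tendsto_intros)
    then show "((\<lambda>z. L * N * norm (z - x)) \<longlongrightarrow> 0) (at x)" by simp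
  qed simp
qed

text \<open>Correlations of \<open>f\<close> with kernels supported in the same \<open>C\<close>
  form a set closed under derivatives, since differentiation only replaces the kernel.\<close>

lemma smooth_correlation:
  fixes k :: "'a::euclidean_space \<Rightarrow> real"
  assumes k: "smooth k" "compact C" "supported_in k C" and f: "integrable lborel f"
  shows "smooth (correlation k f)"
    and "b \<in> Basis \<Longrightarrow> dir_deriv b (correlation k f) x = correlation (\<lambda>x. - dir_deriv b k x) f x"
proof -
  have eq: "dir_deriv b (correlation k f) x = correlation (\<lambda>x. - dir_deriv b k x) f x"
    if k: "smooth k" "supported_in k C" and b: "b \<in> Basis" for k b x
  proof -
    have "dir_deriv b (correlation k f) x
      = (\<Sum>c\<in>Basis. (b \<bullet> c) * correlation (\<lambda>x. - dir_deriv c k x) f x)"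
      using correlation_has_derivative[OF k(1) assms(2) k(2) f] by (rule dir_deriv_eq)
    also have "\<dots> = (\<Sum>c\<in>Basis. if c = b then correlation (\<lambda>x. - dir_deriv c k x) f x else 0)"
      using b by (intro sum.cong) (auto simp: inner_Basis)
    finally show ?thesis using b by simp
  qed
  then show "b \<in> Basis \<Longrightarrow> dir_deriv b (correlation k f) x = correlation (\<lambda>x. - dir_deriv b k x) f x"
    using k by simp
  let ?S = "{correlation k f |k. smooth k \<and> supported_in k C}"
  show "smooth (correlation k f)"
  proof (rule smooth_coinduct[of _ ?S])
    show "correlation k f \<in> ?S" using k by auto
    fix g assume "g \<in> ?S"
    then obtain l where l: "g = correlation l f" "smooth l" "supported_in l C" by auto
    show "g differentiable at x" for x
      using correlation_has_derivative[OF l(2) assms(2) l(3) f] l(1) by (auto simp: differentiable_def)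
    fix b :: 'a assume b: "b \<in> Basis"
    have "dir_deriv b g = correlation (\<lambda>x. - dir_deriv b l x) f"
      using eq[OF l(2,3) b] l(1) by auto
    moreover have "smooth (\<lambda>x. - dir_deriv b l x)"
      using smooth_cmult[OF smooth_dir_deriv[OF l(2) b], of "-1"] by simp
    moreover have "supported_in (\<lambda>x. - dir_deriv b l x) C"
      using supported_in_dir_deriv[OF l(3) assms(2), of b] by (simp add: supported_in_def)
    ultimately show "dir_deriv b g \<in> ?S" by auto
  qed
qed

section \<open>Mollification\<close>

definition mollifier :: "('a::euclidean_space \<Rightarrow> real) \<Rightarrow> 'a set \<Rightarrow> bool" where
  "mollifier \<rho> C \<longleftrightarrow> smooth \<rho> \<and> compact C \<and> supported_in \<rho> C \<and> (\<forall>x. \<rho> x \<ge> 0) \<and>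
     integrable lborel \<rho> \<and> (\<integral>x. \<rho> x \<partial>lborel) = 1"

text \<open>Averages over the translates by \<open>\<epsilon> *\<^sub>R z\<close>, the form in which
  convergence is proved. The substitution \<open>y = x + \<epsilon> *\<^sub>R z\<close> turns it
  into a correlation with \<open>rescale \<rho> \<epsilon>\<close>, the form in which it is
  differentiated.\<close>

definition mollify :: "('a::euclidean_space \<Rightarrow> real) \<Rightarrow> real \<Rightarrow> ('a \<Rightarrow> real) \<Rightarrow> 'a \<Rightarrow> real" where
  "mollify \<rho> \<epsilon> f x = (\<integral>z. \<rho> z * f (x + \<epsilon> *\<^sub>R z) \<partial>lborel)"

definition rescale :: "('a::euclidean_space \<Rightarrow> real) \<Rightarrow> real \<Rightarrow> 'a \<Rightarrow> real" where
  "rescale \<rho> \<epsilon> u = \<rho> (u /\<^sub>R \<epsilon>) / \<epsilon> ^ DIM('a)"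

lemma mollifier_exists:
  assumes "\<kappa> > 0"
  obtains \<rho> C where "mollifier \<rho> C" "C \<subseteq> ball (e::'a::euclidean_space) \<kappa>"
  using exists_smooth_kernel[OF assms, of e] unfolding mollifier_def supported_in_def by metis

lemma smooth_scale_arg:
  fixes f :: "'a::euclidean_space \<Rightarrow> real"
  assumes "smooth f"
  shows "smooth (\<lambda>x. f (c *\<^sub>R x + d))"
proof (rule smooth_coinduct[of _ "{\<lambda>x. a * g (c *\<^sub>R x + d) |a g. smooth g}"])
  have "(\<lambda>x. f (c *\<^sub>R x + d)) = (\<lambda>x. 1 * f (c *\<^sub>R x + d))" by simp
  with assms show "(\<lambda>x. f (c *\<^sub>R x + d)) \<in> {\<lambda>x. a * g (c *\<^sub>R x + d) |a g. smooth g}" by blast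
  fix h assume "h \<in> {\<lambda>x. a * g (c *\<^sub>R x + d) |a g. smooth g}"
  then obtain a g where h: "h = (\<lambda>x. a * g (c *\<^sub>R x + d))" and g: "smooth g" by auto
  have D: "(h has_derivative (\<lambda>v. a * (\<Sum>b\<in>Basis. ((c *\<^sub>R v) \<bullet> b) * dir_deriv b g (c *\<^sub>R x + d)))) (at x)" for x
    unfolding h
    by (intro has_derivative_mult_right has_derivative_compose[OF _ smooth_has_derivative[OF g]])
       (auto intro!: derivative_eq_intros)
  then show "h differentiable at x" for x by (auto simp: differentiable_def)
  fix b :: 'a assume b: "b \<in> Basis"
  have "dir_deriv b h x = (a * c) * dir_deriv b g (c *\<^sub>R x + d)" for x
  proof -
    have "dir_deriv b h x = a * (\<Sum>b'\<in>Basis. ((c *\<^sub>R b) \<bullet> b') * dir_deriv b' g (c *\<^sub>R x + d))"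
      using D by (rule dir_deriv_eq)
    also have "(\<Sum>b'\<in>Basis. ((c *\<^sub>R b) \<bullet> b') * dir_deriv b' g (c *\<^sub>R x + d))
      = (\<Sum>b'\<in>Basis. if b' = b then c * dir_deriv b' g (c *\<^sub>R x + d) else 0)"
      using b by (intro sum.cong) (auto simp: inner_Basis)
    finally show ?thesis using b by simp
  qed
  then show "dir_deriv b h \<in> {\<lambda>x. a * g (c *\<^sub>R x + d) |a g. smooth g}"
    using smooth_dir_deriv[OF g b] by blast
qed

lemma smooth_rescale:
  assumes "smooth \<rho>"
  shows "smooth (rescale \<rho> \<epsilon>)"
  using smooth_cmult[OF smooth_scale_arg[OF assms, of "inverse \<epsilon>" 0], of "inverse (\<epsilon> ^ DIM('a))"]
  by (simp add: rescale_def[abs_def] divide_inverse mult.commute)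

lemma supported_in_rescale:
  assumes "supported_in \<rho> C" "\<epsilon> > 0"
  shows "supported_in (rescale \<rho> \<epsilon>) ((*\<^sub>R) \<epsilon> ` C)"
  unfolding supported_in_def
proof (intro allI impI)
  fix x assume "x \<notin> (*\<^sub>R) \<epsilon> ` C"
  then have "x /\<^sub>R \<epsilon> \<notin> C" using assms(2) by (auto intro: rev_image_eqI)
  then show "rescale \<rho> \<epsilon> x = 0" using assms(1) by (simp add: rescale_def supported_in_def)
qed

lemma mollify_eq_correlation:
  fixes f :: "'a::euclidean_space \<Rightarrow> real"
  assumes [measurable]: "f \<in> borel_measurable borel" "smooth \<rho>" and \<epsilon>: "\<epsilon> > 0"
  shows "mollify \<rho> \<epsilon> f = correlation (rescale \<rho> \<epsilon>) f"
proof
  fix x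
  have [measurable]: "rescale \<rho> \<epsilon> \<in> borel_measurable borel"
    by (intro smooth_borel smooth_rescale assms(2))
  have "correlation (rescale \<rho> \<epsilon>) f x
    = \<epsilon> ^ DIM('a) * (\<integral>z. rescale \<rho> \<epsilon> (x + \<epsilon> *\<^sub>R z - x) * f (x + \<epsilon> *\<^sub>R z) \<partial>lborel)"
    unfolding correlation_def using \<epsilon> by (intro integral_lborel_affine) auto
  also have "\<dots> = mollify \<rho> \<epsilon> f x"
    unfolding mollify_def using \<epsilon>
    by (subst Bochner_Integration.integral_mult_right_zero[symmetric])
       (simp add: rescale_def)
  finally show "mollify \<rho> \<epsilon> f x = correlation (rescale \<rho> \<epsilon>) f x" by simp
qed

lemma smooth_mollify:
  fixes f :: "'a::euclidean_space \<Rightarrow> real"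
  assumes "mollifier \<rho> C" "\<epsilon> > 0" and f: "integrable lborel f"
  shows "smooth (mollify \<rho> \<epsilon> f)"
    and "b \<in> Basis \<Longrightarrow> dir_deriv b (mollify \<rho> \<epsilon> f) x
      = (\<integral>y. - dir_deriv b (rescale \<rho> \<epsilon>) (y - x) * f y \<partial>lborel)"
proof -
  have \<rho>: "smooth \<rho>" "compact C" "supported_in \<rho> C" using assms by (auto simp: mollifier_def)
  have "f \<in> borel_measurable borel" using f by auto
  note eq = mollify_eq_correlation[OF this \<rho>(1) assms(2)]
  have "compact ((*\<^sub>R) \<epsilon> ` C)" using \<rho>(2) by (rule compact_scaling)
  note * = smooth_correlation[OF smooth_rescale[OF \<rho>(1)] this supported_in_rescale[OF \<rho>(3) assms(2)] f]
  show "smooth (mollify \<rho> \<epsilon> f)" unfolding eq by (rule *)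
  show "b \<in> Basis \<Longrightarrow> dir_deriv b (mollify \<rho> \<epsilon> f) x
      = (\<integral>y. - dir_deriv b (rescale \<rho> \<epsilon>) (y - x) * f y \<partial>lborel)"
    unfolding eq using *(2) by (simp add: correlation_def)
qed

text \<open>Jensen's inequality for the probability density \<open>\<rho>\<close>, obtained from
  Cauchy-Schwarz with \<open>sqrt (\<rho> z)\<close> as one factor, followed by Tonelli. The right
  side contains only L2 moduli of translation.\<close>

lemma mollify_L2:
  fixes f :: "'a::euclidean_space \<Rightarrow> real"
  assumes "mollifier \<rho> C" and f: "f \<in> L2 lborel" and \<epsilon>: "\<epsilon> > 0"
  shows "(\<integral>\<^sup>+x. ennreal ((mollify \<rho> \<epsilon> f x - f x)\<^sup>2) \<partial>lborel)
    \<le> (\<integral>\<^sup>+z. ennreal (\<rho> z) * (\<integral>\<^sup>+x. ennreal ((f (x + \<epsilon> *\<^sub>R z) - f x)\<^sup>2) \<partial>lborel) \<partial>lborel)"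
    and "mollify \<rho> \<epsilon> f \<in> borel_measurable borel"
proof -
  have \<rho>: "smooth \<rho>" "compact C" "supported_in \<rho> C" "\<And>x. \<rho> x \<ge> 0" "integrable lborel \<rho>" "(\<integral>x. \<rho> x \<partial>lborel) = 1"
    using assms by (auto simp: mollifier_def)
  have [measurable]: "f \<in> borel_measurable borel" using L2_measurable[OF f] by simp
  have [measurable]: "\<rho> \<in> borel_measurable borel" using smooth_borel[OF \<rho>(1)] .
  obtain B where B: "B \<ge> 0" "\<And>x. \<bar>\<rho> x\<bar> \<le> B" using smooth_compact_bounded[OF \<rho>(1,2,3)] by metis
  have s1: "(\<lambda>z. sqrt (\<rho> z)) \<in> L2 lborel"
    using \<rho> by (auto simp: L2_def)
  have pt: "(mollify \<rho> \<epsilon> f x - f x)\<^sup>2 \<le> (\<integral>z. \<rho> z * (f (x + \<epsilon> *\<^sub>R z) - f x)\<^sup>2 \<partial>lborel)"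
    and fin: "integrable lborel (\<lambda>z. \<rho> z * (f (x + \<epsilon> *\<^sub>R z) - f x)\<^sup>2)" for x
  proof -
    have fx: "(\<lambda>z. f (x + \<epsilon> *\<^sub>R z)) \<in> L2 lborel" by (rule L2_lborel_affine[OF f \<epsilon>])
    have "sqrt (\<rho> z) \<le> sqrt B" for z using B(2)[of z] by simp
    then have "(\<lambda>z. sqrt (\<rho> z) * f (x + \<epsilon> *\<^sub>R z)) \<in> L2 lborel"
      by (intro L2_bounded_mult[OF fx, of _ "sqrt B"]) (auto simp: \<rho>)
    from L2_diff[OF this L2_cmult[OF s1, of "f x"]]
    have s2: "(\<lambda>z. sqrt (\<rho> z) * (f (x + \<epsilon> *\<^sub>R z) - f x)) \<in> L2 lborel"
      by (simp add: algebra_simps)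
    have "integrable lborel (\<lambda>z. sqrt (\<rho> z) * (sqrt (\<rho> z) * f (x + \<epsilon> *\<^sub>R z)))"
      by (intro L2_integrable_mult s1) fact
    then have i: "integrable lborel (\<lambda>z. \<rho> z * f (x + \<epsilon> *\<^sub>R z))"
      using \<rho>(4) by (simp add: mult.assoc[symmetric])
    have "mollify \<rho> \<epsilon> f x - f x = (\<integral>z. \<rho> z * f (x + \<epsilon> *\<^sub>R z) - \<rho> z * f x \<partial>lborel)"
      unfolding mollify_def using i \<rho> by simp
    also have "\<dots> = l2_inner lborel (\<lambda>z. sqrt (\<rho> z)) (\<lambda>z. sqrt (\<rho> z) * (f (x + \<epsilon> *\<^sub>R z) - f x))"
      unfolding l2_inner_def using \<rho>(4)
      by (simp add: mult.assoc[symmetric] right_diff_distrib)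
    also have "\<dots>\<^sup>2 \<le> (l2_norm lborel (\<lambda>z. sqrt (\<rho> z)) * l2_norm lborel (\<lambda>z. sqrt (\<rho> z) * (f (x + \<epsilon> *\<^sub>R z) - f x)))\<^sup>2"
      using l2_Cauchy_Schwarz[OF s1 s2] by (simp add: abs_le_square_iff[symmetric] l2_norm_nonneg abs_mult)
    also have "\<dots> = (\<integral>z. \<rho> z * (f (x + \<epsilon> *\<^sub>R z) - f x)\<^sup>2 \<partial>lborel)"
      using \<rho> by (simp add: power_mult_distrib l2_norm_sq)
    finally show "(mollify \<rho> \<epsilon> f x - f x)\<^sup>2 \<le> (\<integral>z. \<rho> z * (f (x + \<epsilon> *\<^sub>R z) - f x)\<^sup>2 \<partial>lborel)" .
    show "integrable lborel (\<lambda>z. \<rho> z * (f (x + \<epsilon> *\<^sub>R z) - f x)\<^sup>2)"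
      using L2_integrable_sq[OF s2] \<rho>(4) by (simp add: power_mult_distrib)
  qed
  show "mollify \<rho> \<epsilon> f \<in> borel_measurable borel"
    unfolding mollify_def[abs_def] by measurable
  have "(\<integral>\<^sup>+x. ennreal ((mollify \<rho> \<epsilon> f x - f x)\<^sup>2) \<partial>lborel)
    \<le> (\<integral>\<^sup>+x. \<integral>\<^sup>+z. ennreal (\<rho> z * (f (x + \<epsilon> *\<^sub>R z) - f x)\<^sup>2) \<partial>lborel \<partial>lborel)"
    using \<rho>(4) by (intro nn_integral_mono) (subst nn_integral_eq_integral[OF fin]; auto intro!: ennreal_leI pt)
  also have "\<dots> = (\<integral>\<^sup>+z. \<integral>\<^sup>+x. ennreal (\<rho> z * (f (x + \<epsilon> *\<^sub>R z) - f x)\<^sup>2) \<partial>lborel \<partial>lborel)"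
    by (rule lborel_pair.Fubini') measurable
  also have "\<dots> = (\<integral>\<^sup>+z. ennreal (\<rho> z) * (\<integral>\<^sup>+x. ennreal ((f (x + \<epsilon> *\<^sub>R z) - f x)\<^sup>2) \<partial>lborel) \<partial>lborel)"
    using \<rho>(4) by (simp add: ennreal_mult nn_integral_cmult)
  finally show "(\<integral>\<^sup>+x. ennreal ((mollify \<rho> \<epsilon> f x - f x)\<^sup>2) \<partial>lborel)
    \<le> (\<integral>\<^sup>+z. ennreal (\<rho> z) * (\<integral>\<^sup>+x. ennreal ((f (x + \<epsilon> *\<^sub>R z) - f x)\<^sup>2) \<partial>lborel) \<partial>lborel)" .
qed

text \<open>For each fixed \<open>z\<close> the shift \<open>\<epsilon> n *\<^sub>R z\<close> tends
  to 0, wherever the kernel is centred; this allows kernels supported off the origin. The majorant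
  \<open>c\<close> comes from bounding a squared difference by twice the sum of the squares.\<close>

lemma mollify_tendsto:
  fixes f :: "'a::euclidean_space \<Rightarrow> real"
  assumes \<rho>: "mollifier \<rho> C" and f: "f \<in> L2 lborel" and \<epsilon>: "\<And>n. \<epsilon> n > 0" "\<epsilon> \<longlonglongrightarrow> 0"
  shows "(\<lambda>n. \<integral>\<^sup>+x. ennreal ((mollify \<rho> (\<epsilon> n) f x - f x)\<^sup>2) \<partial>lborel) \<longlonglongrightarrow> 0"
proof (rule tendsto_0_le_ennreal[OF mollify_L2(1)[OF \<rho> f \<epsilon>(1)]])
  have [measurable]: "f \<in> borel_measurable borel" using L2_measurable[OF f] by simp
  have [measurable]: "\<rho> \<in> borel_measurable borel" using smooth_borel \<rho> by (auto simp: mollifier_def)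
  have \<rho>': "\<And>x. \<rho> x \<ge> 0" "integrable lborel \<rho>" "(\<integral>x. \<rho> x \<partial>lborel) = 1" using \<rho> by (auto simp: mollifier_def)
  let ?T = "\<lambda>h. \<integral>\<^sup>+x. ennreal ((f (x + h) - f x)\<^sup>2) \<partial>lborel"
  define c where "c = 4 * ennreal ((l2_norm lborel f)\<^sup>2)"
  have T: "?T h \<le> c" for h
  proof -
    have "?T h \<le> (\<integral>\<^sup>+x. 2 * ennreal ((f (x + h))\<^sup>2) + 2 * ennreal ((f x)\<^sup>2) \<partial>lborel)"
    proof (intro nn_integral_mono)
      fix x
      have "(f (x + h) - f x)\<^sup>2 \<le> 2 * (f (x + h))\<^sup>2 + 2 * (f x)\<^sup>2"
        using sum_squares_bound[of "f (x + h)" "- f x"] by (simp add: power2_diff)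
      then have "ennreal ((f (x + h) - f x)\<^sup>2) \<le> ennreal (2 * (f (x + h))\<^sup>2 + 2 * (f x)\<^sup>2)"
        by (rule ennreal_leI)
      then show "ennreal ((f (x + h) - f x)\<^sup>2) \<le> 2 * ennreal ((f (x + h))\<^sup>2) + 2 * ennreal ((f x)\<^sup>2)"
        by (simp add: ennreal_mult')
    qed
    also have "\<dots> = 2 * (\<integral>\<^sup>+x. ennreal ((f (x + h))\<^sup>2) \<partial>lborel) + 2 * (\<integral>\<^sup>+x. ennreal ((f x)\<^sup>2) \<partial>lborel)"
      by (simp add: nn_integral_add nn_integral_cmult)
    also have "\<dots> = c"
      unfolding c_def nn_integral_lborel_translate[of "\<lambda>x. ennreal ((f x)\<^sup>2)" h, simplified] nn_integral_sq[OF f]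
      by (simp flip: distrib_right)
    finally show ?thesis .
  qed
  have "(\<lambda>n. \<integral>\<^sup>+z. ennreal (\<rho> z) * ?T (\<epsilon> n *\<^sub>R z) \<partial>lborel) \<longlonglongrightarrow> (\<integral>\<^sup>+z. 0 \<partial>(lborel :: 'a measure))"
  proof (rule nn_integral_dominated_convergence)
    show "AE z in lborel. ennreal (\<rho> z) * ?T (\<epsilon> n *\<^sub>R z) \<le> ennreal (\<rho> z) * c" for n
      by (intro AE_I2 mult_left_mono T) simp
    show "(\<integral>\<^sup>+z. ennreal (\<rho> z) * c \<partial>lborel) < \<infinity>"
      using \<rho>' by (simp add: nn_integral_multc nn_integral_eq_integral c_def ennreal_mult_less_top)
    show "AE z in lborel. (\<lambda>n. ennreal (\<rho> z) * ?T (\<epsilon> n *\<^sub>R z)) \<longlonglongrightarrow> 0"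
    proof (rule AE_I2)
      fix z :: 'a
      have "(\<lambda>n. \<epsilon> n *\<^sub>R z) \<longlonglongrightarrow> 0 *\<^sub>R z" by (intro tendsto_intros \<epsilon>)
      then have "(\<lambda>n. ?T (\<epsilon> n *\<^sub>R z)) \<longlonglongrightarrow> 0"
        by (intro L2_translation_continuous[OF f]) simp
      from ennreal_tendsto_cmult[OF _ this, of "ennreal (\<rho> z)"]
      show "(\<lambda>n. ennreal (\<rho> z) * ?T (\<epsilon> n *\<^sub>R z)) \<longlonglongrightarrow> 0" by simp
    qed
  qed measurable
  then show "(\<lambda>n. \<integral>\<^sup>+z. ennreal (\<rho> z) * ?T (\<epsilon> n *\<^sub>R z) \<partial>lborel) \<longlonglongrightarrow> 0" by simp
qed

subsection \<open>Weak derivatives on a bounded open set\<close>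

lemma AE_lebesgue_on_iff:
  assumes "\<Omega> \<in> sets borel"
  shows "(AE x in lebesgue_on \<Omega>. P x) \<longleftrightarrow> (AE x in lborel. x \<in> \<Omega> \<longrightarrow> P x)"
proof -
  have "(AE x in lebesgue_on \<Omega>. P x) \<longleftrightarrow> (AE x in lebesgue. x \<in> \<Omega> \<longrightarrow> P x)"
    using assms by (subst AE_restrict_space_iff) auto
  then show ?thesis by (simp add: AE_completion_iff)
qed

lemma nn_integral_lebesgue_on:
  assumes "\<Omega> \<in> sets borel"
  shows "(\<integral>\<^sup>+x. f x \<partial>lebesgue_on \<Omega>) = (\<integral>\<^sup>+x. f x * indicator \<Omega> x \<partial>lborel)"
  using assms by (simp add: nn_integral_restrict_space nn_integral_completion)

lemma borel_measurable_lebesgue_on: "f \<in> borel_measurable borel \<Longrightarrow> f \<in> borel_measurable (lebesgue_on \<Omega>)"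
  by (intro measurable_restrict_space1 measurable_completion) simp

text \<open>Members of \<open>L2 (lebesgue_on \<Omega>)\<close> are only Lebesgue measurable and
  arbitrary outside \<open>\<Omega>\<close>. Translation and Fubini arguments on the whole space
  need a Borel representative that vanishes outside.\<close>

lemma L2_ext_exists:
  fixes \<Omega> :: "'a::euclidean_space set"
  assumes \<Omega>: "\<Omega> \<in> sets borel" and f: "f \<in> L2 (lebesgue_on \<Omega>)"
  shows "\<exists>f'. f' \<in> L2 lborel \<and> (\<forall>x. x \<notin> \<Omega> \<longrightarrow> f' x = 0) \<and> (AE x in lebesgue_on \<Omega>. f x = f' x)"
proof -
  have "(\<lambda>x. indicator \<Omega> x *\<^sub>R f x) \<in> borel_measurable lebesgue"
    using L2_measurable[OF f] \<Omega> by (subst (asm) borel_measurable_restrict_space_iff) auto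
  then obtain g where g: "g \<in> borel_measurable lborel" "AE x in lborel. indicator \<Omega> x *\<^sub>R f x = g x"
    using completion_ex_borel_measurable_real by blast
  define f' where "f' x = indicator \<Omega> x * g x" for x
  have [measurable]: "\<Omega> \<in> sets borel" "g \<in> borel_measurable borel" using \<Omega> g by auto
  have m: "f' \<in> borel_measurable borel" unfolding f'_def[abs_def] by measurable
  have ae: "AE x in lebesgue_on \<Omega>. f x = f' x"
    unfolding AE_lebesgue_on_iff[OF \<Omega>] using g(2) by eventually_elim (auto simp: f'_def)
  have "(\<integral>\<^sup>+x. ennreal ((f' x)\<^sup>2) \<partial>lborel) = (\<integral>\<^sup>+x. ennreal ((f' x)\<^sup>2) \<partial>lebesgue_on \<Omega>)"
    unfolding nn_integral_lebesgue_on[OF \<Omega>] by (intro nn_integral_cong) (auto simp: f'_def indicator_def)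
  also have "\<dots> = (\<integral>\<^sup>+x. ennreal ((f x)\<^sup>2) \<partial>lebesgue_on \<Omega>)"
    by (rule nn_integral_cong_AE) (use ae in eventually_elim, simp)
  also have "\<dots> < \<infinity>" by (simp add: nn_integral_sq[OF f])
  finally have "f' \<in> L2 lborel" using m by (intro L2_I_nn_integral) auto
  with ae show ?thesis by (intro exI[of _ f']) (auto simp: f'_def)
qed

definition extend0 :: "'a::euclidean_space set \<Rightarrow> ('a \<Rightarrow> real) \<Rightarrow> 'a \<Rightarrow> real" where
  "extend0 \<Omega> f = (SOME f'. f' \<in> L2 lborel \<and> (\<forall>x. x \<notin> \<Omega> \<longrightarrow> f' x = 0) \<and> (AE x in lebesgue_on \<Omega>. f x = f' x))"

lemma extend0:
  fixes \<Omega> :: "'a::euclidean_space set"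
  assumes "\<Omega> \<in> sets borel" "f \<in> L2 (lebesgue_on \<Omega>)"
  shows "extend0 \<Omega> f \<in> L2 lborel" "x \<notin> \<Omega> \<Longrightarrow> extend0 \<Omega> f x = 0"
    "AE x in lebesgue_on \<Omega>. f x = extend0 \<Omega> f x" "extend0 \<Omega> f \<in> borel_measurable borel"
proof -
  note * = someI_ex[OF L2_ext_exists[OF assms], folded extend0_def]
  show "extend0 \<Omega> f \<in> L2 lborel" "x \<notin> \<Omega> \<Longrightarrow> extend0 \<Omega> f x = 0"
    "AE x in lebesgue_on \<Omega>. f x = extend0 \<Omega> f x" using * by auto
  then show "extend0 \<Omega> f \<in> borel_measurable borel" using L2_measurable by force
qed

lemma l2_norm_sq_le_lborel:
  fixes \<Omega> :: "'a::euclidean_space set"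
  assumes \<Omega>: "\<Omega> \<in> sets borel" and f: "f \<in> L2 (lebesgue_on \<Omega>)"
    and eq: "AE x in lebesgue_on \<Omega>. f x = g x"
  shows "ennreal ((l2_norm (lebesgue_on \<Omega>) f)\<^sup>2) \<le> (\<integral>\<^sup>+x. ennreal ((g x)\<^sup>2) \<partial>lborel)"
proof -
  have "ennreal ((l2_norm (lebesgue_on \<Omega>) f)\<^sup>2) = (\<integral>\<^sup>+x. ennreal ((f x)\<^sup>2) \<partial>lebesgue_on \<Omega>)"
    by (simp add: nn_integral_sq[OF f])
  also have "\<dots> = (\<integral>\<^sup>+x. ennreal ((g x)\<^sup>2) \<partial>lebesgue_on \<Omega>)"
    by (rule nn_integral_cong_AE) (use eq in eventually_elim, simp)
  also have "\<dots> \<le> (\<integral>\<^sup>+x. ennreal ((g x)\<^sup>2) \<partial>lborel)"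
    unfolding nn_integral_lebesgue_on[OF \<Omega>] by (intro nn_integral_mono) (auto simp: indicator_def)
  finally show ?thesis .
qed

text \<open>Correlating with the indicator of a large ball gives the integral of \<open>F\<close>, which does not
  change under small translations.\<close>

lemma integral_dir_deriv_eq_0:
  fixes F :: "'a::euclidean_space \<Rightarrow> real"
  assumes F: "smooth F" "compact C" "supported_in F C" and b: "b \<in> Basis"
  shows "(\<integral>y. dir_deriv b F y \<partial>lborel) = 0"
proof -
  obtain r where r: "r > 0" "C \<subseteq> ball 0 r"
    using compact_imp_bounded[OF F(2)] bounded_subset_ballD[of C 0] by auto
  define f :: "'a \<Rightarrow> real" where "f = indicator (ball 0 (r + 1))"
  have f: "integrable lborel f"
    unfolding f_def by (intro integrable_real_indicator) (auto intro: emeasure_bounded_finite[OF bounded_ball, simplified])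
  have "correlation F f x = (\<integral>y. F y \<partial>lborel)" if "x \<in> ball 0 1" for x
  proof -
    have "correlation F f x = (\<integral>y. F (y - x) \<partial>lborel)"
      unfolding correlation_def
    proof (intro Bochner_Integration.integral_cong refl)
      fix y
      show "F (y - x) * f y = F (y - x)"
      proof (cases "y - x \<in> C")
        case True
        then have "norm (y - x) < r" using r by auto
        then have "norm y < r + 1" using that norm_triangle_ineq[of "y - x" x] by auto
        then show ?thesis by (simp add: f_def)
      next
        case False
        then show ?thesis using F(3) by (simp add: supported_in_def)
      qed
    qed
    also have "\<dots> = (\<integral>y. F y \<partial>lborel)"
      using integral_lborel_affine[of F 1 "-x"] smooth_borel[OF F(1)] by (simp add: algebra_simps)
    finally show ?thesis .
  qed
  then have "((\<lambda>x. correlation F f x) has_derivative (\<lambda>h. 0)) (at 0)"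
    by (intro has_derivative_transform_within_open[OF has_derivative_const, of "ball 0 1"]) auto
  from dir_deriv_eq[OF this] have "0 = dir_deriv b (correlation F f) 0" by simp
  also have "\<dots> = (\<integral>y. - dir_deriv b F y * f y \<partial>lborel)"
    using smooth_correlation(2)[OF F f b] by (simp add: correlation_def)
  also have "\<dots> = (\<integral>y. - dir_deriv b F y \<partial>lborel)"
  proof (intro Bochner_Integration.integral_cong refl)
    fix y
    show "- dir_deriv b F y * f y = - dir_deriv b F y"
      using supported_in_dir_deriv[OF F(3,2), of b] r by (cases "y \<in> C") (auto simp: f_def supported_in_def)
  qed
  finally show ?thesis by simp
qed

lemma smooth_translate:
  fixes k :: "'a::euclidean_space \<Rightarrow> real"
  assumes "smooth k"
  shows "smooth (\<lambda>y. k (y - x))" "dir_deriv b (\<lambda>y. k (y - x)) y = dir_deriv b k (y - x)"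
proof -
  show "smooth (\<lambda>y. k (y - x))" using smooth_scale_arg[OF assms, of 1 "-x"] by simp
  have "((\<lambda>y. k (y - x)) has_derivative (\<lambda>h. \<Sum>b\<in>Basis. (h \<bullet> b) * dir_deriv b k (y - x))) (at y)"
    by (rule has_derivative_compose[OF _ smooth_has_derivative[OF assms]]) (auto intro!: derivative_eq_intros)
  moreover have "frechet_derivative k (at (y - x)) = (\<lambda>h. \<Sum>b\<in>Basis. (h \<bullet> b) * dir_deriv b k (y - x))"
    using frechet_derivative_at[OF smooth_has_derivative[OF assms]] by metis
  ultimately show "dir_deriv b (\<lambda>y. k (y - x)) y = dir_deriv b k (y - x)"
    using dir_deriv_eq by (metis dir_deriv_def)
qed

lemma dir_deriv_cong_open:
  fixes f g :: "'a::euclidean_space \<Rightarrow> real"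
  assumes "smooth f" "open U" "x \<in> U" "\<And>y. y \<in> U \<Longrightarrow> f y = g y"
  shows "dir_deriv b f x = dir_deriv b g x"
proof -
  have "(f has_derivative frechet_derivative f (at x)) (at x)"
    using smooth_differentiable[OF assms(1)] by (simp add: frechet_derivative_works)
  from has_derivative_transform_within_open[OF this assms(2,3,4)]
  have "(g has_derivative frechet_derivative f (at x)) (at x)" .
  from dir_deriv_eq[OF this] show ?thesis by (simp add: dir_deriv_def)
qed

section \<open>Test functions and the fundamental lemma\<close>

locale bounded_open =
  fixes \<Omega> :: "'a::euclidean_space set"
  assumes open_\<Omega>: "open \<Omega>" and bounded_\<Omega>: "bounded \<Omega>"
begin

abbreviation M :: "'a measure" where "M \<equiv> lebesgue_on \<Omega>"

lemma sets_\<Omega> [measurable]: "\<Omega> \<in> sets borel"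
  using open_\<Omega> by simp

lemma space_M: "space M = \<Omega>"
  by (simp add: space_restrict_space)

lemma finite_measure_M: "finite_measure M"
  by (intro finite_measure_lebesgue_on lmeasurable_open bounded_\<Omega> open_\<Omega>)

lemma borel_M: "f \<in> borel_measurable borel \<Longrightarrow> f \<in> borel_measurable M"
  by (rule borel_measurable_lebesgue_on)

lemma smooth_M: "smooth f \<Longrightarrow> f \<in> borel_measurable M"
  by (intro borel_M smooth_borel)

lemma smooth_bounded:
  assumes "smooth f"
  obtains B where "B \<ge> 0" "\<And>x. x \<in> space M \<Longrightarrow> \<bar>f x\<bar> \<le> B"
proof -
  have "compact (f ` closure \<Omega>)"
    using assms bounded_\<Omega> by (intro compact_continuous_image smooth_continuous_on) (auto simp: compact_closure)
  then obtain B where B: "\<And>x. x \<in> closure \<Omega> \<Longrightarrow> \<bar>f x\<bar> \<le> B"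
    using compact_imp_bounded bounded_iff by (metis imageI real_norm_def)
  then have "\<bar>f x\<bar> \<le> max 0 B" if "x \<in> \<Omega>" for x
    using that closure_subset[of \<Omega>] by (force simp: max.coboundedI2)
  then show ?thesis by (intro that[of "max 0 B"]) (auto simp: space_M)
qed

lemma smooth_L2: "smooth f \<Longrightarrow> f \<in> L2 M"
  by (metis L2_bounded finite_measure_M smooth_M smooth_bounded)

lemma smooth_mult_L2: "smooth \<eta> \<Longrightarrow> f \<in> L2 M \<Longrightarrow> (\<lambda>x. \<eta> x * f x) \<in> L2 M"
  by (metis L2_bounded_mult smooth_M smooth_bounded)

lemma integrable_extend0:
  assumes "f \<in> L2 M"
  shows "integrable lborel (extend0 \<Omega> f)"
proof -
  have "emeasure lborel \<Omega> < \<infinity>" by (rule emeasure_bounded_finite[OF bounded_\<Omega>])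
  then have "(indicat_real \<Omega>) \<in> L2 lborel"
    by (auto simp: L2_def power2_eq_square simp flip: indicator_inter_arith intro!: integrable_real_indicator)
  from L2_integrable_mult[OF this extend0(1)[OF sets_\<Omega> assms]]
  have "integrable lborel (\<lambda>x. indicat_real \<Omega> x * extend0 \<Omega> f x)" .
  also have "(\<lambda>x. indicat_real \<Omega> x * extend0 \<Omega> f x) = extend0 \<Omega> f"
    using extend0(2)[OF sets_\<Omega> assms] by (auto simp: indicator_def fun_eq_iff)
  finally show ?thesis .
qed

lemma l2_inner_eq_lborel:
  assumes f: "f \<in> L2 M" and g: "g \<in> borel_measurable borel"
  shows "l2_inner M f g = (\<integral>x. extend0 \<Omega> f x * g x \<partial>lborel)"
proof -
  note e = extend0[OF sets_\<Omega> f]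
  have [measurable]: "extend0 \<Omega> f \<in> borel_measurable borel" "g \<in> borel_measurable borel" by fact+
  have "l2_inner M f g = l2_inner M (extend0 \<Omega> f) g"
    by (rule l2_inner_cong_AE) (use e g f in \<open>auto intro: borel_M L2_measurable\<close>)
  also have "\<dots> = (\<integral>x. indicator \<Omega> x *\<^sub>R (extend0 \<Omega> f x * g x) \<partial>lebesgue)"
    unfolding l2_inner_def by (subst integral_restrict_space) auto
  also have "\<dots> = (\<integral>x. indicator \<Omega> x *\<^sub>R (extend0 \<Omega> f x * g x) \<partial>lborel)"
    by (subst integral_completion) auto
  also have "\<dots> = (\<integral>x. extend0 \<Omega> f x * g x \<partial>lborel)"
    using e(2) by (intro Bochner_Integration.integral_cong) (auto simp: indicator_def)
  finally show ?thesis .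
qed

lemma test_function_smooth: "test_function \<Omega> \<phi> \<Longrightarrow> smooth \<phi>"
  by (simp add: test_function_def)

lemma test_functionI:
  assumes "smooth \<phi>" "compact K" "K \<subseteq> \<Omega>" "supported_in \<phi> K"
  shows "test_function \<Omega> \<phi>"
  using assms unfolding test_function_def space_M supported_in_def by blast

text \<open>\<open>test_function\<close> says nothing about values outside \<open>\<Omega>\<close>.
  Cutting off there keeps smoothness: a point outside \<open>\<Omega>\<close> has the open set
  \<open>- K\<close> as a neighbourhood, on which the cut-off function is 0. The invariant set
  consists of all such cut-offs, because derivatives vanish on \<open>\<Omega> - K\<close>
  too.\<close>

lemma test_function_extend:
  assumes "test_function \<Omega> \<phi>"
  obtains \<psi> K where "smooth \<psi>" "compact K" "K \<subseteq> \<Omega>" "supported_in \<psi> K" "\<And>x. x \<in> \<Omega> \<Longrightarrow> \<psi> x = \<phi> x"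
proof -
  obtain K where K: "compact K" "K \<subseteq> \<Omega>" "\<And>x. x \<in> \<Omega> - K \<Longrightarrow> \<phi> x = 0" and sm: "smooth \<phi>"
    using assms unfolding test_function_def space_M by blast
  let ?S = "{\<lambda>x. if x \<in> \<Omega> then g x else 0 |g. smooth g \<and> (\<forall>x \<in> \<Omega> - K. g x = 0)}"
  let ?\<psi> = "\<lambda>x. if x \<in> \<Omega> then \<phi> x else 0"
  have opn: "open (- K)" "open (\<Omega> - K)" using K(1) open_\<Omega> compact_imp_closed by auto
  have "smooth ?\<psi>"
  proof (rule smooth_coinduct[of _ ?S])
    show "?\<psi> \<in> ?S" using K sm by blast
    fix h assume "h \<in> ?S"
    then obtain g where h: "h = (\<lambda>x. if x \<in> \<Omega> then g x else 0)" and g: "smooth g" "\<And>x. x \<in> \<Omega> - K \<Longrightarrow> g x = 0"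
      by auto
    have D: "(h has_derivative (if x \<in> \<Omega> then frechet_derivative g (at x) else (\<lambda>h. 0))) (at x)" for x
    proof (cases "x \<in> \<Omega>")
      case True
      have "(g has_derivative frechet_derivative g (at x)) (at x)"
        using smooth_differentiable[OF g(1)] frechet_derivative_works by blast
      from has_derivative_transform_within_open[OF this open_\<Omega> True] True show ?thesis by (simp add: h)
    next
      case False
      then have "x \<in> - K" using K by auto
      have "(h has_derivative (\<lambda>h. 0)) (at x)"
        by (rule has_derivative_transform_within_open[OF has_derivative_const opn(1) \<open>x \<in> - K\<close>, of 0])
           (use g h in auto)
      with False show ?thesis by simp
    qed
    then show "h differentiable at x" for x by (auto simp: differentiable_def)
    fix b :: 'a assume b: "b \<in> Basis"
    have "dir_deriv b h = (\<lambda>x. if x \<in> \<Omega> then dir_deriv b g x else 0)"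
      using dir_deriv_eq[OF D] by (auto simp: dir_deriv_def)
    moreover have "dir_deriv b g x = 0" if "x \<in> \<Omega> - K" for x
      by (rule dir_deriv_zero_on_open[OF opn(2) that g(2)])
    ultimately show "dir_deriv b h \<in> ?S" using smooth_dir_deriv[OF g(1) b] by blast
  qed
  moreover have "supported_in ?\<psi> K" using K by (auto simp: supported_in_def)
  ultimately show ?thesis using K that[of ?\<psi> K] by auto
qed

lemma test_function_dir_deriv:
  assumes "test_function \<Omega> \<phi>" "b \<in> Basis"
  shows "test_function \<Omega> (dir_deriv b \<phi>)"
proof -
  obtain K where K: "compact K" "K \<subseteq> \<Omega>" "\<And>x. x \<in> \<Omega> - K \<Longrightarrow> \<phi> x = 0" and sm: "smooth \<phi>"
    using assms unfolding test_function_def space_M by blast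
  have "dir_deriv b \<phi> x = 0" if "x \<in> \<Omega> - K" for x
    by (rule dir_deriv_zero_on_open[OF _ that K(3)]) (use K(1) open_\<Omega> compact_imp_closed in auto)
  with K sm assms(2) show ?thesis
    unfolding test_function_def space_M by (auto intro!: smooth_dir_deriv)
qed

lemma test_function_mult:
  assumes "test_function \<Omega> \<phi>" "smooth \<eta>"
  shows "test_function \<Omega> (\<lambda>x. \<eta> x * \<phi> x)"
  using assms unfolding test_function_def by (auto intro!: smooth_mult)

text \<open>Writes the mollification at a point as a pairing of \<open>f\<close> with a translated
  kernel, so that knowledge about pairings with test functions applies.\<close>

lemma mollify_eq_l2_inner:
  assumes \<rho>: "mollifier \<rho> C" "\<epsilon> > 0" and f: "f \<in> L2 M"
  shows "mollify \<rho> \<epsilon> (extend0 \<Omega> f) x = l2_inner M f (\<lambda>y. rescale \<rho> \<epsilon> (y - x))"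
proof -
  have sm: "smooth \<rho>" using \<rho> by (simp add: mollifier_def)
  show ?thesis
    unfolding mollify_eq_correlation[OF extend0(4)[OF sets_\<Omega> f] sm \<rho>(2)]
    by (subst l2_inner_eq_lborel[OF f smooth_borel[OF smooth_translate(1)[OF smooth_rescale[OF sm]]]])
       (simp add: correlation_def mult.commute)
qed

lemma kernel_test_function:
  assumes \<rho>: "mollifier \<rho> C" "\<epsilon> > 0" and sub: "\<And>z. z \<in> C \<Longrightarrow> x + \<epsilon> *\<^sub>R z \<in> \<Omega>"
  shows "test_function \<Omega> (\<lambda>y. rescale \<rho> \<epsilon> (y - x))"
proof (rule test_functionI[of _ "(\<lambda>z. x + \<epsilon> *\<^sub>R z) ` C"])
  have \<rho>': "smooth \<rho>" "compact C" "supported_in \<rho> C" using \<rho> by (auto simp: mollifier_def)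
  show "smooth (\<lambda>y. rescale \<rho> \<epsilon> (y - x))" by (intro smooth_translate smooth_rescale \<rho>')
  show "compact ((\<lambda>z. x + \<epsilon> *\<^sub>R z) ` C)"
    by (intro compact_continuous_image continuous_intros \<rho>')
  show "(\<lambda>z. x + \<epsilon> *\<^sub>R z) ` C \<subseteq> \<Omega>" using sub by auto
  show "supported_in (\<lambda>y. rescale \<rho> \<epsilon> (y - x)) ((\<lambda>z. x + \<epsilon> *\<^sub>R z) ` C)"
    using supported_in_rescale[OF \<rho>'(3) \<rho>(2)] unfolding supported_in_def
    by (auto simp: image_iff) (metis add.commute diff_add_cancel)
qed

lemma mollify_AE_subseq:
  assumes \<rho>: "mollifier \<rho> C" and f: "f \<in> L2 M"
  obtains \<epsilon> :: "nat \<Rightarrow> real" where "\<And>n. \<epsilon> n > 0" "\<epsilon> \<longlonglongrightarrow> 0"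
    "AE x in M. (\<lambda>n. mollify \<rho> (\<epsilon> n) (extend0 \<Omega> f) x) \<longlonglongrightarrow> f x"
proof -
  let ?f = "extend0 \<Omega> f"
  note e = extend0[OF sets_\<Omega> f]
  define \<epsilon> :: "nat \<Rightarrow> real" where "\<epsilon> n = inverse (real (Suc n))" for n
  have "\<epsilon> \<longlonglongrightarrow> 0" unfolding \<epsilon>_def[abs_def] by (rule LIMSEQ_inverse_real_of_nat)
  then have \<epsilon>: "\<epsilon> n > 0" "\<epsilon> \<longlonglongrightarrow> 0" for n
    by (simp_all add: \<epsilon>_def)
  let ?g = "\<lambda>n. mollify \<rho> (\<epsilon> n) ?f"
  have m: "?g n \<in> borel_measurable borel" for n by (rule mollify_L2(2)[OF \<rho> e(1) \<epsilon>(1)])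
  have lim: "(\<lambda>n. \<integral>\<^sup>+x. ennreal ((?g n x - ?f x)\<^sup>2) \<partial>lborel) \<longlonglongrightarrow> 0"
    by (rule mollify_tendsto[OF \<rho> e(1) \<epsilon>])
  \<comment> \<open>Only a tail is known to be square integrable: the integrals tend to 0, hence are
    finite from some \<open>N\<close> on.\<close>
  then have "eventually (\<lambda>n. (\<integral>\<^sup>+x. ennreal ((?g n x - ?f x)\<^sup>2) \<partial>lborel) < \<infinity>) sequentially"
    by (intro order_tendstoD(2)) auto
  then obtain N where N: "\<And>n. n \<ge> N \<Longrightarrow> (\<integral>\<^sup>+x. ennreal ((?g n x - ?f x)\<^sup>2) \<partial>lborel) < \<infinity>"
    by (auto simp: eventually_sequentially)
  have L: "(\<lambda>x. ?g (n + N) x - ?f x) \<in> L2 lborel" for n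
    using m e(4) by (intro L2_I_nn_integral N) auto
  have "(\<lambda>n. l2_norm lborel (\<lambda>x. ?g (n + N) x - ?f x - 0)) \<longlonglongrightarrow> 0"
  proof -
    have "(\<lambda>n. ennreal ((l2_norm lborel (\<lambda>x. ?g (n + N) x - ?f x))\<^sup>2)) \<longlonglongrightarrow> ennreal 0"
      using LIMSEQ_ignore_initial_segment[OF lim, of N] by (simp add: nn_integral_sq[OF L, symmetric])
    then have "(\<lambda>n. (l2_norm lborel (\<lambda>x. ?g (n + N) x - ?f x))\<^sup>2) \<longlonglongrightarrow> 0"
      by (subst (asm) tendsto_ennreal_iff) auto
    from tendsto_real_sqrt[OF this] show ?thesis by (simp add: l2_norm_nonneg)
  qed
  from l2_tendsto_AE_subseq[OF L L2_zero this]
  obtain r :: "nat \<Rightarrow> nat" where r: "strict_mono r" "AE x in lborel. (\<lambda>n. ?g (r n + N) x - ?f x) \<longlonglongrightarrow> 0"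
    by auto
  show ?thesis
  proof (rule that[of "\<lambda>n. \<epsilon> (r n + N)"])
    show "(\<lambda>n. \<epsilon> (r n + N)) \<longlonglongrightarrow> 0"
      using LIMSEQ_subseq_LIMSEQ[OF LIMSEQ_ignore_initial_segment[OF \<epsilon>(2), of N] r(1)] by (simp add: o_def)
    have "AE x in M. (\<lambda>n. ?g (r n + N) x - ?f x) \<longlonglongrightarrow> 0"
      unfolding AE_lebesgue_on_iff[OF sets_\<Omega>] using r(2) by eventually_elim auto
    with e(3) show "AE x in M. (\<lambda>n. ?g (r n + N) x) \<longlonglongrightarrow> f x"
      by eventually_elim (simp add: LIM_zero_iff)
  qed (rule \<epsilon>)
qed

text \<open>At an interior point all mollifications with small \<open>\<epsilon>\<close> are
  pairings of \<open>g\<close> with test functions, hence 0, while a sequence of them converges to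
  \<open>g\<close> almost everywhere.\<close>

lemma fundamental_lemma:
  assumes g: "g \<in> L2 M" and 0: "\<And>\<phi>. test_function \<Omega> \<phi> \<Longrightarrow> l2_inner M g \<phi> = 0"
  shows "AE x in M. g x = 0"
proof -
  obtain \<rho> C where \<rho>: "mollifier \<rho> C" "C \<subseteq> ball (0::'a) 1" by (rule mollifier_exists[of 1 0]) auto
  obtain \<epsilon> :: "nat \<Rightarrow> real" where \<epsilon>: "\<And>n. \<epsilon> n > 0" "\<epsilon> \<longlonglongrightarrow> 0"
    "AE x in M. (\<lambda>n. mollify \<rho> (\<epsilon> n) (extend0 \<Omega> g) x) \<longlonglongrightarrow> g x"
    using mollify_AE_subseq[OF \<rho>(1) g] by blast
  have "eventually (\<lambda>n. mollify \<rho> (\<epsilon> n) (extend0 \<Omega> g) x = 0) sequentially" if x: "x \<in> \<Omega>" for x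
  proof -
    obtain d where d: "d > 0" "ball x d \<subseteq> \<Omega>" using open_\<Omega> x open_contains_ball by blast
    have "eventually (\<lambda>n. \<epsilon> n < d) sequentially" by (rule order_tendstoD(2)[OF \<epsilon>(2) d(1)])
    then show ?thesis
    proof eventually_elim
      case (elim n)
      have "test_function \<Omega> (\<lambda>y. rescale \<rho> (\<epsilon> n) (y - x))"
      proof (rule kernel_test_function[OF \<rho>(1) \<epsilon>(1)])
        fix z assume "z \<in> C"
        then have "norm z < 1" using \<rho>(2) by auto
        then have "\<epsilon> n * norm z < d" using elim \<epsilon>(1)[of n]
          by (smt (verit) mult_left_le)
        then show "x + \<epsilon> n *\<^sub>R z \<in> \<Omega>" using d(2) \<epsilon>(1)[of n] by (auto simp: subset_iff dist_norm)
      qed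
      then show ?case using 0 mollify_eq_l2_inner[OF \<rho>(1) \<epsilon>(1) g] by simp
    qed
  qed
  then have "AE x in M. (\<lambda>n. mollify \<rho> (\<epsilon> n) (extend0 \<Omega> g) x) \<longlonglongrightarrow> 0"
    by (intro AE_I2 tendsto_eventually) (simp add: space_M)
  with \<epsilon>(3) show ?thesis by eventually_elim (rule LIMSEQ_unique)
qed

text \<open>Near each point the mollifications are eventually constant, so they converge at every point,
  and the limit is locally constant.\<close>

lemma weak_gradient_zero_imp_const:
  assumes g: "g \<in> L2 M" and con: "connected \<Omega>"
    and 0: "\<And>\<phi> b. test_function \<Omega> \<phi> \<Longrightarrow> b \<in> Basis \<Longrightarrow> l2_inner M g (dir_deriv b \<phi>) = 0"
  shows "\<exists>c. AE x in M. g x = c"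
proof -
  obtain \<rho> C where \<rho>: "mollifier \<rho> C" "C \<subseteq> ball (0::'a) 1" by (rule mollifier_exists[of 1 0]) auto
  obtain \<epsilon> :: "nat \<Rightarrow> real" where \<epsilon>: "\<And>n. \<epsilon> n > 0" "\<epsilon> \<longlonglongrightarrow> 0"
    "AE x in M. (\<lambda>n. mollify \<rho> (\<epsilon> n) (extend0 \<Omega> g) x) \<longlonglongrightarrow> g x"
    using mollify_AE_subseq[OF \<rho>(1) g] by blast
  let ?m = "\<lambda>n. mollify \<rho> (\<epsilon> n) (extend0 \<Omega> g)"
  have sm: "smooth (?m n)" for n by (rule smooth_mollify(1)[OF \<rho>(1) \<epsilon>(1) integrable_extend0[OF g]])
  have loc: "\<exists>d>0. ball x d \<subseteq> \<Omega> \<and> (\<forall>\<^sub>F n in sequentially. \<forall>y\<in>ball x d. ?m n y = ?m n x)" if x: "x \<in> \<Omega>" for x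
  proof -
    obtain d where d: "d > 0" "ball x d \<subseteq> \<Omega>" using open_\<Omega> x open_contains_ball by blast
    have "eventually (\<lambda>n. \<epsilon> n < d / 2) sequentially" using d by (intro order_tendstoD(2)[OF \<epsilon>(2)]) auto
    then have "\<forall>\<^sub>F n in sequentially. \<forall>y\<in>ball x (d / 2). ?m n y = ?m n x"
    proof eventually_elim
      case (elim n)
      have D0: "dir_deriv b (?m n) y = 0" if y: "y \<in> ball x (d / 2)" and b: "b \<in> Basis" for y b
      proof -
        have sub: "y + \<epsilon> n *\<^sub>R z \<in> \<Omega>" if "z \<in> C" for z
        proof -
          have "norm z < 1" using \<rho>(2) that by auto
          then have "\<epsilon> n * norm z \<le> \<epsilon> n * 1" using \<epsilon>(1)[of n] by (intro mult_left_mono) auto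
          moreover have "norm (\<epsilon> n *\<^sub>R z) = \<epsilon> n * norm z" using \<epsilon>(1)[of n] by simp
          ultimately have "norm (\<epsilon> n *\<^sub>R z) < d / 2" using elim by linarith
          moreover have "norm (y + \<epsilon> n *\<^sub>R z - x) \<le> norm (y - x) + norm (\<epsilon> n *\<^sub>R z)"
            using norm_triangle_ineq[of "y - x" "\<epsilon> n *\<^sub>R z"] by (simp add: algebra_simps)
          ultimately have "dist x (y + \<epsilon> n *\<^sub>R z) < d" using y by (simp add: dist_norm norm_minus_commute)
          then show ?thesis using d(2) by auto
        qed
        have smr: "smooth (rescale \<rho> (\<epsilon> n))" using \<rho>(1) by (auto simp: mollifier_def intro: smooth_rescale)
        have "dir_deriv b (?m n) y = (\<integral>w. - dir_deriv b (rescale \<rho> (\<epsilon> n)) (w - y) * extend0 \<Omega> g w \<partial>lborel)"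
          by (rule smooth_mollify(2)[OF \<rho>(1) \<epsilon>(1) integrable_extend0[OF g] b])
        also have "\<dots> = - (\<integral>w. extend0 \<Omega> g w * dir_deriv b (\<lambda>w. rescale \<rho> (\<epsilon> n) (w - y)) w \<partial>lborel)"
          by (simp add: smooth_translate(2)[OF smr] mult.commute)
        also have "\<dots> = - l2_inner M g (dir_deriv b (\<lambda>w. rescale \<rho> (\<epsilon> n) (w - y)))"
          using b by (subst l2_inner_eq_lborel[OF g]) (auto intro!: smooth_borel smooth_dir_deriv smooth_translate smr)
        also have "\<dots> = 0"
          using 0[OF kernel_test_function[OF \<rho>(1) \<epsilon>(1) sub] b] by simp
        finally show ?thesis .
      qed
      have "(?m n has_derivative (\<lambda>h. 0)) (at y within ball x (d / 2))" if "y \<in> ball x (d / 2)" for y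
      proof -
        have "(\<lambda>h. \<Sum>b\<in>Basis. (h \<bullet> b) * dir_deriv b (?m n) y) = (\<lambda>h. 0)"
          using D0[OF that] by simp
        with smooth_has_derivative[OF sm, of n y] show ?thesis by (metis has_derivative_at_withinI)
      qed
      from has_derivative_zero_constant[OF convex_ball this]
      obtain c where "\<And>y. y \<in> ball x (d / 2) \<Longrightarrow> ?m n y = c" by blast
      then show ?case using d(1) by simp
    qed
    then show ?thesis using d by (intro exI[of _ "d / 2"]) auto
  qed
  have conv: "convergent (\<lambda>n. ?m n x)" if x: "x \<in> \<Omega>" for x
  proof -
    obtain d where d: "d > 0" "ball x d \<subseteq> \<Omega>" "\<forall>\<^sub>F n in sequentially. \<forall>y\<in>ball x d. ?m n y = ?m n x"
      using loc[OF x] by auto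
    \<comment> \<open>Almost everywhere convergence must hit the ball, which has positive measure;
      at its centre the sequence is eventually the same as at the point hit.\<close>
    have "\<exists>y\<in>ball x d. (\<lambda>n. ?m n y) \<longlonglongrightarrow> g y"
    proof (rule ccontr)
      assume "\<not> ?thesis"
      then have "AE y in lborel. y \<notin> ball x d"
        using \<epsilon>(3) d(2) unfolding AE_lebesgue_on_iff[OF sets_\<Omega>] by (auto elim!: eventually_mono)
      then have "emeasure lborel (ball x d) = 0"
        by (subst (asm) AE_iff_measurable[OF _ refl]) (auto simp: ball_def)
      then show False using content_ball_pos[OF d(1), of x] by (simp add: measure_def)
    qed
    then obtain y where y: "y \<in> ball x d" "(\<lambda>n. ?m n y) \<longlonglongrightarrow> g y" by auto
    have "(\<lambda>n. ?m n x) \<longlonglongrightarrow> g y"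
      by (rule Lim_transform_eventually[OF y(2)]) (use d(3) y(1) in \<open>auto elim!: eventually_mono\<close>)
    then show ?thesis by (rule convergentI)
  qed
  define L where "L x = lim (\<lambda>n. ?m n x)" for x
  have L: "(\<lambda>n. ?m n x) \<longlonglongrightarrow> L x" if "x \<in> \<Omega>" for x
    using conv[OF that] by (simp add: L_def convergent_LIMSEQ_iff)
  have "L constant_on \<Omega>"
  proof (rule locally_constant_imp_constant[OF con])
    fix x assume x: "x \<in> \<Omega>"
    obtain d where d: "d > 0" "ball x d \<subseteq> \<Omega>" "\<forall>\<^sub>F n in sequentially. \<forall>y\<in>ball x d. ?m n y = ?m n x"
      using loc[OF x] by auto
    have "L y = L x" if y: "y \<in> ball x d" for y
    proof (rule LIMSEQ_unique[OF L])
      show "y \<in> \<Omega>" using d y by auto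
      show "(\<lambda>n. ?m n y) \<longlonglongrightarrow> L x"
        by (rule Lim_transform_eventually[OF L[OF x]]) (use d(3) y in \<open>auto elim!: eventually_mono\<close>)
    qed
    then show "\<exists>U. openin (top_of_set \<Omega>) U \<and> x \<in> U \<and> (\<forall>y\<in>U. L y = L x)"
    proof (intro exI[of _ "ball x d"] conjI ballI)
      show "openin (top_of_set \<Omega>) (ball x d)"
        unfolding openin_open_eq[OF open_\<Omega>] using d(2) by simp
      show "x \<in> ball x d" using d(1) by simp
    qed
  qed
  then obtain c where c: "\<And>x. x \<in> \<Omega> \<Longrightarrow> L x = c" by (auto simp: constant_on_def)
  have "AE x in M. x \<in> \<Omega>" using AE_space[of M] by (simp add: space_M)
  with \<epsilon>(3) have "AE x in M. g x = c"
    by eventually_elim (metis L LIMSEQ_unique c)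
  then show ?thesis by blast
qed

end

lemma tendsto_0_le:
  fixes f g :: "nat \<Rightarrow> real"
  assumes "\<And>n. 0 \<le> f n" "\<And>n. f n \<le> g n" "g \<longlonglongrightarrow> 0"
  shows "f \<longlonglongrightarrow> 0"
  by (rule tendsto_sandwich[OF _ _ tendsto_const assms(3)]) (simp_all add: assms(1,2))

context bounded_open
begin

section \<open>Calculus of weak derivatives\<close>

lemma has_weak_deriv_iff:
  "has_weak_deriv M w f g \<longleftrightarrow> g \<in> L2 M \<and>
     (\<forall>\<phi>. test_function \<Omega> \<phi> \<longrightarrow> l2_inner M f (word_deriv w \<phi>) = (-1) ^ length w * l2_inner M g \<phi>)"
  by (simp only: has_weak_deriv_def space_M)

lemma has_weak_deriv_L2: "has_weak_deriv M w f g \<Longrightarrow> g \<in> L2 M"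
  by (simp add: has_weak_deriv_iff)

lemma test_function_L2: "test_function \<Omega> \<phi> \<Longrightarrow> \<phi> \<in> L2 M"
  by (simp add: test_function_smooth smooth_L2)

lemma test_function_word_deriv:
  "test_function \<Omega> \<phi> \<Longrightarrow> w \<in> lists Basis \<Longrightarrow> test_function \<Omega> (word_deriv w \<phi>)"
  by (induction w) (auto intro: test_function_dir_deriv)

lemma has_weak_deriv_unique:
  assumes "has_weak_deriv M w f g1" "has_weak_deriv M w f g2"
  shows "AE x in M. g1 x = g2 x"
proof -
  have L: "g1 \<in> L2 M" "g2 \<in> L2 M" using assms by (auto simp: has_weak_deriv_iff)
  have "AE x in M. g1 x - g2 x = 0"
  proof (rule fundamental_lemma)
    fix \<phi> assume \<phi>: "test_function \<Omega> \<phi>"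
    have "(- 1) ^ length w * l2_inner M g1 \<phi> = (- 1) ^ length w * l2_inner M g2 \<phi>"
      using assms \<phi> unfolding has_weak_deriv_iff by metis
    then have "l2_inner M g1 \<phi> = l2_inner M g2 \<phi>" by simp
    then show "l2_inner M (\<lambda>x. g1 x - g2 x) \<phi> = 0"
      by (simp add: l2_inner_diff_left L test_function_L2[OF \<phi>])
  qed (rule L2_diff[OF L])
  then show ?thesis by eventually_elim simp
qed

lemma has_weak_deriv_cong:
  assumes d: "has_weak_deriv M w f g" and w: "w \<in> lists Basis"
    and f: "AE x in M. f x = f' x" "f \<in> L2 M" "f' \<in> borel_measurable M"
    and g: "AE x in M. g x = g' x" "g' \<in> borel_measurable M"
  shows "has_weak_deriv M w f' g'"
  unfolding has_weak_deriv_iff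
proof (intro conjI allI impI)
  have gL: "g \<in> L2 M" using d by (rule has_weak_deriv_L2)
  show "g' \<in> L2 M" by (rule L2_cong_AE[OF gL g(2,1)])
  fix \<phi> assume \<phi>: "test_function \<Omega> \<phi>"
  have m: "word_deriv w \<phi> \<in> borel_measurable M" "\<phi> \<in> borel_measurable M"
    using test_function_L2[OF test_function_word_deriv[OF \<phi> w]] test_function_L2[OF \<phi>] L2_measurable by auto
  have "l2_inner M f' (word_deriv w \<phi>) = l2_inner M f (word_deriv w \<phi>)"
    by (rule l2_inner_cong_AE) (use f m L2_measurable in \<open>auto elim!: eventually_mono\<close>)
  also have "\<dots> = (-1) ^ length w * l2_inner M g \<phi>" using d \<phi> by (auto simp: has_weak_deriv_iff)
  also have "l2_inner M g \<phi> = l2_inner M g' \<phi>"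
    by (rule l2_inner_cong_AE) (use g gL m L2_measurable in \<open>auto elim!: eventually_mono\<close>)
  finally show "l2_inner M f' (word_deriv w \<phi>) = (-1) ^ length w * l2_inner M g' \<phi>" .
qed

text \<open>\<open>weak_deriv\<close> is an arbitrary choice of representative. It is used through
  these consequences, while the rules of calculus are stated for
  \<open>has_weak_deriv\<close>.\<close>

lemma weak_deriv:
  assumes "has_weak_deriv M w f g"
  shows "has_weak_deriv M w f (weak_deriv M w f)" "AE x in M. weak_deriv M w f x = g x"
    "weak_deriv M w f \<in> L2 M" "l2_norm M (weak_deriv M w f) = l2_norm M g"
proof -
  show 1: "has_weak_deriv M w f (weak_deriv M w f)"
    unfolding weak_deriv_def by (rule someI[of "has_weak_deriv M w f", OF assms])
  show 2: "AE x in M. weak_deriv M w f x = g x" by (rule has_weak_deriv_unique[OF 1 assms])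
  show 3: "weak_deriv M w f \<in> L2 M" by (rule has_weak_deriv_L2[OF 1])
  show "l2_norm M (weak_deriv M w f) = l2_norm M g"
    using L2_measurable[OF 3] L2_measurable[OF has_weak_deriv_L2[OF assms]] by (rule l2_norm_cong_AE[OF 2])
qed

lemma has_weak_deriv_Nil: "f \<in> L2 M \<Longrightarrow> has_weak_deriv M [] f f"
  by (simp add: has_weak_deriv_iff)

lemma has_weak_deriv_add:
  assumes "has_weak_deriv M w f g" "has_weak_deriv M w f' g'" "f \<in> L2 M" "f' \<in> L2 M" "w \<in> lists Basis"
  shows "has_weak_deriv M w (\<lambda>x. f x + f' x) (\<lambda>x. g x + g' x)"
  unfolding has_weak_deriv_iff
proof (intro conjI allI impI)
  have L: "g \<in> L2 M" "g' \<in> L2 M" using assms has_weak_deriv_L2 by auto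
  then show "(\<lambda>x. g x + g' x) \<in> L2 M" by (rule L2_add)
  fix \<phi> assume \<phi>: "test_function \<Omega> \<phi>"
  have "l2_inner M f (word_deriv w \<phi>) = (-1) ^ length w * l2_inner M g \<phi>"
    "l2_inner M f' (word_deriv w \<phi>) = (-1) ^ length w * l2_inner M g' \<phi>"
    using assms(1,2) \<phi> by (auto simp: has_weak_deriv_iff)
  then show "l2_inner M (\<lambda>x. f x + f' x) (word_deriv w \<phi>) = (-1) ^ length w * l2_inner M (\<lambda>x. g x + g' x) \<phi>"
    by (simp add: l2_inner_add_left assms(3,4) L test_function_L2 \<phi> test_function_word_deriv[OF \<phi> assms(5)] distrib_left)
qed

lemma has_weak_deriv_cmult:
  assumes "has_weak_deriv M w f g"
  shows "has_weak_deriv M w (\<lambda>x. c * f x) (\<lambda>x. c * g x)"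
  using assms by (auto simp: has_weak_deriv_iff l2_inner_cmult_left intro: L2_cmult)

lemma has_weak_deriv_diff:
  assumes "has_weak_deriv M w f g" "has_weak_deriv M w f' g'" "f \<in> L2 M" "f' \<in> L2 M" "w \<in> lists Basis"
  shows "has_weak_deriv M w (\<lambda>x. f x - f' x) (\<lambda>x. g x - g' x)"
  using has_weak_deriv_add[OF assms(1) has_weak_deriv_cmult[OF assms(2), of "-1"] assms(3) L2_cmult[OF assms(4)] assms(5)]
  by simp

text \<open>Integration by parts: the derivative of \<open>f * \<psi>\<close> has integral 0 over
  the whole space. The test function is first replaced by its zero extension \<open>\<psi>\<close>,
  since otherwise the product need not have compact support.\<close>

lemma has_weak_deriv_smooth:
  assumes f: "smooth f" and b: "b \<in> Basis"
  shows "has_weak_deriv M [b] f (dir_deriv b f)"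
  unfolding has_weak_deriv_iff
proof (intro conjI allI impI)
  show "dir_deriv b f \<in> L2 M" by (intro smooth_L2 smooth_dir_deriv f b)
  fix \<phi> assume \<phi>: "test_function \<Omega> \<phi>"
  obtain \<psi> K where \<psi>: "smooth \<psi>" "compact K" "K \<subseteq> \<Omega>" "supported_in \<psi> K" "\<And>x. x \<in> \<Omega> \<Longrightarrow> \<psi> x = \<phi> x"
    by (rule test_function_extend[OF \<phi>]) auto
  have D: "dir_deriv b \<psi> x = dir_deriv b \<phi> x" if "x \<in> \<Omega>" for x
    by (rule dir_deriv_cong_open[OF \<psi>(1) open_\<Omega> that \<psi>(5)])
  let ?F = "\<lambda>x. f x * \<psi> x"
  have F: "smooth ?F" "supported_in ?F K"
    using \<psi> f by (auto intro!: smooth_mult simp: supported_in_def)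
  have DF: "dir_deriv b ?F x = f x * dir_deriv b \<psi> x + dir_deriv b f x * \<psi> x" for x
    by (intro dir_deriv_mult smooth_differentiable f \<psi>)
  have s: "smooth (dir_deriv b f)" "smooth (dir_deriv b \<psi>)" by (intro smooth_dir_deriv f b \<psi>)+
  have sup: "supported_in (dir_deriv b \<psi>) K" by (rule supported_in_dir_deriv[OF \<psi>(4,2)])
  have "(\<integral>x. dir_deriv b ?F x \<partial>M) = (\<integral>x. dir_deriv b ?F x \<partial>lborel)"
  proof -
    have [measurable]: "dir_deriv b ?F \<in> borel_measurable borel"
      by (intro smooth_borel smooth_dir_deriv F b)
    have "(\<integral>x. dir_deriv b ?F x \<partial>M) = (\<integral>x. indicator \<Omega> x *\<^sub>R dir_deriv b ?F x \<partial>lebesgue)"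
      by (subst integral_restrict_space) auto
    also have "\<dots> = (\<integral>x. indicator \<Omega> x *\<^sub>R dir_deriv b ?F x \<partial>lborel)"
      by (subst integral_completion) auto
    also have "\<dots> = (\<integral>x. dir_deriv b ?F x \<partial>lborel)"
      using supported_in_dir_deriv[OF F(2) \<psi>(2), of b] \<psi>(3)
      by (intro Bochner_Integration.integral_cong) (auto simp: indicator_def supported_in_def)
    finally show ?thesis .
  qed
  also have "\<dots> = 0" by (rule integral_dir_deriv_eq_0[OF F(1) \<psi>(2) F(2) b])
  finally have "l2_inner M f (dir_deriv b \<psi>) + l2_inner M (dir_deriv b f) \<psi> = 0"
    unfolding l2_inner_def DF
    by (subst (asm) Bochner_Integration.integral_add) (auto intro!: L2_integrable_mult smooth_L2 f s \<psi>)
  moreover have "l2_inner M f (dir_deriv b \<psi>) = l2_inner M f (dir_deriv b \<phi>)"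
    "l2_inner M (dir_deriv b f) \<psi> = l2_inner M (dir_deriv b f) \<phi>"
    unfolding l2_inner_def by (auto intro!: Bochner_Integration.integral_cong simp: space_M D \<psi>(5))
  ultimately show "l2_inner M f (word_deriv [b] \<phi>) = (-1) ^ length [b] * l2_inner M (dir_deriv b f) \<phi>"
    by simp
qed

text \<open>The product \<open>\<eta> * \<phi>\<close> is again a test function; expanding its
  derivative moves \<open>\<eta>\<close> from the test side to \<open>f\<close>.\<close>

lemma has_weak_deriv_smooth_mult:
  assumes d: "has_weak_deriv M [b] f g" and f: "f \<in> L2 M" and \<eta>: "smooth \<eta>" and b: "b \<in> Basis"
  shows "has_weak_deriv M [b] (\<lambda>x. \<eta> x * f x) (\<lambda>x. \<eta> x * g x + dir_deriv b \<eta> x * f x)"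
  unfolding has_weak_deriv_iff
proof (intro conjI allI impI)
  have g: "g \<in> L2 M" using d by (rule has_weak_deriv_L2)
  have s: "smooth (dir_deriv b \<eta>)" by (intro smooth_dir_deriv \<eta> b)
  have L: "(\<lambda>x. \<eta> x * g x) \<in> L2 M" "(\<lambda>x. dir_deriv b \<eta> x * f x) \<in> L2 M"
    by (intro smooth_mult_L2 \<eta> g f s)+
  then show "(\<lambda>x. \<eta> x * g x + dir_deriv b \<eta> x * f x) \<in> L2 M" by (rule L2_add)
  fix \<phi> assume \<phi>: "test_function \<Omega> \<phi>"
  have s\<phi>: "smooth \<phi>" by (rule test_function_smooth[OF \<phi>])
  have "l2_inner M f (dir_deriv b (\<lambda>x. \<eta> x * \<phi> x)) = - l2_inner M g (\<lambda>x. \<eta> x * \<phi> x)"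
    using d test_function_mult[OF \<phi> \<eta>] by (auto simp: has_weak_deriv_iff)
  moreover have "dir_deriv b (\<lambda>x. \<eta> x * \<phi> x) = (\<lambda>x. \<eta> x * dir_deriv b \<phi> x + dir_deriv b \<eta> x * \<phi> x)"
    by (intro ext dir_deriv_mult smooth_differentiable \<eta> s\<phi>)
  ultimately have "l2_inner M f (\<lambda>x. \<eta> x * dir_deriv b \<phi> x) + l2_inner M f (\<lambda>x. dir_deriv b \<eta> x * \<phi> x)
      = - l2_inner M g (\<lambda>x. \<eta> x * \<phi> x)"
    by (simp add: l2_inner_add_right f smooth_L2 smooth_mult \<eta> s\<phi> s smooth_dir_deriv b)
  then show "l2_inner M (\<lambda>x. \<eta> x * f x) (word_deriv [b] \<phi>)
     = (-1) ^ length [b] * l2_inner M (\<lambda>x. \<eta> x * g x + dir_deriv b \<eta> x * f x) \<phi>"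
    by (simp add: l2_inner_add_left L smooth_L2 s\<phi>) (simp add: l2_inner_def mult_ac)
qed

subsection \<open>The space $H^1$\<close>

lemma words_0: "words B 0 = {[]}" and words_1: "words B (Suc 0) = (\<lambda>b. [b]) ` B"
  by (auto simp: words_def length_Suc_conv)

lemma H1_iff: "f \<in> H 1 \<Omega> \<longleftrightarrow> f \<in> L2 M \<and> (\<forall>b\<in>Basis. \<exists>g. has_weak_deriv M [b] f g)"
proof -
  have *: "l \<le> Suc 0 \<longleftrightarrow> l = 0 \<or> l = Suc 0" for l by auto
  show ?thesis
    unfolding H_def sobolev_def Let_def
    by (auto simp: * words_0 words_1 intro: has_weak_deriv_Nil)
qed

lemma H1_L2: "f \<in> H 1 \<Omega> \<Longrightarrow> f \<in> L2 M"
  by (simp add: H1_iff)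

lemma H1_weak_deriv: "f \<in> H 1 \<Omega> \<Longrightarrow> b \<in> Basis \<Longrightarrow> has_weak_deriv M [b] f (weak_deriv M [b] f)"
  using H1_iff weak_deriv(1) by blast

lemma H1_weak_deriv_L2: "f \<in> H 1 \<Omega> \<Longrightarrow> b \<in> Basis \<Longrightarrow> weak_deriv M [b] f \<in> L2 M"
  using H1_weak_deriv has_weak_deriv_L2 by blast

lemma H1_norm_nonneg: "H_norm s \<Omega> f \<ge> 0"
  unfolding H_norm_def sobolev_norm_def Let_def by (auto intro!: real_sqrt_ge_zero add_nonneg_nonneg sum_nonneg)

text \<open>Any representatives \<open>G b\<close> of the derivatives may be inserted, so norms of
  sums, multiples and differences are computed from the obvious candidates and not from the choice
  in \<open>weak_deriv\<close>.\<close>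

lemma H1_norm_sq:
  assumes "f \<in> L2 M" "\<And>b. b \<in> Basis \<Longrightarrow> has_weak_deriv M [b] f (G b)"
  shows "(H_norm 1 \<Omega> f)\<^sup>2 = (l2_norm M f)\<^sup>2 + (\<Sum>b\<in>Basis. (l2_norm M (G b))\<^sup>2)"
proof -
  have "(\<Sum>l\<le>Suc 0. \<Sum>w\<in>words Basis l. (l2_norm M (weak_deriv M w f))\<^sup>2)
    = (l2_norm M (weak_deriv M [] f))\<^sup>2 + (\<Sum>b\<in>Basis. (l2_norm M (weak_deriv M [b] f))\<^sup>2)"
    by (simp add: words_0 words_1 sum.reindex inj_on_def)
  also have "\<dots> = (l2_norm M f)\<^sup>2 + (\<Sum>b\<in>Basis. (l2_norm M (G b))\<^sup>2)"
    using weak_deriv(4)[OF has_weak_deriv_Nil[OF assms(1)]] weak_deriv(4)[OF assms(2)] by simp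
  finally show ?thesis
    unfolding H_norm_def sobolev_norm_def Let_def by (simp add: sum_nonneg)
qed

lemma H1_norm_sq': "f \<in> H 1 \<Omega> \<Longrightarrow>
    (H_norm 1 \<Omega> f)\<^sup>2 = (l2_norm M f)\<^sup>2 + (\<Sum>b\<in>Basis. (l2_norm M (weak_deriv M [b] f))\<^sup>2)"
  by (rule H1_norm_sq) (auto intro: H1_L2 H1_weak_deriv)

lemma H1_add: "f \<in> H 1 \<Omega> \<Longrightarrow> g \<in> H 1 \<Omega> \<Longrightarrow> (\<lambda>x. f x + g x) \<in> H 1 \<Omega>"
proof -
  assume f: "f \<in> H 1 \<Omega>" and g: "g \<in> H 1 \<Omega>"
  have "has_weak_deriv M [b] (\<lambda>x. f x + g x) (\<lambda>x. weak_deriv M [b] f x + weak_deriv M [b] g x)" if "b \<in> Basis" for b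
    by (rule has_weak_deriv_add[OF H1_weak_deriv[OF f that] H1_weak_deriv[OF g that] H1_L2[OF f] H1_L2[OF g]])
       (simp add: that)
  then show ?thesis unfolding H1_iff using L2_add[OF H1_L2[OF f] H1_L2[OF g]] by blast
qed

lemma H1_cmult: "f \<in> H 1 \<Omega> \<Longrightarrow> (\<lambda>x. c * f x) \<in> H 1 \<Omega>"
  unfolding H1_iff using L2_cmult has_weak_deriv_cmult by blast

lemma H1_diff: "f \<in> H 1 \<Omega> \<Longrightarrow> g \<in> H 1 \<Omega> \<Longrightarrow> (\<lambda>x. f x - g x) \<in> H 1 \<Omega>"
  using H1_add[of f "\<lambda>x. -1 * g x"] H1_cmult[of g "-1"] by simp

lemma H1_smooth: "smooth f \<Longrightarrow> f \<in> H 1 \<Omega>"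
  unfolding H1_iff using has_weak_deriv_smooth smooth_L2 by blast

lemma H1_smooth_mult: "smooth \<eta> \<Longrightarrow> f \<in> H 1 \<Omega> \<Longrightarrow> (\<lambda>x. \<eta> x * f x) \<in> H 1 \<Omega>"
  unfolding H1_iff using has_weak_deriv_smooth_mult smooth_mult_L2 by blast

lemma H1_zero: "(\<lambda>x. 0) \<in> H 1 \<Omega>"
  by (intro H1_smooth smooth_const)

lemma H1_norm_cmult:
  assumes "f \<in> H 1 \<Omega>"
  shows "H_norm 1 \<Omega> (\<lambda>x. c * f x) = \<bar>c\<bar> * H_norm 1 \<Omega> f"
proof -
  have "(H_norm 1 \<Omega> (\<lambda>x. c * f x))\<^sup>2 = (l2_norm M (\<lambda>x. c * f x))\<^sup>2 + (\<Sum>b\<in>Basis. (l2_norm M (\<lambda>x. c * weak_deriv M [b] f x))\<^sup>2)"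
    by (rule H1_norm_sq[OF L2_cmult[OF H1_L2[OF assms]] has_weak_deriv_cmult[OF H1_weak_deriv[OF assms]]])
  also have "\<dots> = (\<bar>c\<bar> * H_norm 1 \<Omega> f)\<^sup>2"
    by (simp add: power_mult_distrib l2_norm_cmult H1_norm_sq'[OF assms] distrib_left sum_distrib_left)
  finally show ?thesis
    using H1_norm_nonneg by (simp add: power2_eq_iff_nonneg)
qed

lemma l2_norm_add_sq_le:
  assumes "f \<in> L2 N" "g \<in> L2 N"
  shows "(l2_norm N (\<lambda>x. f x + g x))\<^sup>2 \<le> 2 * (l2_norm N f)\<^sup>2 + 2 * (l2_norm N g)\<^sup>2"
proof -
  have "(l2_norm N (\<lambda>x. f x + g x))\<^sup>2 \<le> (l2_norm N f + l2_norm N g)\<^sup>2"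
    by (intro power_mono l2_norm_triangle assms l2_norm_nonneg)
  also have "\<dots> \<le> 2 * (l2_norm N f)\<^sup>2 + 2 * (l2_norm N g)\<^sup>2"
    using sum_squares_bound[of "l2_norm N f" "l2_norm N g"] by (simp add: power2_sum)
  finally show ?thesis .
qed

text \<open>A quasi-triangle inequality for squares is enough for limits and for unspecified
  constants; it follows from the L2 version term by term.\<close>

lemma H1_norm_add_sq_le:
  assumes f: "f \<in> H 1 \<Omega>" and g: "g \<in> H 1 \<Omega>"
  shows "(H_norm 1 \<Omega> (\<lambda>x. f x + g x))\<^sup>2 \<le> 2 * (H_norm 1 \<Omega> f)\<^sup>2 + 2 * (H_norm 1 \<Omega> g)\<^sup>2"
proof -
  let ?D = "\<lambda>b f. weak_deriv M [b] f"
  have "(H_norm 1 \<Omega> (\<lambda>x. f x + g x))\<^sup>2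
    = (l2_norm M (\<lambda>x. f x + g x))\<^sup>2 + (\<Sum>b\<in>Basis. (l2_norm M (\<lambda>x. ?D b f x + ?D b g x))\<^sup>2)"
  proof (rule H1_norm_sq)
    show "(\<lambda>x. f x + g x) \<in> L2 M" by (intro L2_add H1_L2 f g)
    show "has_weak_deriv M [b] (\<lambda>x. f x + g x) (\<lambda>x. ?D b f x + ?D b g x)" if "b \<in> Basis" for b
      by (rule has_weak_deriv_add[OF H1_weak_deriv[OF f that] H1_weak_deriv[OF g that] H1_L2[OF f] H1_L2[OF g]])
         (simp add: that)
  qed
  also have "\<dots> \<le> (2 * (l2_norm M f)\<^sup>2 + 2 * (l2_norm M g)\<^sup>2)
      + (\<Sum>b\<in>Basis. 2 * (l2_norm M (?D b f))\<^sup>2 + 2 * (l2_norm M (?D b g))\<^sup>2)"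
    using f g by (intro add_mono sum_mono l2_norm_add_sq_le H1_L2 H1_weak_deriv_L2) auto
  also have "\<dots> = 2 * (H_norm 1 \<Omega> f)\<^sup>2 + 2 * (H_norm 1 \<Omega> g)\<^sup>2"
    by (simp add: H1_norm_sq'[OF f] H1_norm_sq'[OF g] sum.distrib sum_distrib_left)
  finally show ?thesis .
qed

lemma H1_norm_diff_commute:
  assumes "f \<in> H 1 \<Omega>" "g \<in> H 1 \<Omega>"
  shows "H_norm 1 \<Omega> (\<lambda>x. f x - g x) = H_norm 1 \<Omega> (\<lambda>x. g x - f x)"
  using H1_norm_cmult[OF H1_diff[OF assms], of "-1"] by simp

lemma H1_tendsto_iff:
  "(\<lambda>n. H_norm 1 \<Omega> (f n)) \<longlonglongrightarrow> 0 \<longleftrightarrow> (\<lambda>n. (H_norm 1 \<Omega> (f n))\<^sup>2) \<longlonglongrightarrow> 0"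
proof
  assume "(\<lambda>n. (H_norm 1 \<Omega> (f n))\<^sup>2) \<longlonglongrightarrow> 0"
  from tendsto_real_sqrt[OF this] show "(\<lambda>n. H_norm 1 \<Omega> (f n)) \<longlonglongrightarrow> 0"
    by (simp add: H1_norm_nonneg)
qed (auto dest: tendsto_power[of _ _ _ 2])

subsection \<open>Density of smooth functions\<close>

definition smooth_approximable :: "('a \<Rightarrow> real) \<Rightarrow> bool" where
  "smooth_approximable v \<longleftrightarrow> (\<exists>\<phi> :: nat \<Rightarrow> 'a \<Rightarrow> real. (\<forall>n. smooth (\<phi> n)) \<and>
     (\<lambda>n. H_norm 1 \<Omega> (\<lambda>x. \<phi> n x - v x)) \<longlonglongrightarrow> 0)"

lemma smooth_approximable_add:
  assumes v: "smooth_approximable v" "v \<in> H 1 \<Omega>" and w: "smooth_approximable w" "w \<in> H 1 \<Omega>"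
  shows "smooth_approximable (\<lambda>x. v x + w x)"
proof -
  obtain \<phi> \<psi> :: "nat \<Rightarrow> 'a \<Rightarrow> real" where \<phi>: "\<And>n. smooth (\<phi> n)" "(\<lambda>n. H_norm 1 \<Omega> (\<lambda>x. \<phi> n x - v x)) \<longlonglongrightarrow> 0"
    and \<psi>: "\<And>n. smooth (\<psi> n)" "(\<lambda>n. H_norm 1 \<Omega> (\<lambda>x. \<psi> n x - w x)) \<longlonglongrightarrow> 0"
    using v w unfolding smooth_approximable_def by blast
  have le: "(H_norm 1 \<Omega> (\<lambda>x. \<phi> n x + \<psi> n x - (v x + w x)))\<^sup>2
    \<le> 2 * (H_norm 1 \<Omega> (\<lambda>x. \<phi> n x - v x))\<^sup>2 + 2 * (H_norm 1 \<Omega> (\<lambda>x. \<psi> n x - w x))\<^sup>2" for n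
    using H1_norm_add_sq_le[OF H1_diff[OF H1_smooth[OF \<phi>(1)] v(2)] H1_diff[OF H1_smooth[OF \<psi>(1)] w(2)], of n n]
    by (simp add: algebra_simps)
  have "(\<lambda>n. 2 * (H_norm 1 \<Omega> (\<lambda>x. \<phi> n x - v x))\<^sup>2 + 2 * (H_norm 1 \<Omega> (\<lambda>x. \<psi> n x - w x))\<^sup>2) \<longlonglongrightarrow> 2 * 0\<^sup>2 + 2 * 0\<^sup>2"
    by (intro tendsto_intros \<phi> \<psi>)
  then have "(\<lambda>n. 2 * (H_norm 1 \<Omega> (\<lambda>x. \<phi> n x - v x))\<^sup>2 + 2 * (H_norm 1 \<Omega> (\<lambda>x. \<psi> n x - w x))\<^sup>2) \<longlonglongrightarrow> 0" by simp
  from tendsto_0_le[OF zero_le_power2 le this]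
  have "(\<lambda>n. (H_norm 1 \<Omega> (\<lambda>x. \<phi> n x + \<psi> n x - (v x + w x)))\<^sup>2) \<longlonglongrightarrow> 0" .
  then have "(\<lambda>n. H_norm 1 \<Omega> (\<lambda>x. \<phi> n x + \<psi> n x - (v x + w x))) \<longlonglongrightarrow> 0"
    by (rule H1_tendsto_iff[THEN iffD2])
  moreover have "\<forall>n. smooth (\<lambda>x. \<phi> n x + \<psi> n x)" by (intro allI smooth_add \<phi> \<psi>)
  ultimately show ?thesis
    unfolding smooth_approximable_def by (intro exI[of _ "\<lambda>n x. \<phi> n x + \<psi> n x"] conjI)
qed

text \<open>Mollifying with a kernel supported near \<open>e\<close> uses only values inside \<open>\<Omega>\<close>.\<close>

definition cone_patch :: "'a set \<Rightarrow> 'a \<Rightarrow> real \<Rightarrow> bool" where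
  "cone_patch U e \<kappa> \<longleftrightarrow> open U \<and> \<kappa> > 0 \<and>
     (\<forall>x \<in> \<Omega> \<inter> U. \<forall>\<tau> > 0. \<forall>v \<in> ball e \<kappa>. x + \<tau> *\<^sub>R v \<in> U \<longrightarrow> x + \<tau> *\<^sub>R v \<in> \<Omega>)"

text \<open>The kernel translated to a point \<open>x\<close> of \<open>\<Omega>\<close> and
  multiplied by the cutoff \<open>b\<close> is supported in \<open>\<Omega>\<close> by the cone
  property. It is therefore a test function, although the kernel alone may reach across the
  boundary. Hence the derivative of the mollified zero extension equals, inside
  \<open>\<Omega>\<close>, the mollification of the weak derivative of \<open>b * v\<close>.\<close>

lemma smooth_approximable_patch:
  assumes U: "cone_patch U e \<kappa>" and b: "smooth b" "compact C" "C \<subseteq> U" "supported_in b C"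
    and v: "v \<in> H 1 \<Omega>"
  shows "smooth_approximable (\<lambda>x. b x * v x)"
proof -
  have U': "open U" "\<kappa> > 0" and cone: "\<And>x \<tau> z. x \<in> \<Omega> \<Longrightarrow> x \<in> U \<Longrightarrow> \<tau> > 0 \<Longrightarrow> z \<in> ball e \<kappa> \<Longrightarrow>
      x + \<tau> *\<^sub>R z \<in> U \<Longrightarrow> x + \<tau> *\<^sub>R z \<in> \<Omega>"
    using U by (auto simp: cone_patch_def)
  obtain \<rho> K where \<rho>: "mollifier \<rho> K" "K \<subseteq> ball e \<kappa>" using mollifier_exists[OF U'(2)] by blast
  have \<rho>': "smooth \<rho>" "compact K" "supported_in \<rho> K" using \<rho> by (auto simp: mollifier_def)
  let ?v = "\<lambda>c. weak_deriv M [c] v"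
  define D where "D c x = b x * ?v c x + dir_deriv c b x * v x" for c x
  have vL: "v \<in> L2 M" "\<And>c. c \<in> Basis \<Longrightarrow> ?v c \<in> L2 M" using v by (auto intro: H1_L2 H1_weak_deriv_L2)
  have bv: "(\<lambda>x. b x * v x) \<in> L2 M" by (intro smooth_mult_L2 b vL)
  have hD: "has_weak_deriv M [c] (\<lambda>x. b x * v x) (D c)" if "c \<in> Basis" for c
    unfolding D_def[abs_def] by (rule has_weak_deriv_smooth_mult[OF H1_weak_deriv[OF v that] vL(1) b(1) that])
  then have DL: "D c \<in> L2 M" if "c \<in> Basis" for c using that has_weak_deriv_L2 by blast
  obtain d where d: "d > 0" "\<And>x y. x \<in> C \<Longrightarrow> y \<notin> U \<Longrightarrow> d \<le> dist x y"
  proof -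
    have "closed (- U)" "C \<inter> - U = {}" using U'(1) b(3) by auto
    from separate_compact_closed[OF b(2) this] show ?thesis using that by blast
  qed
  \<comment> \<open>Every \<open>z\<close> in the kernel support has norm below
    \<open>norm e + \<kappa>\<close>, so shifts by \<open>\<epsilon> n *\<^sub>R z\<close> stay
    shorter than the distance bound \<open>d\<close> between \<open>C\<close> and the complement of
    \<open>U\<close>. If such a shift lands in \<open>C\<close>, its start lies in
    \<open>U\<close>.\<close>
  define \<epsilon>0 where "\<epsilon>0 = d / (norm e + \<kappa>)"
  have pos: "norm e + \<kappa> > 0" using U'(2) norm_ge_zero[of e] by linarith
  have \<epsilon>0: "\<epsilon>0 > 0" using d pos by (simp add: \<epsilon>0_def)
  define \<epsilon> :: "nat \<Rightarrow> real" where "\<epsilon> n = \<epsilon>0 * inverse (real (Suc n))" for n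
  have \<epsilon>_pos: "\<epsilon> n > 0" for n using \<epsilon>0 by (simp add: \<epsilon>_def)
  have \<epsilon>_le: "\<epsilon> n \<le> \<epsilon>0" for n using \<epsilon>0 by (simp add: \<epsilon>_def divide_simps)
  have "(\<lambda>n. \<epsilon>0 * inverse (real (Suc n))) \<longlonglongrightarrow> \<epsilon>0 * 0"
    by (intro tendsto_mult tendsto_const LIMSEQ_inverse_real_of_nat)
  then have \<epsilon>_lim: "\<epsilon> \<longlonglongrightarrow> 0" by (simp add: \<epsilon>_def[abs_def])
  let ?W = "extend0 \<Omega> (\<lambda>x. b x * v x)"
  define \<phi> where "\<phi> n = mollify \<rho> (\<epsilon> n) ?W" for n
  have \<phi>_smooth: "smooth (\<phi> n)" for n
    unfolding \<phi>_def by (rule smooth_mollify(1)[OF \<rho>(1) \<epsilon>_pos integrable_extend0[OF bv]])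
  have in\<Omega>: "x + \<epsilon> n *\<^sub>R z \<in> \<Omega>" if x: "x \<in> \<Omega>" and z: "z \<in> K" "x + \<epsilon> n *\<^sub>R z \<in> C" for x z n
  proof -
    have "norm z < norm e + \<kappa>"
      using z(1) \<rho>(2) norm_triangle_ineq2[of z e] by (force simp: dist_norm norm_minus_commute)
    then have "\<epsilon> n * norm z < \<epsilon> n * (norm e + \<kappa>)" using \<epsilon>_pos[of n] by simp
    also have "\<dots> \<le> \<epsilon>0 * (norm e + \<kappa>)" using \<epsilon>_le pos by (intro mult_right_mono) auto
    also have "\<dots> = d" using pos by (simp add: \<epsilon>0_def)
    finally have "dist (x + \<epsilon> n *\<^sub>R z) x < d" using \<epsilon>_pos[of n] by (simp add: dist_norm)
    with d(2)[OF z(2), of x] have "x \<in> U" by force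
    then show ?thesis using cone x z \<rho>(2) b(3) \<epsilon>_pos by blast
  qed
  have key: "dir_deriv c (\<phi> n) x = mollify \<rho> (\<epsilon> n) (extend0 \<Omega> (D c)) x"
    if x: "x \<in> \<Omega>" and c: "c \<in> Basis" for x n c
  proof -
    let ?k = "\<lambda>y. rescale \<rho> (\<epsilon> n) (y - x)"
    have k: "smooth ?k" by (intro smooth_translate smooth_rescale \<rho>')
    have Dk: "smooth (dir_deriv c ?k)" by (intro smooth_dir_deriv k c)
    have Db: "smooth (dir_deriv c b)" by (intro smooth_dir_deriv b c)
    let ?S = "(\<lambda>z. x + \<epsilon> n *\<^sub>R z) ` K \<inter> C"
    have supk: "supported_in ?k ((\<lambda>z. x + \<epsilon> n *\<^sub>R z) ` K)"
      using supported_in_rescale[OF \<rho>'(3) \<epsilon>_pos[of n]] unfolding supported_in_def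
      by (auto simp: image_iff) (metis add.commute diff_add_cancel)
    have test: "test_function \<Omega> (\<lambda>y. ?k y * b y)"
    proof (rule test_functionI[of _ ?S])
      show "smooth (\<lambda>y. ?k y * b y)" by (intro smooth_mult k b)
      show "compact ?S"
        by (intro compact_Int b compact_continuous_image continuous_intros \<rho>')
      show "?S \<subseteq> \<Omega>" using in\<Omega>[OF x] by auto
      show "supported_in (\<lambda>y. ?k y * b y) ?S"
        using supk b(4) by (auto simp: supported_in_def)
    qed
    have Dkb: "dir_deriv c (\<lambda>y. ?k y * b y) = (\<lambda>y. ?k y * dir_deriv c b y + dir_deriv c ?k y * b y)"
      by (intro ext dir_deriv_mult smooth_differentiable k b)
    \<comment> \<open>The weak derivative of \<open>v\<close> is tested with kernel times cutoff;
      the term in which the derivative falls on the cutoff supplies the second summand of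
      \<open>D c\<close>.\<close>
    have "l2_inner M v (dir_deriv c (\<lambda>y. ?k y * b y)) = - l2_inner M (?v c) (\<lambda>y. ?k y * b y)"
      using H1_weak_deriv[OF v c] test by (auto simp: has_weak_deriv_iff)
    then have e: "l2_inner M v (\<lambda>y. ?k y * dir_deriv c b y) + l2_inner M v (\<lambda>y. dir_deriv c ?k y * b y)
       = - l2_inner M (?v c) (\<lambda>y. ?k y * b y)"
      unfolding Dkb by (simp add: l2_inner_add_right vL smooth_L2 smooth_mult k Dk Db b)
    have "dir_deriv c (\<phi> n) x = (\<integral>y. - dir_deriv c (rescale \<rho> (\<epsilon> n)) (y - x) * ?W y \<partial>lborel)"
      unfolding \<phi>_def by (rule smooth_mollify(2)[OF \<rho>(1) \<epsilon>_pos integrable_extend0[OF bv] c])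
    also have "\<dots> = - (\<integral>y. ?W y * dir_deriv c ?k y \<partial>lborel)"
      by (simp add: smooth_translate(2)[OF smooth_rescale[OF \<rho>'(1)]] mult.commute)
    also have "\<dots> = - l2_inner M (\<lambda>x. b x * v x) (dir_deriv c ?k)"
      by (subst l2_inner_eq_lborel[OF bv smooth_borel[OF Dk]]) simp
    also have "\<dots> = - l2_inner M v (\<lambda>y. dir_deriv c ?k y * b y)"
      by (simp add: l2_inner_def mult_ac)
    also have "\<dots> = l2_inner M (?v c) (\<lambda>y. ?k y * b y) + l2_inner M v (\<lambda>y. ?k y * dir_deriv c b y)"
      using e by simp
    also have "\<dots> = l2_inner M (\<lambda>x. b x * ?v c x) ?k + l2_inner M (\<lambda>x. dir_deriv c b x * v x) ?k"
      by (simp add: l2_inner_def mult_ac)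
    also have "\<dots> = l2_inner M (D c) ?k"
      unfolding D_def[abs_def]
      by (rule l2_inner_add_left[symmetric]) (intro smooth_mult_L2 b vL c Db smooth_L2 k)+
    also have "\<dots> = mollify \<rho> (\<epsilon> n) (extend0 \<Omega> (D c)) x"
      by (rule mollify_eq_l2_inner[OF \<rho>(1) \<epsilon>_pos DL[OF c], symmetric])
    finally show ?thesis .
  qed
  have conv: "(\<lambda>n. (l2_norm M (\<lambda>x. F n x - f x))\<^sup>2) \<longlonglongrightarrow> 0"
    if f: "f \<in> L2 M" and F: "\<And>n. smooth (F n)" "\<And>n x. x \<in> \<Omega> \<Longrightarrow> F n x = mollify \<rho> (\<epsilon> n) (extend0 \<Omega> f) x" for f F
  proof -
    have "ennreal ((l2_norm M (\<lambda>x. F n x - f x))\<^sup>2)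
      \<le> (\<integral>\<^sup>+x. ennreal ((mollify \<rho> (\<epsilon> n) (extend0 \<Omega> f) x - extend0 \<Omega> f x)\<^sup>2) \<partial>lborel)" for n
    proof (rule l2_norm_sq_le_lborel[OF sets_\<Omega>])
      show "(\<lambda>x. F n x - f x) \<in> L2 M" by (intro L2_diff smooth_L2 F f)
      have "AE x in M. x \<in> \<Omega>" using AE_space[of M] by (simp add: space_M)
      with extend0(3)[OF sets_\<Omega> f]
      show "AE x in M. F n x - f x = mollify \<rho> (\<epsilon> n) (extend0 \<Omega> f) x - extend0 \<Omega> f x"
        by eventually_elim (simp add: F(2))
    qed
    from tendsto_0_le_ennreal[OF this mollify_tendsto[OF \<rho>(1) extend0(1)[OF sets_\<Omega> f] \<epsilon>_pos \<epsilon>_lim]]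
    have "(\<lambda>n. ennreal ((l2_norm M (\<lambda>x. F n x - f x))\<^sup>2)) \<longlonglongrightarrow> ennreal 0" by simp
    then show ?thesis by (subst (asm) tendsto_ennreal_iff) auto
  qed
  have "(H_norm 1 \<Omega> (\<lambda>x. \<phi> n x - b x * v x))\<^sup>2
    = (l2_norm M (\<lambda>x. \<phi> n x - b x * v x))\<^sup>2 + (\<Sum>c\<in>Basis. (l2_norm M (\<lambda>x. dir_deriv c (\<phi> n) x - D c x))\<^sup>2)" for n
  proof (rule H1_norm_sq)
    show "(\<lambda>x. \<phi> n x - b x * v x) \<in> L2 M" by (rule L2_diff[OF smooth_L2[OF \<phi>_smooth] bv])
    show "has_weak_deriv M [c] (\<lambda>x. \<phi> n x - b x * v x) (\<lambda>x. dir_deriv c (\<phi> n) x - D c x)" if "c \<in> Basis" for c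
      by (rule has_weak_deriv_diff[OF has_weak_deriv_smooth[OF \<phi>_smooth that] hD[OF that] smooth_L2[OF \<phi>_smooth] bv])
        (simp add: that)
  qed
  moreover have "(\<lambda>n. (l2_norm M (\<lambda>x. \<phi> n x - b x * v x))\<^sup>2 + (\<Sum>c\<in>Basis. (l2_norm M (\<lambda>x. dir_deriv c (\<phi> n) x - D c x))\<^sup>2))
    \<longlonglongrightarrow> 0 + (\<Sum>c\<in>(Basis::'a set). 0)"
    by (intro tendsto_add tendsto_sum conv bv DL \<phi>_smooth smooth_dir_deriv key) (auto simp: \<phi>_def)
  ultimately have "(\<lambda>n. (H_norm 1 \<Omega> (\<lambda>x. \<phi> n x - b x * v x))\<^sup>2) \<longlonglongrightarrow> 0"
    by (simp del: power_tendsto_0_iff)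
  then have "(\<lambda>n. H_norm 1 \<Omega> (\<lambda>x. \<phi> n x - b x * v x)) \<longlonglongrightarrow> 0"
    by (rule H1_tendsto_iff[THEN iffD2])
  moreover have "\<forall>n. smooth (\<phi> n)" by (intro allI \<phi>_smooth)
  ultimately show ?thesis
    unfolding smooth_approximable_def by (intro exI[of _ \<phi>] conjI)
qed

text \<open>Takes the place of a partition of unity: \<open>v = b v + (1 - b) v\<close>.\<close>

lemma smooth_approximable_induct:
  assumes "finite I" and good: "\<And>b v. b \<in> I \<Longrightarrow> v \<in> H 1 \<Omega> \<Longrightarrow> smooth_approximable (\<lambda>x. b x * v x)"
    and sm: "\<And>b. b \<in> I \<Longrightarrow> smooth b"
    and v: "v \<in> H 1 \<Omega>" "smooth_approximable (\<lambda>x. (\<Prod>b\<in>I. 1 - b x) * v x)"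
  shows "smooth_approximable v"
  using assms
proof (induction I arbitrary: v rule: finite_induct)
  case (insert b I)
  have s: "smooth (\<lambda>x. 1 - b x)" by (intro smooth_diff smooth_const insert.prems) simp
  have bv: "(\<lambda>x. b x * v x) \<in> H 1 \<Omega>" "(\<lambda>x. (1 - b x) * v x) \<in> H 1 \<Omega>"
    by (intro H1_smooth_mult insert.prems s; simp)+
  have "smooth_approximable (\<lambda>x. (1 - b x) * v x)"
  proof (rule insert.IH[OF _ _ bv(2)])
    show "smooth_approximable (\<lambda>x. (\<Prod>b\<in>I. 1 - b x) * ((1 - b x) * v x))"
      using insert.prems(4) insert.hyps by (simp add: mult_ac)
  qed (use insert.prems in auto)
  from smooth_approximable_add[OF insert.prems(1)[OF _ insert.prems(3)] bv(1) this bv(2)]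
  show ?case by (simp add: algebra_simps)
qed simp

theorem smooth_dense_H1:
  assumes patch: "\<And>z. z \<in> closure \<Omega> \<Longrightarrow> \<exists>U e \<kappa>. z \<in> U \<and> cone_patch U e \<kappa>" and v: "v \<in> H 1 \<Omega>"
  shows "smooth_approximable v"
proof -
  have "\<exists>b V. smooth b \<and> open V \<and> z \<in> V \<and> (\<forall>x\<in>V. b x = 1) \<and>
      (\<forall>v \<in> H 1 \<Omega>. smooth_approximable (\<lambda>x. b x * v x))" if z: "z \<in> closure \<Omega>" for z
  proof -
    obtain U e \<kappa> where U: "z \<in> U" "cone_patch U e \<kappa>" using patch[OF z] by blast
    then have "open U" by (simp add: cone_patch_def)
    then obtain b V C where b: "smooth b" "open V" "z \<in> V" "\<And>x. x \<in> V \<Longrightarrow> b x = (1::real)"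
      "compact C" "C \<subseteq> U" "\<And>x. x \<notin> C \<Longrightarrow> b x = 0"
      using exists_smooth_cutoff[OF _ U(1)] by metis
    have "smooth_approximable (\<lambda>x. b x * v x)" if "v \<in> H 1 \<Omega>" for v
      by (rule smooth_approximable_patch[OF U(2) b(1,5,6) _ that]) (simp add: supported_in_def b)
    with b show ?thesis by blast
  qed
  then obtain b V where bV: "\<And>z. z \<in> closure \<Omega> \<Longrightarrow> smooth (b z) \<and> open (V z) \<and> z \<in> V z \<and> (\<forall>x\<in>V z. b z x = (1::real)) \<and>
      (\<forall>v \<in> H 1 \<Omega>. smooth_approximable (\<lambda>x. b z x * v x))"
    by metis
  have "compact (closure \<Omega>)" using bounded_\<Omega> by (simp add: compact_closure)
  then obtain Z where Z: "finite Z" "Z \<subseteq> closure \<Omega>" "closure \<Omega> \<subseteq> (\<Union>z\<in>Z. V z)"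
    by (rule compactE_image[of _ "closure \<Omega>" V]) (use bV in auto)
  show ?thesis
  proof (rule smooth_approximable_induct[of "b ` Z"])
    show "smooth b'" if "b' \<in> b ` Z" for b' using that bV Z(2) by auto
    show "smooth_approximable (\<lambda>x. b' x * v x)" if "b' \<in> b ` Z" "v \<in> H 1 \<Omega>" for b' v
      using that bV Z(2) by auto
    let ?w = "\<lambda>x. (\<Prod>b\<in>b ` Z. 1 - b x) * v x"
    have sm: "smooth (\<lambda>x. \<Prod>b\<in>b ` Z. 1 - b x)"
      using bV Z(2) by (intro smooth_prod smooth_diff smooth_const) auto
    have w: "?w \<in> H 1 \<Omega>" by (intro H1_smooth_mult sm v)
    have 0: "?w x = 0" if "x \<in> \<Omega>" for x
    proof -
      have "x \<in> closure \<Omega>" using that closure_subset by auto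
      then obtain z where "z \<in> Z" "x \<in> V z" using Z(3) by auto
      with Z bV have "\<exists>b'\<in>b ` Z. 1 - b' x = 0" by force
      then have "(\<Prod>b\<in>b ` Z. 1 - b x) = 0" using Z(1) by (intro prod_zero) auto
      then show ?thesis by simp
    qed
    \<comment> \<open>\<open>?w\<close> vanishes on \<open>\<Omega>\<close> only, so it is not the
      zero function; that its norm vanishes follows from the invariance of weak derivatives under
      almost everywhere equality.\<close>
    have ae: "AE x in M. 0 = 0 - ?w x"
      using AE_space[of M] by eventually_elim (simp add: space_M 0)
    have m: "(\<lambda>x. 0 - ?w x) \<in> borel_measurable M" using L2_measurable[OF H1_L2[OF w]] by simp
    have "(H_norm 1 \<Omega> (\<lambda>x. 0 - ?w x))\<^sup>2 = (l2_norm M (\<lambda>x. 0 - ?w x))\<^sup>2 + (\<Sum>c\<in>(Basis::'a set). (l2_norm M (\<lambda>x. 0))\<^sup>2)"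
    proof (rule H1_norm_sq)
      show "(\<lambda>x. 0 - ?w x) \<in> L2 M" by (intro L2_diff L2_zero H1_L2 w)
      fix c :: 'a assume "c \<in> Basis"
      have "has_weak_deriv M [c] (\<lambda>x. 0) (\<lambda>x. 0)" by (simp add: has_weak_deriv_iff L2_zero l2_inner_def)
      from has_weak_deriv_cong[OF this _ ae L2_zero m, of "\<lambda>x. 0"] \<open>c \<in> Basis\<close>
      show "has_weak_deriv M [c] (\<lambda>x. 0 - ?w x) (\<lambda>x. 0)" by simp
    qed
    also have "l2_norm M (\<lambda>x. 0 - ?w x) = l2_norm M (\<lambda>x. 0)"
      by (rule l2_norm_cong_AE[OF _ m]) (use ae in auto)
    finally have "H_norm 1 \<Omega> (\<lambda>x. 0 - ?w x) = 0" by (simp add: l2_norm_zero)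
    then show "smooth_approximable ?w"
      unfolding smooth_approximable_def by (intro exI[of _ "\<lambda>n x. 0"]) (auto intro: smooth_const)
  qed (use Z v in auto)
qed

end

subsection \<open>Trace estimates near a boundary patch\<close>

lemma has_integral_inverse_sqrt: "((\<lambda>s. 1 / sqrt \<bar>s\<bar>) has_integral 2) {0..1::real}"
proof -
  have "((\<lambda>x. x powr (-1/2)) has_integral (1 powr (-1/2 + 1) / (-1/2 + 1))) {0..1::real}"
    by (rule has_integral_powr_from_0) auto
  then have *: "((\<lambda>x::real. x powr (-1/2)) has_integral 2) {0..1}" by simp
  show ?thesis
  proof (rule has_integral_spike[OF _ _ *, of "{0}"])
    fix x :: real assume "x \<in> {0..1} - {0}"
    then show "1 / sqrt \<bar>x\<bar> = x powr (-1/2)"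
      using powr_minus_divide[of x "1/2"] by (simp add: powr_half_sqrt)
  qed simp
qed

lemma nn_integral_has_integral_on:
  fixes f :: "'a::euclidean_space \<Rightarrow> real"
  assumes [measurable]: "f \<in> borel_measurable borel" "S \<in> sets borel"
    and f: "\<And>x. 0 \<le> f x" and I: "(f has_integral I) S"
  shows "(\<integral>\<^sup>+x. ennreal (indicator S x * f x) \<partial>lborel) = ennreal I"
proof (rule nn_integral_has_integral_lborel)
  have "(\<lambda>x. indicator S x * f x) = (\<lambda>x. if x \<in> S then f x else 0)" by (auto simp: indicator_def)
  then show "((\<lambda>x. indicator S x * f x) has_integral I) UNIV"
    using I by (simp only: has_integral_restrict_UNIV)
qed (auto simp: f)

lemma nn_integral_inverse_sqrt:
  "(\<integral>\<^sup>+s. indicator {0<..<1} s * ennreal (1 / sqrt s) \<partial>lborel) = 2"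
proof -
  have "(\<integral>\<^sup>+s. ennreal (indicator {0..1} s * (1 / sqrt \<bar>s\<bar>)) \<partial>lborel) = ennreal 2"
    by (rule nn_integral_has_integral_on[OF _ _ _ has_integral_inverse_sqrt]) auto
  moreover have "(\<integral>\<^sup>+s. indicator {0<..<1} s * ennreal (1 / sqrt s) \<partial>lborel)
      = (\<integral>\<^sup>+s. ennreal (indicator {0..1} s * (1 / sqrt \<bar>s\<bar>)) \<partial>lborel)"
    by (rule nn_integral_cong_AE, rule AE_mp[OF AE_lborel_singleton[of 1]])
       (auto intro!: AE_I2 simp: indicator_def)
  ultimately show ?thesis by simp
qed

text \<open>Cauchy--Schwarz with the weight \<open>sqrt s\<close>. Rescaling \<open>s w\<close> to \<open>w\<close> will cost a factor
  \<open>1 / s\<close>, which this weight makes integrable.\<close>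

lemma segment_increment_bound:
  fixes \<phi> :: "'a::euclidean_space \<Rightarrow> real"
  assumes \<phi>: "smooth \<phi>"
  shows "ennreal ((\<phi> (x + w) - \<phi> x)\<^sup>2) \<le> ennreal (2 * (norm w)\<^sup>2) *
    (\<integral>\<^sup>+s. indicator {0<..<1} s * ennreal (sqrt s * (\<Sum>b\<in>Basis. (dir_deriv b \<phi> (x + s *\<^sub>R w))\<^sup>2)) \<partial>lborel)"
proof -
  define g where "g s = (\<Sum>b\<in>Basis. (dir_deriv b \<phi> (x + s *\<^sub>R w))\<^sup>2)" for s :: real
  define F where "F s = (\<Sum>b\<in>Basis. (w \<bullet> b) * dir_deriv b \<phi> (x + s *\<^sub>R w))" for s :: real
  have cont: "continuous_on S (\<lambda>s. dir_deriv b \<phi> (x + s *\<^sub>R w))" if "b \<in> Basis" for b S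
    by (rule continuous_on_compose2[OF smooth_continuous_on[OF smooth_dir_deriv[OF \<phi> that], of UNIV]])
       (auto intro!: continuous_intros)
  have cg: "continuous_on S g" and cF: "continuous_on S F" for S
    unfolding g_def[abs_def] F_def[abs_def] by (intro continuous_intros cont; assumption)+
  have g0: "g s \<ge> 0" for s unfolding g_def by (intro sum_nonneg) auto
  have Fg: "(F s)\<^sup>2 \<le> (norm w)\<^sup>2 * g s" for s
  proof -
    have "(norm w)\<^sup>2 = (\<Sum>b\<in>Basis. (w \<bullet> b)\<^sup>2)"
      unfolding power2_norm_eq_inner by (subst euclidean_inner) (simp add: power2_eq_square)
    then show ?thesis unfolding F_def g_def using Cauchy_Schwarz_ineq_sum by metis
  qed
  have der: "((\<lambda>s. \<phi> (x + s *\<^sub>R w)) has_vector_derivative F s) (at s within {0..1})" for s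
  proof -
    have "((\<lambda>s. \<phi> (x + s *\<^sub>R w)) has_derivative (\<lambda>h. \<Sum>b\<in>Basis. ((h *\<^sub>R w) \<bullet> b) * dir_deriv b \<phi> (x + s *\<^sub>R w))) (at s within {0..1})"
      by (rule has_derivative_compose[OF _ smooth_has_derivative[OF \<phi>]]) (auto intro!: derivative_eq_intros)
    then show ?thesis by (simp add: has_vector_derivative_def F_def sum_distrib_left mult_ac)
  qed
  have "(F has_integral (\<phi> (x + 1 *\<^sub>R w) - \<phi> (x + 0 *\<^sub>R w))) {0..1}"
    by (rule fundamental_theorem_of_calculus) (auto intro: der)
  then have intF: "(F has_integral (\<phi> (x + w) - \<phi> x)) {0..1}" by simp
  define I where "I = integral {0..1} (\<lambda>s. sqrt s * (F s)\<^sup>2)"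
  have I: "((\<lambda>s. sqrt s * (F s)\<^sup>2) has_integral I) {0..1}"
    unfolding I_def by (intro integrable_integral integrable_continuous_interval continuous_intros cF)
  have X: "(\<phi> (x + w) - \<phi> x)\<^sup>2 \<le> 2 * I"
  proof (cases "\<phi> (x + w) = \<phi> x")
    case True
    have "I \<ge> 0" by (rule has_integral_nonneg[OF I]) auto
    with True show ?thesis by simp
  next
    case False
    define X where "X = \<bar>\<phi> (x + w) - \<phi> x\<bar>"
    have X: "X > 0" using False by (simp add: X_def)
    \<comment> \<open>Young's inequality with parameter \<open>c\<close> bounds the absolute value
      of \<open>F s\<close> by the integrand below. Integration gives
      \<open>X \<le> c + I / (2 * c)\<close>, and \<open>c = X / 2\<close> lets half of
      \<open>X\<close> be absorbed.\<close>
    define c where "c = X / 2"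
    have c: "c > 0" using X by (simp add: c_def)
    define \<sigma> where "\<sigma> = sgn (\<phi> (x + w) - \<phi> x)"
    have \<sigma>: "\<sigma> * (\<phi> (x + w) - \<phi> x) = X" by (simp add: \<sigma>_def X_def sgn_mult_self_eq abs_sgn mult.commute)
    have "\<bar>\<sigma>\<bar> \<le> 1" by (simp add: \<sigma>_def sgn_if)
    have 1: "((\<lambda>s. \<sigma> * F s) has_integral X) {0..1}"
      using has_integral_mult_right[OF intF, of \<sigma>] \<sigma> by simp
    have 2: "((\<lambda>s. c / 2 * (1 / sqrt \<bar>s\<bar>) + 1 / (2 * c) * (sqrt s * (F s)\<^sup>2)) has_integral (c / 2 * 2 + 1 / (2 * c) * I)) {0..1}"
      by (intro has_integral_add has_integral_mult_right has_integral_inverse_sqrt I)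
    \<comment> \<open>At \<open>s = 0\<close> the quotient \<open>1 / sqrt 0\<close> is 0 and the
      pointwise bound could fail, so the value there is replaced, which leaves the integral
      unchanged.\<close>
    have 3: "((\<lambda>s. if s = 0 then \<sigma> * F 0 else c / 2 * (1 / sqrt \<bar>s\<bar>) + 1 / (2 * c) * (sqrt s * (F s)\<^sup>2)) has_integral (c / 2 * 2 + 1 / (2 * c) * I)) {0..1}"
      by (rule has_integral_spike[OF _ _ 2, of "{0}"]) auto
    have "X \<le> c / 2 * 2 + 1 / (2 * c) * I"
    proof (rule has_integral_le[OF 1 3])
      fix s :: real assume s: "s \<in> {0..1}"
      show "\<sigma> * F s \<le> (if s = 0 then \<sigma> * F 0 else c / 2 * (1 / sqrt \<bar>s\<bar>) + 1 / (2 * c) * (sqrt s * (F s)\<^sup>2))"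
      proof (cases "s = 0")
        case False
        define r where "r = sqrt s"
        have r: "r > 0" using s False by (simp add: r_def)
        have "\<sigma> * F s \<le> \<bar>\<sigma>\<bar> * \<bar>F s\<bar>" by (simp flip: abs_mult)
        also have "\<dots> \<le> \<bar>F s\<bar>" using \<open>\<bar>\<sigma>\<bar> \<le> 1\<close> by (simp add: mult_left_le_one_le)
        also have "\<dots> \<le> c / 2 * (1 / r) + 1 / (2 * c) * (r * (F s)\<^sup>2)"
        proof -
          have "0 \<le> (c - r * \<bar>F s\<bar>)\<^sup>2 / (2 * c * r)" using c r by simp
          also have "\<dots> = c / 2 * (1 / r) + 1 / (2 * c) * (r * (F s)\<^sup>2) - \<bar>F s\<bar>"
            using c r by (simp add: power2_diff power_mult_distrib field_simps) (simp add: power2_eq_square)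
          finally show ?thesis by simp
        qed
        finally show ?thesis using False s by (simp add: r_def)
      qed simp
    qed
    also have "\<dots> = X / 2 + I / X" using X by (simp add: c_def)
    finally have "X / 2 \<le> I / X" by linarith
    then have "X * X \<le> 2 * I" using X by (simp add: field_simps)
    then show ?thesis by (simp add: X_def power2_eq_square flip: abs_mult)
  qed
  have J: "((\<lambda>s. sqrt \<bar>s\<bar> * g s) has_integral integral {0..1} (\<lambda>s. sqrt \<bar>s\<bar> * g s)) {0..1}"
    by (intro integrable_integral integrable_continuous_interval continuous_intros cg)
  have "I \<le> (norm w)\<^sup>2 * integral {0..1} (\<lambda>s. sqrt \<bar>s\<bar> * g s)"
  proof (rule has_integral_le[OF I has_integral_mult_right[OF J]])
    fix s :: real assume "s \<in> {0..1}"
    then show "sqrt s * (F s)\<^sup>2 \<le> (norm w)\<^sup>2 * (sqrt \<bar>s\<bar> * g s)"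
      using mult_left_mono[OF Fg[of s], of "sqrt s"] by (simp add: mult_ac)
  qed
  with X have "(\<phi> (x + w) - \<phi> x)\<^sup>2 \<le> 2 * (norm w)\<^sup>2 * integral {0..1} (\<lambda>s. sqrt \<bar>s\<bar> * g s)" by simp
  then have "ennreal ((\<phi> (x + w) - \<phi> x)\<^sup>2) \<le> ennreal (2 * (norm w)\<^sup>2) * ennreal (integral {0..1} (\<lambda>s. sqrt \<bar>s\<bar> * g s))"
    by (simp add: ennreal_mult'[symmetric] ennreal_leI)
  also have "ennreal (integral {0..1} (\<lambda>s. sqrt \<bar>s\<bar> * g s)) = (\<integral>\<^sup>+s. ennreal (indicator {0..1} s * (sqrt \<bar>s\<bar> * g s)) \<partial>lborel)"
    by (rule nn_integral_has_integral_on[OF _ _ _ J, symmetric])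
       (auto simp: g0 intro!: borel_measurable_continuous_onI continuous_intros cg)
  also have "\<dots> = (\<integral>\<^sup>+s. indicator {0<..<1} s * ennreal (sqrt s * g s) \<partial>lborel)"
    by (rule nn_integral_cong_AE, rule AE_mp[OF AE_lborel_singleton[of 1]])
       (auto intro!: AE_I2 simp: indicator_def)
  finally show ?thesis by (simp only: g_def)
qed

lemma power_quotient_1: "s > 0 \<Longrightarrow> n > 0 \<Longrightarrow> (1 / s) ^ n * s ^ (n - 1) = 1 / (s::real)"
  by (cases n) (auto simp: power_divide)

lemma power_quotient_2: "r > 0 \<Longrightarrow> n > 0 \<Longrightarrow> 1 / r ^ (n + 1) * (2 * r\<^sup>2) = 2 * (1 / (r::real) ^ (n - 1))"
  by (cases n) (auto simp: power2_eq_square)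

text \<open>\<open>\<psi>\<close> stands for the height above the boundary: at most a multiple of
  the distance to a point of \<open>P\<close>, and growing linearly along the cone with axis
  \<open>e\<close>. Together with the area bound \<open>ahlfors\<close> this replaces local
  coordinates. \<open>P_ball\<close> leaves room \<open>\<eta>\<close>, so that truncated cones at
  points of \<open>P\<close> do not leave \<open>U\<close>.\<close>

locale trace_patch = bounded_open \<Omega> for \<Omega> :: "'a::euclidean_space set" +
  fixes \<mu> :: "'a measure" and A :: real
    and U P :: "'a set" and \<psi> :: "'a \<Rightarrow> real" and e :: 'a and \<kappa> \<Lambda> \<eta> :: real
  assumes sets_\<mu> [measurable_cong, simp]: "sets \<mu> = sets borel"
    and finite_\<mu>: "finite_measure \<mu>"
    and ahlfors: "\<And>z r. r > 0 \<Longrightarrow> emeasure \<mu> (ball z r) \<le> ennreal (A * r ^ (DIM('a) - 1))"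
    and A_nonneg: "A \<ge> 0"
    and P [measurable]: "P \<in> sets borel"
    and lipschitz_\<psi>: "\<And>x y. \<bar>\<psi> x - \<psi> y\<bar> \<le> \<Lambda> * norm (x - y)" and \<Lambda>: "\<Lambda> > 0"
    and P_\<psi>: "\<And>x. x \<in> P \<Longrightarrow> \<psi> x = 0" and P_ball: "\<And>x. x \<in> P \<Longrightarrow> ball x \<eta> \<subseteq> U"
    and U_\<psi>: "\<And>x. x \<in> U \<Longrightarrow> \<psi> x > 0 \<Longrightarrow> x \<in> \<Omega>"
    and incr: "\<And>x \<tau> v. \<tau> > 0 \<Longrightarrow> v \<in> ball e \<kappa> \<Longrightarrow> \<psi> (x + \<tau> *\<^sub>R v) \<ge> \<psi> x + \<tau> / 2"
    and e: "norm e = 1" and \<kappa>: "0 < \<kappa>" "\<kappa> \<le> 1/2" and \<eta>: "\<eta> > 0"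
begin

sublocale mu: finite_measure \<mu> by (rule finite_\<mu>)

lemma pair_sigma_finite_mu: "pair_sigma_finite \<mu> lborel" "pair_sigma_finite \<mu> \<mu>"
  by (intro pair_sigma_finite.intro mu.sigma_finite_measure_axioms sigma_finite_lborel)+

text \<open>A union of dilated balls is open and scale invariant by construction, and each of its
  points has the form to which \<open>incr\<close> applies.\<close>

definition cone :: "'a set" where
  "cone = (\<Union>\<tau>\<in>{0<..}. ball (\<tau> *\<^sub>R e) (\<tau> * \<kappa>))"

lemma open_cone: "open cone"
  by (auto simp: cone_def)

lemma cone_scale: "w \<in> cone \<Longrightarrow> s > 0 \<Longrightarrow> s *\<^sub>R w \<in> cone"
proof -
  assume "w \<in> cone" and s: "s > 0"
  then obtain \<tau> where \<tau>: "\<tau> > 0" "norm (\<tau> *\<^sub>R e - w) < \<tau> * \<kappa>" by (auto simp: cone_def dist_norm)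
  have "norm ((s * \<tau>) *\<^sub>R e - s *\<^sub>R w) = s * norm (\<tau> *\<^sub>R e - w)"
    using s by (simp add: scaleR_scaleR[symmetric] scaleR_diff_right[symmetric] del: scaleR_scaleR)
  also have "\<dots> < s * \<tau> * \<kappa>" using \<tau> s by simp
  finally show ?thesis using s \<tau> by (auto simp: cone_def dist_norm intro!: bexI[of _ "s * \<tau>"])
qed

lemma cone_norm_pos: "w \<in> cone \<Longrightarrow> norm w > 0"
  and cone_\<psi>: "w \<in> cone \<Longrightarrow> \<psi> (x + w) \<ge> \<psi> x + norm w / 4"
proof -
  assume "w \<in> cone"
  then obtain \<tau> where \<tau>: "\<tau> > 0" "norm (\<tau> *\<^sub>R e - w) < \<tau> * \<kappa>" by (auto simp: cone_def dist_norm)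
  have n: "norm (\<tau> *\<^sub>R e) = \<tau>" using e \<tau> by simp
  have k: "\<tau> * \<kappa> \<le> \<tau> / 2" using \<kappa> \<tau> by simp
  have "\<tau> - norm w \<le> norm (\<tau> *\<^sub>R e - w)" using norm_triangle_ineq2[of "\<tau> *\<^sub>R e" w] n by simp
  with \<tau> k show "norm w > 0" by linarith
  \<comment> \<open>The bound \<open>norm w \<le> 2 * \<tau>\<close> turns the gain
    \<open>\<tau> / 2\<close> of \<open>incr\<close> into \<open>norm w / 4\<close>.\<close>
  have "norm w - \<tau> \<le> norm (\<tau> *\<^sub>R e - w)"
    using norm_triangle_ineq3[of w "\<tau> *\<^sub>R e"] n by (simp add: norm_minus_commute)
  then have nw: "norm w \<le> 2 * \<tau>" using \<tau> k by linarith
  have "\<tau> *\<^sub>R e - w = \<tau> *\<^sub>R (e - w /\<^sub>R \<tau>)" using \<tau>(1) by (simp add: scaleR_diff_right)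
  then have "\<tau> * norm (e - w /\<^sub>R \<tau>) < \<tau> * \<kappa>" using \<tau> by simp
  then have "norm (e - w /\<^sub>R \<tau>) < \<kappa>" using \<tau>(1) by simp
  then have "w /\<^sub>R \<tau> \<in> ball e \<kappa>" by (simp add: dist_norm)
  from incr[OF \<tau>(1) this, of x] have "\<psi> (x + w) \<ge> \<psi> x + \<tau> / 2" using \<tau> by simp
  with nw show "\<psi> (x + w) \<ge> \<psi> x + norm w / 4" by linarith
qed

definition cone0 :: "'a set" where "cone0 = cone \<inter> ball 0 \<eta>"

lemma cone0_borel [measurable]: "cone0 \<in> sets borel"
  using open_cone by (simp add: cone0_def)

text \<open>The degree \<open>1 - n\<close> balances the area growth of degree \<open>n - 1\<close>;
  hence the surface integral of the weight is bounded independently of the interior point.\<close>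

definition weight :: "'a \<Rightarrow> ennreal" where
  "weight w = indicator cone0 w * ennreal (1 / norm w ^ (DIM('a) - 1))"

lemma weight_borel [measurable]: "weight \<in> borel_measurable borel"
  unfolding weight_def[abs_def] by measurable

text \<open>Product of the bound \<open>(\<Lambda> / R) ^ (n - 1)\<close> for the weight and the
  area bound \<open>A * (5 * R) ^ (n - 1)\<close>; the height \<open>R\<close> cancels. The factor 5
  puts points at distance at most \<open>4 * R\<close> strictly inside a ball.\<close>

definition C1 :: real where "C1 = A * (5 * \<Lambda>) ^ (DIM('a) - 1)"

lemma C1_nonneg: "C1 \<ge> 0"
  using A_nonneg \<Lambda> by (simp add: C1_def)

lemma cone0_inside: "x \<in> P \<Longrightarrow> w \<in> cone0 \<Longrightarrow> x + w \<in> \<Omega>"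
proof -
  assume x: "x \<in> P" and w: "w \<in> cone0"
  have c: "w \<in> cone" using w by (simp add: cone0_def)
  have "0 < \<psi> (x + w)" using cone_\<psi>[OF c, of x] cone_norm_pos[OF c] P_\<psi>[OF x] by linarith
  moreover have "x + w \<in> U" using P_ball[OF x] w by (auto simp: cone0_def dist_norm)
  ultimately show ?thesis by (intro U_\<psi>)
qed

text \<open>If \<open>z\<close> lies in the cone at \<open>x\<close>, then \<open>norm (z - x)\<close> is comparable to \<open>\<psi> z\<close>; hence the
  weight is at most a multiple of \<open>\<psi> z\<close> to the power \<open>1 - n\<close> on a ball of radius comparable to \<open>\<psi> z\<close>.\<close>

lemma weight_surface_bound:
  "(\<integral>\<^sup>+x. indicator P x * weight (z - x) \<partial>\<mu>) \<le> ennreal C1 * indicator \<Omega> z"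
proof -
  define R where "R = \<psi> z"
  have pt: "indicator P x * weight (z - x) \<le> indicator (ball z (5 * R)) x * ennreal ((\<Lambda> / R) ^ (DIM('a) - 1))
    \<and> R > 0 \<and> z \<in> \<Omega>" if nz: "indicator P x * weight (z - x) \<noteq> 0" for x
  proof -
    from nz have x: "x \<in> P" and w: "z - x \<in> cone0" by (auto simp: weight_def indicator_def split: if_splits)
    have c: "z - x \<in> cone" using w by (simp add: cone0_def)
    have lo: "norm (z - x) / 4 \<le> R" using cone_\<psi>[OF c, of x] P_\<psi>[OF x] by (simp add: R_def)
    have hi: "R \<le> \<Lambda> * norm (z - x)" using lipschitz_\<psi>[of z x] P_\<psi>[OF x] by (simp add: R_def)
    have pos: "norm (z - x) > 0" by (rule cone_norm_pos[OF c])
    have R: "R > 0" using lo pos by linarith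
    have "x \<in> ball z (5 * R)" using lo R by (simp add: dist_norm)
    moreover have "1 / norm (z - x) \<le> \<Lambda> / R" using hi pos R by (simp add: field_simps)
    then have "1 / norm (z - x) ^ (DIM('a) - 1) \<le> (\<Lambda> / R) ^ (DIM('a) - 1)"
      using power_mono[of "1 / norm (z - x)" "\<Lambda> / R" "DIM('a) - 1"] by (simp add: power_divide)
    moreover have "z \<in> \<Omega>" using cone0_inside[OF x w] by simp
    ultimately show ?thesis using x w R by (auto simp: weight_def intro!: ennreal_leI)
  qed
  show ?thesis
  proof (cases "R > 0 \<and> z \<in> \<Omega>")
    case True
    have "(\<integral>\<^sup>+x. indicator P x * weight (z - x) \<partial>\<mu>)
      \<le> (\<integral>\<^sup>+x. ennreal ((\<Lambda> / R) ^ (DIM('a) - 1)) * indicator (ball z (5 * R)) x \<partial>\<mu>)"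
      by (intro nn_integral_mono) (metis pt mult.commute zero_le)
    also have "\<dots> = ennreal ((\<Lambda> / R) ^ (DIM('a) - 1)) * emeasure \<mu> (ball z (5 * R))"
      by (simp add: nn_integral_cmult_indicator sets_\<mu>)
    also have "\<dots> \<le> ennreal ((\<Lambda> / R) ^ (DIM('a) - 1)) * ennreal (A * (5 * R) ^ (DIM('a) - 1))"
      using True by (intro mult_left_mono ahlfors) auto
    also have "\<dots> = ennreal C1"
      using True \<Lambda> A_nonneg by (simp add: C1_def power_mult_distrib power_divide field_simps flip: ennreal_mult)
    finally show ?thesis using True by simp
  next
    case False
    have "(\<lambda>x. indicator P x * weight (z - x)) = (\<lambda>x. 0)" using pt False by blast
    then show ?thesis by (simp only:) simp
  qed
qed

text \<open>Substituting \<open>z = x + w\<close> and exchanging the integrals leaves the surface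
  integral of the weight, which is uniformly bounded. A quantity on the boundary is thus controlled
  by a volume integral over \<open>\<Omega>\<close>.\<close>

lemma cone_average_le:
  assumes [measurable]: "G \<in> borel_measurable borel"
  shows "(\<integral>\<^sup>+x. indicator P x * (\<integral>\<^sup>+w. weight w * G (x + w) \<partial>lborel) \<partial>\<mu>)
    \<le> ennreal C1 * (\<integral>\<^sup>+z. indicator \<Omega> z * G z \<partial>lborel)"
proof -
  interpret pair_sigma_finite \<mu> lborel by (rule pair_sigma_finite_mu)
  have "(\<integral>\<^sup>+x. indicator P x * (\<integral>\<^sup>+w. weight w * G (x + w) \<partial>lborel) \<partial>\<mu>)
    = (\<integral>\<^sup>+x. \<integral>\<^sup>+z. indicator P x * weight (z - x) * G z \<partial>lborel \<partial>\<mu>)"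
  proof (intro nn_integral_cong)
    fix x
    have "(\<integral>\<^sup>+w. weight w * G (x + w) \<partial>lborel) = (\<integral>\<^sup>+z. weight (z - x) * G z \<partial>lborel)"
      using nn_integral_lborel_translate[of "\<lambda>z. weight (z - x) * G z" x] by (simp add: add.commute)
    then show "indicator P x * (\<integral>\<^sup>+w. weight w * G (x + w) \<partial>lborel) = (\<integral>\<^sup>+z. indicator P x * weight (z - x) * G z \<partial>lborel)"
      by (simp add: nn_integral_cmult mult.assoc)
  qed
  also have "\<dots> = (\<integral>\<^sup>+z. \<integral>\<^sup>+x. indicator P x * weight (z - x) * G z \<partial>\<mu> \<partial>lborel)"
    by (rule Fubini'[symmetric]) measurable
  also have "\<dots> = (\<integral>\<^sup>+z. (\<integral>\<^sup>+x. indicator P x * weight (z - x) \<partial>\<mu>) * G z \<partial>lborel)"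
    by (intro nn_integral_cong nn_integral_multc) measurable
  also have "\<dots> \<le> (\<integral>\<^sup>+z. ennreal C1 * (indicator \<Omega> z * G z) \<partial>lborel)"
    unfolding mult.assoc[symmetric] by (intro nn_integral_mono mult_right_mono weight_surface_bound) simp
  also have "\<dots> = ennreal C1 * (\<integral>\<^sup>+z. indicator \<Omega> z * G z \<partial>lborel)"
    by (intro nn_integral_cmult) measurable
  finally show ?thesis .
qed

abbreviation grad_sq :: "('a \<Rightarrow> real) \<Rightarrow> 'a \<Rightarrow> real" where
  "grad_sq \<phi> x \<equiv> (\<Sum>b\<in>Basis. (dir_deriv b \<phi> x)\<^sup>2)"

lemma grad_sq_borel: "smooth \<phi> \<Longrightarrow> grad_sq \<phi> \<in> borel_measurable borel"
  by (intro borel_measurable_sum borel_measurable_power smooth_borel smooth_dir_deriv)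

text \<open>The bridge to both trace estimates: differences between boundary points and points of
  their cones. The exponent is chosen so that the factor \<open>(norm w)^2\<close> gained along a
  segment leaves exactly \<open>weight\<close>.\<close>

definition increments :: "('a \<Rightarrow> real) \<Rightarrow> ennreal" where
  "increments \<phi> = (\<integral>\<^sup>+x. indicator P x *
     (\<integral>\<^sup>+w. indicator cone0 w * ennreal ((\<phi> (x + w) - \<phi> x)\<^sup>2 / norm w ^ (DIM('a) + 1)) \<partial>lborel) \<partial>\<mu>)"

text \<open>The substitution contributes \<open>s\<close> to the power \<open>- n\<close>, the
  homogeneity of the weight \<open>s\<close> to the power \<open>n - 1\<close>, and shrinking by
  \<open>s < 1\<close> stays in the truncated cone. The net cost is \<open>1 / s\<close>.\<close>

lemma weight_rescaled:
  assumes [measurable]: "G \<in> borel_measurable borel" and s: "0 < s" "s < 1"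
  shows "(\<integral>\<^sup>+w. weight w * G (x + s *\<^sub>R w) \<partial>lborel) \<le> ennreal (1 / s) * (\<integral>\<^sup>+w. weight w * G (x + w) \<partial>lborel)"
proof -
  have "(\<integral>\<^sup>+w. weight w * G (x + s *\<^sub>R w) \<partial>lborel)
     = ennreal ((1 / s) ^ DIM('a)) * (\<integral>\<^sup>+w. weight ((1 / s) *\<^sub>R w) * G (x + w) \<partial>lborel)"
    using nn_integral_lborel_affine[of "\<lambda>w. weight w * G (x + s *\<^sub>R w)" "1 / s" 0] s by simp
  also have "\<dots> \<le> ennreal ((1 / s) ^ DIM('a)) * (\<integral>\<^sup>+w. ennreal (s ^ (DIM('a) - 1)) * (weight w * G (x + w)) \<partial>lborel)"
  proof (intro mult_left_mono nn_integral_mono)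
    fix w
    have "weight ((1 / s) *\<^sub>R w) \<le> ennreal (s ^ (DIM('a) - 1)) * weight w"
    proof (cases "(1 / s) *\<^sub>R w \<in> cone0")
      case True
      then have "(1 / s) *\<^sub>R w \<in> cone" by (simp add: cone0_def)
      from cone_scale[OF this s(1)] have "s *\<^sub>R ((1 / s) *\<^sub>R w) \<in> cone" .
      then have "w \<in> cone" using s by simp
      moreover have "norm w < s * \<eta>" using True s by (auto simp: cone0_def field_simps)
      moreover have "s * \<eta> \<le> \<eta>" using s \<eta> by simp
      ultimately have "w \<in> cone0" using s by (simp add: cone0_def)
      then show ?thesis using True s
        by (simp add: weight_def power_divide flip: ennreal_mult)
    qed (simp add: weight_def)
    then show "weight ((1 / s) *\<^sub>R w) * G (x + w) \<le> ennreal (s ^ (DIM('a) - 1)) * (weight w * G (x + w))"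
      by (simp add: mult_right_mono mult.assoc[symmetric])
  qed simp
  also have "\<dots> = ennreal ((1 / s) ^ DIM('a)) * ennreal (s ^ (DIM('a) - 1)) * (\<integral>\<^sup>+w. weight w * G (x + w) \<partial>lborel)"
    by (subst nn_integral_cmult) (auto simp: mult.assoc)
  also have "ennreal ((1 / s) ^ DIM('a)) * ennreal (s ^ (DIM('a) - 1)) = ennreal (1 / s)"
    using s power_quotient_1[of s "DIM('a)"] by (simp only: ennreal_mult[symmetric] zero_le_power zero_le_divide_1_iff less_imp_le DIM_positive)
  finally show ?thesis .
qed

text \<open>A Hardy-type estimate: bound the increment along the segment, exchange the integrals and
  rescale for each \<open>s\<close>. The constant 4 is the 2 of the segment bound times the integral
  2 of \<open>1 / sqrt s\<close>.\<close>

lemma increments_le: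
  assumes \<phi>: "smooth \<phi>"
  shows "increments \<phi> \<le> ennreal (4 * C1) * (\<integral>\<^sup>+z. indicator \<Omega> z * ennreal (grad_sq \<phi> z) \<partial>lborel)"
proof -
  have [measurable]: "\<phi> \<in> borel_measurable borel" "grad_sq \<phi> \<in> borel_measurable borel"
    by (intro smooth_borel grad_sq_borel \<phi>)+
  have g0: "grad_sq \<phi> x \<ge> 0" for x by (intro sum_nonneg) auto
  have inner: "(\<integral>\<^sup>+w. indicator cone0 w * ennreal ((\<phi> (x + w) - \<phi> x)\<^sup>2 / norm w ^ (DIM('a) + 1)) \<partial>lborel)
    \<le> 4 * (\<integral>\<^sup>+w. weight w * ennreal (grad_sq \<phi> (x + w)) \<partial>lborel)" for x
  proof -
    have "indicator cone0 w * ennreal ((\<phi> (x + w) - \<phi> x)\<^sup>2 / norm w ^ (DIM('a) + 1))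
       \<le> (\<integral>\<^sup>+s. 2 * (indicator {0<..<1} s * ennreal (sqrt s)) * (weight w * ennreal (grad_sq \<phi> (x + s *\<^sub>R w))) \<partial>lborel)" for w
    proof (cases "w \<in> cone0")
      case True
      then have pos: "norm w > 0" using cone_norm_pos[of w] by (simp add: cone0_def)
      have "ennreal ((\<phi> (x + w) - \<phi> x)\<^sup>2 / norm w ^ (DIM('a) + 1))
        = ennreal (1 / norm w ^ (DIM('a) + 1)) * ennreal ((\<phi> (x + w) - \<phi> x)\<^sup>2)"
        by (simp flip: ennreal_mult)
      also have "\<dots> \<le> ennreal (1 / norm w ^ (DIM('a) + 1)) * (ennreal (2 * (norm w)\<^sup>2) *
        (\<integral>\<^sup>+s. indicator {0<..<1} s * ennreal (sqrt s * grad_sq \<phi> (x + s *\<^sub>R w)) \<partial>lborel))"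
        by (intro mult_left_mono segment_increment_bound \<phi>) simp
      also have "\<dots> = (2 * weight w) *
        (\<integral>\<^sup>+s. indicator {0<..<1} s * ennreal (sqrt s * grad_sq \<phi> (x + s *\<^sub>R w)) \<partial>lborel)"
      proof -
        have "1 / norm w ^ (DIM('a) + 1) * (2 * (norm w)\<^sup>2) = 2 * (1 / norm w ^ (DIM('a) - 1))"
          by (rule power_quotient_2[OF pos DIM_positive])
        then have "ennreal (1 / norm w ^ (DIM('a) + 1)) * ennreal (2 * (norm w)\<^sup>2)
            = ennreal (2 * (1 / norm w ^ (DIM('a) - 1)))"
          by (subst ennreal_mult[symmetric]) simp_all
        also have "\<dots> = ennreal 2 * ennreal (1 / norm w ^ (DIM('a) - 1))"
          by (rule ennreal_mult) simp_all
        also have "\<dots> = 2 * weight w" using True by (simp add: weight_def)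
        finally have "ennreal (1 / norm w ^ (DIM('a) + 1)) * ennreal (2 * (norm w)\<^sup>2) = 2 * weight w" .
        then show ?thesis by (simp add: mult.assoc[symmetric])
      qed
      also have "\<dots> = (\<integral>\<^sup>+s. (2 * weight w) * (indicator {0<..<1} s * ennreal (sqrt s * grad_sq \<phi> (x + s *\<^sub>R w))) \<partial>lborel)"
        by (subst nn_integral_cmult) auto
      also have "\<dots> = (\<integral>\<^sup>+s. 2 * (indicator {0<..<1} s * ennreal (sqrt s)) * (weight w * ennreal (grad_sq \<phi> (x + s *\<^sub>R w))) \<partial>lborel)"
      proof (intro nn_integral_cong)
        fix s :: real
        show "(2 * weight w) * (indicator {0<..<1} s * ennreal (sqrt s * grad_sq \<phi> (x + s *\<^sub>R w)))
          = 2 * (indicator {0<..<1} s * ennreal (sqrt s)) * (weight w * ennreal (grad_sq \<phi> (x + s *\<^sub>R w)))"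
          by (cases "s \<in> {0<..<1}") (simp_all add: ennreal_mult g0 mult_ac)
      qed
      finally show ?thesis using True by simp
    qed simp
    then have "(\<integral>\<^sup>+w. indicator cone0 w * ennreal ((\<phi> (x + w) - \<phi> x)\<^sup>2 / norm w ^ (DIM('a) + 1)) \<partial>lborel)
      \<le> (\<integral>\<^sup>+w. \<integral>\<^sup>+s. 2 * (indicator {0<..<1} s * ennreal (sqrt s)) * (weight w * ennreal (grad_sq \<phi> (x + s *\<^sub>R w))) \<partial>lborel \<partial>lborel)"
      by (intro nn_integral_mono)
    also have "\<dots> = (\<integral>\<^sup>+s. \<integral>\<^sup>+w. 2 * (indicator {0<..<1} s * ennreal (sqrt s)) * (weight w * ennreal (grad_sq \<phi> (x + s *\<^sub>R w))) \<partial>lborel \<partial>lborel)"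
      by (rule lborel_pair.Fubini'[symmetric]) measurable
    also have "\<dots> = (\<integral>\<^sup>+s. 2 * (indicator {0<..<1} s * ennreal (sqrt s)) * (\<integral>\<^sup>+w. weight w * ennreal (grad_sq \<phi> (x + s *\<^sub>R w)) \<partial>lborel) \<partial>lborel)"
      by (intro nn_integral_cong nn_integral_cmult) measurable
    also have "\<dots> \<le> (\<integral>\<^sup>+s. 2 * (indicator {0<..<1} s * ennreal (1 / sqrt s)) * (\<integral>\<^sup>+w. weight w * ennreal (grad_sq \<phi> (x + w)) \<partial>lborel) \<partial>lborel)"
    proof (intro nn_integral_mono)
      fix s :: real
      show "2 * (indicator {0<..<1} s * ennreal (sqrt s)) * (\<integral>\<^sup>+w. weight w * ennreal (grad_sq \<phi> (x + s *\<^sub>R w)) \<partial>lborel)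
        \<le> 2 * (indicator {0<..<1} s * ennreal (1 / sqrt s)) * (\<integral>\<^sup>+w. weight w * ennreal (grad_sq \<phi> (x + w)) \<partial>lborel)"
      proof (cases "s \<in> {0<..<1}")
        case True
        have "ennreal (sqrt s) * (\<integral>\<^sup>+w. weight w * ennreal (grad_sq \<phi> (x + s *\<^sub>R w)) \<partial>lborel)
          \<le> ennreal (sqrt s) * (ennreal (1 / s) * (\<integral>\<^sup>+w. weight w * ennreal (grad_sq \<phi> (x + w)) \<partial>lborel))"
          using True by (intro mult_left_mono weight_rescaled) auto
        also have "\<dots> = ennreal (1 / sqrt s) * (\<integral>\<^sup>+w. weight w * ennreal (grad_sq \<phi> (x + w)) \<partial>lborel)"
        proof -
          have "sqrt s * (1 / s) = 1 / sqrt s"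
            using True by (simp add: field_simps flip: real_sqrt_mult)
          then show ?thesis using True by (simp add: mult.assoc[symmetric] flip: ennreal_mult)
        qed
        finally show ?thesis using True by (simp add: mult.assoc mult_left_mono)
      qed simp
    qed
    also have "\<dots> = 2 * (\<integral>\<^sup>+s. indicator {0<..<1} s * ennreal (1 / sqrt s) \<partial>lborel) * (\<integral>\<^sup>+w. weight w * ennreal (grad_sq \<phi> (x + w)) \<partial>lborel)"
      by (subst nn_integral_multc) (auto simp: nn_integral_cmult)
    finally show ?thesis by (simp add: nn_integral_inverse_sqrt)
  qed
  have "increments \<phi> \<le> (\<integral>\<^sup>+x. 4 * (indicator P x * (\<integral>\<^sup>+w. weight w * ennreal (grad_sq \<phi> (x + w)) \<partial>lborel)) \<partial>\<mu>)"
    unfolding increments_def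
  proof (intro nn_integral_mono)
    fix x
    show "indicator P x * (\<integral>\<^sup>+w. indicator cone0 w * ennreal ((\<phi> (x + w) - \<phi> x)\<^sup>2 / norm w ^ (DIM('a) + 1)) \<partial>lborel)
      \<le> 4 * (indicator P x * (\<integral>\<^sup>+w. weight w * ennreal (grad_sq \<phi> (x + w)) \<partial>lborel))"
      using inner[of x] by (cases "x \<in> P") auto
  qed
  also have "\<dots> = 4 * (\<integral>\<^sup>+x. indicator P x * (\<integral>\<^sup>+w. weight w * ennreal (grad_sq \<phi> (x + w)) \<partial>lborel) \<partial>\<mu>)"
    by (intro nn_integral_cmult) measurable
  also have "\<dots> \<le> 4 * (ennreal C1 * (\<integral>\<^sup>+z. indicator \<Omega> z * ennreal (grad_sq \<phi> z) \<partial>lborel))"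
    by (intro mult_left_mono cone_average_le) auto
  also have "\<dots> = ennreal (4 * C1) * (\<integral>\<^sup>+z. indicator \<Omega> z * ennreal (grad_sq \<phi> z) \<partial>lborel)"
    using C1_nonneg by (simp add: ennreal_mult mult.assoc)
  finally show ?thesis .
qed

end

lemma sq_add_le: "(a + b)\<^sup>2 \<le> 2 * a\<^sup>2 + 2 * (b::real)\<^sup>2"
  using sum_squares_bound[of a b] by (simp add: power2_sum)

lemma sq_diff_le: "(a - b)\<^sup>2 \<le> 2 * a\<^sup>2 + 2 * (b::real)\<^sup>2"
  using sq_add_le[of a "-b"] by simp

lemma ennreal_double: "ennreal (2 * a) = 2 * ennreal a"
  by (simp add: ennreal_mult')

lemma ennreal_cancel_pos:
  assumes "ennreal c * X \<le> Y" "c > 0"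
  shows "X \<le> ennreal (1 / c) * Y"
proof -
  have "X = ennreal (1 / c) * (ennreal c * X)"
    using assms(2) by (simp add: mult.assoc[symmetric] flip: ennreal_mult)
  also have "\<dots> \<le> ennreal (1 / c) * Y" by (intro mult_left_mono assms) simp
  finally show ?thesis .
qed

text \<open>The squared H1 norm of a smooth function by classical derivatives, as an extended real
  so that no integrability has to be carried along.\<close>

definition (in bounded_open) energy :: "('a \<Rightarrow> real) \<Rightarrow> ennreal" where
  "energy \<phi> = (\<integral>\<^sup>+z. indicator \<Omega> z * ennreal ((\<phi> z)\<^sup>2 + (\<Sum>b\<in>Basis. (dir_deriv b \<phi> z)\<^sup>2)) \<partial>lborel)"

context trace_patch
begin

section \<open>Trace bounds on a single patch\<close>

lemma grad_sq_nonneg: "grad_sq \<phi> x \<ge> 0"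
  by (intro sum_nonneg) auto

lemma energy_ge:
  shows "(\<integral>\<^sup>+z. indicator \<Omega> z * ennreal ((\<phi> z)\<^sup>2) \<partial>lborel) \<le> energy \<phi>"
    and "(\<integral>\<^sup>+z. indicator \<Omega> z * ennreal (grad_sq \<phi> z) \<partial>lborel) \<le> energy \<phi>"
  unfolding energy_def by (intro nn_integral_mono mult_left_mono ennreal_leI; simp add: grad_sq_nonneg)+

lemma increments_energy: "smooth \<phi> \<Longrightarrow> increments \<phi> \<le> ennreal (4 * C1) * energy \<phi>"
  by (rule order_trans[OF increments_le]) (auto intro!: mult_left_mono energy_ge)

text \<open>Averaging over the cone divides by the total weight; a positive real lower bound makes
  this possible whether or not the integral is finite.\<close>

lemma cone_mass:
  obtains c where "c > 0" "ennreal c \<le> (\<integral>\<^sup>+w. weight w \<partial>lborel)"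
proof -
  let ?I = "\<integral>\<^sup>+w. weight w \<partial>lborel"
  have "?I \<noteq> 0"
  proof
    assume "?I = 0"
    then have ae: "AE w in lborel. weight w = 0" by (subst (asm) nn_integral_0_iff_AE) auto
    \<comment> \<open>The ball around \<open>\<tau> *\<^sub>R e\<close> of radius
      \<open>\<tau> * \<kappa>\<close> lies in the cone and, as \<open>\<kappa> \<le> 1/2\<close>,
      within norm \<open>2 * \<tau> < \<eta>\<close>; so the weight is nonzero on a set of positive
      measure.\<close>
    define \<tau> where "\<tau> = \<eta> / 4"
    have \<tau>: "\<tau> > 0" using \<eta> by (simp add: \<tau>_def)
    have sub: "weight w \<noteq> 0" if w: "w \<in> ball (\<tau> *\<^sub>R e) (\<tau> * \<kappa>)" for w
    proof -
      have c: "w \<in> cone" using \<tau> w by (auto simp: cone_def)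
      have "norm w \<le> norm (\<tau> *\<^sub>R e) + norm (\<tau> *\<^sub>R e - w)" using norm_triangle_sub[of w "\<tau> *\<^sub>R e"] by (simp add: norm_minus_commute)
      moreover have "norm (\<tau> *\<^sub>R e - w) < \<tau> * \<kappa>" using w by (simp add: dist_norm)
      moreover have "\<tau> * \<kappa> \<le> \<tau> / 2" using \<kappa> \<tau> by simp
      moreover have "norm (\<tau> *\<^sub>R e) = \<tau>" using e \<tau> by simp
      ultimately have "norm w < 2 * \<tau>" using \<tau> by linarith
      then have "norm w < \<eta>" using \<eta> by (simp add: \<tau>_def)
      with c cone_norm_pos[OF c] show ?thesis by (simp add: weight_def cone0_def)
    qed
    have "AE w in lborel. w \<notin> ball (\<tau> *\<^sub>R e) (\<tau> * \<kappa>)" using ae by eventually_elim (use sub in blast)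
    then have "emeasure lborel (ball (\<tau> *\<^sub>R e) (\<tau> * \<kappa>)) = 0"
      by (subst (asm) AE_iff_measurable[OF _ refl]) (auto simp: ball_def)
    moreover have "measure lborel (ball (\<tau> *\<^sub>R e) (\<tau> * \<kappa>)) > 0" using \<tau> \<kappa> by (intro content_ball_pos) simp
    ultimately show False by (simp add: measure_def)
  qed
  then show ?thesis
  proof (cases ?I)
    case (real r)
    with \<open>?I \<noteq> 0\<close> show ?thesis by (intro that[of r]) auto
  next
    case top
    then show ?thesis by (intro that[of 1]) auto
  qed
qed

text \<open>The boundary value is \<open>\<phi> (x + w)\<close> minus an increment; this is averaged
  over \<open>w\<close> with the weight. The interior values give the summand \<open>2 * C1\<close>
  of \<open>K\<close>; the increments, with \<open>norm w < \<eta>\<close>, give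
  \<open>2 * \<eta>^2\<close> times \<open>4 * C1\<close>.\<close>

lemma trace_L2_patch:
  obtains C where "C \<ge> 0"
    "\<And>\<phi>. smooth \<phi> \<Longrightarrow> (\<integral>\<^sup>+x. indicator P x * ennreal ((\<phi> x)\<^sup>2) \<partial>\<mu>) \<le> ennreal C * energy \<phi>"
proof -
  obtain c where c: "c > 0" "ennreal c \<le> (\<integral>\<^sup>+w. weight w \<partial>lborel)" by (rule cone_mass)
  define K where "K = 2 * C1 + 8 * \<eta>\<^sup>2 * C1"
  have K: "K \<ge> 0" using C1_nonneg by (simp add: K_def)
  show ?thesis
  proof (rule that[of "1 / c * K"])
    show "1 / c * K \<ge> 0" using c K by simp
    fix \<phi> :: "'a \<Rightarrow> real" assume \<phi>: "smooth \<phi>"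
    have [measurable]: "\<phi> \<in> borel_measurable borel" by (rule smooth_borel[OF \<phi>])
    let ?inc = "\<lambda>x w. indicator cone0 w * ennreal ((\<phi> (x + w) - \<phi> x)\<^sup>2 / norm w ^ (DIM('a) + 1))"
    have pt: "weight w * ennreal ((\<phi> x)\<^sup>2) \<le> 2 * (weight w * ennreal ((\<phi> (x + w))\<^sup>2)) + ennreal (2 * \<eta>\<^sup>2) * ?inc x w" for x w
    proof (cases "w \<in> cone0")
      case True
      then have nw: "norm w > 0" "norm w < \<eta>" using cone_norm_pos by (auto simp: cone0_def)
      have p2: "(norm w)\<^sup>2 * (1 / norm w ^ (DIM('a) + 1)) = 1 / norm w ^ (DIM('a) - 1)"
        using power_quotient_2[OF nw(1), of "DIM('a)"] by simp
      have "1 / norm w ^ (DIM('a) - 1) * (\<phi> (x + w) - \<phi> x)\<^sup>2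
         = (norm w)\<^sup>2 * ((\<phi> (x + w) - \<phi> x)\<^sup>2 / norm w ^ (DIM('a) + 1))"
        unfolding p2[symmetric] by simp
      also have "\<dots> \<le> \<eta>\<^sup>2 * ((\<phi> (x + w) - \<phi> x)\<^sup>2 / norm w ^ (DIM('a) + 1))"
        using nw by (intro mult_right_mono power_mono) auto
      finally have 1: "1 / norm w ^ (DIM('a) - 1) * (\<phi> (x + w) - \<phi> x)\<^sup>2 \<le> \<eta>\<^sup>2 * ((\<phi> (x + w) - \<phi> x)\<^sup>2 / norm w ^ (DIM('a) + 1))" .
      have "1 / norm w ^ (DIM('a) - 1) * (\<phi> x)\<^sup>2
        \<le> 1 / norm w ^ (DIM('a) - 1) * (2 * (\<phi> (x + w))\<^sup>2 + 2 * (\<phi> (x + w) - \<phi> x)\<^sup>2)"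
        using sq_diff_le[of "\<phi> (x + w)" "\<phi> (x + w) - \<phi> x"] nw by (intro mult_left_mono) auto
      also have "\<dots> \<le> 2 * (1 / norm w ^ (DIM('a) - 1) * (\<phi> (x + w))\<^sup>2) + 2 * \<eta>\<^sup>2 * ((\<phi> (x + w) - \<phi> x)\<^sup>2 / norm w ^ (DIM('a) + 1))"
        using 1 unfolding distrib_left by linarith
      finally have le: "1 / norm w ^ (DIM('a) - 1) * (\<phi> x)\<^sup>2
        \<le> 2 * (1 / norm w ^ (DIM('a) - 1) * (\<phi> (x + w))\<^sup>2) + 2 * \<eta>\<^sup>2 * ((\<phi> (x + w) - \<phi> x)\<^sup>2 / norm w ^ (DIM('a) + 1))" .
      have "weight w * ennreal ((\<phi> x)\<^sup>2) = ennreal (1 / norm w ^ (DIM('a) - 1) * (\<phi> x)\<^sup>2)"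
        using True by (simp add: weight_def ennreal_mult[symmetric])
      also have "\<dots> \<le> ennreal (2 * (1 / norm w ^ (DIM('a) - 1) * (\<phi> (x + w))\<^sup>2) + 2 * \<eta>\<^sup>2 * ((\<phi> (x + w) - \<phi> x)\<^sup>2 / norm w ^ (DIM('a) + 1)))"
        by (rule ennreal_leI[OF le])
      also have "\<dots> = ennreal (2 * (1 / norm w ^ (DIM('a) - 1) * (\<phi> (x + w))\<^sup>2)) + ennreal (2 * \<eta>\<^sup>2 * ((\<phi> (x + w) - \<phi> x)\<^sup>2 / norm w ^ (DIM('a) + 1)))"
        by (rule ennreal_plus) auto
      also have "ennreal (2 * (1 / norm w ^ (DIM('a) - 1) * (\<phi> (x + w))\<^sup>2)) = 2 * (weight w * ennreal ((\<phi> (x + w))\<^sup>2))"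
      proof -
        have "ennreal (1 / norm w ^ (DIM('a) - 1) * (\<phi> (x + w))\<^sup>2)
          = ennreal (1 / norm w ^ (DIM('a) - 1)) * ennreal ((\<phi> (x + w))\<^sup>2)"
          by (rule ennreal_mult) simp_all
        then show ?thesis using True unfolding ennreal_double by (simp add: weight_def)
      qed
      also have "ennreal (2 * \<eta>\<^sup>2 * ((\<phi> (x + w) - \<phi> x)\<^sup>2 / norm w ^ (DIM('a) + 1))) = ennreal (2 * \<eta>\<^sup>2) * ?inc x w"
        using True by (subst ennreal_mult) simp_all
      finally show ?thesis .
    qed (simp add: weight_def)
    have "ennreal c * (\<integral>\<^sup>+x. indicator P x * ennreal ((\<phi> x)\<^sup>2) \<partial>\<mu>)
      \<le> (\<integral>\<^sup>+w. weight w \<partial>lborel) * (\<integral>\<^sup>+x. indicator P x * ennreal ((\<phi> x)\<^sup>2) \<partial>\<mu>)"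
      by (intro mult_right_mono c) simp
    also have "\<dots> = (\<integral>\<^sup>+x. (\<integral>\<^sup>+w. weight w \<partial>lborel) * (indicator P x * ennreal ((\<phi> x)\<^sup>2)) \<partial>\<mu>)"
      by (rule nn_integral_cmult[symmetric]) measurable
    also have "\<dots> \<le> (\<integral>\<^sup>+x. 2 * (indicator P x * (\<integral>\<^sup>+w. weight w * ennreal ((\<phi> (x + w))\<^sup>2) \<partial>lborel))
        + ennreal (2 * \<eta>\<^sup>2) * (indicator P x * (\<integral>\<^sup>+w. ?inc x w \<partial>lborel)) \<partial>\<mu>)"
    proof (intro nn_integral_mono)
      fix x
      have "(\<integral>\<^sup>+w. weight w \<partial>lborel) * ennreal ((\<phi> x)\<^sup>2) = (\<integral>\<^sup>+w. weight w * ennreal ((\<phi> x)\<^sup>2) \<partial>lborel)"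
        by (rule nn_integral_multc[symmetric]) measurable
      also have "\<dots> \<le> (\<integral>\<^sup>+w. 2 * (weight w * ennreal ((\<phi> (x + w))\<^sup>2)) + ennreal (2 * \<eta>\<^sup>2) * ?inc x w \<partial>lborel)"
        by (intro nn_integral_mono pt)
      also have "\<dots> = (\<integral>\<^sup>+w. 2 * (weight w * ennreal ((\<phi> (x + w))\<^sup>2)) \<partial>lborel) + (\<integral>\<^sup>+w. ennreal (2 * \<eta>\<^sup>2) * ?inc x w \<partial>lborel)"
        by (rule nn_integral_add) measurable
      also have "(\<integral>\<^sup>+w. 2 * (weight w * ennreal ((\<phi> (x + w))\<^sup>2)) \<partial>lborel) = 2 * (\<integral>\<^sup>+w. weight w * ennreal ((\<phi> (x + w))\<^sup>2) \<partial>lborel)"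
        by (rule nn_integral_cmult) measurable
      also have "(\<integral>\<^sup>+w. ennreal (2 * \<eta>\<^sup>2) * ?inc x w \<partial>lborel) = ennreal (2 * \<eta>\<^sup>2) * (\<integral>\<^sup>+w. ?inc x w \<partial>lborel)"
        by (rule nn_integral_cmult) measurable
      finally show "(\<integral>\<^sup>+w. weight w \<partial>lborel) * (indicator P x * ennreal ((\<phi> x)\<^sup>2))
        \<le> 2 * (indicator P x * (\<integral>\<^sup>+w. weight w * ennreal ((\<phi> (x + w))\<^sup>2) \<partial>lborel))
        + ennreal (2 * \<eta>\<^sup>2) * (indicator P x * (\<integral>\<^sup>+w. ?inc x w \<partial>lborel))"
        by (cases "x \<in> P") simp_all
    qed
    also have "\<dots> = (\<integral>\<^sup>+x. 2 * (indicator P x * (\<integral>\<^sup>+w. weight w * ennreal ((\<phi> (x + w))\<^sup>2) \<partial>lborel)) \<partial>\<mu>)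
        + (\<integral>\<^sup>+x. ennreal (2 * \<eta>\<^sup>2) * (indicator P x * (\<integral>\<^sup>+w. ?inc x w \<partial>lborel)) \<partial>\<mu>)"
      by (rule nn_integral_add) measurable
    also have "(\<integral>\<^sup>+x. 2 * (indicator P x * (\<integral>\<^sup>+w. weight w * ennreal ((\<phi> (x + w))\<^sup>2) \<partial>lborel)) \<partial>\<mu>)
      = 2 * (\<integral>\<^sup>+x. indicator P x * (\<integral>\<^sup>+w. weight w * ennreal ((\<phi> (x + w))\<^sup>2) \<partial>lborel) \<partial>\<mu>)"
      by (rule nn_integral_cmult) measurable
    also have "(\<integral>\<^sup>+x. ennreal (2 * \<eta>\<^sup>2) * (indicator P x * (\<integral>\<^sup>+w. ?inc x w \<partial>lborel)) \<partial>\<mu>)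
      = ennreal (2 * \<eta>\<^sup>2) * increments \<phi>"
      unfolding increments_def by (rule nn_integral_cmult) measurable
    also have "2 * (\<integral>\<^sup>+x. indicator P x * (\<integral>\<^sup>+w. weight w * ennreal ((\<phi> (x + w))\<^sup>2) \<partial>lborel) \<partial>\<mu>) + ennreal (2 * \<eta>\<^sup>2) * increments \<phi>
      \<le> 2 * (ennreal C1 * energy \<phi>) + ennreal (2 * \<eta>\<^sup>2) * (ennreal (4 * C1) * energy \<phi>)"
      by (intro add_mono mult_left_mono increments_energy \<phi> order_trans[OF cone_average_le] energy_ge) auto
    also have "\<dots> = ennreal K * energy \<phi>"
    proof -
      have "ennreal K = ennreal (2 * C1) + ennreal (2 * \<eta>\<^sup>2 * (4 * C1))"
        using C1_nonneg by (subst ennreal_plus[symmetric]) (auto simp: K_def)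
      also have "ennreal (2 * C1) = 2 * ennreal C1" using C1_nonneg by (subst ennreal_mult) auto
      also have "ennreal (2 * \<eta>\<^sup>2 * (4 * C1)) = ennreal (2 * \<eta>\<^sup>2) * ennreal (4 * C1)"
        using C1_nonneg by (subst ennreal_mult) auto
      finally show ?thesis by (simp only: distrib_right mult.assoc)
    qed
    finally have "ennreal c * (\<integral>\<^sup>+x. indicator P x * ennreal ((\<phi> x)\<^sup>2) \<partial>\<mu>) \<le> ennreal K * energy \<phi>" .
    from ennreal_cancel_pos[OF this c(1)]
    have "(\<integral>\<^sup>+x. indicator P x * ennreal ((\<phi> x)\<^sup>2) \<partial>\<mu>) \<le> ennreal (1 / c) * (ennreal K * energy \<phi>)" .
    also have "\<dots> = ennreal (1 / c * K) * energy \<phi>"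
      using c K by (subst ennreal_mult) (auto simp: mult.assoc)
    finally show "(\<integral>\<^sup>+x. indicator P x * ennreal ((\<phi> x)\<^sup>2) \<partial>\<mu>) \<le> ennreal (1 / c * K) * energy \<phi>" .
  qed
qed

text \<open>For two boundary points at distance \<open>r\<close> the comparison ball is placed at
  height \<open>\<tau> = 2 * r / \<kappa>\<close> with tolerance \<open>2 * r\<close>; its points
  are at distance at most \<open>\<tau> + 2 * r\<close> from both, and this is
  \<open>aperture * r\<close>.\<close>

definition aperture :: real where "aperture = 2 / \<kappa> + 2"

lemma aperture: "aperture \<ge> 1" "aperture * \<kappa> = 2 + 2 * \<kappa>"
  using \<kappa> by (simp_all add: aperture_def field_simps)

text \<open>The contribution of the cone at \<open>x\<close> to the pair of \<open>x\<close> and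
  \<open>y\<close>, spread over interior points \<open>z\<close> at distance comparable to
  \<open>norm (x - y)\<close>. Of the exponent \<open>2 * n\<close>, one \<open>n\<close> is that of
  the Slobodeckij integrand of order 1/2, the other compensates the volume of the comparison
  ball.\<close>

definition kernel :: "('a \<Rightarrow> real) \<Rightarrow> 'a \<Rightarrow> 'a \<Rightarrow> 'a \<Rightarrow> ennreal" where
  "kernel \<phi> x y z = indicator P x * indicator cone0 (z - x) *
     (if norm (x - y) \<le> norm (z - x) \<and> norm (z - x) \<le> aperture * norm (x - y)
      then ennreal ((\<phi> z - \<phi> x)\<^sup>2 / norm (x - y) ^ (2 * DIM('a))) else 0)"

lemma kernel_borel [measurable]:
  assumes [measurable]: "\<phi> \<in> borel_measurable borel"
    "f \<in> borel_measurable N" "g \<in> borel_measurable N" "h \<in> borel_measurable N"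
  shows "(\<lambda>v. kernel \<phi> (f v) (g v) (h v)) \<in> borel_measurable N"
  unfolding kernel_def by measurable

text \<open>\<open>aperture ^ (2 * n)\<close> pays for replacing \<open>norm (x - y)\<close> by
  \<open>norm (z - x)\<close> in the denominator; the remaining factors are the area bound for the
  ball of radius \<open>2 * norm (z - x)\<close> that contains the admissible
  \<open>y\<close>.\<close>

definition C2 :: real where
  "C2 = A * 2 ^ (DIM('a) - 1) * aperture ^ (2 * DIM('a))"

lemma C2_nonneg: "C2 \<ge> 0"
  using A_nonneg aperture by (simp add: C2_def)

text \<open>For fixed \<open>x\<close> and \<open>z\<close> the admissible \<open>y\<close> lie in a
  ball of radius comparable to \<open>norm (z - x)\<close>, so integrating out \<open>y\<close>
  lowers the exponent from \<open>2 * n\<close> to \<open>n + 1\<close>. The argument is written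
  \<open>x + (z - x)\<close> to match the integrand of \<open>increments\<close>.\<close>

lemma kernel_surface_integral:
  "(\<integral>\<^sup>+y. kernel \<phi> x y z \<partial>\<mu>)
    \<le> indicator P x * (ennreal C2 * (indicator cone0 (z - x) * ennreal ((\<phi> (x + (z - x)) - \<phi> x)\<^sup>2 / norm (z - x) ^ (DIM('a) + 1))))"
proof (cases "x \<in> P \<and> z - x \<in> cone0")
  case True
  define \<rho> where "\<rho> = norm (z - x)"
  have \<rho>: "\<rho> > 0" using True cone_norm_pos[of "z - x"] unfolding \<rho>_def by (auto simp: cone0_def)
  define D where "D = (\<phi> z - \<phi> x)\<^sup>2"
  let ?n = "DIM('a)"
  have pt: "kernel \<phi> x y z \<le> ennreal (D * (aperture / \<rho>) ^ (2 * ?n)) * indicator (ball x (2 * \<rho>)) y" for y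
  proof (cases "norm (x - y) \<le> \<rho> \<and> \<rho> \<le> aperture * norm (x - y)")
    case le: True
    have pos: "norm (x - y) > 0"
      using le \<rho> by (metis mult_zero_right norm_ge_zero order_le_less order_less_le_trans order_less_irrefl)
    have "1 \<le> (aperture * norm (x - y)) / \<rho>"
      using le by (subst le_divide_eq_1_pos[OF \<rho>]) simp
    then have "1 / norm (x - y) \<le> aperture / \<rho>"
      by (intro mult_imp_div_pos_le[OF pos]) simp
    then have "(1 / norm (x - y)) ^ (2 * ?n) \<le> (aperture / \<rho>) ^ (2 * ?n)"
      by (intro power_mono) auto
    then have "D * (1 / norm (x - y)) ^ (2 * ?n) \<le> D * (aperture / \<rho>) ^ (2 * ?n)"
      by (intro mult_left_mono) (auto simp: D_def)
    then have "D / norm (x - y) ^ (2 * ?n) \<le> D * (aperture / \<rho>) ^ (2 * ?n)"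
      by (simp add: power_divide)
    moreover have "y \<in> ball x (2 * \<rho>)" using le \<rho> by (simp add: dist_norm)
    ultimately show ?thesis using True le by (simp add: kernel_def \<rho>_def D_def ennreal_leI)
  next
    case False
    then show ?thesis by (auto simp: kernel_def \<rho>_def)
  qed
  have "(\<integral>\<^sup>+y. kernel \<phi> x y z \<partial>\<mu>)
    \<le> (\<integral>\<^sup>+y. ennreal (D * (aperture / \<rho>) ^ (2 * ?n)) * indicator (ball x (2 * \<rho>)) y \<partial>\<mu>)"
    by (intro nn_integral_mono pt)
  also have "\<dots> = ennreal (D * (aperture / \<rho>) ^ (2 * ?n)) * emeasure \<mu> (ball x (2 * \<rho>))"
    by (rule nn_integral_cmult_indicator) simp
  also have "\<dots> \<le> ennreal (D * (aperture / \<rho>) ^ (2 * ?n)) * ennreal (A * (2 * \<rho>) ^ (?n - 1))"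
    using \<rho> by (intro mult_left_mono ahlfors) auto
  also have "\<dots> = ennreal (D * (aperture / \<rho>) ^ (2 * ?n) * (A * (2 * \<rho>) ^ (?n - 1)))"
    using \<rho> A_nonneg aperture by (intro ennreal_mult[symmetric]) (auto simp: D_def)
  also have "D * (aperture / \<rho>) ^ (2 * ?n) * (A * (2 * \<rho>) ^ (?n - 1)) = C2 * (D / \<rho> ^ (?n + 1))"
  proof -
    have "\<rho> ^ (?n - 1) / \<rho> ^ (2 * ?n) = 1 / \<rho> ^ (?n + 1)"
    proof -
      have "2 * ?n = (?n - 1) + (?n + 1)" using DIM_positive[where 'a='a] by linarith
      then have "\<rho> ^ (2 * ?n) = \<rho> ^ (?n - 1) * \<rho> ^ (?n + 1)" by (simp only: power_add)
      then show ?thesis using \<rho> by simp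
    qed
    then have "D * (A * 2 ^ (?n - 1) * aperture ^ (2 * ?n)) * (\<rho> ^ (?n - 1) / \<rho> ^ (2 * ?n))
      = D * (A * 2 ^ (?n - 1) * aperture ^ (2 * ?n)) * (1 / \<rho> ^ (?n + 1))" by (simp only:)
    then show ?thesis unfolding C2_def power_divide power_mult_distrib by (simp add: mult_ac)
  qed
  also have "ennreal (C2 * (D / \<rho> ^ (?n + 1))) = ennreal C2 * ennreal (D / \<rho> ^ (?n + 1))"
    using C2_nonneg \<rho> by (intro ennreal_mult) (auto simp: D_def)
  finally show ?thesis using True by (simp add: \<rho>_def D_def)
next
  case False
  then have "kernel \<phi> x y z = 0" for y by (auto simp: kernel_def)
  then show ?thesis by simp
qed

lemma kernel_integral:
  assumes \<phi>: "smooth \<phi>"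
  shows "(\<integral>\<^sup>+x. \<integral>\<^sup>+y. \<integral>\<^sup>+z. kernel \<phi> x y z \<partial>lborel \<partial>\<mu> \<partial>\<mu>) \<le> ennreal C2 * increments \<phi>"
proof -
  interpret pair_sigma_finite \<mu> lborel by (rule pair_sigma_finite_mu)
  have [measurable]: "\<phi> \<in> borel_measurable borel" by (rule smooth_borel[OF \<phi>])
  let ?inc = "\<lambda>x w. indicator cone0 w * ennreal ((\<phi> (x + w) - \<phi> x)\<^sup>2 / norm w ^ (DIM('a) + 1))"
  have "(\<integral>\<^sup>+y. \<integral>\<^sup>+z. kernel \<phi> x y z \<partial>lborel \<partial>\<mu>) \<le> ennreal C2 * (indicator P x * (\<integral>\<^sup>+w. ?inc x w \<partial>lborel))" for x
  proof -
    have "(\<integral>\<^sup>+y. \<integral>\<^sup>+z. kernel \<phi> x y z \<partial>lborel \<partial>\<mu>) = (\<integral>\<^sup>+z. \<integral>\<^sup>+y. kernel \<phi> x y z \<partial>\<mu> \<partial>lborel)"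
      by (rule Fubini'[symmetric]) measurable
    also have "\<dots> \<le> (\<integral>\<^sup>+z. indicator P x * (ennreal C2 * ?inc x (z - x)) \<partial>lborel)"
      by (intro nn_integral_mono kernel_surface_integral)
    also have "\<dots> = (\<integral>\<^sup>+z. indicator P x * (ennreal C2 * ?inc x z) \<partial>lborel)"
      using nn_integral_lborel_translate[of "\<lambda>z. indicator P x * (ennreal C2 * ?inc x z)" "- x"] by simp
    also have "\<dots> = indicator P x * (\<integral>\<^sup>+z. ennreal C2 * ?inc x z \<partial>lborel)"
      by (rule nn_integral_cmult) measurable
    also have "(\<integral>\<^sup>+z. ennreal C2 * ?inc x z \<partial>lborel) = ennreal C2 * (\<integral>\<^sup>+z. ?inc x z \<partial>lborel)"
      by (rule nn_integral_cmult) measurable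
    finally show ?thesis by (simp add: mult_ac)
  qed
  then have "(\<integral>\<^sup>+x. \<integral>\<^sup>+y. \<integral>\<^sup>+z. kernel \<phi> x y z \<partial>lborel \<partial>\<mu> \<partial>\<mu>)
    \<le> (\<integral>\<^sup>+x. ennreal C2 * (indicator P x * (\<integral>\<^sup>+w. ?inc x w \<partial>lborel)) \<partial>\<mu>)"
    by (intro nn_integral_mono)
  also have "\<dots> = ennreal C2 * increments \<phi>"
    unfolding increments_def by (rule nn_integral_cmult) measurable
  finally show ?thesis .
qed

text \<open>Both increments are compared with the values on a ball inside the common part of the
  cones at \<open>x\<close> and \<open>y\<close>, at distance comparable to \<open>norm (x - y)\<close>.\<close>

lemma slobodeckij_kernel_le:
  assumes \<phi>: "smooth \<phi>" and x: "x \<in> P" and y: "y \<in> P" and ne: "x \<noteq> y" and small: "aperture * norm (x - y) < \<eta>"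
  shows "ennreal (unit_ball_vol (real DIM('a))) * ennreal ((\<phi> x - \<phi> y)\<^sup>2 / norm (x - y) ^ DIM('a))
    \<le> 2 * (\<integral>\<^sup>+z. kernel \<phi> x y z \<partial>lborel) + 2 * (\<integral>\<^sup>+z. kernel \<phi> y x z \<partial>lborel)"
proof -
  have [measurable]: "\<phi> \<in> borel_measurable borel" by (rule smooth_borel[OF \<phi>])
  let ?n = "DIM('a)"
  define r where "r = norm (x - y)"
  have r: "r > 0" using ne by (simp add: r_def)
  \<comment> \<open>With \<open>\<tau> * \<kappa> = 2 * r\<close> the ball of radius
    \<open>r\<close> around \<open>x + \<tau> *\<^sub>R e\<close> lies in the cone at
    \<open>x\<close> and, its centre being \<open>r\<close> away from
    \<open>y + \<tau> *\<^sub>R e\<close>, also in the cone at \<open>y\<close>.\<close>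
  define \<tau> where "\<tau> = 2 * r / \<kappa>"
  have \<tau>: "\<tau> > 0" "\<tau> * \<kappa> = 2 * r" using r \<kappa> by (simp_all add: \<tau>_def)
  \<comment> \<open>Keeps the ball away from both boundary points: a vector within
    \<open>2 * r\<close> of \<open>\<tau> *\<^sub>R e\<close> has norm at least
    \<open>r\<close>.\<close>
  have \<tau>4: "\<tau> \<ge> 4 * r" using \<kappa> r by (simp add: \<tau>_def field_simps)
  have ap: "\<tau> + 2 * r = aperture * r" by (simp add: \<tau>_def aperture_def field_simps)
  let ?R = "ball (x + \<tau> *\<^sub>R e) r"
  define D where "D = (\<phi> x - \<phi> y)\<^sup>2 / r ^ (2 * ?n)"
  have nt: "norm (\<tau> *\<^sub>R e) = \<tau>" using \<tau> e by simp
  have near: "v \<in> cone0 \<and> r \<le> norm v \<and> norm v \<le> aperture * r" if v: "norm (v - \<tau> *\<^sub>R e) < 2 * r" for v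
  proof (intro conjI)
    have up: "norm v < \<tau> + 2 * r" using norm_triangle_sub[of v "\<tau> *\<^sub>R e"] v nt by linarith
    then show le: "norm v \<le> aperture * r" using ap by simp
    have "v \<in> cone" using v \<tau> by (auto simp: cone_def dist_norm norm_minus_commute intro!: bexI[of _ \<tau>])
    then show "v \<in> cone0" using up ap small by (simp add: cone0_def r_def)
    show "r \<le> norm v" using norm_triangle_ineq2[of "\<tau> *\<^sub>R e" v] v nt \<tau>4 r by (simp add: norm_minus_commute)
  qed
  have pt: "ennreal D * indicator ?R z \<le> 2 * kernel \<phi> x y z + 2 * kernel \<phi> y x z" for z
  proof (cases "z \<in> ?R")
    case True
    then have z: "norm ((z - x) - \<tau> *\<^sub>R e) < r" by (simp add: dist_norm norm_minus_commute algebra_simps)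
    have 1: "norm ((z - x) - \<tau> *\<^sub>R e) < 2 * r" using z r by linarith
    have "norm ((z - y) - \<tau> *\<^sub>R e) \<le> norm ((z - x) - \<tau> *\<^sub>R e) + norm (x - y)"
      using norm_triangle_ineq[of "(z - x) - \<tau> *\<^sub>R e" "x - y"] by (simp add: algebra_simps)
    then have 2: "norm ((z - y) - \<tau> *\<^sub>R e) < 2 * r" using z by (simp add: r_def)
    have k1: "kernel \<phi> x y z = ennreal ((\<phi> z - \<phi> x)\<^sup>2 / r ^ (2 * ?n))"
      using near[OF 1] x by (simp add: kernel_def r_def)
    have k2: "kernel \<phi> y x z = ennreal ((\<phi> z - \<phi> y)\<^sup>2 / r ^ (2 * ?n))"
      using near[OF 2] y by (simp add: kernel_def r_def norm_minus_commute)
    have "D \<le> 2 * ((\<phi> z - \<phi> x)\<^sup>2 / r ^ (2 * ?n)) + 2 * ((\<phi> z - \<phi> y)\<^sup>2 / r ^ (2 * ?n))"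
    proof -
      have "(\<phi> x - \<phi> y)\<^sup>2 \<le> 2 * (\<phi> z - \<phi> x)\<^sup>2 + 2 * (\<phi> z - \<phi> y)\<^sup>2"
        using sq_diff_le[of "\<phi> z - \<phi> y" "\<phi> z - \<phi> x"] by simp
      from divide_right_mono[OF this, of "r ^ (2 * ?n)"] show ?thesis
        using r by (simp add: D_def add_divide_distrib)
    qed
    then have "ennreal D \<le> ennreal (2 * ((\<phi> z - \<phi> x)\<^sup>2 / r ^ (2 * ?n)) + 2 * ((\<phi> z - \<phi> y)\<^sup>2 / r ^ (2 * ?n)))"
      by (rule ennreal_leI)
    also have "\<dots> = 2 * ennreal ((\<phi> z - \<phi> x)\<^sup>2 / r ^ (2 * ?n)) + 2 * ennreal ((\<phi> z - \<phi> y)\<^sup>2 / r ^ (2 * ?n))"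
      unfolding ennreal_double[symmetric] using r by (intro ennreal_plus) auto
    finally show ?thesis using True by (simp add: k1 k2)
  qed simp
  have "ennreal (unit_ball_vol (real ?n)) * ennreal ((\<phi> x - \<phi> y)\<^sup>2 / norm (x - y) ^ ?n) = ennreal D * emeasure lborel ?R"
  proof -
    have "unit_ball_vol (real ?n) * ((\<phi> x - \<phi> y)\<^sup>2 / r ^ ?n) = D * (unit_ball_vol (real ?n) * r ^ ?n)"
      using r by (simp add: D_def mult_2 power_add)
    then show ?thesis using r
      by (simp add: emeasure_ball D_def r_def[symmetric] ennreal_mult[symmetric])
  qed
  also have "\<dots> = (\<integral>\<^sup>+z. ennreal D * indicator ?R z \<partial>lborel)"
    by (rule nn_integral_cmult_indicator[symmetric]) simp
  also have "\<dots> \<le> (\<integral>\<^sup>+z. 2 * kernel \<phi> x y z + 2 * kernel \<phi> y x z \<partial>lborel)"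
    by (intro nn_integral_mono pt)
  also have "\<dots> = (\<integral>\<^sup>+z. 2 * kernel \<phi> x y z \<partial>lborel) + (\<integral>\<^sup>+z. 2 * kernel \<phi> y x z \<partial>lborel)"
    by (rule nn_integral_add) measurable
  also have "(\<integral>\<^sup>+z. 2 * kernel \<phi> x y z \<partial>lborel) = 2 * (\<integral>\<^sup>+z. kernel \<phi> x y z \<partial>lborel)"
    by (rule nn_integral_cmult) measurable
  also have "(\<integral>\<^sup>+z. 2 * kernel \<phi> y x z \<partial>lborel) = 2 * (\<integral>\<^sup>+z. kernel \<phi> y x z \<partial>lborel)"
    by (rule nn_integral_cmult) measurable
  finally show ?thesis .
qed

definition near_pairs :: "('a \<Rightarrow> real) \<Rightarrow> ennreal" where
  "near_pairs \<phi> = (\<integral>\<^sup>+x. \<integral>\<^sup>+y. indicator P x * indicator P y *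
     (if aperture * norm (x - y) < \<eta> then ennreal ((\<phi> x - \<phi> y)\<^sup>2 / norm (x - y) ^ DIM('a)) else 0) \<partial>\<mu> \<partial>\<mu>)"

text \<open>After integration of the pairwise comparison the two kernels contribute equally, by
  symmetry of the product measure. The unit ball volume \<open>V\<close> stems from the measure of
  the comparison ball and is divided out.\<close>

lemma trace_slobodeckij_patch:
  obtains C where "C \<ge> 0" "\<And>\<phi>. smooth \<phi> \<Longrightarrow> near_pairs \<phi> \<le> ennreal C * energy \<phi>"
proof -
  define V where "V = unit_ball_vol (real DIM('a))"
  have V: "V > 0" by (simp add: V_def)
  define K where "K = 4 * C2 * (4 * C1)"
  have K: "K \<ge> 0" using C1_nonneg C2_nonneg by (simp add: K_def)
  show ?thesis
  proof (rule that[of "1 / V * K"])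
    show "1 / V * K \<ge> 0" using V K by simp
    fix \<phi> :: "'a \<Rightarrow> real" assume \<phi>: "smooth \<phi>"
    have [measurable]: "\<phi> \<in> borel_measurable borel" by (rule smooth_borel[OF \<phi>])
    interpret pair_sigma_finite \<mu> \<mu> by (rule pair_sigma_finite_mu)
    let ?q = "\<lambda>x y. indicator P x * indicator P y *
     (if aperture * norm (x - y) < \<eta> then ennreal ((\<phi> x - \<phi> y)\<^sup>2 / norm (x - y) ^ DIM('a)) else 0)"
    let ?k = "\<lambda>x y. \<integral>\<^sup>+z. kernel \<phi> x y z \<partial>lborel"
    have "ennreal V * near_pairs \<phi> = (\<integral>\<^sup>+x. \<integral>\<^sup>+y. ennreal V * ?q x y \<partial>\<mu> \<partial>\<mu>)"
      unfolding near_pairs_def by (subst nn_integral_cmult, measurable, subst nn_integral_cmult, measurable)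
    also have "\<dots> \<le> (\<integral>\<^sup>+x. \<integral>\<^sup>+y. 2 * ?k x y + 2 * ?k y x \<partial>\<mu> \<partial>\<mu>)"
    proof (intro nn_integral_mono)
      fix x y
      show "ennreal V * ?q x y \<le> 2 * ?k x y + 2 * ?k y x"
      proof (cases "x \<in> P \<and> y \<in> P \<and> x \<noteq> y \<and> aperture * norm (x - y) < \<eta>")
        case True
        then show ?thesis using slobodeckij_kernel_le[OF \<phi>, of x y] by (simp add: V_def)
      next
        case False
        then have "?q x y = 0" by auto
        then show ?thesis by (simp only: mult_zero_right zero_le)
      qed
    qed
    also have "\<dots> = (\<integral>\<^sup>+x. \<integral>\<^sup>+y. 2 * ?k x y \<partial>\<mu> \<partial>\<mu>) + (\<integral>\<^sup>+x. \<integral>\<^sup>+y. 2 * ?k y x \<partial>\<mu> \<partial>\<mu>)"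
      by (subst nn_integral_add, measurable, subst nn_integral_add, measurable)
    also have "(\<integral>\<^sup>+x. \<integral>\<^sup>+y. 2 * ?k y x \<partial>\<mu> \<partial>\<mu>) = (\<integral>\<^sup>+x. \<integral>\<^sup>+y. 2 * ?k x y \<partial>\<mu> \<partial>\<mu>)"
      by (rule Fubini') measurable
    also have "(\<integral>\<^sup>+x. \<integral>\<^sup>+y. 2 * ?k x y \<partial>\<mu> \<partial>\<mu>) = 2 * (\<integral>\<^sup>+x. \<integral>\<^sup>+y. ?k x y \<partial>\<mu> \<partial>\<mu>)"
      by (subst nn_integral_cmult, measurable, subst nn_integral_cmult, measurable)
    also have "2 * (\<integral>\<^sup>+x. \<integral>\<^sup>+y. ?k x y \<partial>\<mu> \<partial>\<mu>) + 2 * (\<integral>\<^sup>+x. \<integral>\<^sup>+y. ?k x y \<partial>\<mu> \<partial>\<mu>) = 4 * (\<integral>\<^sup>+x. \<integral>\<^sup>+y. ?k x y \<partial>\<mu> \<partial>\<mu>)"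
      by (simp flip: distrib_right)
    also have "\<dots> \<le> 4 * (ennreal C2 * (ennreal (4 * C1) * energy \<phi>))"
      by (intro mult_left_mono order_trans[OF kernel_integral[OF \<phi>]] increments_energy \<phi>) auto
    also have "\<dots> = ennreal K * energy \<phi>"
    proof -
      have "ennreal K = ennreal 4 * ennreal C2 * ennreal (4 * C1)"
        unfolding K_def using C1_nonneg C2_nonneg
        by (subst ennreal_mult, simp_all only: ennreal_mult[of 4 C2] zero_le_mult_iff zero_le_numeral simp_thms)
      then show ?thesis by (simp add: mult.assoc)
    qed
    finally have "near_pairs \<phi> \<le> ennreal (1 / V) * (ennreal K * energy \<phi>)"
      using V by (rule ennreal_cancel_pos)
    also have "\<dots> = ennreal (1 / V * K) * energy \<phi>"
      using V K by (subst ennreal_mult) (auto simp: mult.assoc)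
    finally show "near_pairs \<phi> \<le> ennreal (1 / V * K) * energy \<phi>" .
  qed
qed

end

subsection \<open>The surface measure\<close>

text \<open>Moving from \<open>x\<close> in direction \<open>n - n'\<close> leaves the half-space of
  one normal and enters that of the other, against the two local descriptions of
  \<open>\<Omega>\<close>.\<close>

lemma is_outer_normal_unique:
  assumes "is_outer_normal \<Omega> x n" "is_outer_normal \<Omega> x n'"
  shows "n = n'"
proof (rule ccontr)
  assume ne: "n \<noteq> n'"
  obtain r where r: "norm n = 1" "r > 0" "\<Omega> \<inter> ball x r = {y \<in> ball x r. n \<bullet> (y - x) < 0}"
    using assms(1) by (auto simp: is_outer_normal_def)
  obtain r' where r': "norm n' = 1" "r' > 0" "\<Omega> \<inter> ball x r' = {y \<in> ball x r'. n' \<bullet> (y - x) < 0}"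
    using assms(2) by (auto simp: is_outer_normal_def)
  define d where "d = n - n'"
  have d: "norm d > 0" using ne by (simp add: d_def)
  have nn: "n \<bullet> n = 1" "n' \<bullet> n' = 1" using r r' by (simp_all add: norm_eq_1)
  have "d \<bullet> d = 2 - 2 * (n \<bullet> n')" by (simp add: d_def inner_diff_left inner_diff_right nn inner_commute)
  moreover have "d \<bullet> d > 0" using d by simp
  ultimately have lt: "n \<bullet> n' < 1" by simp
  have nd: "n \<bullet> d > 0" "n' \<bullet> d < 0"
    using lt by (simp_all add: d_def inner_diff_right nn inner_commute)
  define t where "t = min r r' / (2 * norm d)"
  have t: "t > 0" using r r' d by (simp add: t_def)
  have mpos: "min r r' > 0" using r r' by simp
  have "norm (t *\<^sub>R d) = t * norm d" using t by simp
  also have "\<dots> = min r r' / 2" using d by (simp add: t_def)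
  finally have "norm (t *\<^sub>R d) = min r r' / 2" .
  moreover note mpos
  ultimately have "norm (t *\<^sub>R d) < min r r'" by linarith
  then have b: "x + t *\<^sub>R d \<in> ball x r" "x + t *\<^sub>R d \<in> ball x r'" by (simp_all add: dist_norm)
  have "n' \<bullet> (x + t *\<^sub>R d - x) < 0" using nd t by (simp add: mult_pos_neg)
  with b(2) have "x + t *\<^sub>R d \<in> {y \<in> ball x r'. n' \<bullet> (y - x) < 0}" by blast
  then have "x + t *\<^sub>R d \<in> \<Omega>" unfolding r'(3)[symmetric] by blast
  with b(1) have "x + t *\<^sub>R d \<in> \<Omega> \<inter> ball x r" by blast
  then have "n \<bullet> (x + t *\<^sub>R d - x) < 0" unfolding r(3) by blast
  then show False using nd t by (simp add: mult_less_0_iff)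
qed

lemma outer_normal_eq: "is_outer_normal \<Omega> x n \<Longrightarrow> outer_normal \<Omega> x = n"
  unfolding outer_normal_def using is_outer_normal_unique by blast

lemma is_outer_normal_frontier:
  assumes "open \<Omega>" "is_outer_normal \<Omega> x n"
  shows "x \<in> frontier \<Omega>"
proof -
  obtain r where r: "norm n = 1" "r > 0" "\<Omega> \<inter> ball x r = {y \<in> ball x r. n \<bullet> (y - x) < 0}"
    using assms(2) by (auto simp: is_outer_normal_def)
  have nn: "n \<bullet> n = 1" using r by (simp add: norm_eq_1)
  have "x \<notin> \<Omega>"
  proof
    assume "x \<in> \<Omega>"
    then have "x \<in> \<Omega> \<inter> ball x r" using r(2) by simp
    then show False unfolding r(3) by simp
  qed
  moreover have "x \<in> closure \<Omega>"
    unfolding closure_approachable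
  proof (intro allI impI)
    fix e :: real assume "e > 0"
    define t where "t = min e r / 2"
    have t: "t > 0" "t < e" "t < r" using \<open>e > 0\<close> r by (auto simp: t_def)
    have "x - t *\<^sub>R n \<in> ball x r" using t r by (simp add: dist_norm)
    moreover have "n \<bullet> (x - t *\<^sub>R n - x) < 0" using t nn by simp
    ultimately have "x - t *\<^sub>R n \<in> {y \<in> ball x r. n \<bullet> (y - x) < 0}" by blast
    then have "x - t *\<^sub>R n \<in> \<Omega>" unfolding r(3)[symmetric] by blast
    moreover have "dist (x - t *\<^sub>R n) x < e" using t r by (simp add: dist_norm)
    ultimately show "\<exists>y\<in>\<Omega>. dist y x < e" by blast
  qed
  ultimately show ?thesis using assms(1) by (simp add: frontier_def interior_open)
qed

text \<open>A frontier point near \<open>x\<close> can lie on neither open side of the hyperplane at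
  \<open>x\<close>, so it lies on the hyperplane, and the half-space description at \<open>x\<close>
  restricts to it. Uniqueness of the normal then applies.\<close>

lemma is_outer_normal_nearby:
  assumes "open \<Omega>" "is_outer_normal \<Omega> x n"
  obtains r where "r > 0" "\<And>x' n'. x' \<in> ball x r \<Longrightarrow> is_outer_normal \<Omega> x' n' \<Longrightarrow> n' = n"
proof -
  obtain r where r: "norm n = 1" "r > 0" "\<Omega> \<inter> ball x r = {y \<in> ball x r. n \<bullet> (y - x) < 0}"
    using assms(2) by (auto simp: is_outer_normal_def)
  have nn: "n \<bullet> n = 1" using r by (simp add: norm_eq_1)
  show ?thesis
  proof (rule that[OF r(2)])
    fix x' n' assume x': "x' \<in> ball x r" and n': "is_outer_normal \<Omega> x' n'"
    have fr: "x' \<in> frontier \<Omega>" by (rule is_outer_normal_frontier[OF assms(1) n'])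
    then have out: "x' \<notin> \<Omega>" using assms(1) by (simp add: frontier_def interior_open)
    have "x' \<notin> {y \<in> ball x r. n \<bullet> (y - x) < 0}" unfolding r(3)[symmetric] using out by blast
    then have ge: "n \<bullet> (x' - x) \<ge> 0" using x' by force
    have "n \<bullet> (x' - x) \<le> 0"
    proof (rule ccontr)
      assume pos: "\<not> ?thesis"
      have "open (ball x r \<inter> {y. 0 < n \<bullet> (y - x)})"
        by (intro open_Int open_ball open_Collect_less continuous_intros)
      also have "ball x r \<inter> {y. 0 < n \<bullet> (y - x)} = {y \<in> ball x r. n \<bullet> (y - x) > 0}" by auto
      finally have "open {y \<in> ball x r. n \<bullet> (y - x) > 0}" .
      moreover have "x' \<in> {y \<in> ball x r. n \<bullet> (y - x) > 0}" using x' pos by auto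
      ultimately obtain d where d: "d > 0" "ball x' d \<subseteq> {y \<in> ball x r. n \<bullet> (y - x) > 0}"
        using open_contains_ball by blast
      have "x' \<in> closure \<Omega>" using fr by (simp add: frontier_def)
      then obtain y where "y \<in> \<Omega>" "dist y x' < d" using d closure_approachable by blast
      then have "y \<in> \<Omega>" "y \<in> ball x r" "n \<bullet> (y - x) > 0" using d by (auto simp: dist_commute subset_iff)
      have "y \<in> {y \<in> ball x r. n \<bullet> (y - x) < 0}"
        unfolding r(3)[symmetric] using \<open>y \<in> \<Omega>\<close> \<open>y \<in> ball x r\<close> by blast
      then show False using \<open>n \<bullet> (y - x) > 0\<close> by simp
    qed
    with ge have z: "n \<bullet> x' = n \<bullet> x" by (simp add: inner_diff_right)
    obtain r' where r': "r' > 0" "ball x' r' \<subseteq> ball x r" using openE[OF open_ball x'] by metis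
    have "\<Omega> \<inter> ball x' r' = (\<Omega> \<inter> ball x r) \<inter> ball x' r'" using r'(2) by blast
    also have "\<dots> = {y \<in> ball x' r'. n \<bullet> (y - x') < 0}"
      unfolding r(3) using r'(2) z by (auto simp: inner_diff_right subset_iff)
    finally have "\<Omega> \<inter> ball x' r' = {y \<in> ball x' r'. n \<bullet> (y - x') < 0}" .
    then have "is_outer_normal \<Omega> x' n" using r r' by (auto simp: is_outer_normal_def)
    with n' show "n' = n" by (rule is_outer_normal_unique)
  qed
qed

text \<open>The normal is locally constant on the regular boundary points, and a facet is
  connected.\<close>

lemma facet_normal:
  assumes "open \<Omega>" "F \<in> facets \<Omega>"
  obtains n where "norm n = 1" "\<And>x. x \<in> F \<Longrightarrow> outer_normal \<Omega> x = n" "F \<subseteq> frontier \<Omega>"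
proof -
  let ?R = "{x. \<exists>n. is_outer_normal \<Omega> x n}"
  have F: "connected F" "F \<subseteq> ?R" "F \<noteq> {}"
    using assms(2) in_components_connected in_components_subset in_components_nonempty unfolding facets_def by blast+
  have "outer_normal \<Omega> constant_on F"
  proof (rule locally_constant_imp_constant[OF F(1)])
    fix x assume x: "x \<in> F"
    then obtain n where n: "is_outer_normal \<Omega> x n" using F by auto
    obtain r where r: "r > 0" "\<And>x' n'. x' \<in> ball x r \<Longrightarrow> is_outer_normal \<Omega> x' n' \<Longrightarrow> n' = n"
      by (rule is_outer_normal_nearby[OF assms(1) n]) blast
    have "outer_normal \<Omega> y = outer_normal \<Omega> x" if y: "y \<in> F \<inter> ball x r" for y
    proof -
      obtain n' where n': "is_outer_normal \<Omega> y n'" using y F by auto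
      with r(2)[of y n'] y have "is_outer_normal \<Omega> y n" by auto
      with n show ?thesis by (simp add: outer_normal_eq)
    qed
    then show "\<exists>T. openin (top_of_set F) T \<and> x \<in> T \<and> (\<forall>y\<in>T. outer_normal \<Omega> y = outer_normal \<Omega> x)"
    proof (intro exI[of _ "F \<inter> ball x r"] conjI ballI)
      show "openin (top_of_set F) (F \<inter> ball x r)" by (rule openin_open_Int[OF open_ball])
      show "x \<in> F \<inter> ball x r" using x r(1) by simp
    qed
  qed
  then obtain n where n: "\<And>x. x \<in> F \<Longrightarrow> outer_normal \<Omega> x = n" by (auto simp: constant_on_def)
  obtain x m where "x \<in> F" "is_outer_normal \<Omega> x m" using F by blast
  then have "norm n = 1" using n[of x] by (auto simp: outer_normal_eq is_outer_normal_def)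
  moreover have "F \<subseteq> frontier \<Omega>" using F(2) is_outer_normal_frontier[OF assms(1)] by auto
  ultimately show ?thesis using n that by blast
qed

locale polyhedral =
  fixes \<Omega> :: "'a::euclidean_space set"
  assumes polyhedral: "polyhedral_domain \<Omega>"
begin

sublocale bounded_open \<Omega>
  using polyhedral by unfold_locales (auto simp: polyhedral_domain_def)

lemma connected_\<Omega>: "connected \<Omega>" and nonempty_\<Omega>: "\<Omega> \<noteq> {}" and finite_facets: "finite (facets \<Omega>)"
  and lipschitz_\<Omega>: "lipschitz_boundary \<Omega>"
  using polyhedral by (auto simp: polyhedral_domain_def)

abbreviation S :: "'a measure" where "S \<equiv> surface_measure \<Omega>"

lemma sets_S: "sets S = sets (restrict_space borel (frontier \<Omega>))"
  and space_S: "space S = frontier \<Omega>"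
proof -
  have sub: "sets (restrict_space borel (frontier \<Omega>)) \<subseteq> Pow (frontier \<Omega>)"
    by (auto simp: sets_restrict_space)
  show "space S = frontier \<Omega>" unfolding surface_measure_def by (rule space_measure_of[OF sub])
  have "sets S = sigma_sets (frontier \<Omega>) (sets (restrict_space borel (frontier \<Omega>)))"
    unfolding surface_measure_def by (rule sets_measure_of[OF sub])
  also have "\<dots> = sets (restrict_space borel (frontier \<Omega>))"
    using sets.sigma_sets_eq[of "restrict_space borel (frontier \<Omega>)"] by (simp add: space_restrict_space)
  finally show "sets S = sets (restrict_space borel (frontier \<Omega>))" .
qed

lemma S_measurable: "f \<in> borel_measurable borel \<Longrightarrow> f \<in> borel_measurable S"
  by (subst measurable_cong_sets[OF sets_S refl]) (rule measurable_restrict_space1)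

text \<open>Only this inequality is needed, so countable additivity of the prism areas is never used.\<close>

lemma emeasure_S_le: "emeasure S X \<le> (\<Sum>F\<in>facets \<Omega>. emeasure lborel (prism \<Omega> (X \<inter> F)))"
  unfolding surface_measure_def by (subst emeasure_measure_of_conv) auto

text \<open>The prism of height \<open>1\<close> is cut into about \<open>1 / r\<close> layers, each inside a ball of radius \<open>2 r\<close>.\<close>

lemma prism_ball_small:
  assumes F: "F \<in> facets \<Omega>" and r: "0 < r" "r \<le> 1"
  shows "emeasure lborel (prism \<Omega> (ball z r \<inter> F))
    \<le> ennreal (unit_ball_vol (real DIM('a)) * 2 ^ (DIM('a) + 1) * r ^ (DIM('a) - 1))"
proof -
  obtain n where n: "norm n = 1" "\<And>x. x \<in> F \<Longrightarrow> outer_normal \<Omega> x = n"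
    using facet_normal[OF open_\<Omega> F] by metis
  define N where "N = Suc (nat \<lfloor>1 / r\<rfloor>)"
  let ?B = "\<lambda>j::nat. ball (z + (real j * r) *\<^sub>R n) (2 * r)"
  have "prism \<Omega> (ball z r \<inter> F) \<subseteq> (\<Union>j<N. ?B j)"
  proof
    fix p assume "p \<in> prism \<Omega> (ball z r \<inter> F)"
    then obtain x s where p: "p = x + s *\<^sub>R n" "x \<in> ball z r" and s: "0 \<le> s" "s \<le> 1"
      using n(2) by (auto simp: prism_def)
    define j where "j = nat \<lfloor>s / r\<rfloor>"
    have j: "real j \<le> s / r" "s / r < real j + 1" using s r by (auto simp: j_def)
    have js: "0 \<le> s - real j * r" "s - real j * r < r" using j r by (auto simp: field_simps)
    have "s / r \<le> 1 / r" using s r by (simp add: divide_right_mono)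
    then have "j < N" unfolding j_def N_def by (simp add: floor_mono nat_mono le_imp_less_Suc)
    moreover have "norm (p - (z + (real j * r) *\<^sub>R n)) \<le> norm (x - z) + norm ((s - real j * r) *\<^sub>R n)"
      using norm_triangle_ineq[of "x - z" "(s - real j * r) *\<^sub>R n"] unfolding p by (simp add: algebra_simps)
    then have "norm (p - (z + (real j * r) *\<^sub>R n)) < 2 * r"
      using p(2) js n(1) by (simp add: dist_norm norm_minus_commute)
    then have "p \<in> ?B j" by (simp add: dist_norm norm_minus_commute)
    ultimately show "p \<in> (\<Union>j<N. ?B j)" by blast
  qed
  then have "emeasure lborel (prism \<Omega> (ball z r \<inter> F)) \<le> emeasure lborel (\<Union>j<N. ?B j)"
    by (rule emeasure_mono) auto
  also have "\<dots> \<le> (\<Sum>j<N. emeasure lborel (?B j))" by (rule emeasure_subadditive_finite) auto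
  also have "\<dots> = (\<Sum>j<N. ennreal (unit_ball_vol (real DIM('a)) * (2 * r) ^ DIM('a)))"
    using r by (intro sum.cong refl emeasure_ball) simp
  also have "\<dots> = ennreal (real N * (unit_ball_vol (real DIM('a)) * (2 * r) ^ DIM('a)))"
    using r by (simp add: ennreal_mult' ennreal_of_nat_eq_real_of_nat)
  also have "\<dots> \<le> ennreal (unit_ball_vol (real DIM('a)) * 2 ^ (DIM('a) + 1) * r ^ (DIM('a) - 1))"
  proof (rule ennreal_leI)
    \<comment> \<open>One layer more than the integer part of \<open>1 / r\<close>; since
      \<open>r \<le> 1\<close> the number is at most \<open>2 / r\<close>, which adds a factor 2 and
      lowers the power of \<open>r\<close> by one.\<close>
    have "real N \<le> 1 / r + 1" using r by (simp add: N_def)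
    also have "\<dots> \<le> 2 / r" using r by (simp add: field_simps)
    finally have "real N * (unit_ball_vol (real DIM('a)) * (2 * r) ^ DIM('a)) \<le> 2 / r * (unit_ball_vol (real DIM('a)) * (2 * r) ^ DIM('a))"
      using r by (intro mult_right_mono) auto
    also have "\<dots> = unit_ball_vol (real DIM('a)) * 2 ^ (DIM('a) + 1) * (r ^ DIM('a) / r)"
      by (simp add: power_mult_distrib)
    also have "r ^ DIM('a) / r = r ^ (DIM('a) - 1)"
      using r power_diff[of r 1 "DIM('a)"] by simp
    finally show "real N * (unit_ball_vol (real DIM('a)) * (2 * r) ^ DIM('a)) \<le> unit_ball_vol (real DIM('a)) * 2 ^ (DIM('a) + 1) * r ^ (DIM('a) - 1)" .
  qed
  finally show ?thesis .
qed

text \<open>Small balls are covered by \<open>prism_ball_small\<close>. For \<open>r > 1\<close> the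
  power of \<open>r\<close> is at least 1, and the prism over any part of a facet lies in a fixed
  ball of volume \<open>T\<close>. Summing over the finitely many facets gives
  \<open>A\<close>.\<close>

lemma surface_ahlfors:
  obtains A where "A \<ge> 0" "\<And>z r. r > 0 \<Longrightarrow> emeasure S (ball z r \<inter> frontier \<Omega>) \<le> ennreal (A * r ^ (DIM('a) - 1))"
    "emeasure S (frontier \<Omega>) < \<infinity>"
proof -
  have "bounded (frontier \<Omega>)" 
    using bounded_closure[OF bounded_\<Omega>] by (rule bounded_subset) (auto simp: frontier_def)
  then obtain R where R: "R > 0" "frontier \<Omega> \<subseteq> ball 0 R" using bounded_subset_ballD[of _ 0] by auto
  define V where "V = unit_ball_vol (real DIM('a))"
  have V: "V \<ge> 0" by (simp add: V_def)
  define T where "T = V * (R + 2) ^ DIM('a)"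
  have T: "T \<ge> 0" using V R by (simp add: T_def)
  have big: "emeasure lborel (prism \<Omega> (X \<inter> F)) \<le> ennreal T" if F: "F \<in> facets \<Omega>" for X F
  proof -
    obtain n where n: "norm n = 1" "\<And>x. x \<in> F \<Longrightarrow> outer_normal \<Omega> x = n" "F \<subseteq> frontier \<Omega>"
      using facet_normal[OF open_\<Omega> F] by metis
    have "prism \<Omega> (X \<inter> F) \<subseteq> ball 0 (R + 2)"
    proof
      fix p assume "p \<in> prism \<Omega> (X \<inter> F)"
      then obtain x s where p: "p = x + s *\<^sub>R n" "x \<in> F" and s: "0 \<le> s" "s \<le> 1"
        using n(2) by (auto simp: prism_def)
      have "norm x < R" using p n(3) R by auto
      moreover have "norm (s *\<^sub>R n) \<le> 1" using s n by simp
      ultimately show "p \<in> ball 0 (R + 2)" using norm_triangle_ineq[of x "s *\<^sub>R n"] p by simp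
    qed
    then have "emeasure lborel (prism \<Omega> (X \<inter> F)) \<le> emeasure lborel (ball (0::'a) (R + 2))" by (rule emeasure_mono) simp
    also have "\<dots> = ennreal T" using R by (simp add: emeasure_ball T_def V_def)
    finally show ?thesis .
  qed
  define A0 where "A0 = V * 2 ^ (DIM('a) + 1) + T"
  have A0: "A0 \<ge> 0" using V T by (simp add: A0_def)
  define A where "A = real (card (facets \<Omega>)) * A0"
  show ?thesis
  proof (rule that)
    show "A \<ge> 0" using A0 by (simp add: A_def)
    have "emeasure S (frontier \<Omega>) \<le> (\<Sum>F\<in>facets \<Omega>. emeasure lborel (prism \<Omega> (frontier \<Omega> \<inter> F)))" by (rule emeasure_S_le)
    also have "\<dots> \<le> (\<Sum>F\<in>facets \<Omega>. ennreal T)" by (intro sum_mono big)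
    also have "\<dots> < \<infinity>" by (simp add: ennreal_mult_less_top of_nat_less_top)
    finally show "emeasure S (frontier \<Omega>) < \<infinity>" .
    fix z :: 'a and r :: real assume r: "r > 0"
    have sub: "emeasure lborel (prism \<Omega> (ball z r \<inter> frontier \<Omega> \<inter> F)) \<le> ennreal (A0 * r ^ (DIM('a) - 1))" if F: "F \<in> facets \<Omega>" for F
    proof (cases "r \<le> 1")
      case True
      have "F \<subseteq> frontier \<Omega>" using facet_normal[OF open_\<Omega> F] by metis
      then have "ball z r \<inter> frontier \<Omega> \<inter> F = ball z r \<inter> F" by auto
      then have "emeasure lborel (prism \<Omega> (ball z r \<inter> frontier \<Omega> \<inter> F)) \<le> ennreal (V * 2 ^ (DIM('a) + 1) * r ^ (DIM('a) - 1))"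
        using prism_ball_small[OF F r True, of z] by (simp add: V_def)
      also have "\<dots> \<le> ennreal (A0 * r ^ (DIM('a) - 1))"
        using r T by (intro ennreal_leI mult_right_mono) (auto simp: A0_def)
      finally show ?thesis .
    next
      case False
      have "emeasure lborel (prism \<Omega> (ball z r \<inter> frontier \<Omega> \<inter> F)) \<le> ennreal (T * 1)" using big[OF F] by simp
      also have "\<dots> \<le> ennreal (A0 * r ^ (DIM('a) - 1))"
        using False T V A0 by (intro ennreal_leI mult_mono one_le_power) (auto simp: A0_def)
      finally show ?thesis .
    qed
    have "emeasure S (ball z r \<inter> frontier \<Omega>) \<le> (\<Sum>F\<in>facets \<Omega>. ennreal (A0 * r ^ (DIM('a) - 1)))"
      by (rule order_trans[OF emeasure_S_le]) (intro sum_mono sub)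
    also have "\<dots> = ennreal (A * r ^ (DIM('a) - 1))"
      using r A0 by (simp add: A_def ennreal_mult' ennreal_of_nat_eq_real_of_nat mult.assoc)
    finally show "emeasure S (ball z r \<inter> frontier \<Omega>) \<le> ennreal (A * r ^ (DIM('a) - 1))" .
  qed
qed

lemma finite_measure_S: "finite_measure S"
  using surface_ahlfors by (intro finite_measureI) (metis space_S less_irrefl infinity_ennreal_def)

text \<open>\<open>S\<close> lives on the Borel sets of the frontier. Its image on all Borel sets of
  the space is the measure to which \<open>trace_patch\<close> applies.\<close>

definition \<mu> :: "'a measure" where "\<mu> = distr S borel (\<lambda>x. x)"

lemma id_S: "(\<lambda>x. x) \<in> S \<rightarrow>\<^sub>M borel"
  by (rule S_measurable) simp

lemma sets_mu: "sets \<mu> = sets borel"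
  by (simp add: \<mu>_def)

lemma nn_integral_mu: "f \<in> borel_measurable borel \<Longrightarrow> (\<integral>\<^sup>+x. f x \<partial>\<mu>) = (\<integral>\<^sup>+x. f x \<partial>S)"
  unfolding \<mu>_def by (rule nn_integral_distr[OF id_S]) simp

lemma emeasure_mu: "B \<in> sets borel \<Longrightarrow> emeasure \<mu> B = emeasure S (B \<inter> frontier \<Omega>)"
  unfolding \<mu>_def by (subst emeasure_distr[OF id_S]) (auto simp: space_S)

lemma finite_measure_mu: "finite_measure \<mu>"
  unfolding \<mu>_def by (intro finite_measure.finite_measure_distr finite_measure_S id_S)

subsection \<open>Lipschitz patches\<close>

definition lipschitz_patch :: "'a set \<Rightarrow> ('a \<Rightarrow> real) \<Rightarrow> 'a \<Rightarrow> real \<Rightarrow> real \<Rightarrow> bool" where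
  "lipschitz_patch U \<psi> e \<kappa> \<Lambda> \<longleftrightarrow> open U \<and> norm e = 1 \<and> 0 < \<kappa> \<and> \<kappa> \<le> 1/2 \<and> \<Lambda> > 0 \<and>
     (\<forall>x y. \<bar>\<psi> x - \<psi> y\<bar> \<le> \<Lambda> * norm (x - y)) \<and>
     (\<forall>x\<in>U. x \<in> \<Omega> \<longleftrightarrow> \<psi> x > 0) \<and> (\<forall>x\<in>U \<inter> frontier \<Omega>. \<psi> x = 0) \<and>
     (\<forall>x \<tau> v. \<tau> > 0 \<longrightarrow> v \<in> ball e \<kappa> \<longrightarrow> \<psi> (x + \<tau> *\<^sub>R v) \<ge> \<psi> x + \<tau> / 2)"

lemma lipschitz_patch_exists:
  assumes z: "z \<in> frontier \<Omega>"
  shows "\<exists>U \<psi> e \<kappa> \<Lambda>. z \<in> U \<and> lipschitz_patch U \<psi> e \<kappa> \<Lambda>"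
proof -
  obtain e \<gamma> L U where e: "norm e = 1" and L: "L-lipschitz_on UNIV \<gamma>"
    and inv: "\<And>x s. \<gamma> (x + s *\<^sub>R e) = \<gamma> x" and U: "open U" "z \<in> U"
    and eq: "\<Omega> \<inter> U = {x \<in> U. \<gamma> x < x \<bullet> e}"
    using lipschitz_\<Omega> z unfolding lipschitz_boundary_def by blast
  have L0: "L \<ge> 0" using L lipschitz_on_nonneg by blast
  have lip: "\<bar>\<gamma> x - \<gamma> y\<bar> \<le> L * norm (x - y)" for x y
    using lipschitz_onD[OF L, of x y] by (simp add: dist_norm)
  define \<psi> where "\<psi> x = x \<bullet> e - \<gamma> x" for x
  \<comment> \<open>Moving by \<open>\<tau> *\<^sub>R v\<close> with \<open>v\<close> within
    \<open>\<kappa>\<close> of \<open>e\<close> raises the coordinate along \<open>e\<close> by at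
    least \<open>\<tau> * (1 - \<kappa>)\<close> and \<open>\<gamma>\<close> by at most
    \<open>L * (\<tau> * \<kappa>)\<close>; the choice \<open>(1 + L) * \<kappa> = 1/2\<close>
    leaves the gain \<open>\<tau> / 2\<close>.\<close>
  define \<kappa> where "\<kappa> = 1 / (2 * (1 + L))"
  have \<kappa>: "0 < \<kappa>" "\<kappa> \<le> 1/2" "(1 + L) * \<kappa> = 1/2" using L0 by (auto simp: \<kappa>_def field_simps)
  have lip\<psi>: "\<bar>\<psi> x - \<psi> y\<bar> \<le> (1 + L) * norm (x - y)" for x y
  proof -
    have "\<bar>(x - y) \<bullet> e\<bar> \<le> norm (x - y)" using Cauchy_Schwarz_ineq2[of "x - y" e] e by simp
    moreover have "\<psi> x - \<psi> y = (x - y) \<bullet> e - (\<gamma> x - \<gamma> y)" by (simp add: \<psi>_def inner_diff_left)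
    ultimately show ?thesis using lip[of x y] by (simp add: distrib_right)
  qed
  have inc: "\<psi> (x + \<tau> *\<^sub>R v) \<ge> \<psi> x + \<tau> / 2" if \<tau>: "\<tau> > 0" and v: "v \<in> ball e \<kappa>" for x \<tau> v
  proof -
    have nv: "norm (v - e) < \<kappa>" using v by (simp add: dist_norm norm_minus_commute)
    have "\<gamma> (x + \<tau> *\<^sub>R v) = \<gamma> (x + \<tau> *\<^sub>R (v - e))"
      using inv[of "x + \<tau> *\<^sub>R (v - e)" \<tau>] by (simp add: algebra_simps)
    moreover have "\<bar>\<gamma> (x + \<tau> *\<^sub>R (v - e)) - \<gamma> x\<bar> \<le> L * norm (\<tau> *\<^sub>R (v - e))"
      using lip[of "x + \<tau> *\<^sub>R (v - e)" x] by simp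
    moreover have "L * norm (\<tau> *\<^sub>R (v - e)) \<le> L * (\<tau> * \<kappa>)" using L0 \<tau> nv by (intro mult_left_mono) auto
    ultimately have 1: "\<gamma> (x + \<tau> *\<^sub>R v) \<le> \<gamma> x + L * (\<tau> * \<kappa>)" by linarith
    have "\<bar>(v - e) \<bullet> e\<bar> \<le> norm (v - e)" using Cauchy_Schwarz_ineq2[of "v - e" e] e by simp
    then have "v \<bullet> e \<ge> 1 - \<kappa>" using nv e by (simp add: inner_diff_left norm_eq_1)
    then have "\<tau> * (v \<bullet> e) \<ge> \<tau> * (1 - \<kappa>)" using \<tau> by simp
    then have 2: "(x + \<tau> *\<^sub>R v) \<bullet> e \<ge> x \<bullet> e + \<tau> * (1 - \<kappa>)" by (simp add: inner_add_left)
    have "\<tau> * (1 - \<kappa>) - L * (\<tau> * \<kappa>) = \<tau> * (1 - (1 + L) * \<kappa>)" by (simp add: algebra_simps)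
    also have "\<dots> = \<tau> / 2" unfolding \<kappa>(3) by simp
    finally show ?thesis using 1 2 by (simp add: \<psi>_def)
  qed
  have cont: "continuous_on UNIV \<gamma>" using L lipschitz_on_continuous_on by blast
  have mem: "x \<in> \<Omega> \<longleftrightarrow> \<psi> x > 0" if "x \<in> U" for x using eq that by (auto simp: \<psi>_def)
  \<comment> \<open>Frontier points are outside the open set \<open>\<Omega>\<close>, hence not
    above the graph; strictly below the graph there would be a neighbourhood free of
    \<open>\<Omega>\<close>.\<close>
  have fr: "\<psi> x = 0" if x: "x \<in> U" "x \<in> frontier \<Omega>" for x
  proof -
    have "x \<notin> \<Omega>" using x open_\<Omega> by (simp add: frontier_def interior_open)
    then have le: "\<psi> x \<le> 0" using mem[OF x(1)] by auto
    have "\<not> \<psi> x < 0"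
    proof
      assume lt: "\<psi> x < 0"
      have "open {y. \<psi> y < 0}"
        unfolding \<psi>_def using cont by (intro open_Collect_less continuous_intros) auto
      then have op: "open (U \<inter> {y. \<psi> y < 0})" using U by auto
      have "x \<in> closure \<Omega>" using x by (simp add: frontier_def)
      then have "(U \<inter> {y. \<psi> y < 0}) \<inter> \<Omega> \<noteq> {}"
        using open_Int_closure_eq_empty[OF op, of \<Omega>] x lt by auto
      then show False using mem by force
    qed
    with le show ?thesis by simp
  qed
  have "lipschitz_patch U \<psi> e \<kappa> (1 + L)"
    unfolding lipschitz_patch_def using U e \<kappa> L0 lip\<psi> mem fr inc by auto
  with U show ?thesis by blast
qed

lemma lipschitz_patch_cone_patch: "lipschitz_patch U \<psi> e \<kappa> \<Lambda> \<Longrightarrow> cone_patch U e \<kappa>"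
proof -
  assume p: "lipschitz_patch U \<psi> e \<kappa> \<Lambda>"
  show ?thesis
    unfolding cone_patch_def
  proof (intro conjI ballI allI impI)
    show "open U" "\<kappa> > 0" using p by (auto simp: lipschitz_patch_def)
    fix x \<tau> v assume x: "x \<in> \<Omega> \<inter> U" and \<tau>: "\<tau> > 0" and v: "v \<in> ball e \<kappa>" and U: "x + \<tau> *\<^sub>R v \<in> U"
    have "\<psi> x > 0" using p x unfolding lipschitz_patch_def by blast
    moreover have "\<psi> (x + \<tau> *\<^sub>R v) \<ge> \<psi> x + \<tau> / 2" using p \<tau> v unfolding lipschitz_patch_def by blast
    ultimately have "\<psi> (x + \<tau> *\<^sub>R v) > 0" using \<tau> by linarith
    then show "x + \<tau> *\<^sub>R v \<in> \<Omega>" using p U unfolding lipschitz_patch_def by blast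
  qed
qed

theorem smooth_dense: "v \<in> H 1 \<Omega> \<Longrightarrow> smooth_approximable v"
proof (rule smooth_dense_H1)
  fix z assume "z \<in> closure \<Omega>"
  then consider "z \<in> \<Omega>" | "z \<in> frontier \<Omega>" using open_\<Omega> by (auto simp: frontier_def interior_open)
  then show "\<exists>U e \<kappa>. z \<in> U \<and> cone_patch U e \<kappa>"
  proof cases
    case 1
    \<comment> \<open>At interior points \<open>\<Omega>\<close> is its own patch: with
      \<open>U = \<Omega>\<close> the cone condition is trivial, and mollification is the ordinary
      one around 0.\<close>
    have "cone_patch \<Omega> 0 1" using open_\<Omega> by (auto simp: cone_patch_def)
    with 1 show ?thesis by blast
  next
    case 2
    obtain U \<psi> e \<kappa> \<Lambda> where U: "z \<in> U" "lipschitz_patch U \<psi> e \<kappa> \<Lambda>"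
      using lipschitz_patch_exists[OF 2] by blast
    from U(1) lipschitz_patch_cone_patch[OF U(2)] show ?thesis by blast
  qed
qed


subsection \<open>The trace inequality for smooth functions\<close>

definition boundary_part :: "'a set \<Rightarrow> real \<Rightarrow> 'a set" where
  "boundary_part U \<eta> = {x \<in> frontier \<Omega>. ball x \<eta> \<subseteq> U}"

lemma boundary_part_borel: "boundary_part U \<eta> \<in> sets borel"
proof -
  have "boundary_part U \<eta> = frontier \<Omega> - (\<Union>y\<in>- U. ball y \<eta>)"
    by (auto simp: boundary_part_def subset_iff dist_commute)
  moreover have "open (\<Union>y\<in>- U. ball y \<eta>)" by auto
  ultimately show ?thesis by auto
qed

lemma energy_smooth: "smooth \<phi> \<Longrightarrow> energy \<phi> = ennreal ((H_norm 1 \<Omega> \<phi>)\<^sup>2)"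
proof -
  assume \<phi>: "smooth \<phi>"
  have L: "\<phi> \<in> L2 M" "\<And>b. b \<in> Basis \<Longrightarrow> dir_deriv b \<phi> \<in> L2 M"
    by (intro smooth_L2 smooth_dir_deriv \<phi>; assumption)+
  have [measurable]: "\<phi> \<in> borel_measurable borel" by (rule smooth_borel[OF \<phi>])
  have Db: "dir_deriv b \<phi> \<in> borel_measurable borel" if "b \<in> Basis" for b
    by (intro smooth_borel smooth_dir_deriv \<phi> that)
  have t0: "(\<lambda>z. indicator \<Omega> z * ennreal ((\<phi> z)\<^sup>2)) \<in> borel_measurable lborel" by measurable
  have t: "(\<lambda>z. indicator \<Omega> z * ennreal ((dir_deriv b \<phi> z)\<^sup>2)) \<in> borel_measurable lborel" if "b \<in> Basis" for b
  proof -
    define g where "g = dir_deriv b \<phi>"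
    have [measurable]: "g \<in> borel_measurable borel" unfolding g_def by (rule Db[OF that])
    show ?thesis unfolding g_def[symmetric] by measurable
  qed
  have *: "(\<integral>\<^sup>+z. indicator \<Omega> z * ennreal ((f z)\<^sup>2) \<partial>lborel) = ennreal ((l2_norm M f)\<^sup>2)" if "f \<in> L2 M" for f
    unfolding nn_integral_sq[OF that, symmetric] nn_integral_lebesgue_on[OF sets_\<Omega>] by (simp add: mult.commute)
  have "energy \<phi> = (\<integral>\<^sup>+z. indicator \<Omega> z * ennreal ((\<phi> z)\<^sup>2) + (\<Sum>b\<in>Basis. indicator \<Omega> z * ennreal ((dir_deriv b \<phi> z)\<^sup>2)) \<partial>lborel)"
    unfolding energy_def
    by (intro nn_integral_cong) (simp add: ennreal_plus sum_nonneg distrib_left sum_distrib_left flip: sum_ennreal)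
  also have "\<dots> = (\<integral>\<^sup>+z. indicator \<Omega> z * ennreal ((\<phi> z)\<^sup>2) \<partial>lborel) + (\<integral>\<^sup>+z. (\<Sum>b\<in>Basis. indicator \<Omega> z * ennreal ((dir_deriv b \<phi> z)\<^sup>2)) \<partial>lborel)"
    by (rule nn_integral_add[OF t0]) (intro borel_measurable_sum t)
  also have "(\<integral>\<^sup>+z. (\<Sum>b\<in>Basis. indicator \<Omega> z * ennreal ((dir_deriv b \<phi> z)\<^sup>2)) \<partial>lborel)
    = (\<Sum>b\<in>Basis. \<integral>\<^sup>+z. indicator \<Omega> z * ennreal ((dir_deriv b \<phi> z)\<^sup>2) \<partial>lborel)"
    by (rule nn_integral_sum) (rule t)
  also have "(\<integral>\<^sup>+z. indicator \<Omega> z * ennreal ((\<phi> z)\<^sup>2) \<partial>lborel) = ennreal ((l2_norm M \<phi>)\<^sup>2)" by (rule *[OF L(1)])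
  also have "(\<Sum>b\<in>Basis. \<integral>\<^sup>+z. indicator \<Omega> z * ennreal ((dir_deriv b \<phi> z)\<^sup>2) \<partial>lborel) = (\<Sum>b\<in>Basis. ennreal ((l2_norm M (dir_deriv b \<phi>))\<^sup>2))"
    by (intro sum.cong refl * L(2))
  also have "ennreal ((l2_norm M \<phi>)\<^sup>2) + (\<Sum>b\<in>Basis. ennreal ((l2_norm M (dir_deriv b \<phi>))\<^sup>2)) = ennreal ((H_norm 1 \<Omega> \<phi>)\<^sup>2)"
    by (subst H1_norm_sq[OF L(1) has_weak_deriv_smooth[OF \<phi>]]) (auto simp: ennreal_plus sum_nonneg simp flip: sum_ennreal)
  finally show ?thesis .
qed

text \<open>The estimates of finitely many patches are added up. Pairs of boundary points closer
  than \<open>\<delta>\<close> lie in a common patch and are covered by \<open>near_pairs\<close>;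
  for the others the denominator is bounded below, and the L2 bound suffices because the total area
  is finite.\<close>

lemma trace_inequality_smooth:
  obtains C where "C \<ge> 0"
    "\<And>\<phi>. smooth \<phi> \<Longrightarrow> (\<integral>\<^sup>+x. ennreal ((\<phi> x)\<^sup>2) \<partial>S) \<le> ennreal (C * (H_norm 1 \<Omega> \<phi>)\<^sup>2)"
    "\<And>\<phi>. smooth \<phi> \<Longrightarrow> slobodeckij S (DIM('a) - 1) (1/2) \<phi> \<le> ennreal (C * (H_norm 1 \<Omega> \<phi>)\<^sup>2)"
proof -
  have "\<forall>z\<in>frontier \<Omega>. \<exists>U \<psi> e \<kappa> \<Lambda>. z \<in> U \<and> lipschitz_patch U \<psi> e \<kappa> \<Lambda>"
    using lipschitz_patch_exists by blast
  then obtain U \<psi> e \<kappa> \<Lambda> where patch: "\<And>z. z \<in> frontier \<Omega> \<Longrightarrow> z \<in> U z"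
    "\<And>z. z \<in> frontier \<Omega> \<Longrightarrow> lipschitz_patch (U z) (\<psi> z) (e z) (\<kappa> z) (\<Lambda> z)"
    by metis
  have opU: "open (U z)" if "z \<in> frontier \<Omega>" for z using patch(2)[OF that] by (simp add: lipschitz_patch_def)
  have comp: "compact (frontier \<Omega>)"
    using bounded_\<Omega> by (simp add: compact_frontier_bounded)
  then obtain Z where Z: "finite Z" "Z \<subseteq> frontier \<Omega>" "frontier \<Omega> \<subseteq> (\<Union>z\<in>Z. U z)"
    by (rule compactE_image[of _ "frontier \<Omega>" U]) (use opU patch(1) in auto)
  obtain d where d: "0 < d" "\<And>x. x \<in> frontier \<Omega> \<Longrightarrow> \<exists>G\<in>U ` Z. ball x d \<subseteq> G"
    by (rule Heine_Borel_lemma[OF comp, of "U ` Z"]) (use Z opU in auto)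
  \<comment> \<open>Half the Lebesgue number of the cover: a point within \<open>\<eta>\<close> of
    \<open>x\<close> still has its \<open>\<eta>\<close>-ball inside the patch chosen for
    \<open>x\<close>.\<close>
  define \<eta> where "\<eta> = d / 2"
  have \<eta>: "\<eta> > 0" using d by (simp add: \<eta>_def)
  define P where "P z = boundary_part (U z) \<eta>" for z
  obtain A where A: "A \<ge> 0" "\<And>z r. r > 0 \<Longrightarrow> emeasure S (ball z r \<inter> frontier \<Omega>) \<le> ennreal (A * r ^ (DIM('a) - 1))"
    "emeasure S (frontier \<Omega>) < \<infinity>" using surface_ahlfors by metis
  have tp: "trace_patch \<Omega> \<mu> A (U z) (P z) (\<psi> z) (e z) (\<kappa> z) (\<Lambda> z) \<eta>" if z: "z \<in> Z" for z
  proof (intro trace_patch.intro trace_patch_axioms.intro bounded_open_axioms)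
    have p: "lipschitz_patch (U z) (\<psi> z) (e z) (\<kappa> z) (\<Lambda> z)" using patch(2) z Z(2) by blast
    note p' = p[unfolded lipschitz_patch_def]
    show "sets \<mu> = sets borel" by (rule sets_mu)
    show "finite_measure \<mu>" by (rule finite_measure_mu)
    show "emeasure \<mu> (ball x r) \<le> ennreal (A * r ^ (DIM('a) - 1))" if "r > 0" for x r
      using A(2)[OF that, of x] by (simp add: emeasure_mu)
    show "A \<ge> 0" by (rule A)
    show "P z \<in> sets borel" unfolding P_def by (rule boundary_part_borel)
    show "\<bar>\<psi> z x - \<psi> z y\<bar> \<le> \<Lambda> z * norm (x - y)" for x y using p' by blast
    show "\<Lambda> z > 0" "norm (e z) = 1" "0 < \<kappa> z" "\<kappa> z \<le> 1/2" "\<eta> > 0" using p' \<eta> by blast+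
    show "\<psi> z x = 0" if "x \<in> P z" for x
    proof -
      have "x \<in> frontier \<Omega>" "ball x \<eta> \<subseteq> U z" using that by (auto simp: P_def boundary_part_def)
      moreover have "x \<in> ball x \<eta>" using \<eta> by simp
      ultimately show ?thesis using p' by blast
    qed
    show "ball x \<eta> \<subseteq> U z" if "x \<in> P z" for x using that by (simp add: P_def boundary_part_def)
    show "x \<in> \<Omega>" if "x \<in> U z" "\<psi> z x > 0" for x using p' that by blast
    show "\<psi> z (x + \<tau> *\<^sub>R v) \<ge> \<psi> z x + \<tau> / 2" if "\<tau> > 0" "v \<in> ball (e z) (\<kappa> z)" for x \<tau> v using p' that by blast
  qed
  let ?near = "\<lambda>z. trace_patch.near_pairs \<mu> (P z) (\<kappa> z) \<eta>"
  let ?ap = "\<lambda>z. trace_patch.aperture (\<kappa> z)"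
  have "\<forall>z\<in>Z. \<exists>C\<ge>0. \<forall>\<phi>. smooth \<phi> \<longrightarrow> (\<integral>\<^sup>+x. indicator (P z) x * ennreal ((\<phi> x)\<^sup>2) \<partial>\<mu>) \<le> ennreal C * energy \<phi>"
    using trace_patch.trace_L2_patch[OF tp] by metis
  then obtain C1 where C1: "\<And>z. z \<in> Z \<Longrightarrow> C1 z \<ge> 0"
    "\<And>z \<phi>. z \<in> Z \<Longrightarrow> smooth \<phi> \<Longrightarrow> (\<integral>\<^sup>+x. indicator (P z) x * ennreal ((\<phi> x)\<^sup>2) \<partial>\<mu>) \<le> ennreal (C1 z) * energy \<phi>"
    by metis
  have "\<forall>z\<in>Z. \<exists>C\<ge>0. \<forall>\<phi>. smooth \<phi> \<longrightarrow> ?near z \<phi> \<le> ennreal C * energy \<phi>"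
    using trace_patch.trace_slobodeckij_patch[OF tp] by metis
  then obtain C2 where C2: "\<And>z. z \<in> Z \<Longrightarrow> C2 z \<ge> 0"
    "\<And>z \<phi>. z \<in> Z \<Longrightarrow> smooth \<phi> \<Longrightarrow> ?near z \<phi> \<le> ennreal (C2 z) * energy \<phi>"
    by metis
  define K1 where "K1 = (\<Sum>z\<in>Z. C1 z)"
  define K2 where "K2 = (\<Sum>z\<in>Z. C2 z)"
  have K0: "K1 \<ge> 0" "K2 \<ge> 0" unfolding K1_def K2_def using C1 C2 by (auto intro: sum_nonneg)
  have cover: "\<exists>z\<in>Z. x \<in> P z \<and> (\<forall>y \<in> frontier \<Omega>. norm (x - y) < \<eta> \<longrightarrow> y \<in> P z)" if x: "x \<in> frontier \<Omega>" for x
  proof -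
    obtain z where z: "z \<in> Z" "ball x d \<subseteq> U z" using d(2)[OF x] by auto
    have "ball y \<eta> \<subseteq> U z" if "norm (x - y) < \<eta>" for y
    proof
      fix w assume "w \<in> ball y \<eta>"
      then have "dist x w < d" using dist_triangle[of x w y] that by (simp add: \<eta>_def dist_norm)
      then show "w \<in> U z" using z(2) by auto
    qed
    moreover from this[of x] have "ball x \<eta> \<subseteq> U z" using \<eta> by simp
    ultimately show ?thesis using z(1) x by (auto simp: P_def boundary_part_def)
  qed
  have L2: "(\<integral>\<^sup>+x. ennreal ((\<phi> x)\<^sup>2) \<partial>S) \<le> ennreal (K1 * (H_norm 1 \<Omega> \<phi>)\<^sup>2)" if \<phi>: "smooth \<phi>" for \<phi>
  proof -
    have m[measurable]: "\<phi> \<in> borel_measurable borel" by (rule smooth_borel[OF \<phi>])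
    have [measurable]: "P z \<in> sets borel" for z unfolding P_def by (rule boundary_part_borel)
    have "(\<integral>\<^sup>+x. ennreal ((\<phi> x)\<^sup>2) \<partial>S) \<le> (\<integral>\<^sup>+x. (\<Sum>z\<in>Z. indicator (P z) x * ennreal ((\<phi> x)\<^sup>2)) \<partial>S)"
    proof (intro nn_integral_mono)
      fix x assume "x \<in> space S"
      then obtain z where z: "z \<in> Z" "x \<in> P z" using cover by (auto simp: space_S)
      have "ennreal ((\<phi> x)\<^sup>2) = indicator (P z) x * ennreal ((\<phi> x)\<^sup>2)" using z by simp
      also have "\<dots> \<le> (\<Sum>z\<in>Z. indicator (P z) x * ennreal ((\<phi> x)\<^sup>2))"
        by (rule member_le_sum[OF z(1) _ Z(1)]) simp
      finally show "ennreal ((\<phi> x)\<^sup>2) \<le> (\<Sum>z\<in>Z. indicator (P z) x * ennreal ((\<phi> x)\<^sup>2))" .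
    qed
    also have "\<dots> = (\<integral>\<^sup>+x. (\<Sum>z\<in>Z. indicator (P z) x * ennreal ((\<phi> x)\<^sup>2)) \<partial>\<mu>)"
      by (rule nn_integral_mu[symmetric]) measurable
    also have "\<dots> = (\<Sum>z\<in>Z. \<integral>\<^sup>+x. indicator (P z) x * ennreal ((\<phi> x)\<^sup>2) \<partial>\<mu>)"
      by (rule nn_integral_sum) (simp add: measurable_cong_sets[OF sets_mu refl])
    also have "\<dots> \<le> (\<Sum>z\<in>Z. ennreal (C1 z) * energy \<phi>)" by (intro sum_mono C1 \<phi>)
    also have "\<dots> = ennreal K1 * energy \<phi>" using C1 by (simp add: K1_def sum_distrib_right[symmetric] sum_ennreal)
    also have "\<dots> = ennreal (K1 * (H_norm 1 \<Omega> \<phi>)\<^sup>2)" using K0 by (simp add: energy_smooth[OF \<phi>] ennreal_mult)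
    finally show ?thesis .
  qed
  \<comment> \<open>One threshold for all patches: dividing \<open>\<eta>\<close> by more than the
    sum of the apertures serves each of them.\<close>
  obtain \<delta> where \<delta>: "\<delta> > 0" "\<delta> \<le> \<eta>" "\<And>z r. z \<in> Z \<Longrightarrow> 0 \<le> r \<Longrightarrow> r < \<delta> \<Longrightarrow> ?ap z * r < \<eta>"
  proof -
    define m where "m = (\<Sum>z\<in>Z. ?ap z) + 1"
    have ap: "?ap z \<ge> 1" if "z \<in> Z" for z using trace_patch.aperture(1)[OF tp[OF that]] .
    have m: "m \<ge> 1" unfolding m_def using ap by (simp add: sum_nonneg order_trans[OF zero_le_one])
    show ?thesis
    proof (rule that[of "\<eta> / m"])
      show "\<eta> / m > 0" "\<eta> / m \<le> \<eta>" using m \<eta> by (auto simp: field_simps)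
      fix z and r :: real assume z: "z \<in> Z" and r: "0 \<le> r" "r < \<eta> / m"
      have "?ap z \<le> (\<Sum>z\<in>Z. ?ap z)" by (rule member_le_sum[OF z _ Z(1)]) (use ap in \<open>auto intro: order_trans[OF zero_le_one]\<close>)
      then have "?ap z \<le> m" by (simp add: m_def)
      then have "?ap z * r \<le> m * r" using r by (intro mult_right_mono) auto
      also have "\<dots> < \<eta>" using r(2) m by (simp add: field_simps)
      finally show "?ap z * r < \<eta>" .
    qed
  qed
  define n where "n = DIM('a)"
  define s where "s = measure S (frontier \<Omega>)"
  have s: "emeasure S (frontier \<Omega>) = ennreal s" "s \<ge> 0"
    using A(3) by (auto simp: s_def emeasure_eq_ennreal_measure)
  \<comment> \<open>The far pairs: the factor \<open>2 / \<delta> ^ n\<close> once for each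
    variable, times the total area \<open>s\<close> and the L2 constant \<open>K1\<close>.\<close>
  define K3 where "K3 = 4 / \<delta> ^ n * s * K1"
  have K3: "K3 \<ge> 0" using \<delta> s K0 by (simp add: K3_def)
  have slob: "slobodeckij S (DIM('a) - 1) (1/2) \<phi> \<le> ennreal ((K2 + K3) * (H_norm 1 \<Omega> \<phi>)\<^sup>2)" if \<phi>: "smooth \<phi>" for \<phi>
  proof -
    have m[measurable]: "\<phi> \<in> borel_measurable borel" by (rule smooth_borel[OF \<phi>])
    have mS: "\<phi> \<in> borel_measurable S" by (rule S_measurable[OF m])
    have Pm[measurable]: "P z \<in> sets borel" for z unfolding P_def by (rule boundary_part_borel)
    have mmu: "f \<in> borel_measurable borel \<Longrightarrow> f \<in> borel_measurable \<mu>" for f :: "'a \<Rightarrow> ennreal"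
      by (simp add: measurable_cong_sets[OF sets_mu refl])
    let ?q = "\<lambda>z x y. indicator (P z) x * indicator (P z) y *
       (if ?ap z * norm (x - y) < \<eta> then ennreal ((\<phi> x - \<phi> y)\<^sup>2 / norm (x - y) ^ DIM('a)) else 0)"
    let ?f = "\<lambda>x y. ennreal (2 / \<delta> ^ n) * (ennreal ((\<phi> x)\<^sup>2) + ennreal ((\<phi> y)\<^sup>2))"
    have q1: "?q z x \<in> borel_measurable borel" for z x by measurable
    interpret mu: finite_measure \<mu> by (rule finite_measure_mu)
    have q2: "(\<lambda>x. \<integral>\<^sup>+y. ?q z x y \<partial>\<mu>) \<in> borel_measurable borel" for z
    proof -
      have [measurable_cong]: "sets \<mu> = sets borel" by (rule sets_mu)
      show ?thesis by measurable
    qed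
    have pt: "ennreal ((\<phi> x - \<phi> y)\<^sup>2 / norm (x - y) powr (real (DIM('a) - 1) + 2 * (1/2))) \<le> (\<Sum>z\<in>Z. ?q z x y) + ?f x y"
      if x: "x \<in> frontier \<Omega>" and y: "y \<in> frontier \<Omega>" for x y
    proof (cases "x = y")
      case False
      \<comment> \<open>On a set of dimension \<open>n - 1\<close> the seminorm of order 1/2 has
        exponent \<open>n\<close>, so \<open>powr\<close> becomes the natural power used in
        \<open>near_pairs\<close>; positivity of the dimension makes the truncated difference
        exact.\<close>
      have "real (DIM('a) - 1) + 2 * (1/2) = real DIM('a)" using DIM_positive[where 'a='a] by (simp add: of_nat_diff)
      then have pw: "norm (x - y) powr (real (DIM('a) - 1) + 2 * (1/2)) = norm (x - y) ^ DIM('a)"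
        using False by (simp add: powr_realpow)
      show ?thesis
      proof (cases "norm (x - y) < \<delta>")
        case True
        obtain z where z: "z \<in> Z" "x \<in> P z" "y \<in> P z" using cover[OF x] y True \<delta>(2) by force
        have "ennreal ((\<phi> x - \<phi> y)\<^sup>2 / norm (x - y) ^ DIM('a)) = ?q z x y"
          using z \<delta>(3)[OF z(1) _ True] by simp
        also have "\<dots> \<le> (\<Sum>z\<in>Z. ?q z x y)" by (rule member_le_sum[OF z(1) _ Z(1)]) simp
        also have "\<dots> \<le> (\<Sum>z\<in>Z. ?q z x y) + ?f x y" by simp
        finally show ?thesis unfolding pw .
      next
        case far: False
        have "(\<phi> x - \<phi> y)\<^sup>2 / norm (x - y) ^ DIM('a) \<le> (2 * (\<phi> x)\<^sup>2 + 2 * (\<phi> y)\<^sup>2) / \<delta> ^ n"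
          using far \<delta>(1) False sq_diff_le[of "\<phi> x" "\<phi> y"] unfolding n_def by (intro frac_le power_mono) auto
        also have "\<dots> = 2 / \<delta> ^ n * ((\<phi> x)\<^sup>2 + (\<phi> y)\<^sup>2)" by (simp add: distrib_left add_divide_distrib)
        finally have "ennreal ((\<phi> x - \<phi> y)\<^sup>2 / norm (x - y) ^ DIM('a)) \<le> ennreal (2 / \<delta> ^ n * ((\<phi> x)\<^sup>2 + (\<phi> y)\<^sup>2))"
          by (rule ennreal_leI)
        also have "\<dots> = ?f x y" using \<delta>(1) by (subst ennreal_mult) simp_all
        also have "\<dots> \<le> (\<Sum>z\<in>Z. ?q z x y) + ?f x y" by simp
        finally show ?thesis unfolding pw .
      qed
    qed simp
    have inner: "(\<integral>\<^sup>+y. (\<Sum>z\<in>Z. ?q z x y) + ?f x y \<partial>S)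
      = (\<Sum>z\<in>Z. \<integral>\<^sup>+y. ?q z x y \<partial>\<mu>) + ennreal (2 / \<delta> ^ n) * (ennreal ((\<phi> x)\<^sup>2) * ennreal s + (\<integral>\<^sup>+y. ennreal ((\<phi> y)\<^sup>2) \<partial>S))" for x
    proof -
      have "(\<integral>\<^sup>+y. (\<Sum>z\<in>Z. ?q z x y) + ?f x y \<partial>S) = (\<integral>\<^sup>+y. (\<Sum>z\<in>Z. ?q z x y) \<partial>S) + (\<integral>\<^sup>+y. ?f x y \<partial>S)"
        by (rule nn_integral_add) (intro borel_measurable_sum S_measurable q1, use mS in measurable)
      also have "(\<integral>\<^sup>+y. (\<Sum>z\<in>Z. ?q z x y) \<partial>S) = (\<Sum>z\<in>Z. \<integral>\<^sup>+y. ?q z x y \<partial>S)"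
        by (rule nn_integral_sum) (intro S_measurable q1)
      also have "\<dots> = (\<Sum>z\<in>Z. \<integral>\<^sup>+y. ?q z x y \<partial>\<mu>)" by (intro sum.cong refl nn_integral_mu[symmetric] q1)
      also have "(\<integral>\<^sup>+y. ?f x y \<partial>S) = ennreal (2 / \<delta> ^ n) * (\<integral>\<^sup>+y. ennreal ((\<phi> x)\<^sup>2) + ennreal ((\<phi> y)\<^sup>2) \<partial>S)"
        by (rule nn_integral_cmult) (use mS in measurable)
      also have "(\<integral>\<^sup>+y. ennreal ((\<phi> x)\<^sup>2) + ennreal ((\<phi> y)\<^sup>2) \<partial>S) = (\<integral>\<^sup>+y. ennreal ((\<phi> x)\<^sup>2) \<partial>S) + (\<integral>\<^sup>+y. ennreal ((\<phi> y)\<^sup>2) \<partial>S)"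
        by (rule nn_integral_add) (use mS in measurable)
      also have "(\<integral>\<^sup>+y. ennreal ((\<phi> x)\<^sup>2) \<partial>S) = ennreal ((\<phi> x)\<^sup>2) * ennreal s" by (simp add: space_S s)
      finally show ?thesis .
    qed
    define N where "N = (\<integral>\<^sup>+y. ennreal ((\<phi> y)\<^sup>2) \<partial>S)"
    have "slobodeckij S (DIM('a) - 1) (1/2) \<phi>
      \<le> (\<integral>\<^sup>+x. \<integral>\<^sup>+y. (\<Sum>z\<in>Z. ?q z x y) + ?f x y \<partial>S \<partial>S)"
      unfolding slobodeckij_def by (intro nn_integral_mono pt) (auto simp: space_S)
    also have "\<dots> = (\<integral>\<^sup>+x. (\<Sum>z\<in>Z. \<integral>\<^sup>+y. ?q z x y \<partial>\<mu>) + ennreal (2 / \<delta> ^ n) * (ennreal ((\<phi> x)\<^sup>2) * ennreal s + N) \<partial>S)"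
      unfolding N_def by (intro nn_integral_cong inner)
    also have "\<dots> = (\<integral>\<^sup>+x. (\<Sum>z\<in>Z. \<integral>\<^sup>+y. ?q z x y \<partial>\<mu>) \<partial>S) + (\<integral>\<^sup>+x. ennreal (2 / \<delta> ^ n) * (ennreal ((\<phi> x)\<^sup>2) * ennreal s + N) \<partial>S)"
      by (rule nn_integral_add) (intro borel_measurable_sum S_measurable q2, use mS in measurable)
    also have "(\<integral>\<^sup>+x. (\<Sum>z\<in>Z. \<integral>\<^sup>+y. ?q z x y \<partial>\<mu>) \<partial>S) = (\<Sum>z\<in>Z. \<integral>\<^sup>+x. \<integral>\<^sup>+y. ?q z x y \<partial>\<mu> \<partial>S)"
      by (rule nn_integral_sum) (intro S_measurable q2)
    also have "\<dots> = (\<Sum>z\<in>Z. \<integral>\<^sup>+x. \<integral>\<^sup>+y. ?q z x y \<partial>\<mu> \<partial>\<mu>)" by (intro sum.cong refl nn_integral_mu[symmetric] q2)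
    also have "\<dots> = (\<Sum>z\<in>Z. ?near z \<phi>)"
      by (intro sum.cong refl) (simp add: trace_patch.near_pairs_def[OF tp])
    also have "\<dots> \<le> (\<Sum>z\<in>Z. ennreal (C2 z) * energy \<phi>)" by (intro sum_mono C2 \<phi>)
    also have "\<dots> = ennreal (K2 * (H_norm 1 \<Omega> \<phi>)\<^sup>2)"
      using C2 K0 by (simp add: K2_def sum_distrib_right[symmetric] sum_ennreal energy_smooth[OF \<phi>] ennreal_mult sum_nonneg)
    also have "(\<integral>\<^sup>+x. ennreal (2 / \<delta> ^ n) * (ennreal ((\<phi> x)\<^sup>2) * ennreal s + N) \<partial>S) = ennreal (2 / \<delta> ^ n) * (N * ennreal s + N * ennreal s)"
    proof -
      have "(\<integral>\<^sup>+x. ennreal (2 / \<delta> ^ n) * (ennreal ((\<phi> x)\<^sup>2) * ennreal s + N) \<partial>S)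
        = ennreal (2 / \<delta> ^ n) * (\<integral>\<^sup>+x. ennreal ((\<phi> x)\<^sup>2) * ennreal s + N \<partial>S)"
        by (rule nn_integral_cmult) (use mS in measurable)
      also have "(\<integral>\<^sup>+x. ennreal ((\<phi> x)\<^sup>2) * ennreal s + N \<partial>S) = (\<integral>\<^sup>+x. ennreal ((\<phi> x)\<^sup>2) * ennreal s \<partial>S) + (\<integral>\<^sup>+x. N \<partial>S)"
        by (rule nn_integral_add) (use mS in measurable)
      also have "(\<integral>\<^sup>+x. ennreal ((\<phi> x)\<^sup>2) * ennreal s \<partial>S) = N * ennreal s"
        unfolding N_def by (rule nn_integral_multc) (use mS in measurable)
      also have "(\<integral>\<^sup>+x. N \<partial>S) = N * ennreal s" by (simp add: space_S s)
      finally show ?thesis .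
    qed
    also have "\<dots> = ennreal (4 / \<delta> ^ n * s) * N"
    proof -
      have "ennreal (4 / \<delta> ^ n * s) = ennreal (2 / \<delta> ^ n * s) + ennreal (2 / \<delta> ^ n * s)"
        using \<delta>(1) s(2) by (subst ennreal_plus[symmetric]) (auto simp: field_simps)
      also have "ennreal (2 / \<delta> ^ n * s) = ennreal (2 / \<delta> ^ n) * ennreal s"
        using \<delta>(1) s(2) by (intro ennreal_mult) auto
      finally show ?thesis by (simp add: distrib_right distrib_left mult_ac)
    qed
    also have "\<dots> \<le> ennreal (4 / \<delta> ^ n * s) * ennreal (K1 * (H_norm 1 \<Omega> \<phi>)\<^sup>2)"
      unfolding N_def by (intro mult_left_mono L2 \<phi>) simp
    also have "\<dots> = ennreal (K3 * (H_norm 1 \<Omega> \<phi>)\<^sup>2)"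
      using \<delta>(1) s(2) K0 by (subst ennreal_mult[symmetric]) (auto simp: K3_def mult_ac)
    also have "ennreal (K2 * (H_norm 1 \<Omega> \<phi>)\<^sup>2) + ennreal (K3 * (H_norm 1 \<Omega> \<phi>)\<^sup>2) = ennreal ((K2 + K3) * (H_norm 1 \<Omega> \<phi>)\<^sup>2)"
      using K0 K3 by (subst ennreal_plus[symmetric]) (auto simp: distrib_right)
    finally show ?thesis by (auto simp: add_mono)
  qed
  show ?thesis
  proof (rule that[of "K1 + K2 + K3"])
    show "K1 + K2 + K3 \<ge> 0" using K0 K3 by simp
    fix \<phi> :: "'a \<Rightarrow> real" assume \<phi>: "smooth \<phi>"
    show "(\<integral>\<^sup>+x. ennreal ((\<phi> x)\<^sup>2) \<partial>S) \<le> ennreal ((K1 + K2 + K3) * (H_norm 1 \<Omega> \<phi>)\<^sup>2)"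
      by (rule order_trans[OF L2[OF \<phi>]]) (use K0 K3 in \<open>auto intro!: ennreal_leI mult_right_mono\<close>)
    show "slobodeckij S (DIM('a) - 1) (1/2) \<phi> \<le> ennreal ((K1 + K2 + K3) * (H_norm 1 \<Omega> \<phi>)\<^sup>2)"
      by (rule order_trans[OF slob[OF \<phi>]]) (use K0 K3 in \<open>auto intro!: ennreal_leI mult_right_mono\<close>)
  qed
qed


subsection \<open>Traces of functions in $H^1$\<close>

abbreviation slob :: "('a \<Rightarrow> real) \<Rightarrow> ennreal" where
  "slob g \<equiv> slobodeckij S (DIM('a) - 1) (1/2) g"

lemma smooth_S: "smooth \<phi> \<Longrightarrow> \<phi> \<in> borel_measurable S"
  by (intro S_measurable smooth_borel)

text \<open>Square integrability on the boundary is read off from the finite right side of the trace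
  inequality.\<close>

lemma smooth_L2_S:
  assumes "smooth \<phi>"
  shows "\<phi> \<in> L2 S"
proof -
  obtain C where "(\<integral>\<^sup>+x. ennreal ((\<phi> x)\<^sup>2) \<partial>S) \<le> ennreal (C * (H_norm 1 \<Omega> \<phi>)\<^sup>2)"
    using trace_inequality_smooth assms by metis
  then have "(\<integral>\<^sup>+x. ennreal ((\<phi> x)\<^sup>2) \<partial>S) < \<infinity>" using ennreal_less_top order_le_less_trans by (metis infinity_ennreal_def)
  then show ?thesis by (intro L2_I_nn_integral smooth_S assms)
qed

definition slob_integrand :: "('a \<Rightarrow> real) \<Rightarrow> 'a \<Rightarrow> 'a \<Rightarrow> ennreal" where
  "slob_integrand g x y = ennreal ((g x - g y)\<^sup>2 / norm (x - y) powr (real (DIM('a) - 1) + 2 * (1/2)))"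

lemma slob_eq: "slob g = (\<integral>\<^sup>+x. \<integral>\<^sup>+y. slob_integrand g x y \<partial>S \<partial>S)"
  by (simp add: slobodeckij_def slob_integrand_def)

lemma slob_integrand_measurable:
  assumes g: "g \<in> borel_measurable S"
  shows "slob_integrand g x \<in> borel_measurable S"
    and "(\<lambda>x. \<integral>\<^sup>+y. slob_integrand g x y \<partial>S) \<in> borel_measurable S"
proof -
  interpret S: finite_measure S by (rule finite_measure_S)
  note [measurable] = id_S g
  show "slob_integrand g x \<in> borel_measurable S"
    unfolding slob_integrand_def[abs_def] by measurable
  show "(\<lambda>x. \<integral>\<^sup>+y. slob_integrand g x y \<partial>S) \<in> borel_measurable S"
    unfolding slob_integrand_def[abs_def] by measurable
qed

lemma slob_cong_AE:
  assumes "AE x in S. f x = g x"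
  shows "slob f = slob g"
proof -
  have "slob_integrand f x y = slob_integrand g x y" if "f x = g x" "f y = g y" for x y
    using that by (simp add: slob_integrand_def)
  then have inner: "(\<integral>\<^sup>+y. slob_integrand f x y \<partial>S) = (\<integral>\<^sup>+y. slob_integrand g x y \<partial>S)" if "f x = g x" for x
    using assms that by (intro nn_integral_cong_AE) (auto elim!: eventually_mono)
  have "AE x in S. (\<integral>\<^sup>+y. slob_integrand f x y \<partial>S) = (\<integral>\<^sup>+y. slob_integrand g x y \<partial>S)"
    using assms by eventually_elim (rule inner)
  then show ?thesis unfolding slob_eq by (rule nn_integral_cong_AE)
qed

lemma slob_add_le:
  assumes f: "f \<in> borel_measurable S" and g: "g \<in> borel_measurable S"
  shows "slob (\<lambda>x. f x + g x) \<le> 2 * slob f + 2 * slob g"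
proof -
  have pt: "slob_integrand (\<lambda>x. f x + g x) x y \<le> 2 * slob_integrand f x y + 2 * slob_integrand g x y" for x y
  proof -
    let ?d = "norm (x - y) powr (real (DIM('a) - 1) + 2 * (1/2))"
    have "(f x + g x - (f y + g y))\<^sup>2 \<le> 2 * (f x - f y)\<^sup>2 + 2 * (g x - g y)\<^sup>2"
      using sq_add_le[of "f x - f y" "g x - g y"] by (simp add: algebra_simps)
    then have "(f x + g x - (f y + g y))\<^sup>2 / ?d \<le> (2 * (f x - f y)\<^sup>2 + 2 * (g x - g y)\<^sup>2) / ?d"
      by (rule divide_right_mono) simp
    also have "\<dots> = 2 * ((f x - f y)\<^sup>2 / ?d) + 2 * ((g x - g y)\<^sup>2 / ?d)" by (simp add: add_divide_distrib)
    finally have "slob_integrand (\<lambda>x. f x + g x) x y \<le> ennreal (2 * ((f x - f y)\<^sup>2 / ?d) + 2 * ((g x - g y)\<^sup>2 / ?d))"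
      unfolding slob_integrand_def by (rule ennreal_leI)
    also have "\<dots> = 2 * slob_integrand f x y + 2 * slob_integrand g x y"
      unfolding slob_integrand_def ennreal_double[symmetric] by (rule ennreal_plus) auto
    finally show ?thesis .
  qed
  have "slob (\<lambda>x. f x + g x) \<le> (\<integral>\<^sup>+x. \<integral>\<^sup>+y. 2 * slob_integrand f x y + 2 * slob_integrand g x y \<partial>S \<partial>S)"
    unfolding slob_eq by (intro nn_integral_mono pt)
  also have "\<dots> = (\<integral>\<^sup>+x. 2 * (\<integral>\<^sup>+y. slob_integrand f x y \<partial>S) + 2 * (\<integral>\<^sup>+y. slob_integrand g x y \<partial>S) \<partial>S)"
    using slob_integrand_measurable(1)[OF f] slob_integrand_measurable(1)[OF g]
    by (intro nn_integral_cong) (simp add: nn_integral_add nn_integral_cmult)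
  also have "\<dots> = 2 * slob f + 2 * slob g"
    using slob_integrand_measurable(2)[OF f] slob_integrand_measurable(2)[OF g]
    unfolding slob_eq by (simp add: nn_integral_add nn_integral_cmult)
  finally show ?thesis .
qed

section \<open>Linearity of the trace\<close>

lemma has_trace_H1: "has_trace \<Omega> v g \<Longrightarrow> v \<in> H 1 \<Omega>"
  and has_trace_L2: "has_trace \<Omega> v g \<Longrightarrow> g \<in> L2 S"
  by (auto simp: has_trace_def)

lemma has_trace_add:
  assumes "has_trace \<Omega> v g" "has_trace \<Omega> v' g'"
  shows "has_trace \<Omega> (\<lambda>x. v x + v' x) (\<lambda>x. g x + g' x)"
proof -
  obtain \<phi> :: "nat \<Rightarrow> 'a \<Rightarrow> real" where v: "v \<in> H 1 \<Omega>" "g \<in> L2 S" and \<phi>: "\<And>n. smooth (\<phi> n)"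
    "(\<lambda>n. H_norm 1 \<Omega> (\<lambda>x. \<phi> n x - v x)) \<longlonglongrightarrow> 0" "(\<lambda>n. l2_norm S (\<lambda>x. \<phi> n x - g x)) \<longlonglongrightarrow> 0"
    using assms(1) unfolding has_trace_def by blast
  obtain \<psi> :: "nat \<Rightarrow> 'a \<Rightarrow> real" where v': "v' \<in> H 1 \<Omega>" "g' \<in> L2 S" and \<psi>: "\<And>n. smooth (\<psi> n)"
    "(\<lambda>n. H_norm 1 \<Omega> (\<lambda>x. \<psi> n x - v' x)) \<longlonglongrightarrow> 0" "(\<lambda>n. l2_norm S (\<lambda>x. \<psi> n x - g' x)) \<longlonglongrightarrow> 0"
    using assms(2) unfolding has_trace_def by blast
  let ?\<chi> = "\<lambda>n x. \<phi> n x + \<psi> n x"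
  have sm: "\<forall>n. smooth (?\<chi> n)" by (intro allI smooth_add \<phi> \<psi>)
  have "(H_norm 1 \<Omega> (\<lambda>x. ?\<chi> n x - (v x + v' x)))\<^sup>2
    \<le> 2 * (H_norm 1 \<Omega> (\<lambda>x. \<phi> n x - v x))\<^sup>2 + 2 * (H_norm 1 \<Omega> (\<lambda>x. \<psi> n x - v' x))\<^sup>2" for n
    using H1_norm_add_sq_le[OF H1_diff[OF H1_smooth[OF \<phi>(1)] v(1)] H1_diff[OF H1_smooth[OF \<psi>(1)] v'(1)], of n n]
    by (simp add: algebra_simps)
  moreover have "(\<lambda>n. 2 * (H_norm 1 \<Omega> (\<lambda>x. \<phi> n x - v x))\<^sup>2 + 2 * (H_norm 1 \<Omega> (\<lambda>x. \<psi> n x - v' x))\<^sup>2) \<longlonglongrightarrow> 0"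
  proof -
    have "(\<lambda>n. 2 * (H_norm 1 \<Omega> (\<lambda>x. \<phi> n x - v x))\<^sup>2 + 2 * (H_norm 1 \<Omega> (\<lambda>x. \<psi> n x - v' x))\<^sup>2) \<longlonglongrightarrow> 2 * 0\<^sup>2 + 2 * 0\<^sup>2"
      by (intro tendsto_intros \<phi> \<psi>)
    then show ?thesis by simp
  qed
  ultimately have "(\<lambda>n. (H_norm 1 \<Omega> (\<lambda>x. ?\<chi> n x - (v x + v' x)))\<^sup>2) \<longlonglongrightarrow> 0"
    by (rule tendsto_0_le[OF zero_le_power2])
  then have c1: "(\<lambda>n. H_norm 1 \<Omega> (\<lambda>x. ?\<chi> n x - (v x + v' x))) \<longlonglongrightarrow> 0"
    by (rule H1_tendsto_iff[THEN iffD2])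
  have "l2_norm S (\<lambda>x. ?\<chi> n x - (g x + g' x)) \<le> l2_norm S (\<lambda>x. \<phi> n x - g x) + l2_norm S (\<lambda>x. \<psi> n x - g' x)" for n
    using l2_norm_triangle[OF L2_diff[OF smooth_L2_S[OF \<phi>(1)] v(2)] L2_diff[OF smooth_L2_S[OF \<psi>(1)] v'(2)], of n n]
    by (simp add: algebra_simps)
  moreover have "(\<lambda>n. l2_norm S (\<lambda>x. \<phi> n x - g x) + l2_norm S (\<lambda>x. \<psi> n x - g' x)) \<longlonglongrightarrow> 0"
    using tendsto_add[OF \<phi>(3) \<psi>(3)] by simp
  ultimately have c2: "(\<lambda>n. l2_norm S (\<lambda>x. ?\<chi> n x - (g x + g' x))) \<longlonglongrightarrow> 0"
    by (rule tendsto_0_le[OF l2_norm_nonneg])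
  show ?thesis
    unfolding has_trace_def
    by (intro conjI H1_add L2_add v v' exI[of _ ?\<chi>] sm c1 c2)
qed

lemma has_trace_cmult:
  assumes "has_trace \<Omega> v g"
  shows "has_trace \<Omega> (\<lambda>x. c * v x) (\<lambda>x. c * g x)"
proof -
  obtain \<phi> :: "nat \<Rightarrow> 'a \<Rightarrow> real" where v: "v \<in> H 1 \<Omega>" "g \<in> L2 S" and \<phi>: "\<And>n. smooth (\<phi> n)"
    "(\<lambda>n. H_norm 1 \<Omega> (\<lambda>x. \<phi> n x - v x)) \<longlonglongrightarrow> 0" "(\<lambda>n. l2_norm S (\<lambda>x. \<phi> n x - g x)) \<longlonglongrightarrow> 0"
    using assms(1) unfolding has_trace_def by blast
  let ?\<chi> = "\<lambda>n x. c * \<phi> n x"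
  have sm: "\<forall>n. smooth (?\<chi> n)" by (intro allI smooth_cmult \<phi>)
  have "H_norm 1 \<Omega> (\<lambda>x. ?\<chi> n x - c * v x) = \<bar>c\<bar> * H_norm 1 \<Omega> (\<lambda>x. \<phi> n x - v x)" for n
    using H1_norm_cmult[OF H1_diff[OF H1_smooth[OF \<phi>(1)] v(1)], of c n] by (simp add: algebra_simps)
  then have c1: "(\<lambda>n. H_norm 1 \<Omega> (\<lambda>x. ?\<chi> n x - c * v x)) \<longlonglongrightarrow> 0"
    using tendsto_mult[OF tendsto_const[of "\<bar>c\<bar>"] \<phi>(2)] by simp
  have "l2_norm S (\<lambda>x. ?\<chi> n x - c * g x) = \<bar>c\<bar> * l2_norm S (\<lambda>x. \<phi> n x - g x)" for n
    using l2_norm_cmult[of S c "\<lambda>x. \<phi> n x - g x"] by (simp add: algebra_simps)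
  then have c2: "(\<lambda>n. l2_norm S (\<lambda>x. ?\<chi> n x - c * g x)) \<longlonglongrightarrow> 0"
    using tendsto_mult[OF tendsto_const[of "\<bar>c\<bar>"] \<phi>(3)] by simp
  show ?thesis
    unfolding has_trace_def
    by (intro conjI H1_cmult L2_cmult v exI[of _ ?\<chi>] sm c1 c2)
qed

lemma has_trace_diff:
  assumes "has_trace \<Omega> v g" "has_trace \<Omega> v' g'"
  shows "has_trace \<Omega> (\<lambda>x. v x - v' x) (\<lambda>x. g x - g' x)"
  using has_trace_add[OF assms(1) has_trace_cmult[OF assms(2), of "-1"]] by simp

lemma H1_norm_zero: "H_norm 1 \<Omega> (\<lambda>x. 0) = 0"
  using H1_norm_cmult[OF H1_zero, of 0] by simp

lemma has_trace_smooth: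
  assumes \<phi>: "smooth \<phi>"
  shows "has_trace \<Omega> \<phi> \<phi>"
  unfolding has_trace_def
  by (intro conjI H1_smooth smooth_L2_S \<phi> exI[of _ "\<lambda>n. \<phi>"]) (simp_all add: \<phi> H1_norm_zero l2_norm_zero)

lemma has_trace_cong:
  assumes "has_trace \<Omega> v g" "\<And>x. x \<in> frontier \<Omega> \<Longrightarrow> g x = g' x"
  shows "has_trace \<Omega> v g'"
proof -
  have "g' \<in> borel_measurable S"
    by (subst measurable_cong[of S _ g]) (use assms has_trace_L2 L2_measurable in \<open>auto simp: space_S\<close>)
  then have "g' \<in> L2 S"
    using assms(2) by (intro L2_cong_AE[OF has_trace_L2[OF assms(1)]] AE_I2) (auto simp: space_S)
  moreover have "l2_norm S (\<lambda>x. f x - g' x) = l2_norm S (\<lambda>x. f x - g x)" for f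
    unfolding l2_norm_def l2_inner_def
    by (intro arg_cong[where f = sqrt] Bochner_Integration.integral_cong) (auto simp: space_S assms(2))
  ultimately show ?thesis using assms(1) unfolding has_trace_def by simp
qed

text \<open>On the boundary the approximating smooth functions converge in L2 only. A subsequence
  converges almost everywhere, and Fatou's lemma in both variables passes the seminorm bound to the
  limit. The factor 4 covers two uses of the squared triangle inequality.\<close>

lemma trace_inequality:
  obtains C where "C \<ge> 0"
    "\<And>v g. has_trace \<Omega> v g \<Longrightarrow> (l2_norm S g)\<^sup>2 \<le> C * (H_norm 1 \<Omega> v)\<^sup>2"
    "\<And>v g. has_trace \<Omega> v g \<Longrightarrow> slob g \<le> ennreal (C * (H_norm 1 \<Omega> v)\<^sup>2)"
proof -
  obtain C where C: "C \<ge> 0"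
    "\<And>\<phi>. smooth \<phi> \<Longrightarrow> (\<integral>\<^sup>+x. ennreal ((\<phi> x)\<^sup>2) \<partial>S) \<le> ennreal (C * (H_norm 1 \<Omega> \<phi>)\<^sup>2)"
    "\<And>\<phi>. smooth \<phi> \<Longrightarrow> slob \<phi> \<le> ennreal (C * (H_norm 1 \<Omega> \<phi>)\<^sup>2)"
    by (rule trace_inequality_smooth) blast
  have main: "(l2_norm S g)\<^sup>2 \<le> 4 * C * (H_norm 1 \<Omega> v)\<^sup>2 \<and> slob g \<le> ennreal (4 * C * (H_norm 1 \<Omega> v)\<^sup>2)"
    if "has_trace \<Omega> v g" for v g
  proof -
    obtain \<phi> :: "nat \<Rightarrow> 'a \<Rightarrow> real" where v: "v \<in> H 1 \<Omega>" and g: "g \<in> L2 S" and \<phi>: "\<And>n. smooth (\<phi> n)"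
      "(\<lambda>n. H_norm 1 \<Omega> (\<lambda>x. \<phi> n x - v x)) \<longlonglongrightarrow> 0" "(\<lambda>n. l2_norm S (\<lambda>x. \<phi> n x - g x)) \<longlonglongrightarrow> 0"
      using \<open>has_trace \<Omega> v g\<close> unfolding has_trace_def by blast
    define N where "N n = 2 * (H_norm 1 \<Omega> (\<lambda>x. \<phi> n x - v x))\<^sup>2 + 2 * (H_norm 1 \<Omega> v)\<^sup>2" for n
    have N: "(H_norm 1 \<Omega> (\<phi> n))\<^sup>2 \<le> N n" for n
      using H1_norm_add_sq_le[OF H1_diff[OF H1_smooth[OF \<phi>(1)] v] v, of n] by (simp add: N_def)
    have "N \<longlonglongrightarrow> 2 * 0\<^sup>2 + 2 * (H_norm 1 \<Omega> v)\<^sup>2" unfolding N_def[abs_def] by (intro tendsto_intros \<phi>)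
    then have Nlim: "N \<longlonglongrightarrow> 2 * (H_norm 1 \<Omega> v)\<^sup>2" by simp
    have l2: "(l2_norm S (\<phi> n))\<^sup>2 \<le> C * N n" for n
    proof -
      have "ennreal ((l2_norm S (\<phi> n))\<^sup>2) \<le> ennreal (C * (H_norm 1 \<Omega> (\<phi> n))\<^sup>2)"
        using C(2)[OF \<phi>(1)] nn_integral_sq[OF smooth_L2_S[OF \<phi>(1)]] by simp
      then have "(l2_norm S (\<phi> n))\<^sup>2 \<le> C * (H_norm 1 \<Omega> (\<phi> n))\<^sup>2"
        using C(1) by (subst (asm) ennreal_le_iff) auto
      also have "\<dots> \<le> C * N n" by (intro mult_left_mono N C(1))
      finally show ?thesis .
    qed
    have "(l2_norm S g)\<^sup>2 \<le> 2 * (C * N n) + 2 * (l2_norm S (\<lambda>x. \<phi> n x - g x))\<^sup>2" for n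
    proof -
      have "(l2_norm S g)\<^sup>2 \<le> 2 * (l2_norm S (\<phi> n))\<^sup>2 + 2 * (l2_norm S (\<lambda>x. g x - \<phi> n x))\<^sup>2"
        using l2_norm_add_sq_le[OF smooth_L2_S[OF \<phi>(1)] L2_diff[OF g smooth_L2_S[OF \<phi>(1)]], of n n] by simp
      then show ?thesis using l2[of n] l2_norm_minus_commute[of S g "\<phi> n"] by simp
    qed
    moreover have "(\<lambda>n. 2 * (C * N n) + 2 * (l2_norm S (\<lambda>x. \<phi> n x - g x))\<^sup>2) \<longlonglongrightarrow> 2 * (C * (2 * (H_norm 1 \<Omega> v)\<^sup>2)) + 2 * 0\<^sup>2"
      by (intro tendsto_intros Nlim \<phi>(3))
    ultimately have "(l2_norm S g)\<^sup>2 \<le> 2 * (C * (2 * (H_norm 1 \<Omega> v)\<^sup>2)) + 2 * 0\<^sup>2"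
      by (intro LIMSEQ_le_const) auto
    then have 1: "(l2_norm S g)\<^sup>2 \<le> 4 * C * (H_norm 1 \<Omega> v)\<^sup>2" by simp
    obtain r :: "nat \<Rightarrow> nat" where r: "strict_mono r" "AE x in S. (\<lambda>n. \<phi> (r n) x) \<longlonglongrightarrow> g x"
      using l2_tendsto_AE_subseq[OF smooth_L2_S[OF \<phi>(1)] g \<phi>(3)] by blast
    have conv: "slob_integrand g x y = liminf (\<lambda>n. slob_integrand (\<phi> (r n)) x y)"
      if x: "(\<lambda>n. \<phi> (r n) x) \<longlonglongrightarrow> g x" and y: "(\<lambda>n. \<phi> (r n) y) \<longlonglongrightarrow> g y" for x y
    proof (cases "x = y")
      case False
      have "(\<lambda>n. slob_integrand (\<phi> (r n)) x y) \<longlonglongrightarrow> slob_integrand g x y"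
        unfolding slob_integrand_def using False by (intro tendsto_ennrealI tendsto_intros x y) simp
      then show ?thesis by (intro lim_imp_Liminf[symmetric]) auto
    qed (simp add: slob_integrand_def Liminf_const)
    have "slob g = (\<integral>\<^sup>+x. \<integral>\<^sup>+y. liminf (\<lambda>n. slob_integrand (\<phi> (r n)) x y) \<partial>S \<partial>S)"
      unfolding slob_eq
    proof (rule nn_integral_cong_AE, use r(2) in eventually_elim)
      case (elim x)
      show ?case by (rule nn_integral_cong_AE, use r(2) in eventually_elim) (rule conv[OF elim])
    qed
    also have "\<dots> \<le> (\<integral>\<^sup>+x. liminf (\<lambda>n. \<integral>\<^sup>+y. slob_integrand (\<phi> (r n)) x y \<partial>S) \<partial>S)"
      by (intro nn_integral_mono nn_integral_liminf slob_integrand_measurable smooth_S \<phi>)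
    also have "\<dots> \<le> liminf (\<lambda>n. \<integral>\<^sup>+x. \<integral>\<^sup>+y. slob_integrand (\<phi> (r n)) x y \<partial>S \<partial>S)"
      by (intro nn_integral_liminf slob_integrand_measurable smooth_S \<phi>)
    also have "\<dots> \<le> liminf (\<lambda>n. ennreal (C * N (r n)))"
    proof (intro Liminf_mono always_eventually allI)
      fix n
      have "slob (\<phi> (r n)) \<le> ennreal (C * (H_norm 1 \<Omega> (\<phi> (r n)))\<^sup>2)" by (intro C \<phi>)
      also have "\<dots> \<le> ennreal (C * N (r n))" by (intro ennreal_leI mult_left_mono N C(1))
      finally show "(\<integral>\<^sup>+x. \<integral>\<^sup>+y. slob_integrand (\<phi> (r n)) x y \<partial>S \<partial>S) \<le> ennreal (C * N (r n))"
        by (simp only: slob_eq)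
    qed
    also have "\<dots> = ennreal (C * (2 * (H_norm 1 \<Omega> v)\<^sup>2))"
    proof (intro lim_imp_Liminf tendsto_ennrealI tendsto_mult tendsto_const)
      show "(\<lambda>n. N (r n)) \<longlonglongrightarrow> 2 * (H_norm 1 \<Omega> v)\<^sup>2"
        using LIMSEQ_subseq_LIMSEQ[OF Nlim r(1)] by (simp add: o_def)
    qed simp
    also have "\<dots> \<le> ennreal (4 * C * (H_norm 1 \<Omega> v)\<^sup>2)"
      using C(1) by (intro ennreal_leI) simp
    finally show ?thesis using 1 by blast
  qed
  show ?thesis using main C(1) by (intro that[of "4 * C"]) auto
qed

text \<open>Completeness of L2 of the boundary, carried out by hand: by the trace inequality,
  approximations with squared errors below \<open>(1/4) ^ j\<close> have summable increments on the
  boundary, so they converge almost everywhere to a measurable limit, which is then recognized as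
  the L2 limit.\<close>

lemma trace_exists:
  assumes v: "v \<in> H 1 \<Omega>"
  shows "\<exists>g. has_trace \<Omega> v g"
proof -
  obtain C where C: "C \<ge> 0"
    "\<And>\<phi>. smooth \<phi> \<Longrightarrow> (\<integral>\<^sup>+x. ennreal ((\<phi> x)\<^sup>2) \<partial>S) \<le> ennreal (C * (H_norm 1 \<Omega> \<phi>)\<^sup>2)"
    by (rule trace_inequality_smooth) blast
  obtain \<phi>0 :: "nat \<Rightarrow> 'a \<Rightarrow> real" where \<phi>0: "\<And>n. smooth (\<phi>0 n)" "(\<lambda>n. H_norm 1 \<Omega> (\<lambda>x. \<phi>0 n x - v x)) \<longlonglongrightarrow> 0"
    using smooth_dense[OF v] unfolding smooth_approximable_def by blast
  have lim2: "(\<lambda>n. (H_norm 1 \<Omega> (\<lambda>x. \<phi>0 n x - v x))\<^sup>2) \<longlonglongrightarrow> 0" using \<phi>0(2) by (rule H1_tendsto_iff[THEN iffD1])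
  have "\<exists>n. (H_norm 1 \<Omega> (\<lambda>x. \<phi>0 n x - v x))\<^sup>2 < (1/4) ^ j" for j :: nat
    using eventually_happens'[OF sequentially_bot order_tendstoD(2)[OF lim2, of "(1/4) ^ j"]] by simp
  then obtain r where r: "\<And>j::nat. (H_norm 1 \<Omega> (\<lambda>x. \<phi>0 (r j) x - v x))\<^sup>2 < (1/4) ^ j" by metis
  define \<phi> where "\<phi> j = \<phi>0 (r j)" for j
  have \<phi>: "\<And>j. smooth (\<phi> j)" "\<And>j. (H_norm 1 \<Omega> (\<lambda>x. \<phi> j x - v x))\<^sup>2 \<le> (1/4) ^ j"
    using \<phi>0(1) r by (auto simp: \<phi>_def less_imp_le)
  have mS: "\<phi> j \<in> borel_measurable S" for j by (rule smooth_S[OF \<phi>(1)])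
  have cauchy: "(\<integral>\<^sup>+x. ennreal ((\<phi> i x - \<phi> j x)\<^sup>2) \<partial>S) \<le> ennreal (4 * C * (1/4) ^ j)" if "j \<le> i" for i j
  proof -
    have "(H_norm 1 \<Omega> (\<lambda>x. \<phi> i x - \<phi> j x))\<^sup>2 \<le> 2 * (H_norm 1 \<Omega> (\<lambda>x. \<phi> i x - v x))\<^sup>2 + 2 * (H_norm 1 \<Omega> (\<lambda>x. v x - \<phi> j x))\<^sup>2"
      using H1_norm_add_sq_le[OF H1_diff[OF H1_smooth[OF \<phi>(1)[of i]] v] H1_diff[OF v H1_smooth[OF \<phi>(1)[of j]]]]
      by (simp add: algebra_simps)
    also have "\<dots> \<le> 2 * (1/4) ^ i + 2 * (1/4) ^ j"
      using \<phi>(2)[of i] \<phi>(2)[of j] H1_norm_diff_commute[OF v H1_smooth[OF \<phi>(1)[of j]]] by simp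
    also have "\<dots> \<le> 4 * (1/4) ^ j"
      using power_decreasing[OF that, of "1/4::real"] by simp
    finally have "C * (H_norm 1 \<Omega> (\<lambda>x. \<phi> i x - \<phi> j x))\<^sup>2 \<le> C * (4 * (1/4) ^ j)" using C(1) by (rule mult_left_mono)
    then have "C * (H_norm 1 \<Omega> (\<lambda>x. \<phi> i x - \<phi> j x))\<^sup>2 \<le> 4 * C * (1/4) ^ j" by simp
    from order_trans[OF C(2)[OF smooth_diff[OF \<phi>(1) \<phi>(1)]] ennreal_leI[OF this]] show ?thesis .
  qed
  interpret S: finite_measure S by (rule finite_measure_S)
  define s where "s = measure S (space S)"
  have ae: "AE x in S. convergent (\<lambda>n. \<phi> n x)"
  proof -
    let ?d = "\<lambda>n x. \<bar>\<phi> (Suc n) x - \<phi> n x\<bar>"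
    have dm: "(\<lambda>x. ennreal (?d n x)) \<in> borel_measurable S" for n using mS by measurable
    have dn: "(\<integral>\<^sup>+x. ennreal (?d n x) \<partial>S) \<le> ennreal ((4 * C + s) * (1/2) ^ n)" for n
    proof -
      \<comment> \<open>The arithmetic-geometric mean inequality, weighted so that squared
        increments of order \<open>(1/4) ^ n\<close> and the finite total area both contribute a
        multiple of \<open>(1/2) ^ n\<close> to the integral of the increment.\<close>
      have p: "\<bar>a\<bar> \<le> 2 ^ n * a\<^sup>2 + (1/2) ^ n" for a :: real
      proof -
        define t :: real where "t = 2 ^ n"
        have t: "t > 0" by (simp add: t_def)
        have "0 \<le> (t * \<bar>a\<bar> - 1)\<^sup>2" by simp
        also have "\<dots> = t * (t * a\<^sup>2 + 1 / t - 2 * \<bar>a\<bar>)"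
          using t by (simp add: power2_diff power_mult_distrib algebra_simps power2_eq_square)
        finally have "0 \<le> t * a\<^sup>2 + 1 / t - 2 * \<bar>a\<bar>" using t by (simp add: zero_le_mult_iff)
        then have "2 * \<bar>a\<bar> \<le> 2 ^ n * a\<^sup>2 + (1/2) ^ n" by (simp add: t_def power_one_over)
        then show ?thesis by linarith
      qed
      have "(\<integral>\<^sup>+x. ennreal (?d n x) \<partial>S) \<le> (\<integral>\<^sup>+x. ennreal (2 ^ n) * ennreal ((\<phi> (Suc n) x - \<phi> n x)\<^sup>2) + ennreal ((1/2) ^ n) \<partial>S)"
      proof (intro nn_integral_mono)
        fix x
        have "ennreal (?d n x) \<le> ennreal (2 ^ n * (\<phi> (Suc n) x - \<phi> n x)\<^sup>2 + (1/2) ^ n)" by (intro ennreal_leI p)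
        also have "\<dots> = ennreal (2 ^ n * (\<phi> (Suc n) x - \<phi> n x)\<^sup>2) + ennreal ((1/2) ^ n)" by (rule ennreal_plus) auto
        also have "ennreal (2 ^ n * (\<phi> (Suc n) x - \<phi> n x)\<^sup>2) = ennreal (2 ^ n) * ennreal ((\<phi> (Suc n) x - \<phi> n x)\<^sup>2)" by (rule ennreal_mult) auto
        finally show "ennreal (?d n x) \<le> ennreal (2 ^ n) * ennreal ((\<phi> (Suc n) x - \<phi> n x)\<^sup>2) + ennreal ((1/2) ^ n)" .
      qed
      also have "\<dots> = ennreal (2 ^ n) * (\<integral>\<^sup>+x. ennreal ((\<phi> (Suc n) x - \<phi> n x)\<^sup>2) \<partial>S) + ennreal ((1/2) ^ n) * ennreal s"
        using mS by (subst nn_integral_add) (simp_all add: nn_integral_cmult s_def S.emeasure_eq_measure)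
      also have "\<dots> \<le> ennreal (2 ^ n) * ennreal (4 * C * (1/4) ^ n) + ennreal ((1/2) ^ n) * ennreal s"
        by (intro add_mono mult_left_mono cauchy) auto
      also have "\<dots> = ennreal (2 ^ n * (4 * C * (1/4) ^ n)) + ennreal ((1/2) ^ n * s)"
        using C(1) by (simp only: ennreal_mult[symmetric] zero_le_power zero_le_numeral zero_le_mult_iff simp_thms) (simp add: s_def ennreal_mult[symmetric])
      also have "\<dots> = ennreal ((4 * C + s) * (1/2) ^ n)"
      proof -
        have "(2::real) ^ n * (1/4) ^ n = (1/2) ^ n" by (simp add: power_mult_distrib[symmetric])
        then have "2 ^ n * (4 * C * (1/4) ^ n) + (1/2) ^ n * s = (4 * C + s) * (1/2) ^ n"
          by (simp add: algebra_simps)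
        then show ?thesis using C(1) by (subst ennreal_plus[symmetric]) (auto simp: s_def)
      qed
      finally show ?thesis .
    qed
    have "(\<integral>\<^sup>+x. (\<Sum>n. ennreal (?d n x)) \<partial>S) = (\<Sum>n. \<integral>\<^sup>+x. ennreal (?d n x) \<partial>S)"
      by (rule nn_integral_suminf[OF dm])
    also have "\<dots> \<le> (\<Sum>n. ennreal ((4 * C + s) * (1/2) ^ n))" by (intro suminf_le dn) auto
    also have "\<dots> = ennreal (\<Sum>n. (4 * C + s) * (1/2) ^ n)"
      by (rule suminf_ennreal_eq) (use C(1) in \<open>auto simp: s_def intro!: sums_mult summable_sums summable_mult summable_geometric\<close>)
    finally have "(\<integral>\<^sup>+x. (\<Sum>n. ennreal (?d n x)) \<partial>S) \<noteq> \<infinity>" by (auto simp: top_unique)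
    then have "AE x in S. (\<Sum>n. ennreal (?d n x)) \<noteq> \<infinity>"
      by (intro nn_integral_PInf_AE) (use dm in auto)
    then show ?thesis
    proof eventually_elim
      case (elim x)
      then have "summable (\<lambda>n. ?d n x)" by (intro summable_suminf_not_top) auto
      then have "summable (\<lambda>n. \<phi> (Suc n) x - \<phi> n x)" by (rule summable_rabs_cancel)
      then have "convergent (\<lambda>n. \<Sum>i<n. \<phi> (Suc i) x - \<phi> i x)" by (simp add: summable_iff_convergent)
      also have "(\<lambda>n. \<Sum>i<n. \<phi> (Suc i) x - \<phi> i x) = (\<lambda>n. \<phi> n x - \<phi> 0 x)"
        by (intro ext sum_lessThan_telescope)
      finally have "convergent (\<lambda>n. \<phi> n x - \<phi> 0 x)" .
      then show "convergent (\<lambda>n. \<phi> n x)" by (simp add: convergent_diff_const_right_iff)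
    qed
  qed
  define g where "g x = lim (\<lambda>n. \<phi> n x)" for x
  have gm: "g \<in> borel_measurable S"
    unfolding g_def[abs_def] using mS by (rule borel_measurable_lim_metric)
  have gl: "AE x in S. (\<lambda>n. \<phi> n x) \<longlonglongrightarrow> g x"
    using ae by eventually_elim (simp add: g_def convergent_LIMSEQ_iff)
  \<comment> \<open>The Cauchy estimate between \<open>\<phi> (m + j)\<close> and
    \<open>\<phi> j\<close> does not depend on \<open>m\<close>, so Fatou's lemma transfers it to
    the limit \<open>g\<close>.\<close>
  have est: "(\<integral>\<^sup>+x. ennreal ((\<phi> j x - g x)\<^sup>2) \<partial>S) \<le> ennreal (4 * C * (1/4) ^ j)" for j
  proof -
    have "(\<integral>\<^sup>+x. ennreal ((\<phi> j x - g x)\<^sup>2) \<partial>S) = (\<integral>\<^sup>+x. liminf (\<lambda>m. ennreal ((\<phi> (m + j) x - \<phi> j x)\<^sup>2)) \<partial>S)"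
    proof (rule nn_integral_cong_AE, use gl in eventually_elim)
      case (elim x)
      have "(\<lambda>m. ennreal ((\<phi> (m + j) x - \<phi> j x)\<^sup>2)) \<longlonglongrightarrow> ennreal ((g x - \<phi> j x)\<^sup>2)"
        by (intro tendsto_ennrealI tendsto_intros LIMSEQ_ignore_initial_segment elim)
      then show ?case by (subst lim_imp_Liminf) (auto simp: power2_commute)
    qed
    also have "\<dots> \<le> liminf (\<lambda>m. \<integral>\<^sup>+x. ennreal ((\<phi> (m + j) x - \<phi> j x)\<^sup>2) \<partial>S)"
      by (rule nn_integral_liminf) (use mS in measurable)
    also have "\<dots> \<le> liminf (\<lambda>m::nat. ennreal (4 * C * (1/4) ^ j))"
      by (intro Liminf_mono always_eventually allI cauchy) simp
    finally show ?thesis by (simp add: Liminf_const)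
  qed
  have dL: "(\<lambda>x. \<phi> j x - g x) \<in> L2 S" for j
    using est[of j] mS gm by (intro L2_I_nn_integral) (auto simp: top_unique less_top[symmetric])
  have gL: "g \<in> L2 S"
    using L2_diff[OF smooth_L2_S[OF \<phi>(1)] dL, of 0 0] by simp
  have "(l2_norm S (\<lambda>x. \<phi> j x - g x))\<^sup>2 \<le> 4 * C * (1/4) ^ j" for j
    using est[of j] unfolding nn_integral_sq[OF dL] by (subst (asm) ennreal_le_iff) (use C(1) in auto)
  moreover have "(\<lambda>j. 4 * C * (1/4::real) ^ j) \<longlonglongrightarrow> 0"
    using tendsto_mult[OF tendsto_const[of "4 * C"] LIMSEQ_power_zero[of "1/4::real"]] by simp
  ultimately have "(\<lambda>j. (l2_norm S (\<lambda>x. \<phi> j x - g x))\<^sup>2) \<longlonglongrightarrow> 0"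
    by (rule tendsto_0_le[OF zero_le_power2])
  from tendsto_real_sqrt[OF this] have c2: "(\<lambda>j. l2_norm S (\<lambda>x. \<phi> j x - g x)) \<longlonglongrightarrow> 0"
    by (simp add: l2_norm_nonneg)
  have "(\<lambda>j. (1/4::real) ^ j) \<longlonglongrightarrow> 0" by (rule LIMSEQ_power_zero) simp
  from tendsto_0_le[OF zero_le_power2 \<phi>(2) this]
  have c1: "(\<lambda>j. H_norm 1 \<Omega> (\<lambda>x. \<phi> j x - v x)) \<longlonglongrightarrow> 0" by (rule H1_tendsto_iff[THEN iffD2])
  have "has_trace \<Omega> v g"
    unfolding has_trace_def by (intro conjI v gL exI[of _ \<phi>] allI \<phi>(1) c1 c2)
  then show ?thesis by blast
qed

lemma Hbd_norm_sq: "(Hbd_norm (1/2) \<Omega> g)\<^sup>2 = (l2_norm S g)\<^sup>2 + enn2real (slob g)"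
  by (simp add: Hbd_norm_def)

lemma trace_theorem:
  obtains C where "C \<ge> 0"
    "\<And>v g. has_trace \<Omega> v g \<Longrightarrow> (Hbd_norm (1/2) \<Omega> g)\<^sup>2 \<le> C * (H_norm 1 \<Omega> v)\<^sup>2"
proof -
  obtain C where C: "C \<ge> 0"
    "\<And>v g. has_trace \<Omega> v g \<Longrightarrow> (l2_norm S g)\<^sup>2 \<le> C * (H_norm 1 \<Omega> v)\<^sup>2"
    "\<And>v g. has_trace \<Omega> v g \<Longrightarrow> slob g \<le> ennreal (C * (H_norm 1 \<Omega> v)\<^sup>2)"
    by (rule trace_inequality) blast
  have "(Hbd_norm (1/2) \<Omega> g)\<^sup>2 \<le> 2 * C * (H_norm 1 \<Omega> v)\<^sup>2" if "has_trace \<Omega> v g" for v g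
  proof -
    have "enn2real (slob g) \<le> C * (H_norm 1 \<Omega> v)\<^sup>2"
      using enn2real_mono[OF C(3)[OF that]] C(1) by simp
    then show ?thesis using C(2)[OF that] by (simp add: Hbd_norm_sq)
  qed
  then show ?thesis using C(1) by (intro that[of "2 * C"]) auto
qed

lemma has_trace_slob_finite: "has_trace \<Omega> v g \<Longrightarrow> slob g < \<infinity>"
  by (rule trace_inequality) (metis ennreal_less_top infinity_ennreal_def order_le_less_trans)

text \<open>Finiteness is needed because \<open>enn2real\<close> sends an infinite seminorm to \<open>0\<close>.\<close>

lemma Hbd_norm_add_sq_le:
  assumes f: "f \<in> L2 S" "slob f < \<infinity>" and g: "g \<in> L2 S" "slob g < \<infinity>"
  shows "(Hbd_norm (1/2) \<Omega> (\<lambda>x. f x + g x))\<^sup>2 \<le> 2 * (Hbd_norm (1/2) \<Omega> f)\<^sup>2 + 2 * (Hbd_norm (1/2) \<Omega> g)\<^sup>2"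
proof -
  have "slob (\<lambda>x. f x + g x) \<le> 2 * slob f + 2 * slob g"
    by (intro slob_add_le L2_measurable f g)
  then have "enn2real (slob (\<lambda>x. f x + g x)) \<le> enn2real (2 * slob f + 2 * slob g)"
    using f g by (intro enn2real_mono) (auto simp: ennreal_mult_less_top)
  also have "\<dots> = 2 * enn2real (slob f) + 2 * enn2real (slob g)"
    using f g by (subst enn2real_plus) (auto simp: ennreal_mult_less_top enn2real_mult)
  finally show ?thesis
    using l2_norm_add_sq_le[OF f(1) g(1)] by (simp add: Hbd_norm_sq)
qed

lemma Hbd_norm_AE_zero:
  assumes "AE x in S. g x = 0" "g \<in> borel_measurable S"
  shows "Hbd_norm (1/2) \<Omega> g = 0"
proof -
  have "slob g = slob (\<lambda>x. 0)" using assms(1) by (intro slob_cong_AE) auto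
  also have "\<dots> = 0" by (simp add: slobodeckij_def)
  moreover have "l2_norm S g = l2_norm S (\<lambda>x. 0)" by (rule l2_norm_cong_AE) (use assms in auto)
  ultimately have "(Hbd_norm (1/2) \<Omega> g)\<^sup>2 = 0" by (simp add: Hbd_norm_sq l2_norm_zero)
  then show ?thesis by simp
qed

end

subsection \<open>Vector fields and the Stokes forms\<close>

lemma finite_dimensional_diff:
  assumes V: "finite_dimensional V" and v: "v \<in> V" and w: "w \<in> V"
  shows "(\<lambda>x. v x - w x) \<in> V"
proof -
  obtain n :: nat and e where V: "V = {v. \<exists>c :: nat \<Rightarrow> real. v = (\<lambda>x. \<Sum>i<n. c i *\<^sub>R e i x)}"
    using V unfolding finite_dimensional_def by blast
  obtain c d :: "nat \<Rightarrow> real" where "v = (\<lambda>x. \<Sum>i<n. c i *\<^sub>R e i x)" "w = (\<lambda>x. \<Sum>i<n. d i *\<^sub>R e i x)"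
    using v w unfolding V by blast
  then have "(\<lambda>x. v x - w x) = (\<lambda>x. \<Sum>i<n. (c i - d i) *\<^sub>R e i x)"
    by (simp add: scaleR_diff_left sum_subtractf)
  then show ?thesis unfolding V by (intro CollectI exI)
qed

lemma finite_dimensional_scale:
  assumes V: "finite_dimensional V" and v: "v \<in> V"
  shows "(\<lambda>x. a *\<^sub>R v x) \<in> V"
proof -
  obtain n :: nat and e where V: "V = {v. \<exists>c :: nat \<Rightarrow> real. v = (\<lambda>x. \<Sum>i<n. c i *\<^sub>R e i x)}"
    using V unfolding finite_dimensional_def by blast
  obtain c :: "nat \<Rightarrow> real" where "v = (\<lambda>x. \<Sum>i<n. c i *\<^sub>R e i x)"
    using v unfolding V by blast
  then have "(\<lambda>x. a *\<^sub>R v x) = (\<lambda>x. \<Sum>i<n. (a * c i) *\<^sub>R e i x)"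
    by (simp add: scaleR_sum_right)
  then show ?thesis unfolding V by (intro CollectI exI)
qed

lemma component_diff: "component (\<lambda>x. v x - w x) b = (\<lambda>x. component v b x - component w b x)"
  by (simp add: component_def inner_diff_left)

lemma component_scale: "component (\<lambda>x. a *\<^sub>R v x) b = (\<lambda>x. a * component v b x)"
  by (simp add: component_def)

lemma component_zero: "component (\<lambda>x. 0) b = (\<lambda>x. 0)"
  by (simp add: component_def)

lemma vec_norm_nonneg: "vec_norm N v \<ge> 0"
  by (simp add: vec_norm_def sum_nonneg)

lemma vec_norm_sq: "(vec_norm N v)\<^sup>2 = (\<Sum>b\<in>Basis. (N (component v b))\<^sup>2)"
  by (simp add: vec_norm_def sum_nonneg)

text \<open>An infimum need not be attained, hence the slack \<open>\<eta>\<close>. Nonnegativity of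
  \<open>f\<close> bounds the image from below, without which a real infimum says nothing about the
  values.\<close>

lemma INF_approx:
  fixes f :: "'a \<Rightarrow> real"
  assumes "X \<noteq> {}" "\<And>x. x \<in> X \<Longrightarrow> 0 \<le> f x" "(INF x\<in>X. f x) \<le> a" "\<eta> > 0"
  obtains x where "x \<in> X" "f x \<le> a + \<eta>"
proof -
  have "bdd_below (f ` X)" using assms(2) by (intro bdd_belowI[of _ 0]) auto
  moreover have "(INF x\<in>X. f x) < a + \<eta>" using assms(3,4) by linarith
  ultimately obtain x where "x \<in> X" "f x < a + \<eta>" using cINF_less_iff[OF assms(1)] by blast
  then show ?thesis using that by force
qed

context polyhedral
begin

abbreviation VH :: "('a \<Rightarrow> 'a) set" where "VH \<equiv> vec_space (H 1 \<Omega>)"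

abbreviation D :: "'a \<Rightarrow> 'a \<Rightarrow> ('a \<Rightarrow> 'a) \<Rightarrow> 'a \<Rightarrow> real" where
  "D c b v \<equiv> weak_deriv M [c] (component v b)"

lemma VH_component: "v \<in> VH \<Longrightarrow> b \<in> Basis \<Longrightarrow> component v b \<in> H 1 \<Omega>"
  by (simp add: vec_space_def)

lemma VH_diff: "v \<in> VH \<Longrightarrow> w \<in> VH \<Longrightarrow> (\<lambda>x. v x - w x) \<in> VH"
  by (simp add: vec_space_def component_diff H1_diff)

lemma VH_scale: "v \<in> VH \<Longrightarrow> (\<lambda>x. a *\<^sub>R v x) \<in> VH"
  by (simp add: vec_space_def component_scale H1_cmult)

lemma D_L2: "v \<in> VH \<Longrightarrow> b \<in> Basis \<Longrightarrow> c \<in> Basis \<Longrightarrow> D c b v \<in> L2 M"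
  by (intro H1_weak_deriv_L2 VH_component)

text \<open>The derivatives on both sides are chosen independently, so linearity holds only almost
  everywhere; paired with L2 functions it becomes exact.\<close>

lemma D_diff:
  assumes "v \<in> VH" "w \<in> VH" "b \<in> Basis" "c \<in> Basis"
  shows "AE x in M. D c b (\<lambda>x. v x - w x) x = D c b v x - D c b w x"
  unfolding component_diff
  by (rule weak_deriv(2)[OF has_weak_deriv_diff])
    (use assms in \<open>auto intro!: H1_weak_deriv VH_component H1_L2\<close>)

lemma D_scale:
  assumes "v \<in> VH" "b \<in> Basis" "c \<in> Basis"
  shows "AE x in M. D c b (\<lambda>x. a *\<^sub>R v x) x = a * D c b v x"
  unfolding component_scale
  by (rule weak_deriv(2)[OF has_weak_deriv_cmult]) (use assms in \<open>auto intro!: H1_weak_deriv VH_component\<close>)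

lemma D_diff_inner:
  assumes v: "v \<in> VH" and w: "w \<in> VH" and b: "b \<in> Basis" "c \<in> Basis" and k: "k \<in> L2 M"
  shows "l2_inner M (D c b (\<lambda>x. v x - w x)) k = l2_inner M (D c b v) k - l2_inner M (D c b w) k"
proof -
  have "l2_inner M (D c b (\<lambda>x. v x - w x)) k = l2_inner M (\<lambda>x. D c b v x - D c b w x) k"
    by (rule l2_inner_cong_AE[OF D_diff[OF v w b]])
      (use L2_measurable[OF D_L2[OF VH_diff[OF v w] b]] L2_measurable[OF L2_diff[OF D_L2[OF v b] D_L2[OF w b]]]
         L2_measurable[OF k] in auto)
  then show ?thesis by (simp add: l2_inner_diff_left D_L2 v w b k)
qed

lemma D_scale_inner:
  assumes v: "v \<in> VH" and b: "b \<in> Basis" "c \<in> Basis" and k: "k \<in> L2 M"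
  shows "l2_inner M (D c b (\<lambda>x. a *\<^sub>R v x)) k = a * l2_inner M (D c b v) k"
proof -
  have "l2_inner M (D c b (\<lambda>x. a *\<^sub>R v x)) k = l2_inner M (\<lambda>x. a * D c b v x) k"
    by (rule l2_inner_cong_AE[OF D_scale[OF v b]])
      (use L2_measurable[OF D_L2[OF VH_scale[OF v] b]] L2_measurable[OF L2_cmult[OF D_L2[OF v b]]]
         L2_measurable[OF k] in auto)
  then show ?thesis by (simp add: l2_inner_cmult_left)
qed

section \<open>The gradient and divergence forms\<close>

abbreviation gi :: "('a \<Rightarrow> 'a) \<Rightarrow> ('a \<Rightarrow> 'a) \<Rightarrow> real" where "gi \<equiv> grad_inner \<Omega>"
abbreviation gn :: "('a \<Rightarrow> 'a) \<Rightarrow> real" where "gn \<equiv> grad_norm \<Omega>"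
abbreviation dv :: "('a \<Rightarrow> 'a) \<Rightarrow> ('a \<Rightarrow> real) \<Rightarrow> real" where "dv v q \<equiv> l2_inner M (divergence \<Omega> v) q"

lemma gi_commute: "gi v w = gi w v"
  by (simp add: grad_inner_def l2_inner_commute)

lemma gi_diff_left: "v \<in> VH \<Longrightarrow> v' \<in> VH \<Longrightarrow> w \<in> VH \<Longrightarrow> gi (\<lambda>x. v x - v' x) w = gi v w - gi v' w"
  by (simp add: grad_inner_def D_diff_inner D_L2 sum_subtractf)

lemma gi_diff_right: "v \<in> VH \<Longrightarrow> v' \<in> VH \<Longrightarrow> w \<in> VH \<Longrightarrow> gi w (\<lambda>x. v x - v' x) = gi w v - gi w v'"
  by (simp add: gi_commute[of w] gi_diff_left)

lemma gi_scale_left: "v \<in> VH \<Longrightarrow> w \<in> VH \<Longrightarrow> gi (\<lambda>x. a *\<^sub>R v x) w = a * gi v w"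
  by (simp add: grad_inner_def D_scale_inner D_L2 sum_distrib_left)

lemma gi_scale_right: "v \<in> VH \<Longrightarrow> w \<in> VH \<Longrightarrow> gi w (\<lambda>x. a *\<^sub>R v x) = a * gi w v"
  by (simp add: gi_commute[of w] gi_scale_left)

lemma gi_self: "gi v v = (\<Sum>b\<in>Basis. \<Sum>c\<in>Basis. (l2_norm M (D c b v))\<^sup>2)"
  by (simp add: grad_inner_def l2_norm_sq_inner)

lemma gi_self_nonneg: "gi v v \<ge> 0"
  unfolding gi_self by (intro sum_nonneg) auto

lemma gn_sq: "(gn v)\<^sup>2 = gi v v"
  using gi_self_nonneg by (simp add: grad_norm_def)

lemma gn_nonneg: "gn v \<ge> 0"
  using gi_self_nonneg by (simp add: grad_norm_def)

lemma gi_Cauchy_Schwarz: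
  assumes v: "v \<in> VH" and w: "w \<in> VH"
  shows "\<bar>gi v w\<bar> \<le> gn v * gn w"
proof -
  have "gi v v + 2 * t * gi v w + t\<^sup>2 * gi w w \<ge> 0" for t
  proof -
    let ?w = "\<lambda>x. (- t) *\<^sub>R w x"
    have w': "?w \<in> VH" by (rule VH_scale[OF w])
    have "0 \<le> gi (\<lambda>x. v x - ?w x) (\<lambda>x. v x - ?w x)" by (rule gi_self_nonneg)
    also have "\<dots> = gi v v + 2 * t * gi v w + t\<^sup>2 * gi w w"
      by (simp add: gi_diff_left[OF v w' VH_diff[OF v w']] gi_diff_right[OF v w' v] gi_diff_right[OF v w' w']
          gi_scale_left[OF w v] gi_scale_left[OF w w'] gi_scale_right[OF w v] gi_scale_right[OF w w]
          gi_commute[of w v] power2_eq_square del: scaleR_minus_left)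
    finally show ?thesis .
  qed
  from discriminant_le[OF this gi_self_nonneg] have "(gi v w)\<^sup>2 \<le> (gn v * gn w)\<^sup>2"
    by (simp add: power_mult_distrib gn_sq)
  then show ?thesis
    using gn_nonneg[of v] gn_nonneg[of w] by (simp add: abs_le_square_iff[symmetric])
qed

lemma gn_diff_le:
  assumes v: "v \<in> VH" and w: "w \<in> VH"
  shows "gn (\<lambda>x. v x - w x) \<le> gn v + gn w"
proof (rule power2_le_imp_le)
  have "(gn (\<lambda>x. v x - w x))\<^sup>2 = (gn v)\<^sup>2 - 2 * gi v w + (gn w)\<^sup>2"
    by (simp add: gn_sq gi_diff_left[OF v w VH_diff[OF v w]] gi_diff_right[OF v w v] gi_diff_right[OF v w w] gi_commute[of w v])
  also have "\<dots> \<le> (gn v + gn w)\<^sup>2" using gi_Cauchy_Schwarz[OF v w] by (simp add: power2_sum)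
  finally show "(gn (\<lambda>x. v x - w x))\<^sup>2 \<le> (gn v + gn w)\<^sup>2" .
qed (simp add: gn_nonneg)

lemma gn_diff_commute:
  assumes v: "v \<in> VH" and w: "w \<in> VH"
  shows "gn (\<lambda>x. v x - w x) = gn (\<lambda>x. w x - v x)"
proof -
  have "gi (\<lambda>x. v x - w x) (\<lambda>x. v x - w x) = gi (\<lambda>x. w x - v x) (\<lambda>x. w x - v x)"
    by (simp add: gi_diff_left[OF v w VH_diff[OF v w]] gi_diff_left[OF w v VH_diff[OF w v]]
        gi_diff_right[OF v w v] gi_diff_right[OF v w w] gi_diff_right[OF w v v] gi_diff_right[OF w v w] gi_commute[of w v])
  then show ?thesis by (simp add: grad_norm_def)
qed

lemma gn_triangle3:
  assumes "u \<in> VH" "v \<in> VH" "w \<in> VH"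
  shows "gn (\<lambda>x. u x - w x) \<le> gn (\<lambda>x. u x - v x) + gn (\<lambda>x. v x - w x)"
proof -
  have "gn (\<lambda>x. u x - w x) = gn (\<lambda>x. (u x - v x) - (w x - v x))" by simp
  also have "\<dots> \<le> gn (\<lambda>x. u x - v x) + gn (\<lambda>x. w x - v x)"
    by (intro gn_diff_le VH_diff assms)
  finally show ?thesis using gn_diff_commute[OF assms(2,3)] by simp
qed

lemma gn_le_H1: "v \<in> VH \<Longrightarrow> gn v \<le> vec_norm (H_norm 1 \<Omega>) v"
proof (rule power2_le_imp_le)
  assume v: "v \<in> VH"
  show "(gn v)\<^sup>2 \<le> (vec_norm (H_norm 1 \<Omega>) v)\<^sup>2"
    unfolding gn_sq gi_self vec_norm_sq
    by (intro sum_mono) (simp add: H1_norm_sq'[OF VH_component[OF v]])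
qed (simp add: vec_norm_nonneg)

lemma divergence_L2: "v \<in> VH \<Longrightarrow> divergence \<Omega> v \<in> L2 M"
  unfolding divergence_def by (intro L2_sum D_L2)

lemma dv_eq: "v \<in> VH \<Longrightarrow> q \<in> L2 M \<Longrightarrow> dv v q = (\<Sum>b\<in>Basis. l2_inner M (D b b v) q)"
  unfolding divergence_def by (rule l2_inner_sum_left) (auto intro: D_L2)

lemma dv_diff_left: "v \<in> VH \<Longrightarrow> w \<in> VH \<Longrightarrow> q \<in> L2 M \<Longrightarrow> dv (\<lambda>x. v x - w x) q = dv v q - dv w q"
  by (simp add: dv_eq VH_diff D_diff_inner sum_subtractf)

lemma dv_diff_right: "v \<in> VH \<Longrightarrow> q \<in> L2 M \<Longrightarrow> r \<in> L2 M \<Longrightarrow> dv v (\<lambda>x. q x - r x) = dv v q - dv v r"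
  by (simp add: l2_inner_diff_right divergence_L2)

lemma D_norm_le_gn: "b \<in> Basis \<Longrightarrow> c \<in> Basis \<Longrightarrow> l2_norm M (D c b v) \<le> gn v"
proof (rule power2_le_imp_le)
  assume b: "b \<in> Basis" and c: "c \<in> Basis"
  have "(l2_norm M (D c b v))\<^sup>2 \<le> (\<Sum>c\<in>Basis. (l2_norm M (D c b v))\<^sup>2)"
    by (rule member_le_sum[OF c]) auto
  also have "\<dots> \<le> (\<Sum>b\<in>Basis. \<Sum>c\<in>Basis. (l2_norm M (D c b v))\<^sup>2)"
    by (rule member_le_sum[OF b]) (auto intro: sum_nonneg)
  finally show "(l2_norm M (D c b v))\<^sup>2 \<le> (gn v)\<^sup>2" by (simp add: gn_sq gi_self)
qed (simp add: gn_nonneg)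

text \<open>Each diagonal derivative in the divergence is bounded by the full gradient norm, hence
  the dimension as a factor.\<close>

lemma dv_bound:
  assumes v: "v \<in> VH" and q: "q \<in> L2 M"
  shows "\<bar>dv v q\<bar> \<le> real DIM('a) * gn v * l2_norm M q"
proof -
  have "\<bar>dv v q\<bar> \<le> (\<Sum>b\<in>(Basis::'a set). gn v * l2_norm M q)"
    unfolding dv_eq[OF v q]
  proof (intro order_trans[OF sum_abs] sum_mono)
    fix b :: 'a assume b: "b \<in> Basis"
    have "\<bar>l2_inner M (D b b v) q\<bar> \<le> l2_norm M (D b b v) * l2_norm M q"
      by (intro l2_Cauchy_Schwarz D_L2 v b q)
    also have "\<dots> \<le> gn v * l2_norm M q" by (intro mult_right_mono D_norm_le_gn b l2_norm_nonneg)
    finally show "\<bar>l2_inner M (D b b v) q\<bar> \<le> gn v * l2_norm M q" .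
  qed
  then show ?thesis by simp
qed

lemma has_trace_vec_diff:
  "has_trace_vec \<Omega> v g \<Longrightarrow> has_trace_vec \<Omega> w k \<Longrightarrow> has_trace_vec \<Omega> (\<lambda>x. v x - w x) (\<lambda>x. g x - k x)"
  by (simp add: has_trace_vec_def component_diff has_trace_diff)

lemma has_trace_vec_VH: "has_trace_vec \<Omega> v g \<Longrightarrow> v \<in> VH"
  by (auto simp: has_trace_vec_def vec_space_def intro: has_trace_H1)

lemma has_trace_vec_exists:
  assumes "v \<in> VH"
  obtains g where "has_trace_vec \<Omega> v g"
proof -
  have "\<forall>b\<in>Basis. \<exists>g. has_trace \<Omega> (component v b) g"
    using trace_exists VH_component[OF assms] by blast
  then obtain G where G: "\<And>b. b \<in> Basis \<Longrightarrow> has_trace \<Omega> (component v b) (G b)" by metis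
  define g where "g x = (\<Sum>b\<in>Basis. G b x *\<^sub>R b)" for x
  have "component g b = G b" if "b \<in> Basis" for b
    using that by (auto simp: component_def g_def)
  then show ?thesis using G by (intro that[of g]) (auto simp: has_trace_vec_def)
qed

lemma Y_zero_VH: "v \<in> Y_zero \<Omega> \<Longrightarrow> v \<in> VH"
  by (simp add: Y_zero_def)

subsection \<open>Uniqueness of the continuous solution\<close>

lemma L2_0_L2: "q \<in> L2_0 M \<Longrightarrow> q \<in> L2 M"
  by (simp add: L2_0_def)

lemma const_L2: "(\<lambda>x. a) \<in> L2 M"
  by (intro smooth_L2 smooth_const)

lemma L2_0_diff_scale:
  assumes "p \<in> L2_0 M" "q \<in> L2_0 M"
  shows "(\<lambda>x. p x - a * q x) \<in> L2_0 M"
  using assms by (auto simp: L2_0_def l2_inner_diff_left L2_cmult const_L2 l2_inner_cmult_left intro!: L2_diff)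

text \<open>A field with a single nonzero component turns the divergence into one partial
  derivative, so testing with such fields tests the weak gradient of the pressure.\<close>

lemma test_field:
  assumes \<psi>: "smooth \<psi>" "supported_in \<psi> K" "K \<subseteq> \<Omega>" and b: "b \<in> Basis"
  shows "(\<lambda>x. \<psi> x *\<^sub>R b) \<in> Y_zero \<Omega>"
    and "AE x in M. divergence \<Omega> (\<lambda>x. \<psi> x *\<^sub>R b) x = dir_deriv b \<psi> x"
proof -
  let ?v = "\<lambda>x. \<psi> x *\<^sub>R b"
  have comp: "component ?v c = (\<lambda>x. (b \<bullet> c) * \<psi> x)" for c by (simp add: component_def mult.commute)
  have sm: "smooth (\<lambda>x. (b \<bullet> c) * \<psi> x)" for c by (intro smooth_cmult \<psi>)
  have "has_trace \<Omega> (\<lambda>x. (b \<bullet> c) * \<psi> x) (\<lambda>x. 0)" for c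
  proof (rule has_trace_cong[OF has_trace_smooth[OF sm]])
    fix x assume "x \<in> frontier \<Omega>"
    then have "x \<notin> \<Omega>" using open_\<Omega> by (simp add: frontier_def interior_open)
    then show "(b \<bullet> c) * \<psi> x = 0" using \<psi>(2,3) by (auto simp: supported_in_def)
  qed
  then have "has_trace_vec \<Omega> ?v (\<lambda>_. 0)" by (simp add: has_trace_vec_def comp component_zero)
  then show "?v \<in> Y_zero \<Omega>" using has_trace_vec_VH by (auto simp: Y_zero_def)
  have "AE x in M. \<forall>c\<in>Basis. D c c ?v x = (b \<bullet> c) * dir_deriv c \<psi> x"
  proof (rule AE_finite_allI)
    fix c :: 'a assume c: "c \<in> Basis"
    show "AE x in M. D c c ?v x = (b \<bullet> c) * dir_deriv c \<psi> x"
      unfolding comp by (rule weak_deriv(2)[OF has_weak_deriv_cmult[OF has_weak_deriv_smooth[OF \<psi>(1) c]]])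
  qed simp
  then show "AE x in M. divergence \<Omega> ?v x = dir_deriv b \<psi> x"
  proof eventually_elim
    case (elim x)
    then have "divergence \<Omega> ?v x = (\<Sum>c\<in>Basis. (b \<bullet> c) * dir_deriv c \<psi> x)" by (simp add: divergence_def)
    also have "\<dots> = (\<Sum>c\<in>Basis. if c = b then dir_deriv c \<psi> x else 0)"
      using b by (intro sum.cong) (auto simp: inner_Basis)
    finally show ?case using b by simp
  qed
qed

text \<open>The weak gradient of \<open>q\<close> vanishes, so \<open>q\<close> is constant on the
  connected domain, and the mean value 0 removes the constant because \<open>\<Omega>\<close> has
  positive measure.\<close>

lemma pressure_unique:
  assumes q: "q \<in> L2_0 M" and 0: "\<And>v. v \<in> Y_zero \<Omega> \<Longrightarrow> dv v q = 0"
  shows "AE x in M. q x = 0"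
proof -
  have qL: "q \<in> L2 M" by (rule L2_0_L2[OF q])
  have "\<exists>c. AE x in M. q x = c"
  proof (rule weak_gradient_zero_imp_const[OF qL connected_\<Omega>])
    fix \<phi> and b :: 'a assume \<phi>: "test_function \<Omega> \<phi>" and b: "b \<in> Basis"
    obtain \<psi> K where \<psi>: "smooth \<psi>" "compact K" "K \<subseteq> \<Omega>" "supported_in \<psi> K" "\<And>x. x \<in> \<Omega> \<Longrightarrow> \<psi> x = \<phi> x"
      by (rule test_function_extend[OF \<phi>]) auto
    note t = test_field[OF \<psi>(1,4,3) b]
    have "0 = dv (\<lambda>x. \<psi> x *\<^sub>R b) q" using 0[OF t(1)] by simp
    also have "\<dots> = l2_inner M (dir_deriv b \<psi>) q"
      using L2_measurable[OF qL] L2_measurable[OF divergence_L2[OF Y_zero_VH[OF t(1)]]] smooth_M[OF smooth_dir_deriv[OF \<psi>(1) b]]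
      by (intro l2_inner_cong_AE t(2)) auto
    also have "\<dots> = l2_inner M q (dir_deriv b \<phi>)"
      unfolding l2_inner_def
      by (intro Bochner_Integration.integral_cong refl)
         (simp add: space_M dir_deriv_cong_open[OF \<psi>(1) open_\<Omega> _ \<psi>(5)] mult.commute)
    finally show "l2_inner M q (dir_deriv b \<phi>) = 0" by simp
  qed
  then obtain c where c: "AE x in M. q x = c" by blast
  have "0 = l2_inner M q (\<lambda>_. 1)" using q by (simp add: L2_0_def)
  also have "\<dots> = l2_inner M (\<lambda>_. c) (\<lambda>_. 1)"
    using L2_measurable[OF qL] by (intro l2_inner_cong_AE c) auto
  also have "\<dots> = c * measure M \<Omega>" by (simp add: l2_inner_def space_M)
  finally have "c * measure M \<Omega> = 0" by simp
  moreover have "measure M \<Omega> > 0"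
  proof -
    obtain x r where r: "r > 0" "ball x r \<subseteq> \<Omega>" using nonempty_\<Omega> open_\<Omega> open_contains_ball by blast
    have "0 < measure lebesgue (ball x r)" using content_ball_pos[OF r(1), of x] by simp
    also have "\<dots> \<le> measure lebesgue \<Omega>"
      using r lmeasurable_open[OF bounded_\<Omega> open_\<Omega>] by (intro measure_mono_fmeasurable) auto
    also have "\<dots> = measure M \<Omega>" by (simp add: measure_restrict_space)
    finally show ?thesis .
  qed
  ultimately have "c = 0" by simp
  with c show ?thesis by simp
qed

text \<open>The difference of the velocities is an admissible test function whose divergence is
  orthogonal to both pressures; in the gradient form it is therefore orthogonal to both velocities
  and so to itself. Then \<open>p - \<nu> * pb\<close> annihilates the divergences of all test
  functions.\<close>

lemma weak_solution_scaling:
  assumes \<nu>: "\<nu> > 0" and s: "weak_solution \<Omega> \<nu> u y p" and s1: "weak_solution \<Omega> 1 u yb pb"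
  shows "gn (\<lambda>x. y x - yb x) = 0" "AE x in M. p x = \<nu> * pb x"
proof -
  have y: "y \<in> VH" "yb \<in> VH" "has_trace_vec \<Omega> y u" "has_trace_vec \<Omega> yb u"
    and p: "p \<in> L2_0 M" "pb \<in> L2_0 M"
    and m: "\<And>v. v \<in> Y_zero \<Omega> \<Longrightarrow> \<nu> * gi y v - dv v p = 0" "\<And>v. v \<in> Y_zero \<Omega> \<Longrightarrow> gi yb v - dv v pb = 0"
    and d: "\<And>q. q \<in> L2_0 M \<Longrightarrow> dv y q = 0" "\<And>q. q \<in> L2_0 M \<Longrightarrow> dv yb q = 0"
    using s s1 by (auto simp: weak_solution_def Y_star_def)
  have pL: "p \<in> L2 M" "pb \<in> L2 M" using p by (auto intro: L2_0_L2)
  let ?e = "\<lambda>x. y x - yb x"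
  have eV: "?e \<in> VH" by (intro VH_diff y)
  have e0: "?e \<in> Y_zero \<Omega>"
    using has_trace_vec_diff[OF y(3,4)] eV by (simp add: Y_zero_def)
  have de: "dv ?e q = 0" if "q \<in> L2_0 M" for q
    using d that by (simp add: dv_diff_left y L2_0_L2)
  have "\<nu> * gi y ?e = 0" "gi yb ?e = 0" using m[OF e0] de p by auto
  then have "gi ?e ?e = 0" using \<nu> by (simp add: gi_diff_left[OF y(1,2) eV])
  then show g0: "gn ?e = 0" by (simp add: grad_norm_def)
  have qL: "(\<lambda>x. p x - \<nu> * pb x) \<in> L2_0 M" by (rule L2_0_diff_scale[OF p])
  have "AE x in M. p x - \<nu> * pb x = 0"
  proof (rule pressure_unique[OF qL])
    fix v assume v: "v \<in> Y_zero \<Omega>"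
    have vV: "v \<in> VH" by (rule Y_zero_VH[OF v])
    have "gi y v - gi yb v = 0"
      using gi_Cauchy_Schwarz[OF eV vV] g0 by (simp add: gi_diff_left[OF y(1,2) vV])
    then have "gi y v = gi yb v" by simp
    then show "dv v (\<lambda>x. p x - \<nu> * pb x) = 0"
      using m[OF v] by (simp add: dv_diff_right[OF vV pL(1) L2_cmult[OF pL(2)]] l2_inner_cmult_right)
  qed
  then show "AE x in M. p x = \<nu> * pb x" by eventually_elim simp
qed

subsection \<open>Quasi-optimality of the discrete solution\<close>

text \<open>Either \<open>x \<le> T\<close>, or \<open>T < x\<close> and \<open>m * T\<close> can be
  absorbed in the linear term, after which one factor \<open>x\<close> is divided out.\<close>

lemma quadratic_bound:
  fixes x T m :: real
  assumes "x\<^sup>2 \<le> T * ((m + 1) * x + m * T)" "T \<ge> 0" "m \<ge> 0" "x \<ge> 0"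
  shows "x \<le> (2 * m + 1) * T"
proof (cases "x \<le> T")
  case True
  also have "T \<le> (2 * m + 1) * T" using assms(2,3) by (simp add: distrib_right)
  finally show ?thesis .
next
  case False
  then have "m * T \<le> m * x" using assms(3) by (intro mult_left_mono) auto
  then have "T * ((m + 1) * x + m * T) \<le> T * ((m + 1) * x + m * x)" using assms(2) by (intro mult_left_mono) auto
  with assms(1) have "x * x \<le> ((2 * m + 1) * T) * x" by (simp add: power2_eq_square algebra_simps)
  then show ?thesis using False assms(2) by (simp add: mult_le_cancel_right)
qed

text \<open>\<open>T\<close> collects the approximation errors; \<open>X\<close> and
  \<open>s\<close> are the velocity and pressure distances of the discrete solution to the
  comparison pair. The inf-sup condition bounds \<open>s\<close> by a multiple of
  \<open>X + T\<close>; the energy identity for \<open>X\<close> contains \<open>s\<close> through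
  the divergence of \<open>y - vh\<close>, on which no discrete orthogonality is available. Both
  combine to the hypothesis of \<open>quadratic_bound\<close> with
  \<open>m = \<delta> / \<alpha>\<close>.\<close>

lemma discrete_quasi_optimal:
  assumes \<alpha>: "\<alpha> > 0"
    and infsup: "\<And>q. q \<in> Qh \<Longrightarrow> (SUP v \<in> Y_zero_h \<Omega> Yh. dv v q / gn v) \<ge> \<alpha> * l2_norm M q"
    and Yh: "finite_dimensional Yh" "Yh \<subseteq> VH" and Qh: "finite_dimensional Qh" "Qh \<subseteq> L2_0 M"
    and sol: "weak_solution \<Omega> 1 u y p" and dsol: "discrete_solution \<Omega> Yh Qh 1 uh yh ph"
    and vh: "vh \<in> Y_star_h \<Omega> Yh uh" and qh: "qh \<in> Qh"
  shows "gn (\<lambda>x. y x - yh x) + l2_norm M (\<lambda>x. p x - ph x)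
    \<le> (1 + (2 * (DIM('a) / \<alpha>) + 1) * (1 + DIM('a)) + (2 * (DIM('a) / \<alpha>) + 2) * (1 + DIM('a)) / \<alpha>)
       * (gn (\<lambda>x. y x - vh x) + l2_norm M (\<lambda>x. p x - qh x))"
proof -
  define \<delta> where "\<delta> = real DIM('a)"
  have \<delta>: "\<delta> > 0" by (simp add: \<delta>_def)
  have y: "y \<in> VH" and p: "p \<in> L2 M"
    and m: "\<And>v. v \<in> Y_zero \<Omega> \<Longrightarrow> gi y v = dv v p" and d: "\<And>q. q \<in> L2_0 M \<Longrightarrow> dv y q = 0"
    using sol by (auto simp: weak_solution_def Y_star_def intro: L2_0_L2)
  have yh: "yh \<in> Yh" "has_trace_vec \<Omega> yh uh" and ph: "ph \<in> Qh"
    and mh: "\<And>v. v \<in> Y_zero_h \<Omega> Yh \<Longrightarrow> gi yh v = dv v ph" and dh: "\<And>q. q \<in> Qh \<Longrightarrow> dv yh q = 0"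
    using dsol by (auto simp: discrete_solution_def Y_star_h_def)
  have vh': "vh \<in> Yh" "has_trace_vec \<Omega> vh uh" using vh by (auto simp: Y_star_h_def)
  have V: "yh \<in> VH" "vh \<in> VH" using yh vh' Yh by auto
  have L: "ph \<in> L2 M" "qh \<in> L2 M" using ph qh Qh by (auto intro: L2_0_L2)
  have Y0: "v \<in> Y_zero \<Omega>" "v \<in> VH" if "v \<in> Y_zero_h \<Omega> Yh" for v
    using that Yh(2) by (auto simp: Y_zero_h_def Y_zero_def)
  let ?d = "\<lambda>x. yh x - vh x" and ?a = "\<lambda>x. y x - vh x" and ?s = "\<lambda>x. ph x - qh x" and ?b = "\<lambda>x. p x - qh x"
  have d0: "?d \<in> Y_zero_h \<Omega> Yh"
    using finite_dimensional_diff[OF Yh(1) yh(1) vh'(1)] has_trace_vec_diff[OF yh(2) vh'(2)] by (simp add: Y_zero_h_def)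
  have dV: "?d \<in> VH" "?a \<in> VH" by (intro VH_diff V y)+
  have sQ: "?s \<in> Qh" by (rule finite_dimensional_diff[OF Qh(1) ph qh])
  have sL: "?s \<in> L2 M" "?b \<in> L2 M" by (intro L2_diff L p)+
  define A B X s where "A = gn ?a" and "B = l2_norm M ?b" and "X = gn ?d" and "s = l2_norm M ?s"
  have nn: "A \<ge> 0" "B \<ge> 0" "X \<ge> 0" "s \<ge> 0" by (simp_all add: A_def B_def X_def s_def gn_nonneg l2_norm_nonneg)
  define T where "T = A + \<delta> * B"
  have T: "T \<ge> 0" using nn \<delta> by (simp add: T_def)
  have err: "dv v ?s = gi ?d v - gi ?a v + dv v ?b" if v: "v \<in> Y_zero_h \<Omega> Yh" for v
    using m[OF Y0(1)[OF v]] mh[OF v] Y0(2)[OF v]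
    by (simp add: dv_diff_right L p gi_diff_left V y)
  have bnd: "dv v ?s \<le> (X + T) * gn v" if v: "v \<in> Y_zero_h \<Omega> Yh" for v
  proof -
    have "dv v ?s \<le> \<bar>gi ?d v\<bar> + \<bar>gi ?a v\<bar> + \<bar>dv v ?b\<bar>" unfolding err[OF v] by linarith
    also have "\<dots> \<le> X * gn v + A * gn v + \<delta> * gn v * B"
      unfolding X_def A_def B_def \<delta>_def
      by (intro add_mono gi_Cauchy_Schwarz dv_bound dV sL Y0(2)[OF v])
    finally show ?thesis by (simp add: T_def algebra_simps)
  qed
  have "\<alpha> * s \<le> (SUP v \<in> Y_zero_h \<Omega> Yh. dv v ?s / gn v)" unfolding s_def by (rule infsup[OF sQ])
  \<comment> \<open>A real supremum over a nonempty family is at most any common upper bound, so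
    bounding every quotient is enough.\<close>
  also have "\<dots> \<le> X + T"
  proof (rule cSUP_least)
    show "Y_zero_h \<Omega> Yh \<noteq> {}" using d0 by blast
    fix v assume v: "v \<in> Y_zero_h \<Omega> Yh"
    show "dv v ?s / gn v \<le> X + T"
    proof (cases "gn v = 0")
      \<comment> \<open>The quotient is then 0 by the convention on division, as in
        \<open>assumption_A1\<close>.\<close>
      case True
      then show ?thesis using nn T by simp
    next
      case False
      then have "gn v > 0" using gn_nonneg[of v] by simp
      then show ?thesis using bnd[OF v] by (simp add: divide_le_eq)
    qed
  qed
  finally have s1: "s \<le> (X + T) / \<alpha>" using \<alpha> by (simp add: le_divide_eq mult.commute)
  have "X\<^sup>2 = dv ?d ?s + gi ?a ?d - dv ?d ?b" using err[OF d0] by (simp add: X_def gn_sq)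
  \<comment> \<open>The divergences of both \<open>yh\<close> and \<open>y\<close> are orthogonal to
    the discrete pressures, so each side equals \<open>- dv vh ?s\<close>. This trades the discrete
    velocity error for the approximation error \<open>?a\<close>.\<close>
  also have "dv ?d ?s = dv ?a ?s"
    using dh[OF sQ] d[of ?s] sQ Qh(2) by (simp add: dv_diff_left V y sL subset_iff)
  also have "dv ?a ?s + gi ?a ?d - dv ?d ?b \<le> \<bar>dv ?a ?s\<bar> + \<bar>gi ?a ?d\<bar> + \<bar>dv ?d ?b\<bar>" by linarith
  also have "\<dots> \<le> \<delta> * A * s + A * X + \<delta> * X * B"
    unfolding X_def A_def B_def s_def \<delta>_def
    by (intro add_mono gi_Cauchy_Schwarz dv_bound dV sL)
  also have "\<dots> = \<delta> * A * s + T * X" by (simp add: T_def algebra_simps)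
  also have "\<dots> \<le> \<delta> * T * ((X + T) / \<alpha>) + T * X"
    using s1 nn \<delta> T by (intro add_mono mult_mono mult_left_mono order_refl) (auto simp: T_def)
  also have "\<dots> = T * ((\<delta> / \<alpha> + 1) * X + \<delta> / \<alpha> * T)" by (simp add: algebra_simps add_divide_distrib)
  finally have "X\<^sup>2 \<le> T * ((\<delta> / \<alpha> + 1) * X + \<delta> / \<alpha> * T)" .
  then have X: "X \<le> (2 * (\<delta> / \<alpha>) + 1) * T" by (rule quadratic_bound) (use T \<delta> \<alpha> nn in auto)
  have TA: "T \<le> (1 + \<delta>) * (A + B)" using nn \<delta> by (simp add: T_def algebra_simps)
  have X2: "X \<le> (2 * (\<delta> / \<alpha>) + 1) * ((1 + \<delta>) * (A + B))"
    using X mult_left_mono[OF TA, of "2 * (\<delta> / \<alpha>) + 1"] \<delta> \<alpha> by simp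
  have XT: "X + T \<le> (2 * (\<delta> / \<alpha>) + 2) * ((1 + \<delta>) * (A + B))"
    using X2 TA by (simp add: distrib_right)
  have s2: "s \<le> (2 * (\<delta> / \<alpha>) + 2) * ((1 + \<delta>) * (A + B)) / \<alpha>"
    using s1 divide_right_mono[OF XT, of \<alpha>] \<alpha> by simp
  have "gn (\<lambda>x. y x - yh x) \<le> A + X"
    using gn_triangle3[OF y V(2,1)] gn_diff_commute[OF V] by (simp add: A_def X_def)
  moreover have "l2_norm M (\<lambda>x. p x - ph x) \<le> B + s"
    using l2_norm_triangle_diff[OF sL(2,1)] by (simp add: B_def s_def)
  ultimately have "gn (\<lambda>x. y x - yh x) + l2_norm M (\<lambda>x. p x - ph x) \<le> (A + B) + X + s" by linarith
  also have "\<dots> \<le> (A + B) + (2 * (\<delta> / \<alpha>) + 1) * ((1 + \<delta>) * (A + B)) + (2 * (\<delta> / \<alpha>) + 2) * ((1 + \<delta>) * (A + B)) / \<alpha>"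
    by (intro add_mono X2 s2 order_refl)
  also have "\<dots> = (1 + (2 * (\<delta> / \<alpha>) + 1) * (1 + \<delta>) + (2 * (\<delta> / \<alpha>) + 2) * (1 + \<delta>) / \<alpha>) * (A + B)"
    by (simp add: distrib_right mult.assoc)
  finally show ?thesis by (simp add: A_def B_def \<delta>_def)
qed

text \<open>Functions in \<open>Qh\<close> have mean value zero, so the constant in an element of \<open>Q_tilde_h Qh\<close> only
  increases the distance to \<open>p\<close>.\<close>

lemma Q_tilde_drop_constant:
  assumes "p \<in> L2_0 M" "q \<in> L2_0 M"
  shows "l2_norm M (\<lambda>x. p x - q x) \<le> l2_norm M (\<lambda>x. p x - (q x + a))"
proof (rule power2_le_imp_le)
  let ?r = "\<lambda>x. p x - q x"
  have r: "?r \<in> L2_0 M" using L2_0_diff_scale[OF assms, of 1] by simp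
  have rL: "?r \<in> L2 M" by (rule L2_0_L2[OF r])
  have "l2_inner M ?r (\<lambda>x. a * 1) = 0" using r by (simp only: l2_inner_cmult_right) (simp add: L2_0_def)
  then have 0: "l2_inner M ?r (\<lambda>x. a) = 0" by simp
  have "(l2_norm M (\<lambda>x. ?r x - a))\<^sup>2 = (l2_norm M ?r)\<^sup>2 + l2_inner M (\<lambda>x. a) (\<lambda>x. a)"
    using 0 l2_inner_commute[of M "\<lambda>x. a" ?r]
    by (simp add: l2_norm_sq_inner l2_inner_diff_left[OF rL const_L2 L2_diff[OF rL const_L2]]
        l2_inner_diff_right[OF rL const_L2 rL] l2_inner_diff_right[OF rL const_L2 const_L2])
  then show "(l2_norm M ?r)\<^sup>2 \<le> (l2_norm M (\<lambda>x. p x - (q x + a)))\<^sup>2"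
    using l2_inner_self_nonneg[of M "\<lambda>x. a"] by (simp add: diff_diff_eq)
qed (rule l2_norm_nonneg)

lemma vec_trace_theorem:
  obtains C where "C \<ge> 0"
    "\<And>v g. has_trace_vec \<Omega> v g \<Longrightarrow> vec_norm (Hbd_norm (1/2) \<Omega>) g \<le> C * vec_norm (H_norm 1 \<Omega>) v"
proof -
  obtain C where C: "C \<ge> 0"
    "\<And>v g. has_trace \<Omega> v g \<Longrightarrow> (Hbd_norm (1/2) \<Omega> g)\<^sup>2 \<le> C * (H_norm 1 \<Omega> v)\<^sup>2"
    by (rule trace_theorem) blast
  have "vec_norm (Hbd_norm (1/2) \<Omega>) g \<le> sqrt C * vec_norm (H_norm 1 \<Omega>) v" if t: "has_trace_vec \<Omega> v g" for v g
  proof (rule power2_le_imp_le)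
    show "(vec_norm (Hbd_norm (1/2) \<Omega>) g)\<^sup>2 \<le> (sqrt C * vec_norm (H_norm 1 \<Omega>) v)\<^sup>2"
      unfolding vec_norm_sq power_mult_distrib sum_distrib_left
      using t C by (intro sum_mono) (auto simp: has_trace_vec_def)
  qed (use C in \<open>simp add: vec_norm_nonneg\<close>)
  then show ?thesis using C by (intro that[of "sqrt C"]) auto
qed

text \<open>The trace hypotheses make both seminorms finite. The second function carries the factor
  -1, so that the difference becomes a sum; in the application this factor turns
  \<open>uh - u\<close> into \<open>u - uh\<close>.\<close>

lemma vec_Hbd_diff_le:
  assumes v: "has_trace_vec \<Omega> v f" and w: "has_trace_vec \<Omega> w g"
  shows "vec_norm (Hbd_norm (1/2) \<Omega>) (\<lambda>x. f x - g x)
    \<le> 2 * (vec_norm (Hbd_norm (1/2) \<Omega>) f + vec_norm (Hbd_norm (1/2) \<Omega>) (\<lambda>x. (-1) *\<^sub>R g x))"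
    (is "?l \<le> 2 * (?f + ?g)")
proof (rule power2_le_imp_le)
  have "(Hbd_norm (1/2) \<Omega> (component (\<lambda>x. f x - g x) b))\<^sup>2
    \<le> 2 * (Hbd_norm (1/2) \<Omega> (component f b))\<^sup>2 + 2 * (Hbd_norm (1/2) \<Omega> (component (\<lambda>x. (-1) *\<^sub>R g x) b))\<^sup>2"
    if b: "b \<in> Basis" for b
  proof -
    have 1: "has_trace \<Omega> (component v b) (component f b)" using v b by (simp add: has_trace_vec_def)
    have "has_trace \<Omega> (component w b) (component g b)" using w b by (simp add: has_trace_vec_def)
    from has_trace_cmult[OF this, of "-1"]
    have 2: "has_trace \<Omega> (\<lambda>x. -1 * component w b x) (component (\<lambda>x. (-1) *\<^sub>R g x) b)" by (simp only: component_scale)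
    have "component (\<lambda>x. f x - g x) b = (\<lambda>x. component f b x + component (\<lambda>x. (-1) *\<^sub>R g x) b x)"
      by (simp add: component_def inner_diff_left)
    then show ?thesis
      using Hbd_norm_add_sq_le[OF has_trace_L2[OF 1] has_trace_slob_finite[OF 1] has_trace_L2[OF 2] has_trace_slob_finite[OF 2]]
      by simp
  qed
  then have "?l\<^sup>2 \<le> 2 * ?f\<^sup>2 + 2 * ?g\<^sup>2"
    unfolding vec_norm_sq sum_distrib_left sum.distrib[symmetric] by (intro sum_mono)
  also have "\<dots> \<le> (2 * (?f + ?g))\<^sup>2"
    using vec_norm_nonneg[of "Hbd_norm (1/2) \<Omega>" f] vec_norm_nonneg[of "Hbd_norm (1/2) \<Omega>" "\<lambda>x. (-1) *\<^sub>R g x"]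
    by (simp add: power2_eq_square algebra_simps)
  finally show "?l\<^sup>2 \<le> (2 * (?f + ?g))\<^sup>2" .
qed (simp add: vec_norm_nonneg)

end

subsection \<open>The error estimate\<close>

context polyhedral
begin

lemma vec_H1_diff_commute:
  assumes "v \<in> VH" "w \<in> VH"
  shows "vec_norm (H_norm 1 \<Omega>) (\<lambda>x. v x - w x) = vec_norm (H_norm 1 \<Omega>) (\<lambda>x. w x - v x)"
  unfolding vec_norm_def component_diff
  by (intro arg_cong[where f = sqrt] sum.cong refl arg_cong[where f = "\<lambda>z. z\<^sup>2"] H1_norm_diff_commute VH_component assms)

lemma approximation_in_Y_star:
  assumes Yh: "finite_dimensional Yh" "Yh \<subseteq> VH"
    and Ct: "Ct \<ge> 0" "\<And>v g. has_trace_vec \<Omega> v g \<Longrightarrow> vec_norm (Hbd_norm (1/2) \<Omega>) g \<le> Ct * vec_norm (H_norm 1 \<Omega>) v"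
    and c1: "c1 > 0" "\<And>wh. wh \<in> Y_bd_h \<Omega> Yh \<Longrightarrow>
      (INF \<phi>h \<in> Y_star_h \<Omega> Yh wh. gn \<phi>h) \<le> c1 * vec_norm (Hbd_norm (1/2) \<Omega>) wh"
    and y: "y \<in> VH" "has_trace_vec \<Omega> y u" and yh: "yh \<in> Yh" "has_trace_vec \<Omega> yh uh"
    and zh: "zh \<in> Yh" "vec_norm (H_norm 1 \<Omega>) (\<lambda>x. y x - zh x) \<le> a"
    and ub: "vec_norm (Hbd_norm (1/2) \<Omega>) (\<lambda>x. u x - uh x) \<le> b" and \<eta>: "\<eta> > 0"
  shows "\<exists>vh \<in> Y_star_h \<Omega> Yh uh. gn (\<lambda>x. y x - vh x) \<le> a + c1 * (2 * (Ct * a + b)) + \<eta>"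
proof -
  have zV: "zh \<in> VH" using zh Yh by blast
  obtain g where g: "has_trace_vec \<Omega> zh g" by (rule has_trace_vec_exists[OF zV])
  let ?w = "\<lambda>x. g x - uh x"
  have t1: "has_trace_vec \<Omega> (\<lambda>x. zh x - y x) (\<lambda>x. g x - u x)" by (rule has_trace_vec_diff[OF g y(2)])
  \<comment> \<open>\<open>yh\<close> extends \<open>uh\<close> to a function in H1; the finiteness
    of the seminorm of \<open>u - uh\<close> comes from this extension.\<close>
  have t2: "has_trace_vec \<Omega> (\<lambda>x. yh x - y x) (\<lambda>x. uh x - u x)" by (rule has_trace_vec_diff[OF yh(2) y(2)])
  have "vec_norm (Hbd_norm (1/2) \<Omega>) (\<lambda>x. g x - u x) \<le> Ct * vec_norm (H_norm 1 \<Omega>) (\<lambda>x. y x - zh x)"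
    using Ct(2)[OF t1] vec_H1_diff_commute[OF zV y(1)] by simp
  also have "\<dots> \<le> Ct * a" by (intro mult_left_mono zh Ct)
  finally have e1: "vec_norm (Hbd_norm (1/2) \<Omega>) (\<lambda>x. g x - u x) \<le> Ct * a" .
  have "vec_norm (Hbd_norm (1/2) \<Omega>) ?w \<le> 2 * (Ct * a + b)"
    using vec_Hbd_diff_le[OF t1 t2] e1 ub by simp
  then have w: "c1 * vec_norm (Hbd_norm (1/2) \<Omega>) ?w \<le> c1 * (2 * (Ct * a + b))"
    using c1(1) by (intro mult_left_mono) auto
  \<comment> \<open>Exhibits \<open>?w\<close> as the trace of a discrete function, so that the
    lifting bound applies to it and its infimum is over a nonempty set.\<close>
  have wbd: "(\<lambda>x. zh x - yh x) \<in> Y_star_h \<Omega> Yh ?w"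
    using finite_dimensional_diff[OF Yh(1) zh(1) yh(1)] has_trace_vec_diff[OF g yh(2)] by (simp add: Y_star_h_def)
  then have "?w \<in> Y_bd_h \<Omega> Yh" by (auto simp: Y_star_h_def Y_bd_h_def)
  note bd = order_trans[OF c1(2)[OF this] w]
  have "Y_star_h \<Omega> Yh ?w \<noteq> {}" using wbd by blast
  from INF_approx[OF this gn_nonneg bd \<eta>]
  obtain \<phi> where \<phi>: "\<phi> \<in> Y_star_h \<Omega> Yh ?w" "gn \<phi> \<le> c1 * (2 * (Ct * a + b)) + \<eta>" by blast
  let ?v = "\<lambda>x. zh x - \<phi> x"
  have \<phi>': "\<phi> \<in> Yh" "has_trace_vec \<Omega> \<phi> ?w" using \<phi> by (auto simp: Y_star_h_def)
  then have \<phi>V: "\<phi> \<in> VH" using Yh by blast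
  have "has_trace_vec \<Omega> ?v uh" using has_trace_vec_diff[OF g \<phi>'(2)] by simp
  then have v: "?v \<in> Y_star_h \<Omega> Yh uh"
    using finite_dimensional_diff[OF Yh(1) zh(1) \<phi>'(1)] by (simp add: Y_star_h_def)
  have "gn (\<lambda>x. y x - ?v x) \<le> gn (\<lambda>x. y x - zh x) + gn (\<lambda>x. zh x - ?v x)"
    by (rule gn_triangle3[OF y(1) zV VH_diff[OF zV \<phi>V]])
  also have "gn (\<lambda>x. zh x - ?v x) = gn \<phi>" by simp
  also have "gn (\<lambda>x. y x - zh x) + gn \<phi> \<le> a + (c1 * (2 * (Ct * a + b)) + \<eta>)"
    using gn_le_H1[OF VH_diff[OF y(1) zV]] zh(2) \<phi>(2) by linarith
  finally show ?thesis using v by (intro bexI[of _ ?v]) simp_all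
qed

text \<open>The error of the boundary datum enters as a free bound \<open>b\<close>, so the estimate
  with the data norm and the one for equal data are both instances. \<open>K\<close> is fixed before
  \<open>\<nu>\<close> and \<open>h\<close>; it depends on \<open>t\<close> through the constant of
  (A2).\<close>

theorem error_estimate:
  assumes sp: "discrete_spaces \<Omega> Y Q" and A1: "assumption_A1 \<Omega> Y Q" and A2: "assumption_A2 \<Omega> Y Q k"
    and A3: "assumption_A3 \<Omega> Y" and t: "t \<ge> 1/2"
  obtains K where "K \<ge> 0"
    "\<And>\<nu> h u uh y p yb pb yh ph b. \<nu> > 0 \<Longrightarrow> h > 0 \<Longrightarrow> weak_solution \<Omega> \<nu> u y p \<Longrightarrow>
      weak_solution \<Omega> 1 u yb pb \<Longrightarrow> discrete_solution \<Omega> (Y h) (Q h) \<nu> uh yh ph \<Longrightarrow>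
      yb \<in> vec_space (H (t + 1/2) \<Omega>) \<Longrightarrow> pb \<in> H (t - 1/2) \<Omega> \<Longrightarrow>
      vec_norm (Hbd_norm (1/2) \<Omega>) (\<lambda>x. u x - uh x) \<le> b \<Longrightarrow> 0 \<le> b \<Longrightarrow>
      \<nu> * gn (\<lambda>x. y x - yh x) + l2_norm M (\<lambda>x. p x - ph x)
      \<le> K * \<nu> * (h powr (min (t - 1/2) (real k)) *
          (vec_norm (H_norm (t + 1/2) \<Omega>) yb + H_norm (t - 1/2) \<Omega> pb) + b)"
proof -
  obtain \<alpha> where \<alpha>: "\<alpha> > 0" "\<And>h q. h > 0 \<Longrightarrow> q \<in> Q h \<Longrightarrow>
      (SUP v \<in> Y_zero_h \<Omega> (Y h). dv v q / gn v) \<ge> \<alpha> * l2_norm M q"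
    using A1 unfolding assumption_A1_def by blast
  obtain c1 where c1: "c1 > 0" "\<And>h wh. h > 0 \<Longrightarrow> wh \<in> Y_bd_h \<Omega> (Y h) \<Longrightarrow>
      (INF \<phi>h \<in> Y_star_h \<Omega> (Y h) wh. gn \<phi>h) \<le> c1 * vec_norm (Hbd_norm (1/2) \<Omega>) wh"
    using A3 unfolding assumption_A3_def by blast
  obtain c2' where c2': "\<And>h. h > 0 \<Longrightarrow>
        (\<forall>v \<in> vec_space (H ((t - 1/2) + 1) \<Omega>).
           (INF vh \<in> Y h. vec_norm (H_norm 1 \<Omega>) (\<lambda>x. v x - vh x))
           \<le> c2' * h powr (min (real k) (t - 1/2)) * vec_norm (H_norm ((t - 1/2) + 1) \<Omega>) v) \<and>
        (\<forall>q \<in> H (t - 1/2) \<Omega>.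
           (INF qh \<in> Q_tilde_h (Q h). l2_norm M (\<lambda>x. q x - qh x))
           \<le> c2' * h powr (min (real k) (t - 1/2)) * H_norm (t - 1/2) \<Omega> q)"
    using A2[unfolded assumption_A2_def, rule_format, of "t - 1/2"] t by auto
  \<comment> \<open>The constant in (A2) comes without a sign, and the estimates below multiply by
    it.\<close>
  define c2 where "c2 = \<bar>c2'\<bar>"
  define E where "E h = h powr (min (t - 1/2) (real k))" for h
  have E0: "E h \<ge> 0" for h by (simp add: E_def)
  have t1: "(t - 1/2) + 1 = t + 1/2" by simp
  obtain Ct where Ct: "Ct \<ge> 0"
    "\<And>v g. has_trace_vec \<Omega> v g \<Longrightarrow> vec_norm (Hbd_norm (1/2) \<Omega>) g \<le> Ct * vec_norm (H_norm 1 \<Omega>) v"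
    by (rule vec_trace_theorem) blast
  define K0 where "K0 = 1 + (2 * (DIM('a) / \<alpha>) + 1) * (1 + DIM('a)) + (2 * (DIM('a) / \<alpha>) + 2) * (1 + DIM('a)) / \<alpha>"
  have K0: "K0 \<ge> 0" using \<alpha>(1) by (simp add: K0_def)
  \<comment> \<open>The error of \<open>zh\<close> enters directly and once more through the lifting
    of its trace error; the factor 2 comes from \<open>vec_Hbd_diff_le\<close>.\<close>
  define K1 where "K1 = 1 + 2 * c1 * Ct"
  have K1: "K1 \<ge> 1" using c1 Ct by (simp add: K1_def)
  define K where "K = K0 * (K1 * c2 + 2 * c1)"
  have c2: "c2 \<ge> 0" by (simp add: c2_def)
  have Kge: "K \<ge> 0" using K0 K1 c1 c2 by (simp add: K_def)
  show ?thesis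
  proof (rule that[OF Kge])
    fix \<nu> h u uh y p yb pb yh ph b
    assume \<nu>: "\<nu> > (0::real)" and h: "h > (0::real)" and s\<nu>: "weak_solution \<Omega> \<nu> u y p"
      and s1: "weak_solution \<Omega> 1 u yb pb" and ds: "discrete_solution \<Omega> (Y h) (Q h) \<nu> uh yh ph"
      and yb: "yb \<in> vec_space (H (t + 1/2) \<Omega>)" and pb: "pb \<in> H (t - 1/2) \<Omega>"
      and ub: "vec_norm (Hbd_norm (1/2) \<Omega>) (\<lambda>x. u x - uh x) \<le> b" "0 \<le> b"
    define N1 where "N1 = vec_norm (H_norm (t + 1/2) \<Omega>) yb"
    define N2 where "N2 = H_norm (t - 1/2) \<Omega> pb"
    have N: "N1 \<ge> 0" "N2 \<ge> 0" by (simp_all add: N1_def N2_def vec_norm_nonneg H1_norm_nonneg)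
    have Yh: "finite_dimensional (Y h)" "Y h \<subseteq> VH" and Qh: "finite_dimensional (Q h)" "Q h \<subseteq> L2_0 M"
      using sp h by (auto simp: discrete_spaces_def)
    have ybV: "yb \<in> VH" "has_trace_vec \<Omega> yb u" "pb \<in> L2_0 M" and yV: "y \<in> VH" and pL: "p \<in> L2_0 M"
      using s1 s\<nu> by (auto simp: weak_solution_def Y_star_def)
    have yh: "yh \<in> Y h" "has_trace_vec \<Omega> yh uh" and ph: "ph \<in> Q h"
      using ds by (auto simp: discrete_solution_def Y_star_h_def)
    have yhV: "yh \<in> VH" using yh Yh by blast
    \<comment> \<open>Dividing the discrete pressure by \<open>\<nu>\<close> gives a discrete
      solution for viscosity 1 with the same velocity, so the constant of the quasi-optimality does
      not see \<open>\<nu>\<close>.\<close>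
    let ?ph = "\<lambda>x. inverse \<nu> * ph x"
    have phQ: "?ph \<in> Q h" using finite_dimensional_scale[OF Qh(1) ph, of "inverse \<nu>"] by simp
    have ds1: "discrete_solution \<Omega> (Y h) (Q h) 1 uh yh ?ph"
      unfolding discrete_solution_def
    proof (intro conjI ballI phQ)
      show "yh \<in> Y_star_h \<Omega> (Y h) uh" using ds by (simp add: discrete_solution_def)
      show "dv yh q = 0" if "q \<in> Q h" for q using ds that by (simp add: discrete_solution_def)
      fix v assume "v \<in> Y_zero_h \<Omega> (Y h)"
      then have "\<nu> * gi yh v - dv v ph = 0" using ds by (simp add: discrete_solution_def)
      then show "1 * gi yh v - dv v ?ph = 0" unfolding l2_inner_cmult_right using \<nu> by (simp add: field_simps)
    qed
    have est: "gn (\<lambda>x. yb x - yh x) + l2_norm M (\<lambda>x. pb x - ?ph x) \<le> K * (E h * (N1 + N2) + b) + e" if e: "e > 0" for e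
    proof -
      \<comment> \<open>Three infima are approximated: the slack of \<open>zh\<close> is multiplied
        by \<open>K1\<close>, those of the lifting and of the pressure enter once each. The added 1
        keeps the denominator positive.\<close>
      define \<eta> where "\<eta> = e / (K0 * (K1 + 2) + 1)"
      have \<eta>: "\<eta> > 0" using e K0 K1 by (simp add: \<eta>_def add_nonneg_pos)
      have K\<eta>: "K0 * (K1 + 2) * \<eta> \<le> e"
      proof -
        have "K0 * (K1 + 2) * \<eta> \<le> (K0 * (K1 + 2) + 1) * \<eta>" using \<eta> by simp
        also have "\<dots> = e" using K0 K1 by (simp add: \<eta>_def add_nonneg_eq_0_iff)
        finally show ?thesis .
      qed
      have "(INF vh \<in> Y h. vec_norm (H_norm 1 \<Omega>) (\<lambda>x. yb x - vh x)) \<le> c2' * E h * N1"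
        using c2'[OF h] yb unfolding t1 E_def N1_def by (auto simp: min.commute)
      also have "\<dots> \<le> c2 * E h * N1" using N E0[of h] by (intro mult_right_mono) (auto simp: c2_def)
      finally have INFy: "(INF vh \<in> Y h. vec_norm (H_norm 1 \<Omega>) (\<lambda>x. yb x - vh x)) \<le> c2 * E h * N1" .
      have "Y h \<noteq> {}" using yh(1) by blast
      from INF_approx[OF this vec_norm_nonneg INFy \<eta>]
      obtain zh where zh: "zh \<in> Y h" "vec_norm (H_norm 1 \<Omega>) (\<lambda>x. yb x - zh x) \<le> c2 * E h * N1 + \<eta>"
        by blast
      define a where "a = c2 * E h * N1 + \<eta>"
      obtain vh where vh: "vh \<in> Y_star_h \<Omega> (Y h) uh"
        "gn (\<lambda>x. yb x - vh x) \<le> a + c1 * (2 * (Ct * a + b)) + \<eta>"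
        using approximation_in_Y_star[OF Yh Ct c1(1) c1(2)[OF h] ybV(1,2) yh zh(1) zh(2)[folded a_def] ub(1) \<eta>] by blast
      have "(INF qh \<in> Q_tilde_h (Q h). l2_norm M (\<lambda>x. pb x - qh x)) \<le> c2' * E h * N2"
        using c2'[OF h] pb unfolding E_def N2_def by (auto simp: min.commute)
      also have "\<dots> \<le> c2 * E h * N2" using N E0[of h] by (intro mult_right_mono) (auto simp: c2_def)
      finally have INFq: "(INF qh \<in> Q_tilde_h (Q h). l2_norm M (\<lambda>x. pb x - qh x)) \<le> c2 * E h * N2" .
      have "Q_tilde_h (Q h) \<noteq> {}" using ph by (auto simp: Q_tilde_h_def)
      from INF_approx[OF this l2_norm_nonneg INFq \<eta>]
      obtain q where q: "q \<in> Q_tilde_h (Q h)" "l2_norm M (\<lambda>x. pb x - q x) \<le> c2 * E h * N2 + \<eta>" by blast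
      then obtain qh r where qh: "qh \<in> Q h" "q = (\<lambda>x. qh x + r)" by (auto simp: Q_tilde_h_def)
      have B: "l2_norm M (\<lambda>x. pb x - qh x) \<le> c2 * E h * N2 + \<eta>"
        using Q_tilde_drop_constant[OF ybV(3), of qh r] qh Qh q(2) by auto
      have "gn (\<lambda>x. yb x - yh x) + l2_norm M (\<lambda>x. pb x - ?ph x)
        \<le> K0 * (gn (\<lambda>x. yb x - vh x) + l2_norm M (\<lambda>x. pb x - qh x))"
        unfolding K0_def by (rule discrete_quasi_optimal[OF \<alpha>(1) \<alpha>(2)[OF h] Yh Qh s1 ds1 vh(1) qh(1)])
      also have "\<dots> \<le> K0 * ((a + c1 * (2 * (Ct * a + b)) + \<eta>) + (c2 * E h * N2 + \<eta>))"
        by (intro mult_left_mono add_mono vh B K0)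
      also have "\<dots> = K0 * (K1 * (c2 * E h * N1) + c2 * E h * N2 + 2 * c1 * b) + K0 * (K1 + 2) * \<eta>"
        by (simp add: a_def K1_def algebra_simps)
      also have "\<dots> \<le> K0 * ((K1 * c2 + 2 * c1) * (E h * (N1 + N2) + b)) + e"
      proof (intro add_mono K\<eta> mult_left_mono K0)
        have "c2 * E h * N2 \<le> K1 * (c2 * E h * N2)"
          using mult_right_mono[OF K1, of "c2 * E h * N2"] c2 E0[of h] N by simp
        moreover have "0 \<le> K1 * c2 * b" "0 \<le> 2 * c1 * (E h * (N1 + N2))" using K1 c2 c1 ub(2) E0[of h] N by auto
        ultimately show "K1 * (c2 * E h * N1) + c2 * E h * N2 + 2 * c1 * b \<le> (K1 * c2 + 2 * c1) * (E h * (N1 + N2) + b)"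
          by (simp add: algebra_simps)
      qed
      finally show ?thesis by (simp add: K_def mult.assoc)
    qed
    have final: "gn (\<lambda>x. yb x - yh x) + l2_norm M (\<lambda>x. pb x - ?ph x) \<le> K * (E h * (N1 + N2) + b)"
      by (rule field_le_epsilon) (rule est)
    note sc = weak_solution_scaling[OF \<nu> s\<nu> s1]
    \<comment> \<open>\<open>y\<close> and \<open>yb\<close> have distance 0 in the gradient norm,
      so \<open>yb\<close> may replace \<open>y\<close>; the pressures agree up to
      \<open>\<nu>\<close> almost everywhere, which makes \<open>\<nu>\<close> a common
      factor.\<close>
    have "gn (\<lambda>x. y x - yh x) \<le> gn (\<lambda>x. yb x - yh x)"
      using gn_triangle3[OF yV ybV(1) yhV] sc(1) by simp
    moreover have "l2_norm M (\<lambda>x. p x - ph x) = \<nu> * l2_norm M (\<lambda>x. pb x - ?ph x)"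
    proof -
      have L: "p \<in> L2 M" "pb \<in> L2 M" "ph \<in> L2 M" using pL ybV(3) ph Qh by (auto intro: L2_0_L2)
      have "l2_norm M (\<lambda>x. p x - ph x) = l2_norm M (\<lambda>x. \<nu> * (pb x - ?ph x))"
      proof (rule l2_norm_cong_AE)
        show "AE x in M. p x - ph x = \<nu> * (pb x - ?ph x)"
          using sc(2) by eventually_elim (use \<nu> in \<open>simp add: right_diff_distrib\<close>)
      qed (use L2_measurable[OF L(1)] L2_measurable[OF L(2)] L2_measurable[OF L(3)] in auto)
      then show ?thesis unfolding l2_norm_cmult using \<nu> by simp
    qed
    ultimately have "\<nu> * gn (\<lambda>x. y x - yh x) + l2_norm M (\<lambda>x. p x - ph x)
      \<le> \<nu> * (gn (\<lambda>x. yb x - yh x) + l2_norm M (\<lambda>x. pb x - ?ph x))"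
      using \<nu> by (simp add: distrib_left)
    also have "\<dots> \<le> \<nu> * (K * (E h * (N1 + N2) + b))" using \<nu> by (intro mult_left_mono final) simp
    finally show "\<nu> * gn (\<lambda>x. y x - yh x) + l2_norm M (\<lambda>x. p x - ph x)
      \<le> K * \<nu> * (h powr (min (t - 1/2) (real k)) *
          (vec_norm (H_norm (t + 1/2) \<Omega>) yb + H_norm (t - 1/2) \<Omega> pb) + b)"
      by (simp add: E_def N1_def N2_def mult_ac)
  qed
qed

lemma vec_Hbd_AE_eq:
  assumes "has_trace_vec \<Omega> v u" "has_trace_vec \<Omega> w uh" and ae: "AE x in S. u x = uh x"
  shows "vec_norm (Hbd_norm (1/2) \<Omega>) (\<lambda>x. u x - uh x) = 0"
proof -
  have "Hbd_norm (1/2) \<Omega> (component (\<lambda>x. u x - uh x) b) = 0" if b: "b \<in> Basis" for b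
  proof (rule Hbd_norm_AE_zero)
    show "AE x in S. component (\<lambda>x. u x - uh x) b x = 0" using ae by eventually_elim (simp add: component_def)
    have "has_trace \<Omega> (component (\<lambda>x. v x - w x) b) (component (\<lambda>x. u x - uh x) b)"
      using has_trace_vec_diff[OF assms(1,2)] b by (simp add: has_trace_vec_def)
    then show "component (\<lambda>x. u x - uh x) b \<in> borel_measurable S" by (intro L2_measurable has_trace_L2)
  qed
  then show ?thesis by (simp add: vec_norm_def)
qed

end

theorem theorem3p4:
  fixes \<Omega> :: "(real ^ 'd) set"
    and Y :: "real \<Rightarrow> (real ^ 'd \<Rightarrow> real ^ 'd) set"
    and Q :: "real \<Rightarrow> (real ^ 'd \<Rightarrow> real) set"
    and k :: nat and t c0 :: real
  assumes "CARD('d) \<in> {2, 3}"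
    and "polyhedral_domain \<Omega>"
    and "discrete_spaces \<Omega> Y Q"
    and "assumption_A1 \<Omega> Y Q"
    and "assumption_A2 \<Omega> Y Q k"
    and "assumption_A3 \<Omega> Y"
    and "t \<ge> 1/2"
  shows "\<exists>c. \<forall>\<nu>>0. \<forall>h>0. \<forall>u uh y p ybar pbar yh ph.
    weak_solution \<Omega> \<nu> u y p \<longrightarrow>
    weak_solution \<Omega> 1 u ybar pbar \<longrightarrow>
    uh \<in> Y_bd_h \<Omega> (Y h) \<longrightarrow>
    discrete_solution \<Omega> (Y h) (Q h) \<nu> uh yh ph \<longrightarrow>
    ybar \<in> vec_space (H (t + 1/2) \<Omega>) \<longrightarrow>
    pbar \<in> H (t - 1/2) \<Omega> \<longrightarrow>
    u \<in> vec_space (Htilde t \<Omega>) \<longrightarrow>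
    vec_norm (Hbd_norm (1/2) \<Omega>) (\<lambda>x. u x - uh x)
      \<le> c0 * h powr (min (t - 1/2) (real k)) * vec_norm (Htilde_norm t \<Omega>) u \<longrightarrow>
    \<nu> * grad_norm \<Omega> (\<lambda>x. y x - yh x) + l2_norm (lebesgue_on \<Omega>) (\<lambda>x. p x - ph x)
      \<le> c * \<nu> * h powr (min (t - 1/2) (real k)) *
          (vec_norm (H_norm (t + 1/2) \<Omega>) ybar + H_norm (t - 1/2) \<Omega> pbar
           + vec_norm (Htilde_norm t \<Omega>) u) \<and>
    ((AE x in surface_measure \<Omega>. u x = uh x) \<longrightarrow>
     \<nu> * grad_norm \<Omega> (\<lambda>x. y x - yh x) + l2_norm (lebesgue_on \<Omega>) (\<lambda>x. p x - ph x)
      \<le> c * \<nu> * h powr (min (t - 1/2) (real k)) *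
          (vec_norm (H_norm (t + 1/2) \<Omega>) ybar + H_norm (t - 1/2) \<Omega> pbar))"
proof -
  interpret polyhedral \<Omega> by (rule polyhedral.intro[OF assms(2)])
  obtain K where K: "K \<ge> 0"
    "\<And>\<nu> h u uh y p yb pb yh ph b. \<nu> > 0 \<Longrightarrow> h > 0 \<Longrightarrow> weak_solution \<Omega> \<nu> u y p \<Longrightarrow>
      weak_solution \<Omega> 1 u yb pb \<Longrightarrow> discrete_solution \<Omega> (Y h) (Q h) \<nu> uh yh ph \<Longrightarrow>
      yb \<in> vec_space (H (t + 1/2) \<Omega>) \<Longrightarrow> pb \<in> H (t - 1/2) \<Omega> \<Longrightarrow>
      vec_norm (Hbd_norm (1/2) \<Omega>) (\<lambda>x. u x - uh x) \<le> b \<Longrightarrow> 0 \<le> b \<Longrightarrow>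
      \<nu> * grad_norm \<Omega> (\<lambda>x. y x - yh x) + l2_norm (lebesgue_on \<Omega>) (\<lambda>x. p x - ph x)
      \<le> K * \<nu> * (h powr (min (t - 1/2) (real k)) *
          (vec_norm (H_norm (t + 1/2) \<Omega>) yb + H_norm (t - 1/2) \<Omega> pb) + b)"
    using error_estimate[OF assms(3-7)] by blast
  show ?thesis
  \<comment> \<open>One constant for both claims: the summand with \<open>c0\<close> accounts for
    the data error, and the absolute value keeps the bound monotone for a negative
    \<open>c0\<close>.\<close>
  proof (intro exI[of _ "K * (1 + \<bar>c0\<bar>)"] allI impI conjI)
    fix \<nu> h u uh y p yb pb yh ph
    assume \<nu>: "\<nu> > (0::real)" and h: "h > (0::real)" and s\<nu>: "weak_solution \<Omega> \<nu> u y p"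
      and s1: "weak_solution \<Omega> 1 u yb pb" and ds: "discrete_solution \<Omega> (Y h) (Q h) \<nu> uh yh ph"
      and yb: "yb \<in> vec_space (H (t + 1/2) \<Omega>)" and pb: "pb \<in> H (t - 1/2) \<Omega>"
      and ub: "vec_norm (Hbd_norm (1/2) \<Omega>) (\<lambda>x. u x - uh x)
        \<le> c0 * h powr (min (t - 1/2) (real k)) * vec_norm (Htilde_norm t \<Omega>) u"
    note est = K(2)[OF \<nu> h s\<nu> s1 ds yb pb]
    define E where "E = h powr (min (t - 1/2) (real k))"
    define N where "N = vec_norm (H_norm (t + 1/2) \<Omega>) yb + H_norm (t - 1/2) \<Omega> pb"
    define N3 where "N3 = vec_norm (Htilde_norm t \<Omega>) u"
    have nn: "E \<ge> 0" "N \<ge> 0" "N3 \<ge> 0"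
      by (simp_all add: E_def N_def N3_def vec_norm_nonneg H1_norm_nonneg)
    let ?lhs = "\<nu> * grad_norm \<Omega> (\<lambda>x. y x - yh x) + l2_norm (lebesgue_on \<Omega>) (\<lambda>x. p x - ph x)"
    have "c0 * E * N3 \<le> \<bar>c0\<bar> * E * N3" using nn by (intro mult_right_mono) auto
    with ub have "vec_norm (Hbd_norm (1/2) \<Omega>) (\<lambda>x. u x - uh x) \<le> \<bar>c0\<bar> * E * N3"
      by (simp add: E_def N3_def)
    from est[OF this] have "?lhs \<le> K * \<nu> * (E * N + \<bar>c0\<bar> * E * N3)"
      using nn by (simp add: E_def N_def)
    also have "\<dots> \<le> K * \<nu> * ((1 + \<bar>c0\<bar>) * E * (N + N3))"
      using K(1) \<nu> nn by (intro mult_left_mono) (simp_all add: algebra_simps)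
    finally show "?lhs \<le> K * (1 + \<bar>c0\<bar>) * \<nu> * h powr (min (t - 1/2) (real k)) *
          (vec_norm (H_norm (t + 1/2) \<Omega>) yb + H_norm (t - 1/2) \<Omega> pb + vec_norm (Htilde_norm t \<Omega>) u)"
      by (simp add: E_def N_def N3_def mult_ac)
    assume ae: "AE x in surface_measure \<Omega>. u x = uh x"
    \<comment> \<open>Almost everywhere equal data have distance 0 in the boundary norm, so the
      estimate is applied with \<open>b = 0\<close> and the data norm disappears.\<close>
    have "vec_norm (Hbd_norm (1/2) \<Omega>) (\<lambda>x. u x - uh x) = 0"
      by (rule vec_Hbd_AE_eq[OF _ _ ae])
        (use s1 ds in \<open>auto simp: weak_solution_def Y_star_def discrete_solution_def Y_star_h_def\<close>)
    then have "?lhs \<le> K * \<nu> * (E * N + 0)" unfolding E_def N_def by (intro est) auto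
    also have "\<dots> \<le> K * \<nu> * ((1 + \<bar>c0\<bar>) * E * N)"
      using K(1) \<nu> nn by (intro mult_left_mono) (simp_all add: algebra_simps)
    finally show "?lhs \<le> K * (1 + \<bar>c0\<bar>) * \<nu> * h powr (min (t - 1/2) (real k)) *
          (vec_norm (H_norm (t + 1/2) \<Omega>) yb + H_norm (t - 1/2) \<Omega> pb)"
      by (simp add: E_def N_def mult_ac)
  qed
qed

end
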